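(* Assume the stochastic setting with $\sigma_\epsilon>0$, $\hat\mu_n\asymp n^{\alpha}$ with $\alpha<1$, and $\Psi$ satisfying the spectral condition. Then for all $n$: (i) If $\frac{d}{2\nu+d}<\alpha<1$, let $\eta=\frac14\big(\frac{(\alpha-1)(2\nu+d)}{2\nu}+1\big)\in(0,1/4)$. With probability (over $X$ and $\epsilon$) at least $1-C_1\exp(-C_2n^{\eta_1})$, $$\sup_{\|f\|_{\mathcal{N}_\Psi(\Omega)}\le1}\|f-\hat f_n\|_{L_2(\Omega)}^2\ge C_3n^{-(1-2\eta)\frac{2\nu}{2\nu+d}},$$ and with probability (over $X$) at least $1-C_4\exp(-C_5n^{\eta_2})$, $$\sup_{\|f\|_{\mathcal{N}_\Psi(\Omega)}\le1}\mathbb{E}_\epsilon\|f-\hat f_n\|_{L_2(\Omega)}^2\ge C_6n^{-(1-2\eta)\frac{2\nu}{2\nu+d}}.$$ (ii) If $\alpha<\frac{d}{2\nu+d}$, then with probability (over $X$) at least $1-C_7\exp(-C_8n^{\eta_3})$, $$\sup_{\|f\|_{\mathcal{N}_\Psi(\Omega)}\le1}\mathbb{E}_\epsilon\|f-\hat f_n\|_{L_2(\Omega)}^2\ge C_9n^{\eta_4},\qquad \eta_4=\min\Big(-\tfrac12,(1-\alpha)\tfrac{d}{2\nu}-1\Big)>-\tfrac{2\nu}{2\nu+d}.$$ All $C_i$ and $\eta_1,\eta_2,\eta_3$ are positive and depend on $\Psi,\Omega,\sigma_\epsilon^2$ but not on $n$; $\mathbb{E}_\epsilon$ is expectation over the 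noise.
   Context: Stochastic setting: $\Omega\subset\mathbb{R}^d$ convex and compact with positive Lebesgue measure. $\Psi$ is a stationary, strictly positive definite, integrable correlation function with $\Psi(0)=1$ whose spectral density $f_\Psi$ (with $\Psi(h)=\int e^{i\omega^Th}f_\Psi(\omega)d\omega$) satisfies the spectral condition: $c_1(1+\|\omega\|_2^2)^{-\nu}\le f_\Psi(\omega)\le c_2(1+\|\omega\|_2^2)^{-\nu}$ for all $\omega$, for constants $c_2\ge c_1>0$ and $\nu>d/2$. $\mathcal{N}_\Psi(\Omega)$ is the RKHS of $\Psi$ on $\Omega$ (restrictions of $\mathcal{N}_\Psi(\mathbb{R}^d)=\{f\in L_2\cap C:\mathcal{F}(f)/\sqrt{\mathcal{F}(\Psi)}\in L_2\}$, norm$^2$ $(2\pi)^{-d/2}\int|\mathcal{F}(f)|^2/\mathcal{F}(\Psi)$, infimum-over-extensions norm). $x_1,\dots,x_n$ are i.i.d. uniform on $\Omega$, $X=\{x_1,\dots,x_n\}$; observations $y_k=f(x_k)+\epsilon_k$ with $\epsilon_k$ i.i.d. $N(0,\sigma_\epsilon^2)$ independent of $X$; $Y=(y_k)$. $\hat\mu_n>0$ is a deterministic regularization sequence. $r(x)=(\Psi(x-x_k))_k$, $R=(\Psi(x_j-x_k))_{jk}$, and $\hat f_n(x)=r(x)^T(R+\hat\mu_nI_n)^{-1}Y$. *)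

theory Defs
  imports "HOL-Probability.Probability"
begin

definition fourier :: "('a::euclidean_space \<Rightarrow> complex) \<Rightarrow> 'a \<Rightarrow> complex" where
  "fourier f w = complex_of_real ((2 * pi) powr (- real DIM('a) / 2)) *
      (LINT x|lborel. f x * exp (- \<i> * complex_of_real (w \<bullet> x)))"

definition l2_fourier_of :: "('a::euclidean_space \<Rightarrow> real) \<Rightarrow> ('a \<Rightarrow> complex) \<Rightarrow> bool" where
  "l2_fourier_of f g \<longleftrightarrow> g \<in> borel_measurable lborel \<and>
     integrable lborel (\<lambda>w. (cmod (g w))\<^sup>2) \<and>
     ((\<lambda>R::real. \<integral>\<^sup>+ w. ennreal ((cmod (g w -
          fourier (\<lambda>x. complex_of_real (indicator (ball 0 R) x * f x)) w))\<^sup>2) \<partial>lborel)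
        \<longlongrightarrow> 0) at_top"

definition native_space_R :: "('a::euclidean_space \<Rightarrow> real) \<Rightarrow> ('a \<Rightarrow> real) set" where
  "native_space_R Psi = {f. f \<in> borel_measurable lborel \<and> integrable lborel (\<lambda>x. (f x)\<^sup>2) \<and>
      continuous_on UNIV f \<and>
      (\<exists>g. l2_fourier_of f g \<and>
         integrable lborel (\<lambda>w. (cmod (g w / csqrt (fourier (\<lambda>x. complex_of_real (Psi x)) w)))\<^sup>2))}"

definition native_norm_R :: "('a::euclidean_space \<Rightarrow> real) \<Rightarrow> ('a \<Rightarrow> real) \<Rightarrow> real" where
  "native_norm_R Psi f = sqrt ((2 * pi) powr (- real DIM('a) / 2) *
      (LINT w|lborel. (cmod ((SOME g. l2_fourier_of f g) w /
          csqrt (fourier (\<lambda>x. complex_of_real (Psi x)) w)))\<^sup>2))"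

text \<open>Native space on Omega: restrictions; norm = infimum over extensions.
  Functions on Omega are represented by total functions whose values off Omega are irrelevant.\<close>
definition native_space_on :: "('a::euclidean_space \<Rightarrow> real) \<Rightarrow> 'a set \<Rightarrow> ('a \<Rightarrow> real) set" where
  "native_space_on Psi Om = {f. \<exists>g \<in> native_space_R Psi. \<forall>x\<in>Om. g x = f x}"

definition native_norm_on :: "('a::euclidean_space \<Rightarrow> real) \<Rightarrow> 'a set \<Rightarrow> ('a \<Rightarrow> real) \<Rightarrow> real" where
  "native_norm_on Psi Om f = Inf {native_norm_R Psi g | g. g \<in> native_space_R Psi \<and> (\<forall>x\<in>Om. g x = f x)}"

definition native_unit_ball :: "('a::euclidean_space \<Rightarrow> real) \<Rightarrow> 'a set \<Rightarrow> ('a \<Rightarrow> real) set" where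
  "native_unit_ball Psi Om = {f \<in> native_space_on Psi Om. native_norm_on Psi Om f \<le> 1}"

text \<open>Kernel ridge regression: c = (R + mu I)^(-1) Y and fhat(x) = r(x)^T c.\<close>
definition krr_coef :: "('a::euclidean_space \<Rightarrow> real) \<Rightarrow> real \<Rightarrow> nat \<Rightarrow> (nat \<Rightarrow> 'a) \<Rightarrow> (nat \<Rightarrow> real) \<Rightarrow> nat \<Rightarrow> real" where
  "krr_coef Psi mu n xs Y = (THE c. (\<forall>j<n. (\<Sum>k<n. (Psi (xs j - xs k) + (if j = k then mu else 0)) * c k) = Y j)
       \<and> (\<forall>k. n \<le> k \<longrightarrow> c k = 0))"

definition krr :: "('a::euclidean_space \<Rightarrow> real) \<Rightarrow> real \<Rightarrow> nat \<Rightarrow> (nat \<Rightarrow> 'a) \<Rightarrow> (nat \<Rightarrow> real) \<Rightarrow> 'a \<Rightarrow> real" where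
  "krr Psi mu n xs Y x = (\<Sum>k<n. Psi (x - xs k) * krr_coef Psi mu n xs Y k)"

definition l2_dist_sq :: "'a::euclidean_space set \<Rightarrow> ('a \<Rightarrow> real) \<Rightarrow> ('a \<Rightarrow> real) \<Rightarrow> ennreal" where
  "l2_dist_sq Om f h = (\<integral>\<^sup>+ x\<in>Om. ennreal ((f x - h x)\<^sup>2) \<partial>lborel)"

definition design_space :: "'a::euclidean_space set \<Rightarrow> nat \<Rightarrow> (nat \<Rightarrow> 'a) measure" where
  "design_space Om n = PiM {..<n} (\<lambda>_. uniform_measure lborel Om)"

definition noise_space :: "real \<Rightarrow> nat \<Rightarrow> (nat \<Rightarrow> real) measure" where
  "noise_space sig n = PiM {..<n} (\<lambda>_. density lborel (normal_density 0 sig))"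

definition strictly_pd :: "('a::euclidean_space \<Rightarrow> real) \<Rightarrow> bool" where
  "strictly_pd Psi \<longleftrightarrow> (\<forall>(m::nat) (xs::nat \<Rightarrow> 'a) (c::nat \<Rightarrow> real).
      inj_on xs {..<m} \<and> (\<exists>j<m. c j \<noteq> 0) \<longrightarrow>
      (\<Sum>j<m. \<Sum>k<m. c j * c k * Psi (xs j - xs k)) > 0)"

end

theory Submission
  imports Defs
begin

text \<open>
  For a test function \<open>\<psi>\<close> the pairing of the estimator with \<open>\<psi>\<close> is \<open>\<Sum> y\<^sub>k a\<^sub>k\<close>, where the weights \<open>a\<close>
  solve \<open>(R + \<mu> I) a = (\<integral> \<Psi>(x - x\<^sub>k) \<psi>(x) dx)\<^sub>k\<close>. Both bounds test against a fixed smooth bump inside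
  \<open>\<Omega>\<close> modulated by a plane wave of frequency \<open>\<omega>\<close>.

  Bias: if \<open>(1 + |\<omega>|\<^sup>2)\<^sup>\<nu>\<close> is a large multiple of \<open>n / \<mu>\<close>, the weights are too small to reproduce
  the modulated bump, for every design; normalised in the native space it therefore keeps a squared
  error of order \<open>\<mu> / n\<close>, which exceeds the claimed rate.

  Variance: with \<open>h\<close> of order \<open>(\<mu> / n) powr (1 / (2\<nu>))\<close> (enlarged so that a ball of radius \<open>h\<close>
  contains at least about \<open>sqrt n\<close> design points) and \<open>|\<omega>| \<le> 1 / h\<close>, the weights must nearly
  reproduce the modulated bump, so \<open>|a|\<^sup>2\<close> is at least of order \<open>1 / n\<close>. This rests on a sampling
  inequality for designs that are dense at scale \<open>\<delta> h\<close>, which hold with high probability by a Chernoff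
  bound. Integrating over \<open>\<omega>\<close> with Bessel's inequality gives a variance of order \<open>h\<^sup>-\<^sup>d / n\<close>.
\<close>

section \<open>Fourier integrals\<close>

text \<open>Norms are compared with norms of transforms through inequalities only, and these come
  from Gaussian damping, so no L2 theory of the Fourier transform has to be set up. The bump must
  reconcile two demands: compact support, so that it fits into \<open>Om\<close> and is its own
  extension to the whole space, and decay of its transform like \<open>wt (- (2 * nu))\<close>. The
  surplus decay lets Peetre's inequality turn modulation by \<open>om\<close> into a factor
  \<open>wt nu om\<close> in the native norm and \<open>wt (- nu) om\<close> in the dual norm, which
  is why one family of test functions serves both bounds. The obstacle in the variance bound is to
  show that the weights cannot be small, for a kernel known only through spectral bounds: the
  residual of the dual system equals \<open>mu * a k\<close> at the design points, its energy
  therefore controls its own samples, and the sampling inequality closes this into an a priori bound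
  on the residual.\<close>

lemma nn_integral_lborel_affine:
  fixes t :: "'a::euclidean_space"
  assumes [measurable]: "f \<in> borel_measurable borel" and "c \<noteq> 0"
  shows "(\<integral>\<^sup>+x. f x \<partial>lborel) = ennreal (\<bar>c\<bar> ^ DIM('a)) * (\<integral>\<^sup>+x. f (t + c *\<^sub>R x) \<partial>lborel)"
  by (subst lborel_affine[OF \<open>c \<noteq> 0\<close>, of t])
    (simp add: nn_integral_density nn_integral_distr nn_integral_cmult)

lemma integrable_lborel_affine:
  fixes f :: "'a::euclidean_space \<Rightarrow> 'b::{banach, second_countable_topology}"
  assumes f: "integrable lborel f" and "c \<noteq> 0"
  shows "integrable lborel (\<lambda>x. f (t + c *\<^sub>R x))"
proof -
  have [measurable]: "f \<in> borel_measurable borel" using f by simp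
  have "integrable (density (distr lborel borel (\<lambda>x. t + c *\<^sub>R x)) (\<lambda>_. ennreal (\<bar>c\<bar> ^ DIM('a)))) f"
    using f lborel_affine[OF \<open>c \<noteq> 0\<close>, of t] by (simp add: ennreal_power)
  then have "integrable lborel (\<lambda>x. \<bar>c\<bar> ^ DIM('a) *\<^sub>R f (t + c *\<^sub>R x))"
    by (subst (asm) integrable_density) (auto simp: integrable_distr_eq)
  then have "integrable lborel (\<lambda>x. inverse (\<bar>c\<bar> ^ DIM('a)) *\<^sub>R (\<bar>c\<bar> ^ DIM('a) *\<^sub>R f (t + c *\<^sub>R x)))"
    by (rule integrable_scaleR_right)
  then show ?thesis using \<open>c \<noteq> 0\<close> by simp
qed

lemma integral_lborel_affine:
  fixes f :: "'a::euclidean_space \<Rightarrow> 'b::{banach, second_countable_topology}"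
  assumes [measurable]: "f \<in> borel_measurable borel" and "c \<noteq> 0"
  shows "(LINT x|lborel. f x) = \<bar>c\<bar> ^ DIM('a) *\<^sub>R (LINT x|lborel. f (t + c *\<^sub>R x))"
proof -
  have "(LINT x|lborel. f x) = (LINT x|density (distr lborel borel (\<lambda>x. t + c *\<^sub>R x)) (\<lambda>_. ennreal (\<bar>c\<bar> ^ DIM('a))). f x)"
    using lborel_affine[OF \<open>c \<noteq> 0\<close>, of t] by (simp add: ennreal_power)
  also have "\<dots> = (LINT x|lborel. \<bar>c\<bar> ^ DIM('a) *\<^sub>R f (t + c *\<^sub>R x))"
    by (subst integral_density) (auto simp: integral_distr)
  finally show ?thesis by simp
qed

lemma integral_lborel_shift:
  fixes f :: "'a::euclidean_space \<Rightarrow> 'b::{banach, second_countable_topology}"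
  assumes "f \<in> borel_measurable borel"
  shows "(LINT x|lborel. f (x + t)) = (LINT x|lborel. f x)"
  using integral_lborel_affine[OF assms, of 1 t] by (simp add: add.commute)

lemma integral_lborel_uminus:
  fixes f :: "'a::euclidean_space \<Rightarrow> 'b::{banach, second_countable_topology}"
  assumes "f \<in> borel_measurable borel"
  shows "(LINT x|lborel. f (- x)) = (LINT x|lborel. f x)"
  using integral_lborel_affine[OF assms, of "-1" 0] by simp

lemma integral_lborel_reflect:
  fixes f :: "'a::euclidean_space \<Rightarrow> 'b::{banach, second_countable_topology}"
  assumes "f \<in> borel_measurable borel"
  shows "(LINT x|lborel. f (t - x)) = (LINT x|lborel. f x)"
  using integral_lborel_affine[OF assms, of "-1" t] by simp

lemma integrable_lborel_reflect:
  fixes f :: "'a::euclidean_space \<Rightarrow> 'b::{banach, second_countable_topology}"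
  assumes "integrable lborel f"
  shows "integrable lborel (\<lambda>x. f (t - x))"
  using integrable_lborel_affine[OF assms, of "-1" t] by simp

lemma integrable_lborel_shift:
  fixes f :: "'a::euclidean_space \<Rightarrow> 'b::{banach, second_countable_topology}"
  assumes "integrable lborel f"
  shows "integrable lborel (\<lambda>x. f (x + t))"
  using integrable_lborel_affine[OF assms, of 1 t] by (simp add: add.commute)

lemma borel_measurable_cis [measurable]:
  "f \<in> borel_measurable M \<Longrightarrow> (\<lambda>x. cis (f x)) \<in> borel_measurable M"
  by (simp add: cis_conv_exp)

lemma borel_measurable_cnj [measurable]:
  assumes [measurable]: "f \<in> borel_measurable M"
  shows "(\<lambda>x. cnj (f x)) \<in> borel_measurable M"
proof -
  have "cnj \<in> borel_measurable borel"
    by (intro borel_measurable_continuous_onI continuous_intros)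
  then show ?thesis by (rule measurable_compose[OF assms])
qed

section \<open>Gaussian damping: multiplication formula, inversion, Bessel and Plancherel
  inequalities\<close>

definition gauss :: "'a::euclidean_space \<Rightarrow> real" where
  "gauss x = (2 * pi) powr (- real DIM('a) / 2) * exp (- (norm x)\<^sup>2 / 2)"

lemma gauss_measurable [measurable]: "gauss \<in> borel_measurable borel"
  unfolding gauss_def[abs_def] by measurable

lemma isCont_gauss: "isCont gauss x"
  unfolding gauss_def[abs_def] by (intro continuous_intros) auto

lemma gauss_pos: "gauss x > 0"
  by (simp add: gauss_def)

lemma gauss_le: "gauss (x::'a::euclidean_space) \<le> gauss (0::'a)"
  by (simp add: gauss_def mult_le_cancel_left)

lemma sum_Basis_square: "(\<Sum>b\<in>Basis. (x \<bullet> b)\<^sup>2) = (norm (x::'a::euclidean_space))\<^sup>2"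
  unfolding power2_norm_eq_inner euclidean_inner[of x x] by (simp add: power2_eq_square)

lemma gauss_prod: "gauss (x::'a::euclidean_space) = (\<Prod>b\<in>Basis. std_normal_density (x \<bullet> b))"
proof -
  have "(\<Prod>b\<in>Basis. std_normal_density (x \<bullet> b))
      = (\<Prod>b\<in>(Basis::'a set). 1 / sqrt (2 * pi)) * (\<Prod>b\<in>Basis. exp (- (x \<bullet> b)\<^sup>2 / 2))"
    by (simp only: std_normal_density_def prod.distrib)
  also have "(\<Prod>b\<in>Basis. exp (- (x \<bullet> b)\<^sup>2 / 2)) = exp (\<Sum>b\<in>Basis. - (x \<bullet> b)\<^sup>2 / 2)"
    by (simp add: exp_sum)
  also have "(\<Sum>b\<in>Basis. - (x \<bullet> b)\<^sup>2 / 2) = - (norm x)\<^sup>2 / 2"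
    by (simp add: sum_divide_distrib[symmetric] sum_negf sum_Basis_square)
  also have "(\<Prod>b\<in>(Basis::'a set). 1 / sqrt (2 * pi)) = ((2 * pi) powr (- 1 / 2)) ^ DIM('a)"
    using powr_minus_divide[of "2 * pi" "1 / 2"] by (simp add: powr_half_sqrt)
  also have "\<dots> = ((2 * pi) powr (- 1 / 2)) powr (real DIM('a))"
    by (rule powr_realpow[symmetric]) simp
  also have "\<dots> = (2 * pi) powr (- real DIM('a) / 2)"
    by (subst powr_powr) simp
  finally show ?thesis by (simp add: gauss_def)
qed

text \<open>Fubini over the standard basis; it reduces transforms of tensor products such as the
  Gaussian to one dimension.\<close>

lemma integral_lborel_prod:
  fixes f :: "'a::euclidean_space \<Rightarrow> real \<Rightarrow> complex"
  assumes f: "\<And>b. b \<in> Basis \<Longrightarrow> integrable lborel (f b)"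
  shows "(LINT x|lborel. (\<Prod>b\<in>Basis. f b (x \<bullet> b))) = (\<Prod>b\<in>Basis. (LINT x|lborel. f b x))"
proof -
  interpret product_sigma_finite "\<lambda>_::'a. lborel :: real measure" ..
  have [measurable]: "f b \<in> borel_measurable borel" if "b \<in> Basis" for b
    using f[OF that] by simp
  have "(LINT x|lborel. (\<Prod>b\<in>Basis. f b (x \<bullet> b)))
     = (LINT g|(\<Pi>\<^sub>M b\<in>Basis. lborel). (\<Prod>b\<in>Basis. f b (g b)))"
    by (subst lborel_eq, subst integral_distr) (auto intro!: Bochner_Integration.integral_cong prod.cong simp: inner_sum_left inner_Basis if_distrib cong: if_cong)
  also have "\<dots> = (\<Prod>b\<in>Basis. (LINT x|lborel. f b x))"
    using f by (intro product_integral_prod) auto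
  finally show ?thesis .
qed

lemma nn_integral_gauss: "(\<integral>\<^sup>+(x::'a::euclidean_space). ennreal (gauss x) \<partial>lborel) = 1"
proof -
  have 1: "(\<integral>\<^sup>+x. ennreal (std_normal_density x) \<partial>lborel) = 1"
    by (subst nn_integral_eq_integral) (simp_all add: integrable_normal_density)
  have "(\<integral>\<^sup>+(x::'a). ennreal (gauss x) \<partial>lborel) = (\<integral>\<^sup>+(x::'a). (\<Prod>b\<in>Basis. ennreal (std_normal_density (x \<bullet> b))) \<partial>lborel)"
    by (simp add: gauss_prod prod_ennreal)
  also have "\<dots> = 1" by (subst nn_integral_lborel_prod) (auto simp: 1)
  finally show ?thesis .
qed

lemma integrable_gauss: "integrable lborel (gauss :: 'a::euclidean_space \<Rightarrow> real)"
  using nn_integral_gauss[where 'a='a] by (intro integrableI_nonneg) (auto simp: less_imp_le[OF gauss_pos])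

lemma integral_gauss: "(LINT x|lborel. gauss (x::'a::euclidean_space)) = 1"
  using nn_integral_gauss by (simp add: integral_eq_nn_integral less_imp_le[OF gauss_pos])

text \<open>Both factors split over \<open>Basis\<close>, so the claim reduces to the characteristic
  function of the standard normal distribution.\<close>

lemma gauss_fourier:
  fixes w :: "'a::euclidean_space"
  shows "(LINT x|lborel. complex_of_real (gauss x) * cis (x \<bullet> w)) = complex_of_real (exp (- (norm w)\<^sup>2 / 2))"
proof -
  have 1: "(LINT x|lborel. complex_of_real (std_normal_density x) * cis (t * x)) = complex_of_real (exp (- t\<^sup>2 / 2))" for t
  proof -
    have "char std_normal_distribution t = (LINT x|lborel. std_normal_density x *\<^sub>R iexp (t * x))"
      unfolding char_def by (subst integral_density) auto
    then show ?thesis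
      by (simp add: char_std_normal_distribution scaleR_conv_of_real cis_conv_exp)
  qed
  have 2: "complex_of_real (gauss x) * cis (x \<bullet> w) =
     (\<Prod>b\<in>Basis. complex_of_real (std_normal_density (x \<bullet> b)) * cis ((w \<bullet> b) * (x \<bullet> b)))" for x
  proof -
    have "cis (x \<bullet> w) = (\<Prod>b\<in>Basis. cis ((w \<bullet> b) * (x \<bullet> b)))"
      by (subst euclidean_inner) (simp add: cis_conv_exp exp_sum sum_distrib_left mult.commute)
    then show ?thesis by (simp add: gauss_prod prod.distrib)
  qed
  have "integrable lborel (\<lambda>x. complex_of_real (std_normal_density x) * cis (t * x))" for t
    by (rule Bochner_Integration.integrable_bound[where f="\<lambda>x. std_normal_density x"])
       (auto simp: norm_mult integrable_normal_density)
  then have "(LINT x|lborel. complex_of_real (gauss x) * cis (x \<bullet> w)) =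
      (\<Prod>b\<in>Basis. complex_of_real (exp (- (w \<bullet> b)\<^sup>2 / 2)))"
    unfolding 2 by (subst integral_lborel_prod) (auto simp: 1)
  also have "\<dots> = complex_of_real (exp (\<Sum>b\<in>Basis. - (w \<bullet> b)\<^sup>2 / 2))"
    by (simp add: exp_sum)
  also have "(\<Sum>b\<in>Basis. - (w \<bullet> b)\<^sup>2 / 2) = - (norm w)\<^sup>2 / 2"
    by (simp add: sum_divide_distrib[symmetric] sum_negf sum_Basis_square)
  finally show ?thesis .
qed

lemma gauss_fourier_scaled:
  fixes w :: "'a::euclidean_space"
  assumes "s > 0"
  shows "(LINT x|lborel. complex_of_real (gauss (s *\<^sub>R x)) * cis (x \<bullet> w)) =
    complex_of_real ((2 * pi) powr (real DIM('a) / 2) / s ^ DIM('a) * gauss (w /\<^sub>R s))"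
proof -
  have "complex_of_real (exp (- (norm (w /\<^sub>R s))\<^sup>2 / 2)) = (LINT x|lborel. complex_of_real (gauss x) * cis (x \<bullet> (w /\<^sub>R s)))"
    by (rule gauss_fourier[symmetric])
  also have "\<dots> = s ^ DIM('a) *\<^sub>R (LINT x|lborel. complex_of_real (gauss (s *\<^sub>R x)) * cis (x \<bullet> w))"
    using assms by (subst integral_lborel_affine[where c=s and t=0]) (auto simp flip: mult.assoc)
  finally have "(LINT x|lborel. complex_of_real (gauss (s *\<^sub>R x)) * cis (x \<bullet> w)) =
     complex_of_real (exp (- (norm (w /\<^sub>R s))\<^sup>2 / 2) / s ^ DIM('a))"
    using assms by (simp add: scaleR_conv_of_real field_simps)
  also have "exp (- (norm (w /\<^sub>R s))\<^sup>2 / 2) = (2 * pi) powr (real DIM('a) / 2) * gauss (w /\<^sub>R s)"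
    by (simp add: gauss_def powr_add[symmetric] flip: mult.assoc)
  finally show ?thesis by simp
qed

text \<open>Sign and normalisation are chosen so that \<open>Psi\<close> is the transform of
  \<open>fPsi\<close> without any factor. \<open>fourier_eq_ftr\<close> relates it to
  \<open>fourier\<close>, which has the opposite sign and an additional power of 2 pi.\<close>

definition ftr :: "('a::euclidean_space \<Rightarrow> complex) \<Rightarrow> 'a \<Rightarrow> complex" where
  "ftr F x = (LINT w|lborel. F w * cis (w \<bullet> x))"

lemma ftr_measurable [measurable]:
  fixes F :: "'a::euclidean_space \<Rightarrow> complex"
  assumes [measurable]: "F \<in> borel_measurable borel"
  shows "ftr F \<in> borel_measurable borel"
proof -
  have "(\<lambda>x. LINT w|lborel. F w * cis (w \<bullet> x)) \<in> borel_measurable borel"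
    by (rule sigma_finite_measure.borel_measurable_lebesgue_integral) (auto simp: lborel.sigma_finite_measure_axioms split_beta')
  then show ?thesis by (simp add: ftr_def[abs_def])
qed

lemma integrable_mult_cis:
  assumes "integrable lborel F" and [measurable]: "g \<in> borel_measurable borel"
  shows "integrable lborel (\<lambda>w. F w * cis (g w))"
proof -
  have [measurable]: "F \<in> borel_measurable borel" using assms by simp
  show ?thesis
    by (rule Bochner_Integration.integrable_bound[OF integrable_norm[OF assms(1)]]) (auto simp: norm_mult)
qed

lemma norm_ftr_le:
  assumes "integrable lborel F"
  shows "cmod (ftr F x) \<le> (LINT w|lborel. cmod (F w))"
  unfolding ftr_def
  by (rule order.trans[OF integral_norm_bound]) (simp add: norm_mult)

lemma continuous_ftr:
  assumes "integrable lborel F"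
  shows "continuous_on UNIV (ftr F)"
proof -
  have [measurable]: "F \<in> borel_measurable borel" using assms by simp
  have "isCont (ftr F) x" for x
    unfolding ftr_def[abs_def] continuous_at_sequentially comp_def
  proof safe
    fix y assume y: "y \<longlonglongrightarrow> x"
    show "(\<lambda>n. LINT w|lborel. F w * cis (w \<bullet> y n)) \<longlonglongrightarrow> (LINT w|lborel. F w * cis (w \<bullet> x))"
      by (rule integral_dominated_convergence[OF _ _ integrable_norm[OF assms]])
         (auto simp: norm_mult cis_conv_exp intro!: tendsto_intros y)
  qed
  then show ?thesis by (simp add: continuous_on_eq_continuous_at)
qed

text \<open>The multiplication formula: Fubini, with the characters bounded by 1. It moves the
  transform from one factor to the other and underlies the spectral pairings below.\<close>

lemma ftr_integral_swap:
  fixes F G :: "'a::euclidean_space \<Rightarrow> complex"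
  assumes F: "integrable lborel F" and G: "integrable lborel G"
  shows "(LINT x|lborel. G x * ftr F x) = (LINT w|lborel. F w * ftr G w)"
proof -
  have [measurable]: "F \<in> borel_measurable borel" "G \<in> borel_measurable borel" using F G by simp_all
  have 1: "integrable (lborel \<Otimes>\<^sub>M lborel) (\<lambda>(x, w). G x * (F w * cis (w \<bullet> x)))"
  proof (rule lborel_pair.Fubini_integrable)
    have "integrable lborel (\<lambda>x. cmod (G x) * (LINT w|lborel. cmod (F w)))"
      using G by auto
    then show "integrable lborel (\<lambda>x. LINT w|lborel. norm (case (x, w) of (x, w) \<Rightarrow> G x * (F w * cis (w \<bullet> x))))"
      by (simp add: norm_mult)
    show "AE x in lborel. integrable lborel (\<lambda>w. case (x, w) of (x, w) \<Rightarrow> G x * (F w * cis (w \<bullet> x)))"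
      using integrable_mult_cis[OF F] by simp
  qed (simp add: split_beta')
  have "(LINT x|lborel. G x * ftr F x) = (LINT x|lborel. LINT w|lborel. G x * (F w * cis (w \<bullet> x)))"
    by (simp add: ftr_def integrable_mult_cis[OF F])
  also have "\<dots> = (LINT w|lborel. LINT x|lborel. G x * (F w * cis (w \<bullet> x)))"
    by (rule lborel_pair.Fubini_integral[symmetric]) (use 1 in \<open>simp add: split_beta'\<close>)
  also have "\<dots> = (LINT w|lborel. LINT x|lborel. F w * (G x * cis (x \<bullet> w)))"
    by (simp add: mult_ac inner_commute)
  also have "\<dots> = (LINT w|lborel. F w * ftr G w)"
    by (simp add: ftr_def integrable_mult_cis[OF G])
  finally show ?thesis .
qed

text \<open>The multiplication formula against a Gaussian-damped character, whose transform is again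
  a Gaussian, centred at \<open>w\<close> with width \<open>s\<close>. A damped inverse transform is
  thus a Gaussian average of \<open>F\<close> near \<open>w\<close>.\<close>

lemma ftr_gauss_multiplication:
  fixes F :: "'a::euclidean_space \<Rightarrow> complex"
  assumes F: "integrable lborel F" and s: "s > 0"
  shows "(LINT x|lborel. ftr F x * (cis (- (x \<bullet> w)) * gauss (s *\<^sub>R x))) =
    (2 * pi) powr (real DIM('a) / 2) * (LINT z|lborel. F (w + s *\<^sub>R z) * gauss z)"
proof -
  have [measurable]: "F \<in> borel_measurable borel" using F by simp
  let ?G = "\<lambda>x::'a. complex_of_real (gauss (s *\<^sub>R x)) * cis (- (x \<bullet> w))"
  have ig: "integrable lborel (\<lambda>x::'a. complex_of_real (gauss (s *\<^sub>R x)))"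
    using integrable_lborel_affine[OF integrable_gauss[where 'a='a], of s 0] s by simp
  have G: "integrable lborel ?G"
    by (rule integrable_mult_cis[OF ig]) auto
  have fG: "ftr ?G v = complex_of_real ((2 * pi) powr (real DIM('a) / 2) / s ^ DIM('a) * gauss ((v - w) /\<^sub>R s))" for v
  proof -
    have "ftr ?G v = (LINT x|lborel. complex_of_real (gauss (s *\<^sub>R x)) * cis (x \<bullet> (v - w)))"
      unfolding ftr_def by (intro Bochner_Integration.integral_cong) (auto simp: cis_mult inner_diff_right)
    then show ?thesis using gauss_fourier_scaled[OF s, of "v - w"] by simp
  qed
  have "(LINT x|lborel. ftr F x * (cis (- (x \<bullet> w)) * gauss (s *\<^sub>R x))) = (LINT x|lborel. ?G x * ftr F x)"
    by (simp add: mult_ac)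
  also have "\<dots> = (LINT v|lborel. F v * ftr ?G v)"
    by (rule ftr_integral_swap[OF F G])
  also have "\<dots> = (LINT v|lborel. complex_of_real ((2 * pi) powr (real DIM('a) / 2) / s ^ DIM('a)) * (F v * gauss ((v - w) /\<^sub>R s)))"
    unfolding fG by (intro Bochner_Integration.integral_cong) (auto simp: mult_ac)
  also have "\<dots> = complex_of_real ((2 * pi) powr (real DIM('a) / 2) / s ^ DIM('a)) * (LINT v|lborel. F v * gauss ((v - w) /\<^sub>R s))"
    by simp
  also have "(LINT v|lborel. F v * gauss ((v - w) /\<^sub>R s)) = s ^ DIM('a) *\<^sub>R (LINT z|lborel. F (w + s *\<^sub>R z) * gauss z)"
    using s by (subst integral_lborel_affine[where c=s and t=w]) (auto simp: )
  finally show ?thesis using s by (simp add: scaleR_conv_of_real field_simps)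
qed

lemma gauss_approximate_identity:
  fixes F :: "'a::euclidean_space \<Rightarrow> complex"
  assumes cont: "continuous_on UNIV F" and bd: "\<And>x. cmod (F x) \<le> B"
  shows "(\<lambda>k. LINT z|lborel. F (w + inverse (real (Suc k)) *\<^sub>R z) * gauss z) \<longlonglongrightarrow> F w"
proof -
  have [measurable]: "F \<in> borel_measurable borel" by (rule borel_measurable_continuous_onI[OF cont])
  have "(\<lambda>k. LINT z|lborel. F (w + inverse (real (Suc k)) *\<^sub>R z) * gauss z) \<longlonglongrightarrow> (LINT (z::'a)|lborel. F w * gauss z)"
  proof (rule integral_dominated_convergence[where w="\<lambda>z::'a. B * gauss z"])
    show "integrable lborel (\<lambda>z::'a. B * gauss z)" using integrable_gauss by auto
    have "(\<lambda>k. F (w + inverse (real (Suc k)) *\<^sub>R z) * gauss z) \<longlonglongrightarrow> F w * gauss z" for z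
    proof -
      have "(\<lambda>k. w + inverse (real (Suc k)) *\<^sub>R z) \<longlonglongrightarrow> w + 0 *\<^sub>R z"
        by (intro tendsto_intros LIMSEQ_inverse_real_of_nat)
      then have "(\<lambda>k. F (w + inverse (real (Suc k)) *\<^sub>R z)) \<longlonglongrightarrow> F w"
        using cont by (intro isCont_tendsto_compose[of _ F]) (auto simp: continuous_on_eq_continuous_at)
      then show ?thesis by (intro tendsto_intros)
    qed
    then show "AE z in lborel. (\<lambda>k. F (w + inverse (real (Suc k)) *\<^sub>R z) * gauss z) \<longlonglongrightarrow> F w * gauss z" by simp
    show "\<And>k. AE z in lborel. cmod (F (w + inverse (real (Suc k)) *\<^sub>R z) * complex_of_real (gauss z)) \<le> B * gauss z"
      using bd by (auto simp: norm_mult less_imp_le[OF gauss_pos] intro!: mult_right_mono)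
  qed auto
  also have "(LINT (z::'a)|lborel. F w * complex_of_real (gauss z)) = F w"
    using integrable_gauss[where 'a='a] by (simp add: integral_gauss)
  finally show ?thesis .
qed

text \<open>The factor \<open>gauss 0\<close> remains when the damping is removed, because
  \<open>gauss\<close> is normalised to mass one and not to value one at the origin.\<close>

lemma gauss_damping_limit:
  fixes g :: "'a::euclidean_space \<Rightarrow> complex"
  assumes g: "integrable lborel g"
  shows "(\<lambda>k. LINT x|lborel. g x * gauss (inverse (real (Suc k)) *\<^sub>R x)) \<longlonglongrightarrow> (LINT x|lborel. g x) * gauss (0::'a)"
proof -
  have [measurable]: "g \<in> borel_measurable borel" using g by simp
  have "(\<lambda>k. LINT x|lborel. g x * gauss (inverse (real (Suc k)) *\<^sub>R x)) \<longlonglongrightarrow> (LINT x|lborel. g x * gauss (0::'a))"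
  proof (rule integral_dominated_convergence[where w="\<lambda>x. cmod (g x) * gauss (0::'a)"])
    show "integrable lborel (\<lambda>x. cmod (g x) * gauss (0::'a))" using g by simp
    have "(\<lambda>k. gauss (inverse (real (Suc k)) *\<^sub>R x)) \<longlonglongrightarrow> gauss (0::'a)" for x :: 'a
    proof -
      have "(\<lambda>k. inverse (real (Suc k)) *\<^sub>R x) \<longlonglongrightarrow> 0 *\<^sub>R x"
        by (intro tendsto_intros LIMSEQ_inverse_real_of_nat)
      from isCont_tendsto_compose[OF isCont_gauss this] show ?thesis by simp
    qed
    then show "AE x in lborel. (\<lambda>k. g x * gauss (inverse (real (Suc k)) *\<^sub>R x)) \<longlonglongrightarrow> g x * gauss (0::'a)"
      by (intro AE_I2 tendsto_intros) 
    show "\<And>k. AE x in lborel. cmod (g x * complex_of_real (gauss (inverse (real (Suc k)) *\<^sub>R x))) \<le> cmod (g x) * gauss (0::'a)"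
      by (intro AE_I2) (auto simp: norm_mult less_imp_le[OF gauss_pos] intro!: mult_left_mono gauss_le)
  qed auto
  then show ?thesis by simp
qed

lemma gauss_zero: "(2 * pi) powr (real DIM('a) / 2) = 1 / gauss (0::'a::euclidean_space)"
  using powr_minus_divide[of "2 * pi" "real DIM('a) / 2"] by (simp add: gauss_def)

lemma gauss_zero_sq: "1 / (gauss (0::'a::euclidean_space))\<^sup>2 = (2 * pi) ^ DIM('a)"
proof -
  have "1 / (gauss (0::'a))\<^sup>2 = ((2 * pi) powr (real DIM('a) / 2))\<^sup>2"
    by (simp add: gauss_zero power_divide)
  also have "\<dots> = (2 * pi) powr (real DIM('a))"
    by (simp add: power2_eq_square flip: powr_add)
  finally show ?thesis by (simp add: powr_realpow)
qed

text \<open>The damped integral has two limits as the scale \<open>inverse (real (Suc k))\<close>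
  tends to zero: dominated convergence gives the undamped integral, the approximate identity gives
  \<open>F w\<close>. Comparing them leaves the factor \<open>1 / (gauss 0)^2\<close>, which is
  \<open>(2 * pi) ^ DIM('a)\<close>.\<close>

lemma fourier_inversion:
  fixes F :: "'a::euclidean_space \<Rightarrow> complex"
  assumes F: "integrable lborel F" and F': "integrable lborel (ftr F)"
    and cont: "continuous_on UNIV F" and bd: "\<And>x. cmod (F x) \<le> B"
  shows "(LINT x|lborel. ftr F x * cis (- (x \<bullet> w))) = (2 * pi) ^ DIM('a) * F w"
proof -
  have ip: "0 < inverse (real (Suc k))" for k by simp
  have "integrable lborel (\<lambda>x. ftr F x * cis (- (x \<bullet> w)))"
    by (rule integrable_mult_cis[OF F']) auto
  from gauss_damping_limit[OF this]
  have "(\<lambda>k. LINT x|lborel. ftr F x * (cis (- (x \<bullet> w)) * gauss (inverse (real (Suc k)) *\<^sub>R x)))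
      \<longlonglongrightarrow> (LINT x|lborel. ftr F x * cis (- (x \<bullet> w))) * gauss (0::'a)" by (simp add: mult.assoc)
  moreover have "(\<lambda>k. LINT x|lborel. ftr F x * (cis (- (x \<bullet> w)) * gauss (inverse (real (Suc k)) *\<^sub>R x)))
      \<longlonglongrightarrow> (2 * pi) powr (real DIM('a) / 2) * F w"
    unfolding ftr_gauss_multiplication[OF F ip] by (intro tendsto_intros gauss_approximate_identity[OF cont bd])
  ultimately have "(LINT x|lborel. ftr F x * cis (- (x \<bullet> w))) * gauss (0::'a) = complex_of_real (1 / gauss (0::'a)) * F w"
    unfolding gauss_zero[where 'a='a] by (rule LIMSEQ_unique)
  then have "(LINT x|lborel. ftr F x * cis (- (x \<bullet> w))) = complex_of_real (1 / (gauss (0::'a))\<^sup>2) * F w"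
    using gauss_pos[of "0::'a"] by (simp add: field_simps power2_eq_square)
  then show ?thesis by (simp add: gauss_zero_sq)
qed

text \<open>The conjugate of \<open>ftr F\<close> is the transform of the reflected conjugate of
  \<open>F\<close>, so the multiplication formula turns the damped energy into an autocorrelation of
  \<open>F\<close> averaged over Gaussian shifts of size \<open>s\<close>. The damping makes the
  left side finite before \<open>ftr F\<close> is known to be square integrable.\<close>

lemma ftr_norm_square_damped:
  fixes F :: "'a::euclidean_space \<Rightarrow> complex"
  assumes F: "integrable lborel F" and s: "s > 0"
  shows "complex_of_real (LINT x|lborel. (cmod (ftr F x))\<^sup>2 * gauss (s *\<^sub>R x)) =
    (2 * pi) powr (real DIM('a) / 2) * (LINT v|lborel. cnj (F v) * (LINT z|lborel. F (v + s *\<^sub>R z) * gauss z))"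
proof -
  have [measurable]: "F \<in> borel_measurable borel" using F by simp
  let ?G = "\<lambda>x::'a. ftr F x * gauss (s *\<^sub>R x)"
  let ?c = "complex_of_real ((2 * pi) powr (real DIM('a) / 2))"
  have G: "integrable lborel ?G"
  proof (rule Bochner_Integration.integrable_bound)
    show "integrable lborel (\<lambda>x::'a. (LINT w|lborel. cmod (F w)) * gauss (s *\<^sub>R x))"
      using integrable_lborel_affine[OF integrable_gauss[where 'a='a], of s 0] s by simp
    have "0 \<le> (LINT w|lborel. cmod (F w))" by simp
    then show "AE x in lborel. cmod (ftr F x * gauss (s *\<^sub>R x)) \<le> norm ((LINT w|lborel. cmod (F w)) * gauss (s *\<^sub>R x))"
      using norm_ftr_le[OF F] by (auto simp: norm_mult abs_mult less_imp_le[OF gauss_pos] intro!: mult_right_mono)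
  qed auto
  have [measurable]: "(\<lambda>v. ftr ?G (- v)) \<in> borel_measurable borel"
    by (rule measurable_compose[of uminus _ borel]) auto
  have Fm: "integrable lborel (\<lambda>v. cnj (F (- v)))"
    using integrable_lborel_affine[OF F, of "-1" 0] by simp
  have cf: "cnj (ftr F x) = ftr (\<lambda>v. cnj (F (- v))) x" for x
  proof -
    have "ftr (\<lambda>v. cnj (F (- v))) x = (LINT v|lborel. (\<lambda>v. cnj (F v) * cis (- (v \<bullet> x))) (- v))"
      by (simp add: ftr_def)
    also have "\<dots> = (LINT v|lborel. cnj (F v) * cis (- (v \<bullet> x)))"
      by (rule integral_lborel_uminus) auto
    also have "\<dots> = cnj (ftr F x)" unfolding ftr_def Bochner_Integration.integral_cnj[symmetric] by (simp add: cis_cnj)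
    finally show ?thesis by simp
  qed
  have "complex_of_real (LINT x|lborel. (cmod (ftr F x))\<^sup>2 * gauss (s *\<^sub>R x)) = (LINT x|lborel. ?G x * ftr (\<lambda>v. cnj (F (- v))) x)"
    unfolding cf[symmetric] integral_complex_of_real[symmetric]
    by (intro Bochner_Integration.integral_cong) (simp_all add: complex_norm_square mult_ac del: of_real_power)
  also have "\<dots> = (LINT v|lborel. cnj (F (- v)) * ftr ?G v)"
    by (rule ftr_integral_swap[OF Fm G])
  also have "\<dots> = (LINT v|lborel. (\<lambda>v. cnj (F v) * ftr ?G (- v)) (- v))" by simp
  also have "\<dots> = (LINT v|lborel. cnj (F v) * ftr ?G (- v))"
    by (rule integral_lborel_uminus) measurable
  also have "\<dots> = (LINT v|lborel. ?c * (cnj (F v) * (LINT z|lborel. F (v + s *\<^sub>R z) * gauss z)))"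
  proof (intro Bochner_Integration.integral_cong refl)
    fix v
    have "ftr ?G (- v) = (LINT x|lborel. ftr F x * (cis (- (x \<bullet> v)) * gauss (s *\<^sub>R x)))"
      unfolding ftr_def[of ?G] by (simp add: mult_ac)
    then show "cnj (F v) * ftr ?G (- v) = ?c * (cnj (F v) * (LINT z|lborel. F (v + s *\<^sub>R z) * gauss z))"
      by (simp add: ftr_gauss_multiplication[OF F s])
  qed
  finally show ?thesis by simp
qed

text \<open>An autocorrelation never exceeds the energy: |F(v)| |F(v+u)| is at most half the sum of
  the squares, and shifts preserve the integral. The damped energies are therefore bounded uniformly
  in \<open>s\<close>, and Fatou's lemma removes the damping.\<close>

lemma bessel:
  fixes F :: "'a::euclidean_space \<Rightarrow> complex"
  assumes F: "integrable lborel F" and F2: "integrable lborel (\<lambda>x. (cmod (F x))\<^sup>2)"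
  shows "(\<integral>\<^sup>+x. ennreal ((cmod (ftr F x))\<^sup>2) \<partial>lborel) \<le> ennreal ((2 * pi) ^ DIM('a) * (LINT x|lborel. (cmod (F x))\<^sup>2))"
proof -
  have [measurable]: "F \<in> borel_measurable borel" using F by simp
  define I where "I = (LINT x|lborel. (cmod (F x))\<^sup>2)"
  have shift: "integrable lborel (\<lambda>v. (cmod (F (v + u)))\<^sup>2)" "(LINT v|lborel. (cmod (F (v + u)))\<^sup>2) = I" for u
    using integrable_lborel_shift[OF F2, of u] integral_lborel_shift[of "\<lambda>x. (cmod (F x))\<^sup>2" u] by (auto simp: I_def)
  have "I \<ge> 0" by (simp add: I_def)
  have key: "(LINT x|lborel. (cmod (ftr F x))\<^sup>2 * gauss (s *\<^sub>R x)) \<le> I / gauss (0::'a)" if s: "s > 0" for s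
  proof -
    let ?h = "\<lambda>v z. cnj (F v) * (F (v + s *\<^sub>R z) * complex_of_real (gauss z))"
    let ?b = "\<lambda>v z. ((cmod (F v))\<^sup>2 + (cmod (F (v + s *\<^sub>R z)))\<^sup>2) / 2 * gauss z"
    have hb: "cmod (?h v z) \<le> ?b v z" for v z
    proof -
      have "cmod (F v) * cmod (F (v + s *\<^sub>R z)) \<le> ((cmod (F v))\<^sup>2 + (cmod (F (v + s *\<^sub>R z)))\<^sup>2) / 2"
        using sum_squares_bound[of "cmod (F v)" "cmod (F (v + s *\<^sub>R z))"] by simp
      from mult_right_mono[OF this less_imp_le[OF gauss_pos[of z]]] show ?thesis
        using gauss_pos[of z] by (simp add: norm_mult mult_ac)
    qed
    have ibz: "integrable lborel (\<lambda>v. ?b v z)" "(LINT v|lborel. ?b v z) = I * gauss z" for z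
      using F2 shift[of "s *\<^sub>R z"] by (auto simp: I_def field_simps)
    have nb: "norm (?b v z) = ?b v z" for v z
      by (simp add: less_imp_le[OF gauss_pos])
    have ib: "integrable (lborel \<Otimes>\<^sub>M lborel) (\<lambda>(z, v). ?b v z)"
    proof (rule lborel_pair.Fubini_integrable)
      have "integrable lborel (\<lambda>z::'a. I * gauss z)" using integrable_gauss[where 'a='a] by auto
      then show "integrable lborel (\<lambda>z. LINT v|lborel. norm (case (z, v) of (z, v) \<Rightarrow> ?b v z))"
        by (simp only: prod.case nb ibz(2))
    qed (use ibz in auto)
    have ih: "integrable (lborel \<Otimes>\<^sub>M lborel) (\<lambda>(z, v). ?h v z)"
    proof (rule Bochner_Integration.integrable_bound[OF ib])
      show "AE x in lborel \<Otimes>\<^sub>M lborel. norm (case x of (z, v) \<Rightarrow> ?h v z) \<le> norm (case x of (z, v) \<Rightarrow> ?b v z)"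
        unfolding split_beta' nb by (intro AE_I2 hb)
    qed simp
    have "(LINT v|lborel. cnj (F v) * (LINT z|lborel. F (v + s *\<^sub>R z) * gauss z)) = (LINT v|lborel. LINT z|lborel. ?h v z)"
      by simp
    also have "\<dots> = (LINT z|lborel. LINT v|lborel. ?h v z)"
      by (rule lborel_pair.Fubini_integral) (use ih in simp)
    finally have "cmod (LINT v|lborel. cnj (F v) * (LINT z|lborel. F (v + s *\<^sub>R z) * gauss z)) \<le> (LINT z|lborel. cmod (LINT v|lborel. ?h v z))"
      using integral_norm_bound[of lborel "\<lambda>z. LINT v|lborel. ?h v z"] by (simp only:)
    also have "\<dots> \<le> (LINT z|lborel. I * gauss (z::'a))"
    proof (rule integral_mono)
      show "integrable lborel (\<lambda>z. cmod (LINT v|lborel. ?h v z))"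
        using lborel_pair.integrable_fst'[OF ih] by simp
      show "integrable lborel (\<lambda>z::'a. I * gauss z)" using integrable_gauss[where 'a='a] by auto
      fix z
      have "cmod (LINT v|lborel. ?h v z) \<le> (LINT v|lborel. ?b v z)"
      proof (rule Bochner_Integration.integral_norm_bound_integral)
        show "integrable lborel (\<lambda>v. ?h v z)"
          by (rule Bochner_Integration.integrable_bound[OF ibz(1)[of z]]) (simp, unfold nb, rule AE_I2, rule hb)
      qed (rule ibz(1), rule hb)
      then show "cmod (LINT v|lborel. ?h v z) \<le> I * gauss z" unfolding ibz(2) .
    qed
    also have "\<dots> = I" using integrable_gauss[where 'a='a] by (simp add: integral_gauss)
    finally have le: "cmod (LINT v|lborel. cnj (F v) * (LINT z|lborel. F (v + s *\<^sub>R z) * gauss z)) \<le> I" .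
    have "(LINT x|lborel. (cmod (ftr F x))\<^sup>2 * gauss (s *\<^sub>R x)) \<le> cmod (complex_of_real (LINT x|lborel. (cmod (ftr F x))\<^sup>2 * gauss (s *\<^sub>R x)))"
      by (simp del: of_real_mult)
    also have "\<dots> \<le> I / gauss (0::'a)"
      unfolding ftr_norm_square_damped[OF F s] gauss_zero[where 'a='a] norm_mult
      using le gauss_pos[of "0::'a"] by (simp add: divide_right_mono norm_divide)
    finally show ?thesis .
  qed
  have lim: "(\<lambda>k. ennreal ((cmod (ftr F x))\<^sup>2 * gauss (inverse (real (Suc k)) *\<^sub>R x))) \<longlonglongrightarrow> ennreal ((cmod (ftr F x))\<^sup>2 * gauss (0::'a))" for x
  proof -
    have "(\<lambda>k. inverse (real (Suc k)) *\<^sub>R x) \<longlonglongrightarrow> 0 *\<^sub>R x"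
      by (intro tendsto_intros LIMSEQ_inverse_real_of_nat)
    from isCont_tendsto_compose[OF isCont_gauss this] show ?thesis
      by (intro tendsto_ennrealI tendsto_mult_left) simp
  qed
  \<comment> \<open>Fatou along the scales \<open>inverse (real (Suc k))\<close>; the limiting
    factor \<open>gauss 0\<close> is carried on the left and divided out at the end.\<close>
  have "ennreal (gauss (0::'a)) * (\<integral>\<^sup>+x. ennreal ((cmod (ftr F x))\<^sup>2) \<partial>lborel) = (\<integral>\<^sup>+x. ennreal ((cmod (ftr F x))\<^sup>2 * gauss (0::'a)) \<partial>lborel)"
    by (subst nn_integral_cmult[symmetric]) (auto simp: ennreal_mult less_imp_le[OF gauss_pos] mult.commute)
  also have "\<dots> = (\<integral>\<^sup>+x. liminf (\<lambda>k. ennreal ((cmod (ftr F x))\<^sup>2 * gauss (inverse (real (Suc k)) *\<^sub>R x))) \<partial>lborel)"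
    by (intro nn_integral_cong lim_imp_Liminf[symmetric] lim) simp
  also have "\<dots> \<le> liminf (\<lambda>k. \<integral>\<^sup>+x. ennreal ((cmod (ftr F x))\<^sup>2 * gauss (inverse (real (Suc k)) *\<^sub>R x)) \<partial>lborel)"
    by (rule nn_integral_liminf) auto
  also have "\<dots> \<le> ennreal (I / gauss (0::'a))"
  proof (rule Liminf_le)
    show "\<forall>\<^sub>F k in sequentially. (\<integral>\<^sup>+x. ennreal ((cmod (ftr F x))\<^sup>2 * gauss (inverse (real (Suc k)) *\<^sub>R x)) \<partial>lborel) \<le> ennreal (I / gauss (0::'a))"
    proof (intro always_eventually allI)
      fix k
      have ig: "integrable lborel (\<lambda>x::'a. gauss (inverse (real (Suc k)) *\<^sub>R x))"
        using integrable_lborel_affine[OF integrable_gauss[where 'a='a], of "inverse (real (Suc k))" 0] by simp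
      have "integrable lborel (\<lambda>x::'a. (cmod (ftr F x))\<^sup>2 * gauss (inverse (real (Suc k)) *\<^sub>R x))"
      proof (rule Bochner_Integration.integrable_bound)
        show "integrable lborel (\<lambda>x::'a. (LINT w|lborel. cmod (F w))\<^sup>2 * gauss (inverse (real (Suc k)) *\<^sub>R x))"
          using ig by (rule integrable_mult_right)
        show "AE x in lborel. norm ((cmod (ftr F x))\<^sup>2 * gauss (inverse (real (Suc k)) *\<^sub>R x)) \<le> norm ((LINT w|lborel. cmod (F w))\<^sup>2 * gauss (inverse (real (Suc k)) *\<^sub>R x))"
          by (intro AE_I2) (auto simp: abs_mult less_imp_le[OF gauss_pos] intro!: mult_right_mono power_mono norm_ftr_le[OF F])
      qed auto
      then have "(\<integral>\<^sup>+x. ennreal ((cmod (ftr F x))\<^sup>2 * gauss (inverse (real (Suc k)) *\<^sub>R x)) \<partial>lborel) = ennreal (LINT x|lborel. (cmod (ftr F x))\<^sup>2 * gauss (inverse (real (Suc k)) *\<^sub>R x))"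
        by (intro nn_integral_eq_integral) (auto simp: less_imp_le[OF gauss_pos])
      also have "\<dots> \<le> ennreal (I / gauss (0::'a))"
        by (intro ennreal_leI key) simp
      finally show "(\<integral>\<^sup>+x. ennreal ((cmod (ftr F x))\<^sup>2 * gauss (inverse (real (Suc k)) *\<^sub>R x)) \<partial>lborel) \<le> ennreal (I / gauss (0::'a))" .
    qed
  qed simp
  finally have le: "ennreal (gauss (0::'a)) * (\<integral>\<^sup>+x. ennreal ((cmod (ftr F x))\<^sup>2) \<partial>lborel) \<le> ennreal (I / gauss (0::'a))" .
  have "(\<integral>\<^sup>+x. ennreal ((cmod (ftr F x))\<^sup>2) \<partial>lborel)
      = ennreal (1 / gauss (0::'a)) * ennreal (gauss (0::'a)) * (\<integral>\<^sup>+x. ennreal ((cmod (ftr F x))\<^sup>2) \<partial>lborel)"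
    using gauss_pos[of "0::'a"] by (simp flip: ennreal_mult')
  also have "\<dots> \<le> ennreal (1 / gauss (0::'a)) * ennreal (I / gauss (0::'a))"
    unfolding mult.assoc by (intro mult_left_mono le) simp
  also have "\<dots> = ennreal (1 / (gauss (0::'a))\<^sup>2 * I)"
    using gauss_pos[of "0::'a"] by (subst ennreal_mult'[symmetric]) (simp_all add: power2_eq_square)
  finally have "(\<integral>\<^sup>+x. ennreal ((cmod (ftr F x))\<^sup>2) \<partial>lborel) \<le> ennreal (1 / (gauss (0::'a))\<^sup>2 * I)" .
  then show ?thesis by (simp add: gauss_zero_sq I_def)
qed

text \<open>The direction opposite to \<open>bessel\<close>: for continuous bounded \<open>W\<close>
  the averaged autocorrelations converge to the energy of \<open>W\<close>, while each damped energy
  is at most \<open>gauss 0\<close> times the undamped one.\<close>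

lemma plancherel_le:
  fixes W :: "'a::euclidean_space \<Rightarrow> complex"
  assumes W: "integrable lborel W" and cont: "continuous_on UNIV W" and bd: "\<And>x. cmod (W x) \<le> B"
    and w2: "integrable lborel (\<lambda>x. (cmod (ftr W x))\<^sup>2)"
  shows "(2 * pi) ^ DIM('a) * (LINT x|lborel. (cmod (W x))\<^sup>2) \<le> (LINT x|lborel. (cmod (ftr W x))\<^sup>2)"
proof -
  have [measurable]: "W \<in> borel_measurable borel" using W by simp
  let ?s = "\<lambda>k. inverse (real (Suc k))"
  have ip: "0 < ?s k" for k by simp
  have "B \<ge> 0" using order.trans[OF norm_ge_zero bd] by blast
  let ?A = "\<lambda>k v. LINT z|lborel. W (v + ?s k *\<^sub>R z) * gauss z"
  have Ab: "cmod (?A k v) \<le> B" for k v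
  proof -
    have "cmod (?A k v) \<le> (LINT (z::'a)|lborel. B * gauss z)"
    proof (rule Bochner_Integration.integral_norm_bound_integral)
      show "integrable lborel (\<lambda>z. W (v + ?s k *\<^sub>R z) * complex_of_real (gauss z))"
        by (rule Bochner_Integration.integrable_bound[where f="\<lambda>z. B * gauss z"])
           (use integrable_gauss[where 'a='a] \<open>B \<ge> 0\<close> bd in \<open>auto simp: norm_mult abs_mult less_imp_le[OF gauss_pos] intro!: mult_right_mono\<close>)
    qed (use integrable_gauss[where 'a='a] bd in \<open>auto simp: norm_mult less_imp_le[OF gauss_pos] intro!: mult_right_mono\<close>)
    also have "\<dots> = B" using integrable_gauss[where 'a='a] by (simp add: integral_gauss)
    finally show ?thesis .
  qed
  have Am [measurable]: "?A k \<in> borel_measurable borel" for k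
    by (rule sigma_finite_measure.borel_measurable_lebesgue_integral) (auto simp: lborel.sigma_finite_measure_axioms split_beta')
  have "(\<lambda>k. LINT v|lborel. cnj (W v) * ?A k v) \<longlonglongrightarrow> (LINT v|lborel. cnj (W v) * W v)"
  proof (rule integral_dominated_convergence[where w="\<lambda>v. cmod (W v) * B"])
    show "AE v in lborel. (\<lambda>k. cnj (W v) * ?A k v) \<longlonglongrightarrow> cnj (W v) * W v"
      by (intro AE_I2 tendsto_mult_left gauss_approximate_identity[OF cont bd])
    show "\<And>k. AE v in lborel. cmod (cnj (W v) * ?A k v) \<le> cmod (W v) * B"
      unfolding norm_mult complex_mod_cnj by (intro AE_I2 mult_left_mono Ab) auto
  qed (use W Am in auto)
  also have "(LINT v|lborel. cnj (W v) * W v) = complex_of_real (LINT v|lborel. (cmod (W v))\<^sup>2)"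
    unfolding integral_complex_of_real[symmetric] by (intro Bochner_Integration.integral_cong) (simp_all add: complex_norm_square mult.commute del: of_real_power)
  finally have "(\<lambda>k. complex_of_real ((2 * pi) powr (real DIM('a) / 2)) * (LINT v|lborel. cnj (W v) * ?A k v))
       \<longlonglongrightarrow> complex_of_real ((2 * pi) powr (real DIM('a) / 2)) * complex_of_real (LINT v|lborel. (cmod (W v))\<^sup>2)"
    by (intro tendsto_mult_left)
  then have "(\<lambda>k. complex_of_real (LINT x|lborel. (cmod (ftr W x))\<^sup>2 * gauss (?s k *\<^sub>R x)))
      \<longlonglongrightarrow> complex_of_real ((2 * pi) powr (real DIM('a) / 2) * (LINT v|lborel. (cmod (W v))\<^sup>2))"
    unfolding ftr_norm_square_damped[OF W ip] of_real_mult .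
  then have "(\<lambda>k. (LINT x|lborel. (cmod (ftr W x))\<^sup>2 * gauss (?s k *\<^sub>R x)))
      \<longlonglongrightarrow> (2 * pi) powr (real DIM('a) / 2) * (LINT v|lborel. (cmod (W v))\<^sup>2)"
    unfolding tendsto_of_real_iff .
  then have "(2 * pi) powr (real DIM('a) / 2) * (LINT v|lborel. (cmod (W v))\<^sup>2) \<le> gauss (0::'a) * (LINT x|lborel. (cmod (ftr W x))\<^sup>2)"
  proof (rule LIMSEQ_le_const2)
    have "(LINT x|lborel. (cmod (ftr W x))\<^sup>2 * gauss (?s k *\<^sub>R x)) \<le> (LINT x|lborel. gauss (0::'a) * (cmod (ftr W x))\<^sup>2)" for k
    proof (rule integral_mono')
      show "integrable lborel (\<lambda>x. gauss (0::'a) * (cmod (ftr W x))\<^sup>2)" using w2 by simp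
      show "(cmod (ftr W x))\<^sup>2 * gauss (?s k *\<^sub>R x) \<le> gauss (0::'a) * (cmod (ftr W x))\<^sup>2" for x
        by (subst mult.commute) (intro mult_right_mono gauss_le, simp)
    qed (use gauss_pos[of "0::'a"] in simp)
    then show "\<exists>N. \<forall>n\<ge>N. (LINT x|lborel. (cmod (ftr W x))\<^sup>2 * gauss (?s n *\<^sub>R x)) \<le> gauss (0::'a) * (LINT x|lborel. (cmod (ftr W x))\<^sup>2)"
      by auto
  qed
  then have "(1 / gauss (0::'a))\<^sup>2 * (LINT v|lborel. (cmod (W v))\<^sup>2) \<le> (LINT x|lborel. (cmod (ftr W x))\<^sup>2)"
    using gauss_pos[of "0::'a"] unfolding gauss_zero[where 'a='a] by (simp add: field_simps power2_eq_square)
  then show ?thesis by (simp add: gauss_zero_sq power_divide)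
qed

section \<open>Bump functions with rapidly decaying Fourier transform\<close>

lemma compact_support_integrable:
  fixes f :: "'a::euclidean_space \<Rightarrow> 'b::{euclidean_space}"
  assumes cont: "continuous_on UNIV f" and supp: "\<And>x. r \<le> norm (x - z) \<Longrightarrow> f x = 0"
  shows "integrable lborel f" and "\<exists>B. \<forall>x. norm (f x) \<le> B"
proof -
  have c: "continuous_on (cball z r) f" using cont continuous_on_subset by blast
  have ind: "indicator (cball z r) x *\<^sub>R f x = f x" for x
    using supp[of x] by (auto simp: indicator_def dist_norm norm_minus_commute)
  have "integrable lborel (\<lambda>x. indicator (cball z r) x *\<^sub>R f x)"
    using c by (intro borel_integrable_compact) auto
  then show "integrable lborel f" unfolding ind .
  have "bounded (f ` cball z r)" using c by (intro compact_imp_bounded compact_continuous_image) auto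
  then obtain B where B: "\<And>x. x \<in> cball z r \<Longrightarrow> norm (f x) \<le> B" "B > 0"
    unfolding bounded_pos by blast
  then have "norm (f x) \<le> B" for x
    using supp[of x] by (cases "x \<in> cball z r") (auto simp: dist_norm norm_minus_commute)
  then show "\<exists>B. \<forall>x. norm (f x) \<le> B" by blast
qed

lemma ftr_shift:
  fixes f :: "'a::euclidean_space \<Rightarrow> complex"
  assumes [measurable]: "f \<in> borel_measurable borel"
  shows "ftr (\<lambda>x. f (x + v)) w = cis (- (v \<bullet> w)) * ftr f w"
proof -
  have "ftr (\<lambda>x. f (x + v)) w = (LINT x|lborel. (\<lambda>y. cis (- (v \<bullet> w)) * (f y * cis (y \<bullet> w))) (x + v))"
    unfolding ftr_def by (intro Bochner_Integration.integral_cong) (auto simp: cis_mult inner_add_left)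
  also have "\<dots> = (LINT x|lborel. cis (- (v \<bullet> w)) * (f x * cis (x \<bullet> w)))"
    by (rule integral_lborel_shift) simp
  also have "\<dots> = cis (- (v \<bullet> w)) * ftr f w" by (simp add: ftr_def)
  finally show ?thesis .
qed

text \<open>Lipschitz with compact support is enough for one power of decay; higher powers come from
  repeated convolution.\<close>

definition tent :: "real \<Rightarrow> 'a::euclidean_space \<Rightarrow> real" where
  "tent r x = max 0 (r - norm x)"

lemma tent_props:
  "continuous_on UNIV (tent r)" "0 \<le> tent r x" "r \<le> norm x \<Longrightarrow> tent r x = 0"
  "\<bar>tent r x - tent r y\<bar> \<le> norm (x - y)"
proof -
  show "continuous_on UNIV (tent r)" unfolding tent_def[abs_def] by (intro continuous_intros)
  show "\<bar>tent r x - tent r y\<bar> \<le> norm (x - y)"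
    using norm_triangle_ineq3[of x y] unfolding tent_def by linarith
qed (auto simp: tent_def)

lemma tent_integrable: "integrable lborel (tent r :: 'a::euclidean_space \<Rightarrow> real)"
  by (rule compact_support_integrable[where r=r and z=0]) (auto simp: tent_props)

lemma tent_integral_pos:
  assumes "r > 0"
  shows "(LINT x|lborel. tent r (x::'a::euclidean_space)) > 0"
proof -
  have "0 < measure lborel (ball (0::'a) (r / 2)) * (r / 2)"
    using assms content_ball_pos[of "r / 2" "0::'a"] by simp
  also have "\<dots> = (LINT x|lborel. indicator (ball (0::'a) (r / 2)) x * (r / 2))"
    by (simp add: emeasure_lborel_ball_finite)
  also have "\<dots> \<le> (LINT x|lborel. tent r (x::'a))"
    using assms emeasure_lborel_ball_finite[of "0::'a" "r / 2"]
    by (intro integral_mono tent_integrable) (simp, auto simp: tent_def indicator_def)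
  finally show ?thesis .
qed

text \<open>Translating by \<open>v = \<pi> w / |w|\<^sup>2\<close> flips the sign of the transform at \<open>w\<close>, so the transform
  is controlled by the \<open>L\<^sub>1\<close> modulus of continuity.\<close>

lemma tent_fourier_decay:
  assumes r: "r > 0"
  shows "\<exists>C. \<forall>w::'a::euclidean_space. cmod (ftr (\<lambda>x. complex_of_real (tent r x)) w) \<le> C / (1 + norm w)"
proof -
  let ?g = "\<lambda>x::'a. complex_of_real (tent r x)"
  have gi: "integrable lborel ?g" using tent_integrable by auto
  have gm [measurable]: "?g \<in> borel_measurable borel" using gi by simp
  define I where "I = (LINT x|lborel. tent r (x::'a))"
  \<comment> \<open>The radius \<open>r + pi\<close> covers the support of the tent and of its
    translate by \<open>v\<close>, since \<open>norm v \<le> pi\<close> once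
    \<open>norm w > 1\<close>.\<close>
  define V where "V = measure lborel (cball (0::'a) (r + pi))"
  have "I > 0" unfolding I_def by (rule tent_integral_pos[OF r])
  have "V \<ge> 0" by (simp add: V_def)
  have "cmod (ftr ?g w) \<le> (2 * I + pi * V) / (1 + norm w)" for w
  proof (cases "norm w \<le> 1")
    case True
    have "cmod (ftr ?g w) \<le> I"
      using norm_ftr_le[OF gi, of w] by (simp add: I_def tent_props)
    also have "\<dots> \<le> (2 * I + pi * V) / (1 + norm w)"
    proof -
      have "I * (1 + norm w) \<le> I * 2" using True \<open>I > 0\<close> by (intro mult_left_mono) auto
      also have "\<dots> \<le> 2 * I + pi * V" using \<open>V \<ge> 0\<close> by simp
      finally show ?thesis by (subst pos_le_divide_eq) (use norm_ge_zero[of w] in linarith, simp)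
    qed
    finally show ?thesis .
  next
    case False
    define v where "v = (pi / (norm w)\<^sup>2) *\<^sub>R w"
    have vw: "v \<bullet> w = pi" using False by (auto simp: v_def power2_norm_eq_inner[symmetric])
    have nv: "norm v = pi / norm w" using False by (auto simp: v_def power2_eq_square)
    have nv1: "norm v \<le> pi" using False by (simp add: nv divide_le_eq)
    have gvi: "integrable lborel (\<lambda>x. ?g (x + v))" by (rule integrable_lborel_shift[OF gi])
    have "ftr (\<lambda>x. ?g (x + v)) w = - ftr ?g w"
      by (subst ftr_shift) (auto simp: vw cis.ctr complex_eq_iff)
    then have "2 * ftr ?g w = ftr ?g w - ftr (\<lambda>x. ?g (x + v)) w" by simp
    also have "\<dots> = ftr (\<lambda>x. ?g x - ?g (x + v)) w"
      unfolding ftr_def left_diff_distrib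
      by (rule Bochner_Integration.integral_diff[symmetric]) (auto intro!: integrable_mult_cis gi gvi)
    finally have "2 * cmod (ftr ?g w) = cmod (ftr (\<lambda>x. ?g x - ?g (x + v)) w)"
      by (metis norm_mult norm_numeral)
    also have "\<dots> \<le> (LINT x|lborel. cmod (?g x - ?g (x + v)))"
      by (rule norm_ftr_le) (use gi gvi in simp)
    also have "\<dots> \<le> (LINT x|lborel. norm v * indicator (cball (0::'a) (r + pi)) x)"
    proof (rule integral_mono)
      show "integrable lborel (\<lambda>x. cmod (?g x - ?g (x + v)))"
        using gi gvi by (intro integrable_norm Bochner_Integration.integrable_diff)
      show "integrable lborel (\<lambda>x. norm v * indicator (cball (0::'a) (r + pi)) x)"
        using emeasure_lborel_cball_finite[of "0::'a" "r + pi"] by (intro integrable_mult_right integrable_real_indicator) auto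
      fix x
      show "cmod (?g x - ?g (x + v)) \<le> norm v * indicator (cball 0 (r + pi)) x"
      proof (cases "norm x \<le> r + pi")
        case True
        have "cmod (?g x - ?g (x + v)) = \<bar>tent r x - tent r (x + v)\<bar>"
          by (simp flip: of_real_diff)
        also have "\<dots> \<le> norm v" using tent_props(4)[of r x "x + v"] by simp
        finally show ?thesis using True by simp
      next
        case False
        then have "norm x \<ge> r" "norm (x + v) \<ge> r"
          using nv1 norm_triangle_ineq4[of "x + v" v, simplified] pi_ge_zero by linarith+
        then show ?thesis by (simp add: tent_props)
      qed
    qed
    also have "\<dots> = norm v * V" by (simp add: V_def emeasure_lborel_cball_finite)
    also have "\<dots> = pi * V / norm w" by (simp add: nv)
    finally have le: "2 * cmod (ftr ?g w) \<le> pi * V / norm w" .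
    have "cmod (ftr ?g w) * (1 + norm w) \<le> cmod (ftr ?g w) * (2 * norm w)"
      using False by (intro mult_left_mono) auto
    also have "\<dots> \<le> pi * V" using mult_right_mono[OF le, of "norm w"] False by (auto simp: mult_ac split: if_splits)
    also have "\<dots> \<le> 2 * I + pi * V" using \<open>I > 0\<close> by simp
    finally show ?thesis by (subst pos_le_divide_eq) (use norm_ge_zero[of w] in linarith, simp)
  qed
  then show ?thesis by blast
qed

text \<open>Induction on the order of decay: convolving with a tent multiplies the transforms and so
  gains one factor 1 / (1 + |w|), keeps nonnegativity and positive mass, and adds the radii of the
  supports. Both factors are therefore taken with radius \<open>r / 2\<close>.\<close>

lemma bump_exists_origin:
  assumes "r > 0"
  shows "\<exists>\<beta>::'a::euclidean_space \<Rightarrow> real. continuous_on UNIV \<beta> \<and> (\<forall>x. 0 \<le> \<beta> x) \<and> (\<forall>x. r \<le> norm x \<longrightarrow> \<beta> x = 0) \<and>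
     (LINT x|lborel. \<beta> x) > 0 \<and> (\<exists>C. \<forall>w. cmod (ftr (\<lambda>x. complex_of_real (\<beta> x)) w) \<le> C / (1 + norm w) ^ Suc m)"
  using assms
proof (induction m arbitrary: r)
  case 0
  show ?case
    by (rule exI[of _ "tent r"]) (use tent_props tent_integral_pos[OF 0] tent_fourier_decay[OF 0] in auto)
next
  case (Suc m)
  from Suc.prems have r2: "r / 2 > 0" by simp
  from Suc.IH[OF r2] obtain \<beta> :: "'a \<Rightarrow> real" and C where
    \<beta>: "continuous_on UNIV \<beta>" "\<And>x. 0 \<le> \<beta> x" "\<And>x. r / 2 \<le> norm x \<Longrightarrow> \<beta> x = 0" "(LINT x|lborel. \<beta> x) > 0"
    and C: "\<And>w. cmod (ftr (\<lambda>x. complex_of_real (\<beta> x)) w) \<le> C / (1 + norm w) ^ Suc m" by blast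
  from tent_fourier_decay[OF r2] obtain D where
    D: "\<And>w::'a. cmod (ftr (\<lambda>x. complex_of_real (tent (r / 2) x)) w) \<le> D / (1 + norm w)" by blast
  let ?g = "tent (r / 2) :: 'a \<Rightarrow> real"
  define \<beta>' where "\<beta>' = (\<lambda>x. LINT y|lborel. \<beta> y * ?g (x - y))"
  have \<beta>i: "integrable lborel \<beta>" by (rule compact_support_integrable[where r="r/2" and z=0]) (use \<beta> in auto)
  have gi: "integrable lborel ?g" by (rule tent_integrable)
  have [measurable]: "\<beta> \<in> borel_measurable borel" "?g \<in> borel_measurable borel" using \<beta>i gi by auto
  have gb: "\<bar>?g x\<bar> \<le> r / 2" for x using Suc.prems norm_ge_zero[of x] unfolding tent_def by linarith
  have pi: "integrable lborel (\<lambda>y. \<beta> y * ?g (x - y))" for x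
  proof (rule Bochner_Integration.integrable_bound)
    show "integrable lborel (\<lambda>y. \<beta> y * (r / 2))" using \<beta>i by simp
    show "AE y in lborel. norm (\<beta> y * ?g (x - y)) \<le> norm (\<beta> y * (r / 2))"
      unfolding norm_mult by (intro AE_I2 mult_left_mono) (use gb r2 in auto)
  qed simp
  \<comment> \<open>The tent has Lipschitz constant 1, so the convolution inherits the mass of
    \<open>\<beta>\<close> as its Lipschitz constant.\<close>
  have lip: "\<bar>\<beta>' x - \<beta>' z\<bar> \<le> (LINT y|lborel. \<beta> y) * norm (x - z)" for x z
  proof -
    have "\<beta>' x - \<beta>' z = (LINT y|lborel. \<beta> y * ?g (x - y) - \<beta> y * ?g (z - y))"
      unfolding \<beta>'_def by (rule Bochner_Integration.integral_diff[symmetric]) (rule pi)+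
    also have "norm \<dots> \<le> (LINT y|lborel. \<beta> y * norm (x - z))"
    proof (rule Bochner_Integration.integral_norm_bound_integral)
      show "norm (\<beta> y * ?g (x - y) - \<beta> y * ?g (z - y)) \<le> \<beta> y * norm (x - z)" for y
        using mult_left_mono[OF tent_props(4)[of "r/2" "x - y" "z - y"] \<beta>(2)[of y]] \<beta>(2)[of y]
        by (simp add: right_diff_distrib[symmetric] abs_mult)
    qed (use pi \<beta>i in auto)
    finally show ?thesis by simp
  qed
  have cont: "continuous_on UNIV \<beta>'"
  proof (rule lipschitz_on_continuous_on[where L="LINT y|lborel. \<beta> y"])
    show "(LINT y|lborel. \<beta> y)-lipschitz_on UNIV \<beta>'"
      using lip \<beta>(4) by (intro lipschitz_onI) (auto simp: dist_norm)
  qed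
  have supp: "\<beta>' x = 0" if "r \<le> norm x" for x
  proof -
    have "\<beta> y * ?g (x - y) = 0" for y
    proof (cases "r / 2 \<le> norm y")
      case False
      then have "r / 2 \<le> norm (x - y)" using that norm_triangle_ineq2[of x y] by auto
      then show ?thesis by (simp add: tent_props)
    qed (simp add: \<beta>)
    then show ?thesis by (simp only: \<beta>'_def) simp
  qed
  have ft: "ftr (\<lambda>x. complex_of_real (\<beta>' x)) w = ftr (\<lambda>x. complex_of_real (\<beta> x)) w * ftr (\<lambda>x. complex_of_real (?g x)) w" for w
  proof -
    let ?k = "\<lambda>x y. complex_of_real (\<beta> y) * (complex_of_real (?g (x - y)) * cis (x \<bullet> w))"
    have gs: "integrable lborel (\<lambda>x. complex_of_real (?g (x - y)))" for y
      using integrable_lborel_shift[OF gi, of "- y"] by simp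
    have gsc: "integrable lborel (\<lambda>x. complex_of_real (?g (x - y)) * cis (x \<bullet> w))" for y
      by (rule integrable_mult_cis[OF gs]) simp
    have ki: "integrable (lborel \<Otimes>\<^sub>M lborel) (\<lambda>(y, x). ?k x y)"
    proof (rule lborel_pair.Fubini_integrable)
      have "(LINT x|lborel. norm (?k x y)) = \<beta> y * (LINT x|lborel. ?g x)" for y
        using \<beta>(2)[of y] integral_lborel_shift[of ?g "- y"] by (simp add: norm_mult tent_props)
      then show "integrable lborel (\<lambda>y. LINT x|lborel. norm (case (y, x) of (y, x) \<Rightarrow> ?k x y))"
        using \<beta>i by simp
      show "AE y in lborel. integrable lborel (\<lambda>x. case (y, x) of (y, x) \<Rightarrow> ?k x y)"
        using gsc by simp
    qed measurable
    have "ftr (\<lambda>x. complex_of_real (\<beta>' x)) w = (LINT x|lborel. LINT y|lborel. ?k x y)"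
      unfolding ftr_def \<beta>'_def
    proof (intro Bochner_Integration.integral_cong refl)
      fix x
      have "complex_of_real (LINT y|lborel. \<beta> y * ?g (x - y)) * cis (x \<bullet> w) = (LINT y|lborel. complex_of_real (\<beta> y * ?g (x - y))) * cis (x \<bullet> w)"
        by (simp only: integral_complex_of_real)
      also have "\<dots> = (LINT y|lborel. complex_of_real (\<beta> y * ?g (x - y)) * cis (x \<bullet> w))"
        using pi[of x] by (intro Bochner_Integration.integral_mult_left[symmetric] integrable_of_real) auto
      finally show "complex_of_real (LINT y|lborel. \<beta> y * ?g (x - y)) * cis (x \<bullet> w) = (LINT y|lborel. ?k x y)"
        by (simp add: mult.assoc)
    qed
    also have "\<dots> = (LINT y|lborel. LINT x|lborel. ?k x y)"
      by (rule lborel_pair.Fubini_integral) (use ki in simp)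
    also have "\<dots> = (LINT y|lborel. complex_of_real (\<beta> y) * ftr (\<lambda>x. complex_of_real (?g (x + - y))) w)"
      using gsc by (simp add: ftr_def)
    also have "\<dots> = (LINT y|lborel. complex_of_real (\<beta> y) * cis (y \<bullet> w) * ftr (\<lambda>x. complex_of_real (?g x)) w)"
    proof -
      have "ftr (\<lambda>x. complex_of_real (?g (x + - y))) w = cis (- (- y \<bullet> w)) * ftr (\<lambda>x. complex_of_real (?g x)) w" for y
        by (rule ftr_shift) simp
      then show ?thesis by (simp add: mult.assoc)
    qed
    also have "\<dots> = (LINT y|lborel. complex_of_real (\<beta> y) * cis (y \<bullet> w)) * ftr (\<lambda>x. complex_of_real (?g x)) w"
      using \<beta>i by (intro Bochner_Integration.integral_mult_left integrable_mult_cis) auto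
    finally show ?thesis by (simp add: ftr_def)
  qed
  have int: "(LINT x|lborel. \<beta>' x) > 0"
  proof -
    have "complex_of_real (LINT x|lborel. \<beta>' x) = complex_of_real ((LINT x|lborel. \<beta> x) * (LINT x|lborel. ?g x))"
      using ft[of 0] by (simp add: ftr_def)
    then have "(LINT x|lborel. \<beta>' x) = (LINT x|lborel. \<beta> x) * (LINT x|lborel. ?g x)"
      by (simp only: of_real_eq_iff)
    then show ?thesis using \<beta>(4) tent_integral_pos[OF r2, where 'a='a] by simp
  qed
  have dec: "cmod (ftr (\<lambda>x. complex_of_real (\<beta>' x)) w) \<le> (C * D) / (1 + norm w) ^ Suc (Suc m)" for w
  proof -
    have "cmod (ftr (\<lambda>x. complex_of_real (\<beta>' x)) w) \<le> (C / (1 + norm w) ^ Suc m) * (D / (1 + norm w))"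
      unfolding ft norm_mult by (intro mult_mono C D order.trans[OF norm_ge_zero C]) auto
    then show ?thesis by (simp add: mult_ac)
  qed
  have nn: "0 \<le> \<beta>' x" for x unfolding \<beta>'_def using \<beta>(2) by (simp add: tent_props)
  show ?case using cont nn supp int dec by blast
qed

text \<open>The order is chosen with \<open>Suc m \<ge> 2 * p\<close>, which suffices for positive
  \<open>p\<close> since (1 + |w|)^2 dominates 1 + |w|^2. The translation to \<open>x0\<close> only
  multiplies the transform by a phase, and \<open>C + 1\<close> makes the constant positive.\<close>

lemma bump_exists:
  fixes x0 :: "'a::euclidean_space"
  assumes r: "r > 0"
  obtains \<beta> :: "'a \<Rightarrow> real" and C where "continuous_on UNIV \<beta>" "\<And>x. 0 \<le> \<beta> x"
    "\<And>x. r \<le> norm (x - x0) \<Longrightarrow> \<beta> x = 0" "(LINT x|lborel. \<beta> x) > 0" "C > 0"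
    "\<And>w. cmod (ftr (\<lambda>x. complex_of_real (\<beta> x)) w) \<le> C * (1 + (norm w)\<^sup>2) powr (- p)"
proof -
  define m where "m = nat \<lceil>2 * p\<rceil>"
  have m: "real (Suc m) \<ge> 2 * p" unfolding m_def by linarith
  from bump_exists_origin[OF r, of m] obtain \<beta> :: "'a \<Rightarrow> real" and C where
    \<beta>: "continuous_on UNIV \<beta>" "\<And>x. 0 \<le> \<beta> x" "\<And>x. r \<le> norm x \<Longrightarrow> \<beta> x = 0" "(LINT x|lborel. \<beta> x) > 0"
    and C: "\<And>w. cmod (ftr (\<lambda>x. complex_of_real (\<beta> x)) w) \<le> C / (1 + norm w) ^ Suc m" by blast
  have [measurable]: "\<beta> \<in> borel_measurable borel" by (rule borel_measurable_continuous_onI[OF \<beta>(1)])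
  let ?b = "\<lambda>x. \<beta> (x + - x0)"
  have C0: "C \<ge> 0" using order.trans[OF norm_ge_zero C[of 0]] by simp
  have bd: "cmod (ftr (\<lambda>x. complex_of_real (?b x)) w) \<le> (C + 1) * (1 + (norm w)\<^sup>2) powr (- p)" for w
  proof -
    have "ftr (\<lambda>x. complex_of_real (?b x)) w = cis (- (- x0 \<bullet> w)) * ftr (\<lambda>x. complex_of_real (\<beta> x)) w"
      by (rule ftr_shift) simp
    then have "cmod (ftr (\<lambda>x. complex_of_real (?b x)) w) \<le> C / (1 + norm w) ^ Suc m"
      using C[of w] by (simp add: norm_mult)
    also have "\<dots> \<le> (C + 1) / (1 + norm w) ^ Suc m" by (intro divide_right_mono) auto
    also have "\<dots> = (C + 1) * (1 + norm w) powr (- real (Suc m))"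
      using norm_ge_zero[of w] by (subst powr_minus_divide, subst powr_realpow) (linarith, simp)
    also have "\<dots> \<le> (C + 1) * (1 + (norm w)\<^sup>2) powr (- p)"
    proof (intro mult_left_mono)
      show "(1 + norm w) powr (- real (Suc m)) \<le> (1 + (norm w)\<^sup>2) powr (- p)"
      proof (cases "p \<ge> 0")
        case True
        have "(1 + norm w) powr (- real (Suc m)) \<le> (1 + norm w) powr (- 2 * p)"
          using m by (intro powr_mono) auto
        also have "\<dots> = ((1 + norm w)\<^sup>2) powr (- p)"
          by (simp add: powr_powr flip: powr_numeral)
        also have "\<dots> \<le> (1 + (norm w)\<^sup>2) powr (- p)"
          using True by (intro powr_mono2') (auto simp: power2_sum add_pos_nonneg)
        finally show ?thesis .
      next
        case False
        have "(1 + norm w) powr (- real (Suc m)) \<le> (1 + norm w) powr 0" by (intro powr_mono) auto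
        also have "\<dots> = 1" by (simp add: add_pos_nonneg add_nonneg_eq_0_iff)
        also have "1 \<le> (1 + (norm w)\<^sup>2) powr (- p)" using False by (intro ge_one_powr_ge_zero) auto
        finally show ?thesis .
      qed
    qed (use C0 in simp)
    finally show ?thesis .
  qed
  show ?thesis
  proof (rule that[of ?b "C + 1"])
    show "continuous_on UNIV ?b" by (intro continuous_on_compose2[OF \<beta>(1)] continuous_intros) auto
    show "(LINT x|lborel. ?b x) > 0" using \<beta>(4) by (subst integral_lborel_shift) auto
  qed (use \<beta> bd C0 in auto)
qed

section \<open>Ridge regression coefficients\<close>

text \<open>Gaussian elimination of the last unknown: the Schur complement \<open>A'\<close> is
  again positive definite, because its form at \<open>c\<close> is the form of \<open>A\<close> at a
  suitable extension of \<open>c\<close>.\<close>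

lemma positive_definite_solvable:
  fixes A :: "nat \<Rightarrow> nat \<Rightarrow> real"
  assumes "\<And>c. \<exists>j<n. c j \<noteq> 0 \<Longrightarrow> (\<Sum>j<n. c j * (\<Sum>k<n. A j k * c k)) > 0"
  shows "\<exists>c. \<forall>j<n. (\<Sum>k<n. A j k * c k) = Y j"
  using assms
proof (induction n arbitrary: A Y)
  case 0
  then show ?case by simp
next
  case (Suc n)
  define a where "a = A n n"
  have a: "a > 0"
  proof -
    let ?c = "\<lambda>j. if j = n then 1 else 0 :: real"
    have "(\<Sum>j<Suc n. ?c j * (\<Sum>k<Suc n. A j k * ?c k)) > 0" by (rule Suc.prems) auto
    then show ?thesis by (simp add: a_def)
  qed
  define A' where "A' j k = A j k - A j n * A n k / a" for j k
  have row: "(\<Sum>k<n. A' j k * c k) = (\<Sum>k<n. A j k * c k) - A j n * (\<Sum>k<n. A n k * c k) / a" for j c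
    by (simp add: A'_def left_diff_distrib sum_subtractf sum_distrib_left sum_divide_distrib mult.assoc)
  have "\<exists>c. \<forall>j<n. (\<Sum>k<n. A' j k * c k) = Y j - A j n * Y n / a"
  proof (rule Suc.IH)
    fix c :: "nat \<Rightarrow> real" assume "\<exists>j<n. c j \<noteq> 0"
    then obtain i where i: "i < n" "c i \<noteq> 0" by blast
    \<comment> \<open>The last entry is chosen so that row \<open>n\<close> of \<open>A\<close>
      annihilates \<open>c'\<close>; the remaining rows then agree with those of
      \<open>A'\<close>.\<close>
    define c' where "c' = c(n := - (\<Sum>k<n. A n k * c k) / a)"
    have lt: "(\<Sum>k<n. A j k * c' k) = (\<Sum>k<n. A j k * c k)" for j
      by (intro sum.cong) (auto simp: c'_def)
    have rn: "(\<Sum>k<Suc n. A n k * c' k) = 0"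
      using a by (simp add: lt) (simp add: c'_def a_def)
    have rj: "(\<Sum>k<Suc n. A j k * c' k) = (\<Sum>k<n. A' j k * c k)" for j
      by (simp add: lt row) (simp add: c'_def)
    have "0 < (\<Sum>j<Suc n. c' j * (\<Sum>k<Suc n. A j k * c' k))"
      by (rule Suc.prems) (use i in \<open>auto simp: c'_def intro!: exI[of _ i]\<close>)
    also have "\<dots> = (\<Sum>j<n. c' j * (\<Sum>k<Suc n. A j k * c' k))"
      by (simp only: sum.lessThan_Suc[of "\<lambda>j. c' j * (\<Sum>k<Suc n. A j k * c' k)"] rn mult_zero_right add_0_right)
    also have "\<dots> = (\<Sum>j<n. c' j * (\<Sum>k<n. A' j k * c k))"
      by (simp only: rj)
    also have "\<dots> = (\<Sum>j<n. c j * (\<Sum>k<n. A' j k * c k))"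
      by (intro sum.cong) (auto simp: c'_def)
    finally show "0 < (\<Sum>j<n. c j * (\<Sum>k<n. A' j k * c k))" .
  qed
  then obtain c where c: "\<And>j. j < n \<Longrightarrow> (\<Sum>k<n. A' j k * c k) = Y j - A j n * Y n / a" by blast
  define c' where "c' = c(n := (Y n - (\<Sum>k<n. A n k * c k)) / a)"
  have lt: "(\<Sum>k<n. A j k * c' k) = (\<Sum>k<n. A j k * c k)" for j
    by (intro sum.cong) (auto simp: c'_def)
  have "(\<Sum>k<Suc n. A j k * c' k) = Y j" if "j < Suc n" for j
  proof (cases "j = n")
    case True
    then show ?thesis using a by (simp add: lt) (simp add: c'_def a_def)
  next
    case False
    then have "j < n" using that by simp
    from c[OF this] show ?thesis
      by (simp add: lt row) (simp add: c'_def right_diff_distrib diff_divide_distrib)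
  qed
  then show ?case by blast
qed

text \<open>Only nonnegativity of the form is assumed, so repeated design points are covered;
  \<open>mu > 0\<close> supplies definiteness.\<close>

locale ridge_system =
  fixes R :: "nat \<Rightarrow> nat \<Rightarrow> real" and n :: nat and mu :: real
  assumes psd: "\<And>c. 0 \<le> (\<Sum>j<n. c j * (\<Sum>k<n. R j k * c k))" and mu: "mu > 0"
begin

lemma row_sum: "j < n \<Longrightarrow> (\<Sum>k<n. (R j k + (if j = k then mu else 0)) * c k) = (\<Sum>k<n. R j k * c k) + mu * c j"
proof -
  assume j: "j < n"
  have "(\<Sum>k<n. (R j k + (if j = k then mu else 0)) * c k) = (\<Sum>k<n. R j k * c k + (if j = k then mu * c k else 0))"
    by (intro sum.cong) (auto simp: distrib_right)
  then show ?thesis using j by (simp add: sum.distrib)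
qed

lemma energy_pos:
  assumes "\<exists>j<n. c j \<noteq> 0"
  shows "(\<Sum>j<n. c j * ((\<Sum>k<n. R j k * c k) + mu * c j)) > 0"
proof -
  from assms obtain i where i: "i < n" "c i \<noteq> 0" by blast
  have "0 < mu * (c i)\<^sup>2" using mu i by simp
  also have "\<dots> \<le> (\<Sum>j<n. mu * (c j)\<^sup>2)"
    using i mu by (intro member_le_sum) auto
  also have "\<dots> \<le> (\<Sum>j<n. c j * (\<Sum>k<n. R j k * c k)) + (\<Sum>j<n. mu * (c j)\<^sup>2)"
    using psd by simp
  also have "\<dots> = (\<Sum>j<n. c j * ((\<Sum>k<n. R j k * c k) + mu * c j))"
    by (simp add: sum.distrib[symmetric] distrib_left power2_eq_square mult_ac)
  finally show ?thesis .
qed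

lemma solution_exists: "\<exists>c. \<forall>j<n. (\<Sum>k<n. R j k * c k) + mu * c j = Y j"
proof -
  have "\<exists>c. \<forall>j<n. (\<Sum>k<n. (R j k + (if j = k then mu else 0)) * c k) = Y j"
  proof (rule positive_definite_solvable)
    fix c :: "nat \<Rightarrow> real" assume "\<exists>j<n. c j \<noteq> 0"
    note energy_pos[OF this]
    also have "(\<Sum>j<n. c j * ((\<Sum>k<n. R j k * c k) + mu * c j)) = (\<Sum>j<n. c j * (\<Sum>k<n. (R j k + (if j = k then mu else 0)) * c k))"
      by (intro sum.cong refl) (simp add: row_sum)
    finally show "0 < (\<Sum>j<n. c j * (\<Sum>k<n. (R j k + (if j = k then mu else 0)) * c k))" .
  qed
  then show ?thesis by (simp add: row_sum)
qed

lemma solution_unique: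
  assumes c: "\<And>j. j < n \<Longrightarrow> (\<Sum>k<n. R j k * c k) + mu * c j = Y j"
    and d: "\<And>j. j < n \<Longrightarrow> (\<Sum>k<n. R j k * d k) + mu * d j = Y j" and k: "k < n"
  shows "c k = d k"
proof (rule ccontr)
  assume "c k \<noteq> d k"
  then have "\<exists>j<n. c j - d j \<noteq> 0" using k by auto
  from energy_pos[OF this] have "0 < (\<Sum>j<n. (c j - d j) * ((\<Sum>k<n. R j k * (c k - d k)) + mu * (c j - d j)))" .
  moreover have "(\<Sum>k<n. R j k * (c k - d k)) + mu * (c j - d j) = 0" if "j < n" for j
    using c[OF that] d[OF that] by (simp add: right_diff_distrib sum_subtractf)
  ultimately show False by simp
qed

end

text \<open>The definite description in \<open>krr_coef\<close> denotes: existence comes from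
  \<open>solution_exists\<close>, uniqueness below \<open>n\<close> from
  \<open>solution_unique\<close>, and the clause for \<open>n \<le> k\<close> fixes the remaining
  values.\<close>

lemma krr_coef_eq:
  assumes "ridge_system (\<lambda>j k. Psi (xs j - xs k)) n mu" and j: "j < n"
  shows "(\<Sum>k<n. Psi (xs j - xs k) * krr_coef Psi mu n xs Y k) + mu * krr_coef Psi mu n xs Y j = Y j"
proof -
  interpret ridge_system "\<lambda>j k. Psi (xs j - xs k)" n mu by fact
  let ?P = "\<lambda>c. (\<forall>j<n. (\<Sum>k<n. (Psi (xs j - xs k) + (if j = k then mu else 0)) * c k) = Y j) \<and> (\<forall>k. n \<le> k \<longrightarrow> c k = 0)"
  obtain c where c: "\<And>j. j < n \<Longrightarrow> (\<Sum>k<n. Psi (xs j - xs k) * c k) + mu * c j = Y j"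
    using solution_exists by blast
  let ?c = "\<lambda>k. if k < n then c k else 0"
  have "(\<Sum>k<n. Psi (xs j - xs k) * ?c k) = (\<Sum>k<n. Psi (xs j - xs k) * c k)" for j
    by (intro sum.cong) auto
  then have "?P ?c" using c by (simp add: row_sum)
  moreover have "d = ?c" if d: "?P d" for d
  proof
    fix k
    show "d k = ?c k"
    proof (cases "k < n")
      case True
      have "\<And>j. j < n \<Longrightarrow> (\<Sum>k<n. Psi (xs j - xs k) * d k) + mu * d j = Y j" using d by (simp add: row_sum)
      from solution_unique[OF this c True] True show ?thesis by simp
    qed (use d in simp)
  qed
  ultimately have "?P (THE c. ?P c)" by (rule theI)
  then have "\<forall>j<n. (\<Sum>k<n. (Psi (xs j - xs k) + (if j = k then mu else 0)) * krr_coef Psi mu n xs Y k) = Y j"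
    unfolding krr_coef_def by blast
  then show ?thesis using j by (simp add: row_sum)
qed

lemma krr_coef_unique:
  assumes "ridge_system (\<lambda>j k. Psi (xs j - xs k)) n mu"
    and "\<And>j. j < n \<Longrightarrow> (\<Sum>k<n. Psi (xs j - xs k) * c k) + mu * c j = Y j" and "k < n"
  shows "krr_coef Psi mu n xs Y k = c k"
  using ridge_system.solution_unique[OF assms(1) krr_coef_eq[OF assms(1)] assms(2) assms(3)] by simp

section \<open>Sobolev weights and kernels with algebraic spectral decay\<close>

text \<open>Placed against squared transforms, this is the weight of the Sobolev space of order
  \<open>p\<close>; negative orders give the dual weights.\<close>

definition wt :: "real \<Rightarrow> 'a::euclidean_space \<Rightarrow> real" where
  "wt p w = (1 + (norm w)\<^sup>2) powr p"

lemma wt_measurable [measurable]: "wt p \<in> borel_measurable borel"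
  unfolding wt_def[abs_def] by measurable

lemma one_plus_norm_sq_pos: "0 < 1 + (norm w)\<^sup>2"
  by (simp add: add_pos_nonneg)

lemma wt_pos: "0 < wt p w"
  using one_plus_norm_sq_pos[of w] by (simp add: wt_def)

lemma wt_nonneg [simp]: "0 \<le> wt p w"
  using wt_pos[of p w] by simp

lemma wt_add: "wt p w * wt q w = wt (p + q) w"
  by (simp add: wt_def powr_add)

lemma wt_zero [simp]: "wt 0 w = 1"
  using one_plus_norm_sq_pos[of w] by (simp add: wt_def)

lemma wt_minus: "wt (- p) w = 1 / wt p w"
  by (simp add: wt_def powr_minus_divide)

lemma wt_uminus [simp]: "wt p (- w) = wt p w"
  by (simp add: wt_def)

lemma wt_mono: "p \<le> q \<Longrightarrow> wt p w \<le> wt q w"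
  unfolding wt_def by (intro powr_mono) auto

lemma continuous_wt: "continuous_on UNIV (wt p)"
  unfolding wt_def[abs_def] by (intro continuous_intros ballI) (simp add: add_nonneg_eq_0_iff)

lemma wt_le_one: "p \<le> 0 \<Longrightarrow> wt p w \<le> 1"
  using wt_mono[of p 0 w] by simp

lemma norm_sq_peetre:
  fixes a b :: "'a::euclidean_space"
  shows "1 + (norm (a + b))\<^sup>2 \<le> 2 * (1 + (norm a)\<^sup>2) * (1 + (norm b)\<^sup>2)"
proof -
  have "(norm (a + b))\<^sup>2 \<le> (norm a + norm b)\<^sup>2"
    by (intro power_mono norm_triangle_ineq) auto
  also have "\<dots> \<le> 2 * (norm a)\<^sup>2 + 2 * (norm b)\<^sup>2"
    using sum_squares_bound[of "norm a" "norm b"] by (simp add: power2_sum)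
  also have "\<dots> \<le> 2 * (norm a)\<^sup>2 + 2 * (norm b)\<^sup>2 + 2 * (norm a)\<^sup>2 * (norm b)\<^sup>2"
    by simp
  finally show ?thesis by (simp add: algebra_simps)
qed

text \<open>Peetre's inequality: translating the weight costs only a weight of the shift. The shift
  will be a modulation frequency or a convolution variable.\<close>

lemma wt_peetre:
  assumes "p \<ge> 0"
  shows "wt p (a + b) \<le> 2 powr p * wt p a * wt p b"
proof -
  have "wt p (a + b) \<le> (2 * (1 + (norm a)\<^sup>2) * (1 + (norm b)\<^sup>2)) powr p"
    unfolding wt_def using assms norm_sq_peetre[of a b] by (intro powr_mono2) auto
  moreover have "(2 * A * B) powr p = 2 powr p * A powr p * B powr p" if "0 < A" "0 < B" for A B :: real
    using that by (simp add: powr_mult)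
  ultimately show ?thesis unfolding wt_def using one_plus_norm_sq_pos by metis
qed

lemma integral_cauchy_schwarz:
  fixes u v :: "'b \<Rightarrow> complex"
  assumes [measurable]: "u \<in> borel_measurable M" "v \<in> borel_measurable M"
    and u: "integrable M (\<lambda>x. (cmod (u x))\<^sup>2)" and v: "integrable M (\<lambda>x. (cmod (v x))\<^sup>2)"
  shows "integrable M (\<lambda>x. u x * v x)"
    and "(cmod (LINT x|M. u x * v x))\<^sup>2 \<le> (LINT x|M. (cmod (u x))\<^sup>2) * (LINT x|M. (cmod (v x))\<^sup>2)"
proof -
  show i: "integrable M (\<lambda>x. u x * v x)"
  proof (rule Bochner_Integration.integrable_bound)
    show "integrable M (\<lambda>x. (cmod (u x))\<^sup>2 + (cmod (v x))\<^sup>2)" using u v by simp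
    have "cmod (u x) * cmod (v x) \<le> (cmod (u x))\<^sup>2 + (cmod (v x))\<^sup>2" for x
      using sum_squares_bound[of "cmod (u x)" "cmod (v x)"] zero_le_power2[of "cmod (u x)"] zero_le_power2[of "cmod (v x)"]
      by linarith
    then show "AE x in M. norm (u x * v x) \<le> norm ((cmod (u x))\<^sup>2 + (cmod (v x))\<^sup>2)"
      by (intro AE_I2) (auto simp: norm_mult)
  qed simp
  let ?I = "LINT x|M. cmod (u x) * cmod (v x)"
  have iuv: "integrable M (\<lambda>x. cmod (u x) * cmod (v x))" using integrable_norm[OF i] by (simp add: norm_mult)
  have "ennreal (?I\<^sup>2) = (\<integral>\<^sup>+x. ennreal (cmod (u x)) * ennreal (cmod (v x)) \<partial>M)\<^sup>2"
    using iuv by (simp add: nn_integral_eq_integral ennreal_power flip: ennreal_mult)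
  also have "\<dots> \<le> (\<integral>\<^sup>+x. (ennreal (cmod (u x)))\<^sup>2 \<partial>M) * (\<integral>\<^sup>+x. (ennreal (cmod (v x)))\<^sup>2 \<partial>M)"
    by (rule Cauchy_Schwarz_nn_integral) auto
  also have "\<dots> = ennreal ((LINT x|M. (cmod (u x))\<^sup>2) * (LINT x|M. (cmod (v x))\<^sup>2))"
    using u v by (simp add: ennreal_power nn_integral_eq_integral ennreal_mult)
  finally have I: "?I\<^sup>2 \<le> (LINT x|M. (cmod (u x))\<^sup>2) * (LINT x|M. (cmod (v x))\<^sup>2)"
    by (subst (asm) ennreal_le_iff) (auto intro!: mult_nonneg_nonneg)
  have "cmod (LINT x|M. u x * v x) \<le> ?I"
    using integral_norm_bound[of M "\<lambda>x. u x * v x"] by (simp add: norm_mult)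
  then have "(cmod (LINT x|M. u x * v x))\<^sup>2 \<le> ?I\<^sup>2" by (intro power_mono) auto
  from order.trans[OF this I] show "(cmod (LINT x|M. u x * v x))\<^sup>2 \<le> (LINT x|M. (cmod (u x))\<^sup>2) * (LINT x|M. (cmod (v x))\<^sup>2)" .
qed

text \<open>In the convention of \<open>ftr\<close>, the transform of the discrete measure with
  masses \<open>c k\<close> at the points \<open>xs k\<close>.\<close>

definition trig :: "nat \<Rightarrow> (nat \<Rightarrow> 'a::euclidean_space) \<Rightarrow> (nat \<Rightarrow> real) \<Rightarrow> 'a \<Rightarrow> complex" where
  "trig n xs c w = (\<Sum>k<n. complex_of_real (c k) * cis (w \<bullet> xs k))"

lemma trig_measurable [measurable]: "trig n xs c \<in> borel_measurable borel"
  unfolding trig_def[abs_def] by measurable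

lemma trig_bound: "cmod (trig n xs c w) \<le> (\<Sum>k<n. \<bar>c k\<bar>)"
  unfolding trig_def by (rule order.trans[OF norm_sum]) (simp add: norm_mult)

locale spectral_kernel =
  fixes Psi fPsi :: "'a::euclidean_space \<Rightarrow> real" and nu c1 c2 :: real
  assumes Psi_0: "Psi 0 = 1"
    and Psi_int: "integrable lborel Psi"
    and Psi_spec: "\<And>h. complex_of_real (Psi h) =
          (LINT w|lborel. exp (\<i> * complex_of_real (w \<bullet> h)) * complex_of_real (fPsi w))"
    and c_pos: "0 < c1" "c1 \<le> c2"
    and nu_gt: "nu > real DIM('a) / 2"
    and spec_bounds: "\<And>w. c1 * (1 + (norm w)\<^sup>2) powr (- nu) \<le> fPsi w \<and>
                            fPsi w \<le> c2 * (1 + (norm w)\<^sup>2) powr (- nu)"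
begin

lemma nu_pos: "nu > 0"
  using nu_gt DIM_positive[where 'a='a] by (simp add: order.strict_trans1[of 0 "real DIM('a) / 2"])

lemma fPsi_lower: "c1 * wt (- nu) w \<le> fPsi w" and fPsi_upper: "fPsi w \<le> c2 * wt (- nu) w"
  using spec_bounds by (auto simp: wt_def)

lemma fPsi_pos: "0 < fPsi w"
  by (rule order.strict_trans2[OF _ fPsi_lower]) (simp add: c_pos wt_pos)

lemma fPsi_nonneg [simp]: "0 \<le> fPsi w"
  using fPsi_pos[of w] by simp

text \<open>The integral of a non-integrable function is 0 by convention, whereas the spectral
  identity at the origin has the value \<open>Psi 0 = 1\<close>. Integrability, and with it
  measurability, is thus contained in that identity.\<close>

lemma fPsi_integrable_complex: "integrable lborel (\<lambda>w. complex_of_real (fPsi w))"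
proof (rule ccontr)
  assume "\<not> ?thesis"
  then have "(LINT w|lborel. complex_of_real (fPsi w)) = 0" by (rule not_integrable_integral_eq)
  then show False using Psi_spec[of 0] Psi_0 by simp
qed

lemma fPsi_integrable: "integrable lborel fPsi"
  using integrable_Re[OF fPsi_integrable_complex] by simp

lemma fPsi_measurable [measurable]: "fPsi \<in> borel_measurable borel"
  using fPsi_integrable by simp

text \<open>Inherited from \<open>fPsi\<close> through the lower spectral bound.\<close>

lemma wt_integrable: "integrable lborel (wt (- nu) :: 'a \<Rightarrow> real)"
proof (rule Bochner_Integration.integrable_bound[where f="\<lambda>w. fPsi w / c1"])
  show "integrable lborel (\<lambda>w. fPsi w / c1)" using fPsi_integrable by simp
  show "AE w in lborel. norm (wt (- nu) w) \<le> norm (fPsi w / c1)"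
    using fPsi_lower c_pos by (intro AE_I2) (auto simp: field_simps abs_mult)
qed simp

lemma wt_integrable_le:
  assumes "q \<le> - nu"
  shows "integrable lborel (wt q :: 'a \<Rightarrow> real)"
  by (rule Bochner_Integration.integrable_bound[OF wt_integrable]) (auto intro!: wt_mono assms)

lemma Psi_ftr: "complex_of_real (Psi h) = ftr (\<lambda>w. complex_of_real (fPsi w)) h"
  unfolding Psi_spec ftr_def by (simp add: cis_conv_exp mult.commute)

lemma Psi_ftr_shift: "complex_of_real (Psi (x - y)) = ftr (\<lambda>w. complex_of_real (fPsi w) * cis (- (w \<bullet> y))) x"
  unfolding Psi_ftr ftr_def
  by (intro Bochner_Integration.integral_cong) (auto simp: cis_mult inner_diff_right)

lemma Psi_uminus [simp]: "Psi (- h) = Psi h"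
proof -
  have "complex_of_real (Psi (- h)) = (LINT w|lborel. cnj (complex_of_real (fPsi w) * cis (w \<bullet> h)))"
    unfolding Psi_ftr ftr_def by (simp add: cis_cnj del: Bochner_Integration.integral_cnj)
  also have "\<dots> = cnj (complex_of_real (Psi h))" by (simp only: Psi_ftr ftr_def Bochner_Integration.integral_cnj)
  finally show ?thesis by simp
qed

lemma Psi_commute: "Psi (x - y) = Psi (y - x)"
  using Psi_uminus[of "x - y"] by simp

lemma Psi_continuous: "continuous_on UNIV Psi"
proof -
  have "continuous_on UNIV (\<lambda>h. Re (complex_of_real (Psi h)))"
    unfolding Psi_ftr using continuous_ftr[OF fPsi_integrable_complex] by (intro continuous_intros)
  then show ?thesis by simp
qed

lemma Psi_measurable [measurable]: "Psi \<in> borel_measurable borel"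
  by (rule borel_measurable_continuous_onI[OF Psi_continuous])

text \<open>Gaussian averages of the spectral density converge to the transform of \<open>Psi\<close>, so the lower
  spectral bound, being continuous, carries over pointwise without Fourier inversion.\<close>

lemma fourier_Psi_lower:
  "(2 * pi) powr (real DIM('a) / 2) * c1 * wt (- nu) w \<le> cmod (fourier (\<lambda>x. complex_of_real (Psi x)) w)"
proof -
  let ?s = "\<lambda>k. inverse (real (Suc k))"
  let ?d = "(2 * pi) powr (real DIM('a) / 2)"
  have ip: "0 < ?s k" for k by simp
  let ?J = "LINT x|lborel. complex_of_real (Psi x) * cis (- (x \<bullet> w))"
  have "integrable lborel (\<lambda>x. complex_of_real (Psi x) * cis (- (x \<bullet> w)))"
    using Psi_int by (intro integrable_mult_cis) auto
  from gauss_damping_limit[OF this]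
  have "(\<lambda>k. LINT x|lborel. complex_of_real (Psi x) * (cis (- (x \<bullet> w)) * gauss (?s k *\<^sub>R x))) \<longlonglongrightarrow> ?J * gauss (0::'a)"
    by (simp add: mult.assoc)
  then have lim1: "(\<lambda>k. cmod (?d * (LINT z|lborel. complex_of_real (fPsi (w + ?s k *\<^sub>R z)) * complex_of_real (gauss z)))) \<longlonglongrightarrow> cmod (?J * gauss (0::'a))"
    unfolding Psi_ftr ftr_gauss_multiplication[OF fPsi_integrable_complex ip] by (rule tendsto_norm)
  have "(\<lambda>k. LINT z|lborel. complex_of_real (c1 * wt (- nu) (w + ?s k *\<^sub>R z)) * complex_of_real (gauss z)) \<longlonglongrightarrow> complex_of_real (c1 * wt (- nu) w)"
  proof (rule gauss_approximate_identity)
    show "continuous_on UNIV (\<lambda>w::'a. complex_of_real (c1 * wt (- nu) w))"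
      by (intro continuous_intros continuous_wt)
    show "cmod (complex_of_real (c1 * wt (- nu) x)) \<le> c1" for x :: 'a
      using wt_le_one[of "- nu" x] nu_pos c_pos by (simp add: norm_mult mult_left_le)
  qed
  then have lim2: "(\<lambda>k. ?d * cmod (LINT z|lborel. complex_of_real (c1 * wt (- nu) (w + ?s k *\<^sub>R z)) * complex_of_real (gauss z))) \<longlonglongrightarrow> ?d * cmod (complex_of_real (c1 * wt (- nu) w))"
    by (intro tendsto_mult_left tendsto_norm)
  \<comment> \<open>Averages against the positive function \<open>gauss\<close> preserve the
    pointwise spectral bound; for nonnegative integrands the modulus of the complex integral is the
    real integral, which is what \<open>r\<close> records.\<close>
  have le: "?d * cmod (LINT z|lborel. complex_of_real (c1 * wt (- nu) (w + ?s k *\<^sub>R z)) * complex_of_real (gauss z))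
     \<le> cmod (?d * (LINT z|lborel. complex_of_real (fPsi (w + ?s k *\<^sub>R z)) * complex_of_real (gauss z)))" for k
  proof -
    have r: "cmod (LINT z|lborel. complex_of_real (g z) * complex_of_real (gauss z)) = (LINT z|lborel. g z * gauss z)" if "\<And>z. 0 \<le> g z" for g :: "'a \<Rightarrow> real"
    proof -
      have "0 \<le> (LINT z|lborel. g z * gauss z)" using that by (simp add: less_imp_le[OF gauss_pos])
      then show ?thesis by (simp flip: of_real_mult)
    qed
    have ig: "integrable lborel (\<lambda>z. fPsi (w + ?s k *\<^sub>R z) * gauss z)"
    proof (rule Bochner_Integration.integrable_bound[where f="\<lambda>z. fPsi (w + ?s k *\<^sub>R z) * gauss (0::'a)"])
      show "integrable lborel (\<lambda>z. fPsi (w + ?s k *\<^sub>R z) * gauss (0::'a))"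
        using integrable_lborel_affine[OF fPsi_integrable, of "?s k" w] by simp
      show "AE z in lborel. norm (fPsi (w + ?s k *\<^sub>R z) * gauss z) \<le> norm (fPsi (w + ?s k *\<^sub>R z) * gauss (0::'a))"
        by (intro AE_I2) (auto simp: abs_mult less_imp_le[OF gauss_pos] intro!: mult_left_mono gauss_le)
    qed measurable
    have "(LINT z|lborel. c1 * wt (- nu) (w + ?s k *\<^sub>R z) * gauss z) \<le> (LINT z|lborel. fPsi (w + ?s k *\<^sub>R z) * gauss z)"
      using fPsi_lower by (intro integral_mono' ig) (auto intro!: mult_right_mono simp: less_imp_le[OF gauss_pos])
    moreover have "cmod (LINT z|lborel. complex_of_real (c1 * wt (- nu) (w + ?s k *\<^sub>R z)) * complex_of_real (gauss z)) = (LINT z|lborel. c1 * wt (- nu) (w + ?s k *\<^sub>R z) * gauss z)"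
      by (rule r) (use c_pos in simp)
    moreover have "cmod (LINT z|lborel. complex_of_real (fPsi (w + ?s k *\<^sub>R z)) * complex_of_real (gauss z)) = (LINT z|lborel. fPsi (w + ?s k *\<^sub>R z) * gauss z)"
      by (rule r) simp
    ultimately show ?thesis unfolding norm_mult by (auto intro!: mult_left_mono)
  qed
  from lim2 lim1 have "?d * cmod (complex_of_real (c1 * wt (- nu) w)) \<le> cmod (?J * gauss (0::'a))"
    by (rule LIMSEQ_le) (use le in blast)
  then have "?d * c1 * wt (- nu) w \<le> cmod ?J * gauss (0::'a)"
    using c_pos gauss_pos[of "0::'a"] by (simp add: norm_mult)
  also have "\<dots> = cmod (fourier (\<lambda>x. complex_of_real (Psi x)) w)"
    unfolding fourier_def norm_mult by (simp add: gauss_def cis_conv_exp inner_commute mult.commute)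
  finally show ?thesis .
qed

text \<open>The multiplication formula applied to a translate of \<open>Psi\<close>, whose density
  is \<open>fPsi\<close> times a character.\<close>

lemma spectral_pairing:
  fixes psi :: "'a \<Rightarrow> real"
  assumes "integrable lborel psi"
  shows "complex_of_real (LINT x|lborel. Psi (x - y) * psi x) =
     (LINT w|lborel. complex_of_real (fPsi w) * (ftr (\<lambda>x. complex_of_real (psi x)) w * cis (- (w \<bullet> y))))"
proof -
  have i: "integrable lborel (\<lambda>w. complex_of_real (fPsi w) * cis (- (w \<bullet> y)))"
    by (rule integrable_mult_cis[OF fPsi_integrable_complex]) simp
  have "complex_of_real (LINT x|lborel. Psi (x - y) * psi x) = (LINT x|lborel. complex_of_real (psi x) * complex_of_real (Psi (x - y)))"
    by (simp add: mult.commute flip: of_real_mult)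
  also have "\<dots> = (LINT w|lborel. (complex_of_real (fPsi w) * cis (- (w \<bullet> y))) * ftr (\<lambda>x. complex_of_real (psi x)) w)"
    unfolding Psi_ftr_shift using assms by (intro ftr_integral_swap[OF i]) auto
  finally show ?thesis by (simp add: mult_ac)
qed

lemma fPsi_bounded_integrable:
  fixes g :: "'a \<Rightarrow> complex"
  assumes [measurable]: "g \<in> borel_measurable borel" and b: "\<And>w. cmod (g w) \<le> B"
  shows "integrable lborel (\<lambda>w. complex_of_real (fPsi w) * g w)"
proof (rule Bochner_Integration.integrable_bound)
  show "integrable lborel (\<lambda>w. fPsi w * B)" using fPsi_integrable by simp
  show "AE w in lborel. norm (complex_of_real (fPsi w) * g w) \<le> norm (fPsi w * B)"
    by (intro AE_I2) (auto simp: norm_mult intro!: order.trans[OF mult_left_mono[OF b] abs_ge_self])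
qed simp

lemma fPsi_bounded_integrable_sq:
  fixes g :: "'a \<Rightarrow> complex"
  assumes [measurable]: "g \<in> borel_measurable borel" and b: "\<And>w. cmod (g w) \<le> B"
  shows "integrable lborel (\<lambda>w. fPsi w * (cmod (g w))\<^sup>2)"
proof (rule Bochner_Integration.integrable_bound)
  show "integrable lborel (\<lambda>w. fPsi w * B\<^sup>2)" using fPsi_integrable by simp
  show "AE w in lborel. norm (fPsi w * (cmod (g w))\<^sup>2) \<le> norm (fPsi w * B\<^sup>2)"
    by (intro AE_I2) (auto simp: norm_mult abs_mult intro!: mult_left_mono power_mono b)
qed simp

lemma fPsi_cauchy_schwarz:
  fixes u v :: "'a \<Rightarrow> complex"
  assumes [measurable]: "u \<in> borel_measurable borel" "v \<in> borel_measurable borel"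
    and u: "\<And>w. cmod (u w) \<le> B" and v: "\<And>w. cmod (v w) \<le> D"
  shows "(cmod (LINT w|lborel. complex_of_real (fPsi w) * (u w * v w)))\<^sup>2 \<le>
     (LINT w|lborel. fPsi w * (cmod (u w))\<^sup>2) * (LINT w|lborel. fPsi w * (cmod (v w))\<^sup>2)"
proof -
  let ?u = "\<lambda>w. complex_of_real (sqrt (fPsi w)) * u w" and ?v = "\<lambda>w. complex_of_real (sqrt (fPsi w)) * v w"
  have e: "complex_of_real (fPsi w) * (u w * v w) = ?u w * ?v w" for w
  proof -
    have "complex_of_real (fPsi w) = complex_of_real (sqrt (fPsi w)) * complex_of_real (sqrt (fPsi w))"
      by (simp flip: of_real_mult)
    then show ?thesis by (simp add: mult_ac)
  qed
  have s: "(cmod (?u w))\<^sup>2 = fPsi w * (cmod (u w))\<^sup>2" "(cmod (?v w))\<^sup>2 = fPsi w * (cmod (v w))\<^sup>2" for w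
    by (simp_all add: norm_mult power_mult_distrib)
  show ?thesis
    unfolding e s[symmetric]
    by (rule integral_cauchy_schwarz) (simp, simp, unfold s, auto intro: fPsi_bounded_integrable_sq u v)
qed

text \<open>The easy half of Bochner's theorem: the squared modulus of \<open>trig\<close> expands
  into a double sum of characters whose integrals against \<open>fPsi\<close> are the kernel values.
  The kernel matrix is thus positive semidefinite for every design.\<close>

lemma quadratic_form_spectral:
  "(\<Sum>j<n. c j * (\<Sum>k<n. Psi (xs j - xs k) * c k)) = (LINT w|lborel. fPsi w * (cmod (trig n xs c w))\<^sup>2)"
proof -
  have P: "complex_of_real (Psi (xs j - xs k)) = (LINT w|lborel. complex_of_real (fPsi w) * (cis (w \<bullet> xs j) * cnj (cis (w \<bullet> xs k))))" for j k
    unfolding Psi_ftr ftr_def by (simp add: cis_cnj cis_mult inner_diff_right)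
  have i: "integrable lborel (\<lambda>w. complex_of_real (fPsi w) * (cis (w \<bullet> xs j) * cnj (cis (w \<bullet> xs k))))" for j k
    by (rule fPsi_bounded_integrable[where B=1]) (auto simp: norm_mult)
  have "complex_of_real (\<Sum>j<n. c j * (\<Sum>k<n. Psi (xs j - xs k) * c k)) =
     (\<Sum>j<n. \<Sum>k<n. complex_of_real (c j) * complex_of_real (c k) * complex_of_real (Psi (xs j - xs k)))"
    by (simp add: sum_distrib_left mult_ac)
  also have "\<dots> = (LINT w|lborel. (\<Sum>j<n. \<Sum>k<n. complex_of_real (c j) * complex_of_real (c k) * (complex_of_real (fPsi w) * (cis (w \<bullet> xs j) * cnj (cis (w \<bullet> xs k))))))"
    unfolding P by (simp add: Bochner_Integration.integral_sum i)
  also have "\<dots> = (LINT w|lborel. complex_of_real (fPsi w * (cmod (trig n xs c w))\<^sup>2))"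
  proof (intro Bochner_Integration.integral_cong refl)
    fix w
    have "complex_of_real (fPsi w * (cmod (trig n xs c w))\<^sup>2) = complex_of_real (fPsi w) * (trig n xs c w * cnj (trig n xs c w))"
      by (simp only: of_real_mult complex_norm_square)
    also have "trig n xs c w * cnj (trig n xs c w) = (\<Sum>j<n. \<Sum>k<n. (complex_of_real (c j) * cis (w \<bullet> xs j)) * (complex_of_real (c k) * cnj (cis (w \<bullet> xs k))))"
      unfolding trig_def cnj_sum by (simp add: sum_product)
    finally show "(\<Sum>j<n. \<Sum>k<n. complex_of_real (c j) * complex_of_real (c k) * (complex_of_real (fPsi w) * (cis (w \<bullet> xs j) * cnj (cis (w \<bullet> xs k))))) = complex_of_real (fPsi w * (cmod (trig n xs c w))\<^sup>2)"
      by (simp add: sum_distrib_left mult_ac)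
  qed
  finally show ?thesis by (simp only: integral_complex_of_real of_real_eq_iff)
qed

lemma ridge_system_Psi: "mu > 0 \<Longrightarrow> ridge_system (\<lambda>j k. Psi (xs j - xs k)) n mu"
  by unfold_locales (auto simp: quadratic_form_spectral)

end

section \<open>Modulated bumps as test functions\<close>

text \<open>Decay of order \<open>2 * nu\<close> leaves room to spend one weight
  \<open>wt nu\<close> on the transform, or on its square, and still be bounded by the integrable
  \<open>wt (- nu)\<close>.\<close>

locale kernel_bump = spectral_kernel Psi fPsi nu c1 c2
  for Psi fPsi :: "'a::euclidean_space \<Rightarrow> real" and nu c1 c2 :: real +
  fixes beta :: "'a \<Rightarrow> real" and z0 :: 'a and rho CB :: real
  assumes beta_cont: "continuous_on UNIV beta"
    and beta_nonneg: "\<And>x. 0 \<le> beta x"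
    and beta_supp: "\<And>x. rho \<le> norm (x - z0) \<Longrightarrow> beta x = 0"
    and beta_pos: "(LINT x|lborel. beta x) > 0"
    and CB_pos: "CB > 0"
    and beta_decay: "\<And>w. cmod (ftr (\<lambda>x. complex_of_real (beta x)) w) \<le> CB * wt (- (2 * nu)) w"
begin

definition bhat :: "'a \<Rightarrow> complex" where "bhat = ftr (\<lambda>x. complex_of_real (beta x))"
definition tf :: "'a \<Rightarrow> real \<Rightarrow> 'a \<Rightarrow> real" where "tf om th x = beta x * cos (om \<bullet> x + th)"
definition tfh :: "'a \<Rightarrow> real \<Rightarrow> 'a \<Rightarrow> complex" where "tfh om th = ftr (\<lambda>x. complex_of_real (tf om th x))"
definition b2 :: real where "b2 = (LINT x|lborel. (beta x)\<^sup>2)"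
text \<open>Any upper bound of \<open>beta\<close> serves; positivity is built into the choice
  because \<open>bm\<close> is divided by later.\<close>

definition bm :: real where "bm = (SOME M. M > 0 \<and> (\<forall>x. beta x \<le> M))"
text \<open>The constant common to the native bound \<open>tfh_sobolev\<close> and the dual bound
  \<open>tfh_dual\<close>.\<close>

definition K1 :: real where "K1 = CB\<^sup>2 * 2 powr nu * (LINT w|lborel. wt (- nu) (w::'a))"

section \<open>The modulated bump and its norms in the Sobolev space and its dual\<close>

lemma beta_integrable: "integrable lborel beta"
  by (rule compact_support_integrable[OF beta_cont beta_supp])

lemma beta_measurable [measurable]: "beta \<in> borel_measurable borel"
  using beta_integrable by simp

lemma bm: "bm > 0" "beta x \<le> bm"
proof -
  from compact_support_integrable(2)[OF beta_cont beta_supp] obtain B where B: "\<And>x. norm (beta x) \<le> B" by blast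
  have "beta x \<le> max B 1" for x using B[of x] by (simp add: abs_le_iff max.coboundedI1)
  then have "\<exists>M. M > 0 \<and> (\<forall>x. beta x \<le> M)" by (intro exI[of _ "max B 1"]) auto
  from someI_ex[OF this] show "bm > 0" "beta x \<le> bm" unfolding bm_def by auto
qed

lemma beta_sq_integrable: "integrable lborel (\<lambda>x. (beta x)\<^sup>2)"
proof (rule compact_support_integrable[of _ rho z0])
  show "continuous_on UNIV (\<lambda>x. (beta x)\<^sup>2)" by (intro continuous_intros beta_cont)
qed (simp add: beta_supp)

lemma b2_pos: "b2 > 0"
proof (rule ccontr)
  assume "\<not> b2 > 0"
  moreover have "b2 \<ge> 0" by (simp add: b2_def)
  ultimately have "b2 = 0" by simp
  then have "AE x in lborel. (beta x)\<^sup>2 = 0"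
    using integral_nonneg_eq_0_iff_AE[OF beta_sq_integrable] by (simp add: b2_def)
  then have "AE x in lborel. beta x = 0" by auto
  then have "(LINT x|lborel. beta x) = 0" by (rule integral_eq_zero_AE)
  then show False using beta_pos by simp
qed

lemma bhat_bound: "cmod (bhat w) \<le> CB * wt (- (2 * nu)) w"
  using beta_decay by (simp add: bhat_def)

lemma bhat_measurable [measurable]: "bhat \<in> borel_measurable borel"
  unfolding bhat_def by (rule ftr_measurable) simp

lemma bhat_integrable: "integrable lborel bhat"
proof (rule Bochner_Integration.integrable_bound)
  show "integrable lborel (\<lambda>w::'a. CB * wt (- (2 * nu)) w)"
    using wt_integrable_le[of "- (2 * nu)"] nu_pos by simp
  show "AE w in lborel. norm (bhat w) \<le> norm (CB * wt (- (2 * nu)) w)"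
    using bhat_bound CB_pos by (intro AE_I2) (simp add: abs_mult)
qed simp

lemma bhat_cont: "continuous_on UNIV bhat"
  unfolding bhat_def using beta_integrable by (intro continuous_ftr) auto

lemma tf_cont: "continuous_on UNIV (tf om th)"
  unfolding tf_def[abs_def] by (intro continuous_intros beta_cont)

lemma tf_measurable [measurable]: "tf om th \<in> borel_measurable borel"
  by (rule borel_measurable_continuous_onI[OF tf_cont])

lemma tf_supp: "rho \<le> norm (x - z0) \<Longrightarrow> tf om th x = 0"
  by (simp add: tf_def beta_supp)

lemma tf_integrable: "integrable lborel (tf om th)"
  by (rule compact_support_integrable[OF tf_cont tf_supp])

lemma tf_abs_le: "\<bar>tf om th x\<bar> \<le> beta x"
  unfolding tf_def abs_mult using beta_nonneg[of x] abs_cos_le_one[of "om \<bullet> x + th"]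
  by (simp add: mult_left_le)

lemma tf_sq_integrable: "integrable lborel (\<lambda>x. (tf om th x)\<^sup>2)"
proof (rule compact_support_integrable[of _ rho z0])
  show "continuous_on UNIV (\<lambda>x. (tf om th x)\<^sup>2)" by (intro continuous_intros tf_cont)
qed (simp add: tf_supp)

lemma tf_sq_le: "(LINT x|lborel. (tf om th x)\<^sup>2) \<le> b2"
proof -
  have "(tf om th x)\<^sup>2 \<le> (beta x)\<^sup>2" for x
    using power_mono[OF tf_abs_le[of om th x], of 2] by simp
  then show ?thesis
    unfolding b2_def by (intro integral_mono tf_sq_integrable beta_sq_integrable)
qed

text \<open>The phases 0 and pi / 2 give the squares of a cosine and of a sine, which add up to the
  square of \<open>beta\<close>; one of the two therefore keeps half of the energy.\<close>

lemma phase_exists: "\<exists>th. (LINT x|lborel. (tf om th x)\<^sup>2) \<ge> b2 / 2"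
proof -
  have "(tf om 0 x)\<^sup>2 + (tf om (pi / 2) x)\<^sup>2 = (beta x)\<^sup>2" for x
    by (simp add: tf_def power_mult_distrib cos_add) (simp flip: distrib_left)
  then have "(LINT x|lborel. (tf om 0 x)\<^sup>2) + (LINT x|lborel. (tf om (pi / 2) x)\<^sup>2) = b2"
    unfolding b2_def by (subst Bochner_Integration.integral_add[symmetric]) (auto intro: tf_sq_integrable)
  then have "(LINT x|lborel. (tf om 0 x)\<^sup>2) \<ge> b2 / 2 \<or> (LINT x|lborel. (tf om (pi / 2) x)\<^sup>2) \<ge> b2 / 2"
    by linarith
  then show ?thesis by blast
qed

text \<open>The cosine splits into two characters, each of which shifts \<open>bhat\<close>; the
  transform concentrates near \<open>om\<close> and \<open>- om\<close>.\<close>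

lemma tfh_eq: "tfh om th w = (cis th * bhat (w + om) + cis (- th) * bhat (w - om)) / 2"
proof -
  have b: "integrable lborel (\<lambda>x. complex_of_real (beta x))" using beta_integrable by auto
  have i: "integrable lborel (\<lambda>x. complex_of_real (beta x) * cis (x \<bullet> v))" for v
    by (rule integrable_mult_cis[OF b]) simp
  have c: "complex_of_real (cos t) = (cis t + cis (- t)) / 2" for t
    by (simp add: complex_eq_iff)
  have "tfh om th w = (LINT x|lborel. (cis th * (complex_of_real (beta x) * cis (x \<bullet> (w + om))) + cis (- th) * (complex_of_real (beta x) * cis (x \<bullet> (w - om)))) / 2)"
    unfolding tfh_def ftr_def tf_def of_real_mult c
  proof (intro Bochner_Integration.integral_cong refl)
    fix x
    have "cis (om \<bullet> x + th) * cis (x \<bullet> w) = cis th * cis (x \<bullet> (w + om))"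
         "cis (- (om \<bullet> x + th)) * cis (x \<bullet> w) = cis (- th) * cis (x \<bullet> (w - om))"
      by (simp_all add: cis_mult inner_add_right inner_diff_right inner_commute algebra_simps)
    then show "complex_of_real (beta x) * ((cis (om \<bullet> x + th) + cis (- (om \<bullet> x + th))) / 2) * cis (x \<bullet> w) =
      (cis th * (complex_of_real (beta x) * cis (x \<bullet> (w + om))) + cis (- th) * (complex_of_real (beta x) * cis (x \<bullet> (w - om)))) / 2"
      by algebra
  qed
  also have "\<dots> = (cis th * bhat (w + om) + cis (- th) * bhat (w - om)) / 2"
    unfolding bhat_def ftr_def using i by simp
  finally show ?thesis .
qed

lemma tfh_measurable [measurable]: "tfh om th \<in> borel_measurable borel"
  unfolding tfh_def by (rule ftr_measurable) simp

lemma tfh_bounded: "cmod (tfh om th w) \<le> (LINT x|lborel. \<bar>tf om th x\<bar>)"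
  unfolding tfh_def using norm_ftr_le[of "\<lambda>x. complex_of_real (tf om th x)" w] tf_integrable by auto

lemma tfh_integrable: "integrable lborel (tfh om th)"
proof -
  have "integrable lborel (\<lambda>w. (cis th * bhat (w + om) + cis (- th) * bhat (w + (- om))) / 2)"
    using integrable_lborel_shift[OF bhat_integrable, of om] integrable_lborel_shift[OF bhat_integrable, of "- om"]
    by (intro integrable_divide Bochner_Integration.integrable_add integrable_mult_right) auto
  moreover have "(\<lambda>w. (cis th * bhat (w + om) + cis (- th) * bhat (w + (- om))) / 2) = tfh om th"
    by (rule ext) (simp add: tfh_eq)
  ultimately show ?thesis by (simp only:)
qed

lemma tf_inversion: "(LINT w|lborel. tfh om th w * cis (- (w \<bullet> x))) = (2 * pi) ^ DIM('a) * complex_of_real (tf om th x)"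
proof -
  have "cmod (complex_of_real (tf om th x)) \<le> bm" for x
    using tf_abs_le[of om th x] bm(2)[of x] by simp
  then show ?thesis
    unfolding tfh_def
    using tf_integrable tfh_integrable[of om th] tf_cont
    by (intro fourier_inversion) (auto simp: tfh_def intro!: continuous_intros)
qed

text \<open>What is left of the squared transform of a modulated bump once all weights are spent:
  two translates of \<open>wt (- nu)\<close>, with an integral independent of
  \<open>om\<close>.\<close>

definition twin :: "'a \<Rightarrow> 'a \<Rightarrow> real" where "twin om w = (wt (- nu) (w + om) + wt (- nu) (w - om)) / 2"

lemma twin_integral:
  "integrable lborel (twin om)" "(LINT w|lborel. twin om w) = (LINT w|lborel. wt (- nu) (w::'a))"
proof -
  have i: "integrable lborel (\<lambda>w. wt (- nu) (w + om))" "integrable lborel (\<lambda>w. wt (- nu) (w - om))"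
    using integrable_lborel_shift[OF wt_integrable, of om] integrable_lborel_shift[OF wt_integrable, of "- om"] by auto
  have e: "(LINT w|lborel. wt (- nu) (w + om)) = (LINT w|lborel. wt (- nu) (w::'a))" "(LINT w|lborel. wt (- nu) (w - om)) = (LINT w|lborel. wt (- nu) (w::'a))"
    using integral_lborel_shift[of "wt (- nu)" om] integral_lborel_shift[of "wt (- nu)" "- om"] by simp_all
  show "integrable lborel (twin om)" unfolding twin_def[abs_def] using i by simp
  show "(LINT w|lborel. twin om w) = (LINT w|lborel. wt (- nu) (w::'a))"
    unfolding twin_def[abs_def] using i by (simp add: e)
qed

lemma bhat_sq_bound: "(cmod (bhat w))\<^sup>2 * wt nu w \<le> CB\<^sup>2 * wt (- nu) w"
proof -
  have "(cmod (bhat w))\<^sup>2 * wt nu w \<le> (CB * wt (- (2 * nu)) w)\<^sup>2 * wt nu w"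
    by (intro mult_right_mono power_mono bhat_bound) auto
  also have "\<dots> = CB\<^sup>2 * wt (- 3 * nu) w"
    by (simp add: power_mult_distrib power2_eq_square mult.assoc wt_add)
  also have "\<dots> \<le> CB\<^sup>2 * wt (- nu) w"
    using nu_pos by (intro mult_left_mono wt_mono) auto
  finally show ?thesis .
qed

lemma tfh_sq_bound: "(cmod (tfh om th w))\<^sup>2 \<le> ((cmod (bhat (w + om)))\<^sup>2 + (cmod (bhat (w - om)))\<^sup>2) / 2"
proof -
  have "cmod (tfh om th w) \<le> (cmod (bhat (w + om)) + cmod (bhat (w - om))) / 2"
    unfolding tfh_eq norm_divide using norm_triangle_ineq[of "cis th * bhat (w + om)" "cis (- th) * bhat (w - om)"]
    by (simp add: norm_mult)
  then have "(cmod (tfh om th w))\<^sup>2 \<le> ((cmod (bhat (w + om)) + cmod (bhat (w - om))) / 2)\<^sup>2"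
    by (intro power_mono) auto
  also have "\<dots> \<le> ((cmod (bhat (w + om)))\<^sup>2 + (cmod (bhat (w - om)))\<^sup>2) / 2"
    using sum_squares_bound[of "cmod (bhat (w + om))" "cmod (bhat (w - om))"] by (simp add: power_divide power2_sum)
  finally show ?thesis .
qed

text \<open>Peetre's inequality exchanges \<open>wt nu w\<close> for \<open>wt nu om\<close> at the
  price of a weight at \<open>w + om\<close> or \<open>w - om\<close>, which the decay of
  \<open>bhat\<close> absorbs.\<close>

lemma tfh_wt_upper: "(cmod (tfh om th w))\<^sup>2 * wt nu w \<le> CB\<^sup>2 * 2 powr nu * wt nu om * twin om w"
proof -
  have *: "(cmod (bhat (w + v)))\<^sup>2 * wt nu w \<le> CB\<^sup>2 * 2 powr nu * wt nu om * wt (- nu) (w + v)" if v: "v = om \<or> v = - om" for v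
  proof -
    have "wt nu w \<le> 2 powr nu * wt nu (w + v) * wt nu om"
      using wt_peetre[of nu "w + v" "- v"] nu_pos v by auto
    then have "(cmod (bhat (w + v)))\<^sup>2 * wt nu w \<le> (cmod (bhat (w + v)))\<^sup>2 * (2 powr nu * wt nu (w + v) * wt nu om)"
      by (intro mult_left_mono) auto
    also have "\<dots> = (2 powr nu * wt nu om) * ((cmod (bhat (w + v)))\<^sup>2 * wt nu (w + v))" by simp
    also have "\<dots> \<le> (2 powr nu * wt nu om) * (CB\<^sup>2 * wt (- nu) (w + v))"
      by (intro mult_left_mono bhat_sq_bound) auto
    finally show ?thesis by (simp add: mult_ac)
  qed
  have "(cmod (tfh om th w))\<^sup>2 * wt nu w \<le> ((cmod (bhat (w + om)))\<^sup>2 + (cmod (bhat (w - om)))\<^sup>2) / 2 * wt nu w"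
    by (intro mult_right_mono tfh_sq_bound) auto
  also have "\<dots> \<le> CB\<^sup>2 * 2 powr nu * wt nu om * twin om w"
    using *[of om] *[of "- om"] by (simp add: twin_def algebra_simps)
  finally show ?thesis .
qed

text \<open>Peetre's inequality is used the other way round, bounding \<open>wt nu om\<close>
  through \<open>w\<close>, because the weight at \<open>w\<close> now stands in the
  denominator.\<close>

lemma tfh_wt_lower: "(cmod (tfh om th w))\<^sup>2 * wt (- nu) w \<le> CB\<^sup>2 * 2 powr nu * wt (- nu) om * twin om w"
proof -
  have *: "(cmod (bhat (w + v)))\<^sup>2 * wt (- nu) w \<le> CB\<^sup>2 * 2 powr nu * wt (- nu) om * wt (- nu) (w + v)" if v: "v = om \<or> v = - om" for v
  proof -
    have "wt nu om \<le> 2 powr nu * wt nu (w + v) * wt nu w"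
      using wt_peetre[of nu "w + v" "- w"] nu_pos v by auto
    then have "wt (- nu) w \<le> 2 powr nu * wt nu (w + v) * wt (- nu) om"
      using wt_pos[of nu om] wt_pos[of nu w] by (simp add: wt_minus field_simps)
    then have "(cmod (bhat (w + v)))\<^sup>2 * wt (- nu) w \<le> (cmod (bhat (w + v)))\<^sup>2 * (2 powr nu * wt nu (w + v) * wt (- nu) om)"
      by (intro mult_left_mono) auto
    also have "\<dots> = (2 powr nu * wt (- nu) om) * ((cmod (bhat (w + v)))\<^sup>2 * wt nu (w + v))" by simp
    also have "\<dots> \<le> (2 powr nu * wt (- nu) om) * (CB\<^sup>2 * wt (- nu) (w + v))"
      by (intro mult_left_mono bhat_sq_bound) auto
    finally show ?thesis by (simp add: mult_ac)
  qed
  have "(cmod (tfh om th w))\<^sup>2 * wt (- nu) w \<le> ((cmod (bhat (w + om)))\<^sup>2 + (cmod (bhat (w - om)))\<^sup>2) / 2 * wt (- nu) w"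
    by (intro mult_right_mono tfh_sq_bound) auto
  also have "\<dots> \<le> CB\<^sup>2 * 2 powr nu * wt (- nu) om * twin om w"
    using *[of om] *[of "- om"] by (simp add: twin_def algebra_simps)
  finally show ?thesis .
qed

lemma K1_pos: "K1 > 0"
proof -
  have "complex_of_real (LINT w|lborel. fPsi w) = 1" using Psi_spec[of 0] Psi_0 by simp
  then have "1 = (LINT w|lborel. fPsi w)" by (metis of_real_eq_1_iff)
  also have "\<dots> \<le> (LINT w|lborel. c2 * wt (- nu) (w::'a))"
    by (intro integral_mono fPsi_integrable integrable_mult_right wt_integrable fPsi_upper)
  finally have "0 < c2 * (LINT w|lborel. wt (- nu) (w::'a))" by simp
  then have "0 < (LINT w|lborel. wt (- nu) (w::'a))" using c_pos by (simp add: zero_less_mult_iff)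
  then show ?thesis using CB_pos by (simp add: K1_def)
qed

text \<open>Up to constants this is the squared native norm of the modulated bump: modulation costs
  a factor \<open>wt nu om\<close>.\<close>

lemma tfh_sobolev:
  "integrable lborel (\<lambda>w. (cmod (tfh om th w))\<^sup>2 * wt nu w)"
  "(LINT w|lborel. (cmod (tfh om th w))\<^sup>2 * wt nu w) \<le> K1 * wt nu om"
proof -
  have r: "integrable lborel (\<lambda>w. CB\<^sup>2 * 2 powr nu * wt nu om * twin om w)"
    by (intro integrable_mult_right twin_integral)
  show i: "integrable lborel (\<lambda>w. (cmod (tfh om th w))\<^sup>2 * wt nu w)"
    by (rule Bochner_Integration.integrable_bound[OF r])
      (simp, intro AE_I2, use tfh_wt_upper[of om th] in \<open>auto intro: order.trans[OF _ abs_ge_self]\<close>)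
  have "(LINT w|lborel. (cmod (tfh om th w))\<^sup>2 * wt nu w) \<le> (LINT w|lborel. CB\<^sup>2 * 2 powr nu * wt nu om * twin om w)"
    by (intro integral_mono i r tfh_wt_upper)
  also have "\<dots> = K1 * wt nu om" using twin_integral[of om] by (simp add: K1_def)
  finally show "(LINT w|lborel. (cmod (tfh om th w))\<^sup>2 * wt nu w) \<le> K1 * wt nu om" .
qed

text \<open>The counterpart for the kernel potential of the bump, whose squared native norm is this
  integral up to normalisation: modulation now gains a factor \<open>wt (- nu) om\<close>.\<close>

lemma tfh_dual: "(LINT w|lborel. fPsi w * (cmod (tfh om th w))\<^sup>2) \<le> c2 * K1 * wt (- nu) om"
proof -
  have r: "integrable lborel (\<lambda>w. c2 * (CB\<^sup>2 * 2 powr nu * wt (- nu) om * twin om w))"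
    by (intro integrable_mult_right twin_integral)
  have "(LINT w|lborel. fPsi w * (cmod (tfh om th w))\<^sup>2) \<le> (LINT w|lborel. c2 * (CB\<^sup>2 * 2 powr nu * wt (- nu) om * twin om w))"
  proof (rule integral_mono[OF fPsi_bounded_integrable_sq r])
    fix w
    have "fPsi w * (cmod (tfh om th w))\<^sup>2 \<le> c2 * wt (- nu) w * (cmod (tfh om th w))\<^sup>2"
      by (intro mult_right_mono fPsi_upper) auto
    also have "\<dots> \<le> c2 * (CB\<^sup>2 * 2 powr nu * wt (- nu) om * twin om w)"
      using mult_left_mono[OF tfh_wt_lower[of om th w], of c2] c_pos by (simp add: mult_ac)
    finally show "fPsi w * (cmod (tfh om th w))\<^sup>2 \<le> c2 * (CB\<^sup>2 * 2 powr nu * wt (- nu) om * twin om w)" .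
  qed (auto intro: tfh_bounded)
  also have "\<dots> = c2 * K1 * wt (- nu) om" using twin_integral[of om] by (simp add: K1_def)
  finally show ?thesis .
qed

end

subsection \<open>Membership in the native unit ball\<close>

lemma fourier_eq_ftr: "fourier f w = complex_of_real ((2 * pi) powr (- real DIM('a) / 2)) * ftr f (- (w::'a::euclidean_space))"
  by (simp add: fourier_def ftr_def cis_conv_exp inner_commute)

lemma fourier_measurable [measurable]:
  fixes f :: "'a::euclidean_space \<Rightarrow> complex"
  assumes [measurable]: "f \<in> borel_measurable borel"
  shows "fourier f \<in> borel_measurable borel"
proof -
  have [measurable]: "(\<lambda>w. ftr f (- w)) \<in> borel_measurable borel"
    by (rule measurable_compose[of uminus _ borel]) auto
  show ?thesis unfolding fourier_eq_ftr[abs_def] by measurable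
qed

lemma norm_div_csqrt_sq: "(cmod (g / csqrt z))\<^sup>2 = (cmod g)\<^sup>2 / cmod z"
  by (simp add: norm_divide power_divide norm_csqrt)

text \<open>For compactly supported \<open>f\<close> the truncation to balls in
  \<open>l2_fourier_of\<close> eventually changes nothing, so the expression under the limit is
  eventually constant. The second part gives uniqueness almost everywhere, which is required because
  \<open>native_norm_R\<close> picks an L2 transform by \<open>SOME\<close>.\<close>

lemma compact_support_l2_fourier:
  fixes f :: "'a::euclidean_space \<Rightarrow> real"
  assumes supp: "\<And>x. r \<le> norm (x - z) \<Longrightarrow> f x = 0" and [measurable]: "f \<in> borel_measurable borel"
    and sq: "integrable lborel (\<lambda>w. (cmod (fourier (\<lambda>x. complex_of_real (f x)) w))\<^sup>2)"
  shows "l2_fourier_of f (fourier (\<lambda>x. complex_of_real (f x)))"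
    and "l2_fourier_of f g \<Longrightarrow> AE w in lborel. g w = fourier (\<lambda>x. complex_of_real (f x)) w"
proof -
  let ?F = "fourier (\<lambda>x. complex_of_real (f x))"
  have trunc: "\<forall>\<^sub>F R in at_top. (\<lambda>x. complex_of_real (indicator (ball 0 R) x * f x)) = (\<lambda>x. complex_of_real (f x))"
    using eventually_gt_at_top[of "norm z + r"]
  proof eventually_elim
    case (elim R)
    have "indicator (ball 0 R) x * f x = f x" for x
    proof (cases "norm x < R")
      case False
      then have "r \<le> norm (x - z)" using elim norm_triangle_ineq2[of x z] by linarith
      then show ?thesis by (simp add: supp)
    qed simp
    then show ?case by (intro ext) (simp only:)
  qed
  have ev: "((\<lambda>R::real. \<integral>\<^sup>+ w. ennreal ((cmod (h w - fourier (\<lambda>x. complex_of_real (indicator (ball 0 R) x * f x)) w))\<^sup>2) \<partial>lborel) \<longlongrightarrow> 0) at_top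
     \<longleftrightarrow> ((\<lambda>R::real. \<integral>\<^sup>+ w. ennreal ((cmod (h w - ?F w))\<^sup>2) \<partial>lborel) \<longlongrightarrow> 0) at_top" for h
    by (rule tendsto_cong, rule eventually_mono[OF trunc]) (simp only:)
  show "l2_fourier_of f ?F"
    unfolding l2_fourier_of_def ev using sq by simp
  assume g: "l2_fourier_of f g"
  then have [measurable]: "g \<in> borel_measurable borel" by (simp add: l2_fourier_of_def)
  from g have "((\<lambda>R::real. \<integral>\<^sup>+ w. ennreal ((cmod (g w - ?F w))\<^sup>2) \<partial>lborel) \<longlongrightarrow> 0) at_top"
    unfolding l2_fourier_of_def ev by simp
  then have "(\<integral>\<^sup>+ w. ennreal ((cmod (g w - ?F w))\<^sup>2) \<partial>lborel) = 0"
    by (simp add: tendsto_const_iff)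
  then have "AE w in lborel. ennreal ((cmod (g w - ?F w))\<^sup>2) = 0"
    by (subst (asm) nn_integral_0_iff_AE) auto
  then show "AE w in lborel. g w = ?F w" by eventually_elim simp
qed

context kernel_bump
begin

text \<open>The bump is its own extension. By \<open>fourier_Psi_lower\<close> its squared native
  norm is at most \<open>A^2 / c1\<close> times the Sobolev bound \<open>K1 * wt nu om\<close>; each
  power of 2 pi lies on the favourable side of 1 and is dropped.\<close>

lemma tf_in_unit_ball:
  assumes A: "A\<^sup>2 * K1 * wt nu om \<le> c1"
  shows "(\<lambda>x. A * tf om th x) \<in> native_unit_ball Psi Om"
proof -
  let ?f = "\<lambda>x. A * tf om th x" and ?P = "fourier (\<lambda>x. complex_of_real (Psi x))"
  let ?F = "fourier (\<lambda>x. complex_of_real (?f x))"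
  have pi1: "(2 * pi) powr (- real DIM('a) / 2) \<le> 1"
    using pi_gt3 powr_mono[of "- real DIM('a) / 2" 0 "2 * pi"] by simp
  have pi2: "1 \<le> (2 * pi) powr (real DIM('a) / 2)"
    using pi_gt3 by (intro ge_one_powr_ge_zero) auto
  have F: "?F w = complex_of_real ((2 * pi) powr (- real DIM('a) / 2) * A) * tfh om th (- w)" for w
  proof -
    have "ftr (\<lambda>x. complex_of_real (?f x)) v = A * tfh om th v" for v
      unfolding tfh_def ftr_def by (simp add: mult.assoc)
    then show ?thesis by (simp add: fourier_eq_ftr)
  qed
  have Fsq: "(cmod (?F w))\<^sup>2 \<le> A\<^sup>2 * (cmod (tfh om th (- w)))\<^sup>2" for w
  proof -
    have "(cmod (?F w))\<^sup>2 = ((2 * pi) powr (- real DIM('a) / 2))\<^sup>2 * (A\<^sup>2 * (cmod (tfh om th (- w)))\<^sup>2)"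
      unfolding F norm_mult norm_of_real abs_mult power_mult_distrib power2_abs by (simp only: mult.assoc)
    also have "\<dots> \<le> 1 * (A\<^sup>2 * (cmod (tfh om th (- w)))\<^sup>2)"
      using pi1 by (intro mult_right_mono) (auto simp: power_le_one)
    finally show ?thesis by simp
  qed
  have P: "c1 * wt (- nu) w \<le> cmod (?P w)" for w
  proof -
    have "c1 * wt (- nu) w \<le> (2 * pi) powr (real DIM('a) / 2) * (c1 * wt (- nu) w)"
      using mult_right_mono[OF pi2, of "c1 * wt (- nu) w"] c_pos by simp
    then show ?thesis using fourier_Psi_lower[of w] by (simp add: mult.assoc)
  qed
  have Ppos: "0 < cmod (?P w)" for w
    by (rule order.strict_trans2[OF _ P]) (simp add: c_pos wt_pos)
  have quot: "(cmod (?F w))\<^sup>2 / cmod (?P w) \<le> A\<^sup>2 / c1 * ((cmod (tfh om th (- w)))\<^sup>2 * wt nu (- w))" for w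
  proof -
    have "(cmod (?F w))\<^sup>2 / cmod (?P w) \<le> A\<^sup>2 * (cmod (tfh om th (- w)))\<^sup>2 / (c1 * wt (- nu) w)"
      by (intro frac_le Fsq P) (auto simp: c_pos wt_pos)
    then show ?thesis by (simp add: wt_minus)
  qed
  have ti: "integrable lborel (\<lambda>w. (cmod (tfh om th (- w)))\<^sup>2 * wt nu (- w))"
    using integrable_lborel_affine[OF tfh_sobolev(1)[of om th], of "-1" 0] by simp
  have tl: "(LINT w|lborel. (cmod (tfh om th (- w)))\<^sup>2 * wt nu (- w)) \<le> K1 * wt nu om"
    using integral_lborel_uminus[of "\<lambda>w. (cmod (tfh om th w))\<^sup>2 * wt nu w"] tfh_sobolev(2)[of om th] by simp
  have [measurable]: "(\<lambda>w. tfh om th (- w)) \<in> borel_measurable borel"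
    by (rule measurable_compose[of uminus _ borel]) auto
  have qi: "integrable lborel (\<lambda>w. (cmod (?F w))\<^sup>2 / cmod (?P w))"
    by (rule Bochner_Integration.integrable_bound[OF integrable_mult_right[OF ti, of "A\<^sup>2 / c1"]])
      (simp, intro AE_I2, use quot c_pos in \<open>auto simp: abs_of_pos\<close>)
  have sq: "integrable lborel (\<lambda>w. (cmod (?F w))\<^sup>2)"
  proof (rule Bochner_Integration.integrable_bound[OF integrable_mult_right[OF ti, of "A\<^sup>2"]])
    have "(cmod (?F w))\<^sup>2 \<le> A\<^sup>2 * ((cmod (tfh om th (- w)))\<^sup>2 * wt nu (- w))" for w
    proof -
      have "(cmod (tfh om th (- w)))\<^sup>2 * 1 \<le> (cmod (tfh om th (- w)))\<^sup>2 * wt nu (- w)"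
        using wt_mono[of 0 nu "- w"] nu_pos by (intro mult_left_mono) auto
      from mult_left_mono[OF this, of "A\<^sup>2"] Fsq[of w] show ?thesis by simp
    qed
    then show "AE w in lborel. norm ((cmod (?F w))\<^sup>2) \<le> norm (A\<^sup>2 * ((cmod (tfh om th (- w)))\<^sup>2 * wt nu (- w)))"
      by (intro AE_I2) (auto intro: order.trans[OF _ abs_ge_self])
  qed simp
  have supp: "\<And>x. rho \<le> norm (x - z0) \<Longrightarrow> ?f x = 0" by (simp add: tf_supp)
  have fm: "?f \<in> borel_measurable borel" by (intro borel_measurable_times borel_measurable_const tf_measurable)
  note l2 = compact_support_l2_fourier[where r=rho and z=z0, OF _ fm sq]
  have fF: "l2_fourier_of ?f ?F" by (rule l2(1)) (rule supp)
  have sqi: "integrable lborel (\<lambda>x. (?f x)\<^sup>2)"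
    using tf_sq_integrable[of om th] by (simp add: power_mult_distrib)
  have mem: "?f \<in> native_space_R Psi"
    unfolding native_space_R_def norm_div_csqrt_sq
    using fF qi sqi by (auto intro!: continuous_intros tf_cont)
  let ?g = "SOME g. l2_fourier_of ?f g"
  have g: "l2_fourier_of ?f ?g" by (rule someI[of "l2_fourier_of ?f", OF fF])
  have [measurable]: "?g \<in> borel_measurable borel" using g by (simp add: l2_fourier_of_def)
  \<comment> \<open>The transform chosen by \<open>SOME\<close> is known only up to a null set,
    which is enough under the integral.\<close>
  have "AE w in lborel. ?g w = ?F w" by (rule l2(2)[OF _ g]) (rule supp)
  then have "(LINT w|lborel. (cmod (?g w))\<^sup>2 / cmod (?P w)) = (LINT w|lborel. (cmod (?F w))\<^sup>2 / cmod (?P w))"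
    by (intro integral_cong_AE) auto
  also have "\<dots> \<le> (LINT w|lborel. A\<^sup>2 / c1 * ((cmod (tfh om th (- w)))\<^sup>2 * wt nu (- w)))"
    by (intro integral_mono qi integrable_mult_right ti quot)
  also have "\<dots> \<le> A\<^sup>2 / c1 * (K1 * wt nu om)"
    unfolding integral_mult_right_zero using c_pos by (intro mult_left_mono tl) auto
  also have "\<dots> \<le> 1" using A c_pos by (simp add: field_simps)
  finally have le1: "(LINT w|lborel. (cmod (?g w))\<^sup>2 / cmod (?P w)) \<le> 1" .
  have "native_norm_R Psi ?f \<le> 1"
    unfolding native_norm_R_def norm_div_csqrt_sq
    using mult_mono[OF pi1 le1] by (simp add: real_sqrt_le_1_iff)
  moreover have "native_norm_on Psi Om ?f \<le> native_norm_R Psi ?f"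
    unfolding native_norm_on_def
    by (rule cInf_lower) (use mem in \<open>auto intro!: bdd_belowI[of _ 0] simp: native_norm_R_def\<close>)
  ultimately show ?thesis using mem by (auto simp: native_unit_ball_def native_space_on_def)
qed

end

section \<open>Pairing the estimator with test functions\<close>

text \<open>Cauchy-Schwarz on \<open>Om\<close> against \<open>psi\<close>. Working in
  \<open>ennreal\<close> avoids presupposing that the distance is finite.\<close>

lemma l2_dist_sq_lower:
  fixes psi :: "'a::euclidean_space \<Rightarrow> real"
  assumes [measurable]: "(\<lambda>x. f x - h x) \<in> borel_measurable borel" "psi \<in> borel_measurable borel"
    and i: "integrable lborel (\<lambda>x. (f x - h x) * psi x)"
    and supp: "\<And>x. x \<notin> Om \<Longrightarrow> psi x = 0" and [measurable]: "Om \<in> sets borel"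
    and psi2: "integrable lborel (\<lambda>x. (psi x)\<^sup>2)" "(LINT x|lborel. (psi x)\<^sup>2) \<le> b" and b: "b > 0"
  shows "ennreal ((LINT x|lborel. (f x - h x) * psi x)\<^sup>2 / b) \<le> l2_dist_sq Om f h"
proof -
  let ?I = "LINT x|lborel. (f x - h x) * psi x"
  have "ennreal (?I\<^sup>2) = (ennreal \<bar>?I\<bar>)\<^sup>2" by (simp add: ennreal_power)
  also have "\<dots> \<le> (\<integral>\<^sup>+x. ennreal \<bar>f x - h x\<bar> * indicator Om x * ennreal \<bar>psi x\<bar> \<partial>lborel)\<^sup>2"
  proof (rule power_mono)
    have "ennreal \<bar>?I\<bar> \<le> (\<integral>\<^sup>+x. ennreal (norm ((f x - h x) * psi x)) \<partial>lborel)"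
      using integral_norm_bound_ennreal[OF i] by simp
    also have "\<dots> = (\<integral>\<^sup>+x. ennreal \<bar>f x - h x\<bar> * indicator Om x * ennreal \<bar>psi x\<bar> \<partial>lborel)"
      by (intro nn_integral_cong) (auto simp: indicator_def supp abs_mult ennreal_mult)
    finally show "ennreal \<bar>?I\<bar> \<le> (\<integral>\<^sup>+x. ennreal \<bar>f x - h x\<bar> * indicator Om x * ennreal \<bar>psi x\<bar> \<partial>lborel)" .
  qed simp
  also have "\<dots> \<le> (\<integral>\<^sup>+x. (ennreal \<bar>f x - h x\<bar> * indicator Om x)\<^sup>2 \<partial>lborel) * (\<integral>\<^sup>+x. (ennreal \<bar>psi x\<bar>)\<^sup>2 \<partial>lborel)"
    by (rule Cauchy_Schwarz_nn_integral) auto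
  also have "(\<integral>\<^sup>+x. (ennreal \<bar>f x - h x\<bar> * indicator Om x)\<^sup>2 \<partial>lborel) = l2_dist_sq Om f h"
    unfolding l2_dist_sq_def by (intro nn_integral_cong) (auto simp: indicator_def ennreal_power)
  also have "(\<integral>\<^sup>+x. (ennreal \<bar>psi x\<bar>)\<^sup>2 \<partial>lborel) = ennreal (LINT x|lborel. (psi x)\<^sup>2)"
    using psi2 by (simp add: ennreal_power nn_integral_eq_integral)
  also have "l2_dist_sq Om f h * ennreal (LINT x|lborel. (psi x)\<^sup>2) \<le> l2_dist_sq Om f h * ennreal b"
    using psi2 by (intro mult_left_mono ennreal_leI) auto
  finally have le: "ennreal (?I\<^sup>2) \<le> l2_dist_sq Om f h * ennreal b" .
  have "ennreal (?I\<^sup>2 / b) = ennreal (?I\<^sup>2) * ennreal (1 / b)"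
    using b by (simp flip: ennreal_mult')
  also have "\<dots> \<le> l2_dist_sq Om f h * ennreal b * ennreal (1 / b)"
    by (intro mult_right_mono le) simp
  also have "\<dots> = l2_dist_sq Om f h" using b by (simp add: mult.assoc flip: ennreal_mult')
  finally show ?thesis .
qed

section \<open>The dual system of a test function\<close>

context spectral_kernel
begin

lemma Psi_bounded: "\<bar>Psi h\<bar> \<le> (LINT w|lborel. fPsi w)"
proof -
  have "cmod (complex_of_real (Psi h)) \<le> (LINT w|lborel. cmod (complex_of_real (fPsi w)))"
    by (subst Psi_ftr) (rule norm_ftr_le[OF fPsi_integrable_complex])
  then show ?thesis by (simp only: norm_of_real abs_of_nonneg[OF fPsi_nonneg])
qed

lemma Psi_mult_integrable:
  assumes "integrable lborel psi"
  shows "integrable lborel (\<lambda>x. Psi (x - y) * psi x)"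
proof -
  have [measurable]: "psi \<in> borel_measurable borel" using assms by simp
  show ?thesis
  proof (rule Bochner_Integration.integrable_bound)
    show "integrable lborel (\<lambda>x. (LINT w|lborel. fPsi w) * psi x)" using assms by simp
    show "AE x in lborel. norm (Psi (x - y) * psi x) \<le> norm ((LINT w|lborel. fPsi w) * psi x)"
      unfolding norm_mult using Psi_bounded by (intro AE_I2 mult_right_mono) (auto intro: order.trans[OF _ abs_ge_self])
  qed measurable
qed

lemma krr_continuous: "continuous_on UNIV (krr Psi mu n xs Y)"
  unfolding krr_def[abs_def]
  by (intro continuous_intros continuous_on_compose2[OF Psi_continuous]) auto

text \<open>By symmetry of \<open>Psi\<close> this is the kernel representer of integration against
  \<open>psi\<close>.\<close>

definition pot :: "('a \<Rightarrow> real) \<Rightarrow> 'a \<Rightarrow> real" where "pot psi y = (LINT x|lborel. Psi (x - y) * psi x)"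

definition dual_solution :: "real \<Rightarrow> nat \<Rightarrow> (nat \<Rightarrow> 'a) \<Rightarrow> ('a \<Rightarrow> real) \<Rightarrow> (nat \<Rightarrow> real) \<Rightarrow> bool" where
  "dual_solution mu n xs psi a \<longleftrightarrow> (\<forall>j<n. (\<Sum>k<n. Psi (xs j - xs k) * a k) + mu * a j = pot psi (xs j))"

lemma dual_solution_exists: "mu > 0 \<Longrightarrow> \<exists>a. dual_solution mu n xs psi a"
  unfolding dual_solution_def by (rule ridge_system.solution_exists[OF ridge_system_Psi])

text \<open>The coefficients of the estimator and the weights \<open>a\<close> solve systems with
  the same symmetric matrix, so the matrix can be moved from one to the other.\<close>

lemma krr_pairing:
  assumes mu: "mu > 0" and a: "dual_solution mu n xs psi a" and psi: "integrable lborel psi"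
  shows "integrable lborel (\<lambda>x. krr Psi mu n xs Y x * psi x)"
    and "(LINT x|lborel. krr Psi mu n xs Y x * psi x) = (\<Sum>j<n. Y j * a j)"
proof -
  let ?c = "krr_coef Psi mu n xs Y"
  note c = krr_coef_eq[where Psi=Psi and xs=xs, OF ridge_system_Psi[OF mu], of _ n Y]
  have e: "krr Psi mu n xs Y x * psi x = (\<Sum>k<n. ?c k * (Psi (x - xs k) * psi x))" for x
    unfolding krr_def sum_distrib_right by (simp add: mult_ac)
  have i: "integrable lborel (\<lambda>x. Psi (x - xs k) * psi x)" for k by (rule Psi_mult_integrable[OF psi])
  show "integrable lborel (\<lambda>x. krr Psi mu n xs Y x * psi x)" unfolding e using i by auto
  have "(LINT x|lborel. krr Psi mu n xs Y x * psi x) = (\<Sum>k<n. ?c k * pot psi (xs k))"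
    unfolding e pot_def using i by simp
  also have "\<dots> = (\<Sum>k<n. ?c k * ((\<Sum>j<n. Psi (xs k - xs j) * a j) + mu * a k))"
    using a unfolding dual_solution_def by (intro sum.cong refl) auto
  also have "\<dots> = (\<Sum>k<n. \<Sum>j<n. ?c k * (Psi (xs k - xs j) * a j)) + (\<Sum>k<n. ?c k * (mu * a k))"
    unfolding distrib_left sum.distrib sum_distrib_left ..
  also have "(\<Sum>k<n. \<Sum>j<n. ?c k * (Psi (xs k - xs j) * a j)) = (\<Sum>j<n. \<Sum>k<n. ?c k * (Psi (xs k - xs j) * a j))"
    by (rule sum.swap)
  also have "\<dots> = (\<Sum>j<n. (\<Sum>k<n. Psi (xs j - xs k) * ?c k) * a j)"
    unfolding sum_distrib_right
  proof (intro sum.cong refl)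
    fix j k show "?c k * (Psi (xs k - xs j) * a j) = Psi (xs j - xs k) * ?c k * a j"
      using Psi_commute[of "xs k" "xs j"] by simp
  qed
  also have "\<dots> + (\<Sum>k<n. ?c k * (mu * a k)) = (\<Sum>j<n. ((\<Sum>k<n. Psi (xs j - xs k) * ?c k) + mu * ?c j) * a j)"
    unfolding distrib_right sum.distrib by (simp add: mult_ac)
  also have "\<dots> = (\<Sum>j<n. Y j * a j)"
  proof (intro sum.cong refl)
    fix j assume "j \<in> {..<n}"
    then have "(\<Sum>k<n. Psi (xs j - xs k) * ?c k) + mu * ?c j = Y j" by (intro c) simp
    then show "((\<Sum>k<n. Psi (xs j - xs k) * ?c k) + mu * ?c j) * a j = Y j * a j" by (simp only:)
  qed
  finally show "(LINT x|lborel. krr Psi mu n xs Y x * psi x) = (\<Sum>j<n. Y j * a j)" .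
qed

lemma ftr_real_bounded:
  assumes "integrable lborel psi"
  shows "cmod (ftr (\<lambda>x. complex_of_real (psi x)) w) \<le> (LINT x|lborel. \<bar>psi x\<bar>)"
  using norm_ftr_le[of "\<lambda>x. complex_of_real (psi x)" w] assms by simp

lemma trig_pairing:
  assumes psi: "integrable lborel psi"
  shows "complex_of_real (\<Sum>k<n. a k * pot psi (xs k)) =
    (LINT w|lborel. complex_of_real (fPsi w) * (ftr (\<lambda>x. complex_of_real (psi x)) w * cnj (trig n xs a w)))"
proof -
  let ?h = "ftr (\<lambda>x. complex_of_real (psi x))"
  have [measurable]: "?h \<in> borel_measurable borel" using psi by (intro ftr_measurable) auto
  have i: "integrable lborel (\<lambda>w. complex_of_real (fPsi w) * (?h w * cis (- (w \<bullet> y))))" for y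
    by (rule fPsi_bounded_integrable[where B="LINT x|lborel. \<bar>psi x\<bar>"])
      (simp, simp add: norm_mult ftr_real_bounded[OF psi])
  have "complex_of_real (\<Sum>k<n. a k * pot psi (xs k)) = (\<Sum>k<n. complex_of_real (a k) * (LINT w|lborel. complex_of_real (fPsi w) * (?h w * cis (- (w \<bullet> xs k)))))"
    unfolding pot_def of_real_sum of_real_mult spectral_pairing[OF psi] ..
  also have "\<dots> = (LINT w|lborel. (\<Sum>k<n. complex_of_real (a k) * (complex_of_real (fPsi w) * (?h w * cis (- (w \<bullet> xs k))))))"
    using i by simp
  also have "\<dots> = (LINT w|lborel. complex_of_real (fPsi w) * (?h w * cnj (trig n xs a w)))"
    unfolding trig_def by (intro Bochner_Integration.integral_cong) (auto simp: cis_cnj sum_distrib_left mult_ac)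
  finally show ?thesis .
qed

text \<open>The dual system tested against its own solution.\<close>

lemma dual_energy:
  assumes "dual_solution mu n xs psi a"
  shows "(LINT w|lborel. fPsi w * (cmod (trig n xs a w))\<^sup>2) + mu * (\<Sum>k<n. (a k)\<^sup>2) = (\<Sum>k<n. a k * pot psi (xs k))"
proof -
  have split: "(\<Sum>k<n. a k * (X k + mu * a k)) = (\<Sum>k<n. a k * X k) + mu * (\<Sum>k<n. (a k)\<^sup>2)" for X :: "nat \<Rightarrow> real"
    by (simp add: distrib_left sum.distrib sum_distrib_left power2_eq_square mult_ac)
  have "(\<Sum>k<n. a k * pot psi (xs k)) = (\<Sum>k<n. a k * ((\<Sum>j<n. Psi (xs k - xs j) * a j) + mu * a k))"
    using assms unfolding dual_solution_def by (intro sum.cong refl) auto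
  then show ?thesis unfolding split quadratic_form_spectral by simp
qed

text \<open>With \<open>Q\<close> the kernel energy of \<open>a\<close>, \<open>V\<close> that of
  \<open>psi\<close> and \<open>S\<close> the pairing of the two, \<open>dual_energy\<close> reads Q
  + mu |a|^2 = S, while S^2 \<le> V Q implies S \<le> Q + V / 4. The term \<open>Q\<close> cancels,
  and with it all dependence of the bound on the design.\<close>

lemma dual_solution_norm_le:
  assumes a: "dual_solution mu n xs psi a" and psi: "integrable lborel psi"
  shows "4 * mu * (\<Sum>k<n. (a k)\<^sup>2) \<le> (LINT w|lborel. fPsi w * (cmod (ftr (\<lambda>x. complex_of_real (psi x)) w))\<^sup>2)"
proof -
  let ?h = "ftr (\<lambda>x. complex_of_real (psi x))"
  have hm: "?h \<in> borel_measurable borel" using psi by (intro ftr_measurable) auto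
  define Q V S where "Q = (LINT w|lborel. fPsi w * (cmod (trig n xs a w))\<^sup>2)"
    and "V = (LINT w|lborel. fPsi w * (cmod (?h w))\<^sup>2)" and "S = (\<Sum>k<n. a k * pot psi (xs k))"
  have "S\<^sup>2 = (cmod (complex_of_real S))\<^sup>2" by simp
  also have "\<dots> \<le> V * (LINT w|lborel. fPsi w * (cmod (cnj (trig n xs a w)))\<^sup>2)"
    unfolding S_def trig_pairing[OF psi] V_def
  proof (rule fPsi_cauchy_schwarz)
    show "\<And>w. cmod (?h w) \<le> (LINT x|lborel. \<bar>psi x\<bar>)" by (rule ftr_real_bounded[OF psi])
    show "\<And>w. cmod (cnj (trig n xs a w)) \<le> (\<Sum>k<n. \<bar>a k\<bar>)" unfolding complex_mod_cnj by (rule trig_bound)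
  qed (rule hm, measurable)
  finally have S2: "S\<^sup>2 \<le> V * Q" by (simp add: Q_def)
  have "Q \<ge> 0" "V \<ge> 0" by (simp_all add: Q_def V_def)
  have "(Q + V / 4)\<^sup>2 = V * Q + (Q - V / 4)\<^sup>2"
    by (simp add: power2_eq_square field_simps)
  with S2 zero_le_power2[of "Q - V / 4"] have "S\<^sup>2 \<le> (Q + V / 4)\<^sup>2" by linarith
  from power2_le_imp_le[OF this] have "S \<le> Q + V / 4" using \<open>Q \<ge> 0\<close> \<open>V \<ge> 0\<close> by simp
  then show ?thesis
    using dual_energy[OF a] unfolding Q_def[symmetric] V_def[symmetric] S_def[symmetric] by linarith
qed

end

section \<open>Bias lower bound\<close>

context kernel_bump
begin

lemma tf_krr_pairing:
  assumes mu: "mu > 0" and a: "dual_solution mu n xs (tf om th) a"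
  shows "integrable lborel (\<lambda>x. (A * tf om th x - krr Psi mu n xs Y x) * tf om th x)"
    and "(LINT x|lborel. (A * tf om th x - krr Psi mu n xs Y x) * tf om th x) =
      A * (LINT x|lborel. (tf om th x)\<^sup>2) - (\<Sum>j<n. Y j * a j)"
proof -
  have e: "(A * tf om th x - krr Psi mu n xs Y x) * tf om th x = A * (tf om th x)\<^sup>2 - krr Psi mu n xs Y x * tf om th x" for x
    by (simp add: left_diff_distrib power2_eq_square)
  note k = krr_pairing[OF mu a tf_integrable, of Y]
  show "integrable lborel (\<lambda>x. (A * tf om th x - krr Psi mu n xs Y x) * tf om th x)"
    unfolding e by (intro Bochner_Integration.integrable_diff integrable_mult_right tf_sq_integrable k)
  show "(LINT x|lborel. (A * tf om th x - krr Psi mu n xs Y x) * tf om th x) =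
      A * (LINT x|lborel. (tf om th x)\<^sup>2) - (\<Sum>j<n. Y j * a j)"
    unfolding e using k tf_sq_integrable[of om th] by (simp add: Bochner_Integration.integral_diff)
qed

text \<open>The error paired with the bump splits into \<open>A\<close> times a deficit free of
  noise, minus a noise term free of \<open>A\<close>. Changing the sign of \<open>A\<close>
  therefore changes only the first part.\<close>

lemma l2_dist_tf_lower:
  assumes mu: "mu > 0" and a: "dual_solution mu n xs (tf om th) a"
    and Om: "Om \<in> sets borel" "\<And>x. norm (x - z0) < rho \<Longrightarrow> x \<in> Om"
  shows "ennreal ((A * ((LINT x|lborel. (tf om th x)\<^sup>2) - (\<Sum>j<n. tf om th (xs j) * a j)) - (\<Sum>j<n. e j * a j))\<^sup>2 / b2)
    \<le> l2_dist_sq Om (\<lambda>x. A * tf om th x) (krr Psi mu n xs (\<lambda>k. A * tf om th (xs k) + e k))"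
proof -
  let ?Y = "\<lambda>k. A * tf om th (xs k) + e k"
  have [measurable]: "krr Psi mu n xs ?Y \<in> borel_measurable borel"
    by (rule borel_measurable_continuous_onI[OF krr_continuous])
  have "ennreal ((LINT x|lborel. (A * tf om th x - krr Psi mu n xs ?Y x) * tf om th x)\<^sup>2 / b2) \<le> l2_dist_sq Om (\<lambda>x. A * tf om th x) (krr Psi mu n xs ?Y)"
  proof (rule l2_dist_sq_lower)
    show "(\<lambda>x. A * tf om th x - krr Psi mu n xs ?Y x) \<in> borel_measurable borel"
      using tf_measurable[of om th] by measurable
    show "tf om th x = 0" if "x \<notin> Om" for x
      using Om(2)[of x] that by (intro tf_supp) force
  qed (use tf_krr_pairing(1)[OF mu a] Om(1) tf_sq_integrable tf_sq_le b2_pos in auto)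
  also have "(LINT x|lborel. (A * tf om th x - krr Psi mu n xs ?Y x) * tf om th x) =
     A * ((LINT x|lborel. (tf om th x)\<^sup>2) - (\<Sum>j<n. tf om th (xs j) * a j)) - (\<Sum>j<n. e j * a j)"
    unfolding tf_krr_pairing(2)[OF mu a] by (simp add: algebra_simps sum.distrib sum_distrib_left)
  finally show ?thesis .
qed

text \<open>Above the frequency threshold \<open>om\<close>, \<open>tfh_dual\<close> makes the
  weights so small that, by Cauchy-Schwarz over \<open>n\<close> sample values bounded by
  \<open>bm\<close>, they recover at most \<open>b2 / 4\<close> of an energy of at least
  \<open>b2 / 2\<close>.\<close>

lemma bias_gap:
  assumes mu: "mu > 0" and a: "dual_solution mu n xs (tf om th) a"
    and th: "(LINT x|lborel. (tf om th x)\<^sup>2) \<ge> b2 / 2"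
    and om: "4 * real n * bm\<^sup>2 * (c2 * K1) \<le> mu * b2\<^sup>2 * wt nu om"
  shows "b2 / 4 \<le> (LINT x|lborel. (tf om th x)\<^sup>2) - (\<Sum>j<n. tf om th (xs j) * a j)"
proof -
  have a2: "4 * mu * (\<Sum>k<n. (a k)\<^sup>2) \<le> c2 * K1 * wt (- nu) om"
    using dual_solution_norm_le[OF a tf_integrable] tfh_dual[of om th] by (simp add: tfh_def)
  have tf2: "(tf om th x)\<^sup>2 \<le> bm\<^sup>2" for x
    using power_mono[of "\<bar>tf om th x\<bar>" bm 2] tf_abs_le[of om th x] bm(2)[of x] by simp
  have "(\<Sum>j<n. tf om th (xs j) * a j)\<^sup>2 \<le> (\<Sum>j<n. (tf om th (xs j))\<^sup>2) * (\<Sum>j<n. (a j)\<^sup>2)"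
    by (rule Cauchy_Schwarz_ineq_sum)
  also have "\<dots> \<le> (real n * bm\<^sup>2) * (\<Sum>j<n. (a j)\<^sup>2)"
    using sum_bounded_above[of "{..<n}" "\<lambda>j. (tf om th (xs j))\<^sup>2" "bm\<^sup>2"] tf2
    by (intro mult_right_mono sum_nonneg) auto
  finally have 1: "(\<Sum>j<n. tf om th (xs j) * a j)\<^sup>2 \<le> (real n * bm\<^sup>2) * (\<Sum>j<n. (a j)\<^sup>2)" .
  have "(16 * mu * wt nu om) * (\<Sum>j<n. tf om th (xs j) * a j)\<^sup>2 \<le> (16 * mu * wt nu om) * ((real n * bm\<^sup>2) * (\<Sum>j<n. (a j)\<^sup>2))"
    using mu by (intro mult_left_mono 1) auto
  also have "\<dots> = (4 * real n * bm\<^sup>2 * wt nu om) * (4 * mu * (\<Sum>j<n. (a j)\<^sup>2))" by simp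
  also have "\<dots> \<le> (4 * real n * bm\<^sup>2 * wt nu om) * (c2 * K1 * wt (- nu) om)"
    by (intro mult_left_mono a2) auto
  also have "\<dots> = 4 * real n * bm\<^sup>2 * (c2 * K1)"
    using wt_pos[of nu om] by (simp add: wt_minus)
  also have "\<dots> \<le> (16 * mu * wt nu om) * (b2 / 4)\<^sup>2"
    using om by (simp add: power_divide mult_ac)
  finally have "(\<Sum>j<n. tf om th (xs j) * a j)\<^sup>2 \<le> (b2 / 4)\<^sup>2"
    using mu wt_pos[of nu om] by (simp add: mult_le_cancel_left_pos)
  from power2_le_imp_le[OF this] have "(\<Sum>j<n. tf om th (xs j) * a j) \<le> b2 / 4" using b2_pos by simp
  then show ?thesis using th by linarith
qed

text \<open>Allows a frequency to be prescribed through its weight; the radius \<open>t\<close>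
  inverts (1 + t^2) powr nu = L.\<close>

lemma wt_surj:
  assumes "L \<ge> 1"
  shows "\<exists>om::'a. wt nu om = L"
proof -
  obtain b :: 'a where b: "norm b = 1" using SOME_Basis norm_Basis by blast
  define t where "t = sqrt (L powr (1 / nu) - 1)"
  have "L powr (1 / nu) \<ge> 1" using assms nu_pos by (intro ge_one_powr_ge_zero) auto
  then have "1 + (norm (t *\<^sub>R b))\<^sup>2 = L powr (1 / nu)" by (simp add: b t_def)
  then have "wt nu (t *\<^sub>R b) = L" using nu_pos assms by (simp add: wt_def powr_powr)
  then show ?thesis by blast
qed

text \<open>The error for \<open>f\<close> and for \<open>- f\<close> involves the same noise term, which therefore cannot cancel
  the bias of both; no property of the design is needed.\<close>

lemma bias_lower_bound:
  assumes mu: "mu > 0" and Om: "Om \<in> sets borel" "\<And>x. norm (x - z0) < rho \<Longrightarrow> x \<in> Om"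
    and L: "L \<ge> 1" "4 * real n * bm\<^sup>2 * (c2 * K1) \<le> mu * b2\<^sup>2 * L"
  shows "ennreal (c1 * b2 / (16 * K1) / L) \<le> (SUP f \<in> native_unit_ball Psi Om. l2_dist_sq Om f (krr Psi mu n xs (\<lambda>k. f (xs k) + e k)))"
    and "prob_space M \<Longrightarrow> (\<And>k. k < n \<Longrightarrow> (\<lambda>e. e k) \<in> borel_measurable M) \<Longrightarrow>
      ennreal (c1 * b2 / (16 * K1) / L) \<le> (SUP f \<in> native_unit_ball Psi Om. \<integral>\<^sup>+ e. l2_dist_sq Om f (krr Psi mu n xs (\<lambda>k. f (xs k) + e k)) \<partial>M)"
proof -
  obtain om :: 'a where om: "wt nu om = L" using wt_surj[OF L(1)] by blast
  obtain th where th: "(LINT x|lborel. (tf om th x)\<^sup>2) \<ge> b2 / 2" using phase_exists by blast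
  obtain a where a: "dual_solution mu n xs (tf om th) a" using dual_solution_exists[OF mu] by blast
  \<comment> \<open>The amplitude for which the condition of \<open>tf_in_unit_ball\<close> holds
    with equality.\<close>
  define A where "A = sqrt (c1 / (K1 * L))"
  have A2: "A\<^sup>2 = c1 / (K1 * L)" using c_pos K1_pos L by (simp add: A_def)
  define G where "G = (LINT x|lborel. (tf om th x)\<^sup>2) - (\<Sum>j<n. tf om th (xs j) * a j)"
  have G: "G \<ge> b2 / 4" unfolding G_def by (rule bias_gap[OF mu a th]) (simp add: om L)
  let ?f = "\<lambda>s x. s * A * tf om th x"
  have mem: "?f s \<in> native_unit_ball Psi Om" if "s\<^sup>2 = 1" for s
    using K1_pos L that by (intro tf_in_unit_ball) (simp add: power_mult_distrib A2 om)
  have p2: "(A * G)\<^sup>2 / b2 \<ge> c1 * b2 / (16 * K1) / L"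
  proof -
    have "c1 * b2 / (16 * K1) / L = A\<^sup>2 * (b2 / 4)\<^sup>2 / b2"
      unfolding A2 using b2_pos by (simp add: power2_eq_square)
    also have "\<dots> \<le> (A * G)\<^sup>2 / b2"
      unfolding power_mult_distrib using G b2_pos by (intro divide_right_mono mult_left_mono power_mono) auto
    finally show ?thesis .
  qed
  let ?q = "\<lambda>e. \<Sum>j<n. e j * a j"
  have lower: "ennreal ((s * A * G - ?q e)\<^sup>2 / b2) \<le> l2_dist_sq Om (?f s) (krr Psi mu n xs (\<lambda>k. ?f s (xs k) + e k))" for s e
    unfolding G_def by (rule l2_dist_tf_lower[OF mu a Om])
  have one: "(1::real)\<^sup>2 = 1" "(-1::real)\<^sup>2 = 1" by simp_all
  show "ennreal (c1 * b2 / (16 * K1) / L) \<le> (SUP f \<in> native_unit_ball Psi Om. l2_dist_sq Om f (krr Psi mu n xs (\<lambda>k. f (xs k) + e k)))"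
  proof -
    have sq: "p\<^sup>2 \<le> (p - q)\<^sup>2" if "p * q \<le> 0" for p q :: real
      using that zero_le_power2[of q] unfolding power2_diff mult.assoc by linarith
    have "\<exists>s. s\<^sup>2 = 1 \<and> (A * G)\<^sup>2 \<le> (s * A * G - ?q e)\<^sup>2"
    proof (cases "A * G * ?q e \<le> 0")
      case True
      then have "(A * G)\<^sup>2 \<le> (1 * A * G - ?q e)\<^sup>2" using sq[of "A * G" "?q e"] by simp
      then show ?thesis using one by blast
    next
      case False
      then have "(A * G)\<^sup>2 \<le> (- 1 * A * G - ?q e)\<^sup>2" using sq[of "- (A * G)" "?q e"] by simp
      then show ?thesis using one by blast
    qed
    then obtain s where s: "s\<^sup>2 = 1" "(A * G)\<^sup>2 \<le> (s * A * G - ?q e)\<^sup>2" by blast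
    have "ennreal (c1 * b2 / (16 * K1) / L) \<le> ennreal ((s * A * G - ?q e)\<^sup>2 / b2)"
      using p2 divide_right_mono[OF s(2), of b2] b2_pos by (intro ennreal_leI) auto
    also have "\<dots> \<le> l2_dist_sq Om (?f s) (krr Psi mu n xs (\<lambda>k. ?f s (xs k) + e k))" by (rule lower)
    also have "\<dots> \<le> (SUP f \<in> native_unit_ball Psi Om. l2_dist_sq Om f (krr Psi mu n xs (\<lambda>k. f (xs k) + e k)))"
      by (rule SUP_upper2[OF mem[OF s(1)]]) simp
    finally show ?thesis .
  qed
  assume M: "prob_space M" and e: "\<And>k. k < n \<Longrightarrow> (\<lambda>e. e k) \<in> borel_measurable M"
  let ?S = "SUP f \<in> native_unit_ball Psi Om. \<integral>\<^sup>+ e. l2_dist_sq Om f (krr Psi mu n xs (\<lambda>k. f (xs k) + e k)) \<partial>M"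
  have [measurable]: "?q \<in> borel_measurable M" using e by (intro borel_measurable_sum) auto
  have le: "(\<integral>\<^sup>+e. ennreal ((s * A * G - ?q e)\<^sup>2 / b2) \<partial>M) \<le> ?S" if "s\<^sup>2 = 1" for s
    by (rule order.trans[OF nn_integral_mono[OF lower] SUP_upper2[OF mem[OF that]]]) simp
  \<comment> \<open>The good sign depends on \<open>e\<close>, so in expectation the two signs are
    added instead of chosen: the cross terms cancel in the sum of the two squares for each
    \<open>e\<close>, and both expectations are bounded by the same supremum.\<close>
  have "2 * ennreal ((A * G)\<^sup>2 / b2) = (\<integral>\<^sup>+e. 2 * ennreal ((A * G)\<^sup>2 / b2) \<partial>M)"
    using prob_space.emeasure_space_1[OF M] by simp
  also have "\<dots> \<le> (\<integral>\<^sup>+e. ennreal ((1 * A * G - ?q e)\<^sup>2 / b2) + ennreal ((- 1 * A * G - ?q e)\<^sup>2 / b2) \<partial>M)"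
  proof (rule nn_integral_mono)
    fix e
    have "2 * ennreal ((A * G)\<^sup>2 / b2) = ennreal (2 * ((A * G)\<^sup>2 / b2))"
      by (subst ennreal_mult') simp_all
    also have "\<dots> \<le> ennreal ((1 * A * G - ?q e)\<^sup>2 / b2 + (- 1 * A * G - ?q e)\<^sup>2 / b2)"
    proof (intro ennreal_leI)
      have "2 * (A * G)\<^sup>2 \<le> (1 * A * G - ?q e)\<^sup>2 + (- 1 * A * G - ?q e)\<^sup>2" by (simp add: power2_diff)
      from divide_right_mono[OF this, of b2] b2_pos
      show "2 * ((A * G)\<^sup>2 / b2) \<le> (1 * A * G - ?q e)\<^sup>2 / b2 + (- 1 * A * G - ?q e)\<^sup>2 / b2" by (simp add: add_divide_distrib)
    qed
    finally show "2 * ennreal ((A * G)\<^sup>2 / b2) \<le> ennreal ((1 * A * G - ?q e)\<^sup>2 / b2) + ennreal ((- 1 * A * G - ?q e)\<^sup>2 / b2)"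
      using b2_pos by (simp flip: ennreal_plus)
  qed
  also have "\<dots> = (\<integral>\<^sup>+e. ennreal ((1 * A * G - ?q e)\<^sup>2 / b2) \<partial>M) + (\<integral>\<^sup>+e. ennreal ((- 1 * A * G - ?q e)\<^sup>2 / b2) \<partial>M)"
    by (rule nn_integral_add) measurable
  also have "\<dots> \<le> ?S + ?S" by (intro add_mono le one)
  also have "\<dots> = 2 * ?S" by (simp add: mult_2)
  finally have "ennreal ((A * G)\<^sup>2 / b2) \<le> ?S"
    by (subst (asm) ennreal_mult_le_mult_iff) auto
  then show "ennreal (c1 * b2 / (16 * K1) / L) \<le> ?S"
    using ennreal_leI[OF p2] by (rule order.trans[rotated])
qed

end

section \<open>A sampling inequality\<close>

text \<open>Both bounds are kept: the quadratic one gives smallness at low frequencies, the trivial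
  one preserves integrability against \<open>wt (- nu)\<close> at high frequencies.\<close>

lemma cmod_cis_diff_sq: "(cmod (cis a - cis b))\<^sup>2 \<le> min 4 ((a - b)\<^sup>2)"
proof -
  have "cmod (cis a - cis b) \<le> 2"
    using norm_triangle_ineq4[of "cis a" "cis b"] by simp
  then have 1: "(cmod (cis a - cis b))\<^sup>2 \<le> 2\<^sup>2" by (intro power_mono) auto
  have "cis a - cis b = cis b * (cis (a - b) - 1)" by (simp add: right_diff_distrib cis_mult)
  then have "cmod (cis a - cis b) = cmod (iexp (a - b) - 1)" by (simp add: norm_mult cis_conv_exp)
  also have "\<dots> \<le> \<bar>a - b\<bar>" using iexp_approx1[of "a - b" 0] by simp
  finally have "(cmod (cis a - cis b))\<^sup>2 \<le> \<bar>a - b\<bar>\<^sup>2" by (intro power_mono) auto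
  then show ?thesis using 1 by simp
qed

text \<open>The right-hand side is the maximum of u^p exp ((1 - u) / 2), where u stands for 1 +
  |x|^2, attained at u = 2 p; it follows from ln t \<le> t - 1 at t = u / (2 p).\<close>

lemma wt_gauss_bounded: "p > 0 \<Longrightarrow> wt p (x::'a::euclidean_space) * gauss x \<le> exp (1 / 2 + p * (ln (2 * p) - 1))"
proof -
  assume p: "p > 0"
  let ?u = "1 + (norm x)\<^sup>2"
  have u: "?u > 0" by (rule one_plus_norm_sq_pos)
  have "ln (?u / (2 * p)) \<le> ?u / (2 * p) - 1" using u p by (intro ln_le_minus_one) auto
  then have "ln ?u \<le> ?u / (2 * p) - 1 + ln (2 * p)" using u p by (simp add: ln_div)
  from mult_left_mono[OF this, of p] have "p * ln ?u \<le> p * (?u / (2 * p)) + p * (ln (2 * p) - 1)"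
    using p by (simp add: algebra_simps)
  moreover have "p * (?u / (2 * p)) = 1 / 2 + (norm x)\<^sup>2 / 2" using p by (simp add: field_simps)
  ultimately have "p * ln ?u \<le> (1 / 2 + p * (ln (2 * p) - 1)) + (norm x)\<^sup>2 / 2" by linarith
  then have "wt p x \<le> exp (1 / 2 + p * (ln (2 * p) - 1)) * exp ((norm x)\<^sup>2 / 2)"
    using u by (simp add: wt_def powr_def flip: exp_add)
  then have "wt p x * exp (- (norm x)\<^sup>2 / 2) \<le> exp (1 / 2 + p * (ln (2 * p) - 1)) * exp ((norm x)\<^sup>2 / 2) * exp (- (norm x)\<^sup>2 / 2)"
    by (intro mult_right_mono) auto
  also have "\<dots> = exp (1 / 2 + p * (ln (2 * p) - 1))" by (simp add: mult.assoc flip: exp_add)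
  finally have 1: "wt p x * exp (- (norm x)\<^sup>2 / 2) \<le> exp (1 / 2 + p * (ln (2 * p) - 1))" .
  have 2: "(2 * pi) powr (- real DIM('a) / 2) \<le> 1"
    using pi_gt3 powr_mono[of "- real DIM('a) / 2" 0 "2 * pi"] by simp
  have "wt p x * gauss x = (wt p x * exp (- (norm x)\<^sup>2 / 2)) * (2 * pi) powr (- real DIM('a) / 2)"
    by (simp add: gauss_def)
  also have "\<dots> \<le> wt p x * exp (- (norm x)\<^sup>2 / 2)" using 2 by (intro mult_left_le) auto
  finally show ?thesis using 1 by simp
qed

section \<open>Oscillation at scale \<open>h\<close>, measured through Gaussian windows\<close>

context spectral_kernel
begin

text \<open>Bounds the squared dual Sobolev norm of the difference of two point evaluations at
  distance \<open>\<delta>\<close>, in units of the window width.\<close>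

definition kap :: "real \<Rightarrow> real" where
  "kap \<delta> = (LINT t|lborel. min 4 (\<delta>\<^sup>2 * (norm (t::'a))\<^sup>2) * wt (- nu) t)"

lemma kap_integrable: "integrable lborel (\<lambda>t::'a. min 4 (\<delta>\<^sup>2 * (norm t)\<^sup>2) * wt (- nu) t)"
  by (rule Bochner_Integration.integrable_bound[OF integrable_mult_right[OF wt_integrable, of 4]])
    (auto simp: abs_mult intro!: mult_right_mono)

lemma kap_nonneg: "0 \<le> kap \<delta>"
  unfolding kap_def by simp

text \<open>Dominated convergence. No rate is extracted: a single good \<open>\<delta>\<close> will
  be fixed independently of \<open>n\<close>.\<close>

lemma kap_small:
  assumes "eps > 0"
  shows "\<exists>\<delta>>0. \<delta> \<le> 1 \<and> kap \<delta> < eps"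
proof -
  let ?d = "\<lambda>k. inverse (real (Suc k))"
  have "(\<lambda>k. kap (?d k)) \<longlonglongrightarrow> (LINT t|lborel. 0 * wt (- nu) (t::'a))"
    unfolding kap_def
  proof (rule integral_dominated_convergence[where w="\<lambda>t. 4 * wt (- nu) t"])
    show "integrable lborel (\<lambda>t::'a. 4 * wt (- nu) t)" using wt_integrable by simp
    have "(\<lambda>k. min 4 ((?d k)\<^sup>2 * (norm t)\<^sup>2) * wt (- nu) t) \<longlonglongrightarrow> min 4 (0\<^sup>2 * (norm t)\<^sup>2) * wt (- nu) t" for t :: 'a
      by (intro tendsto_intros LIMSEQ_inverse_real_of_nat)
    then show "AE t in lborel. (\<lambda>k. min 4 ((?d k)\<^sup>2 * (norm (t::'a))\<^sup>2) * wt (- nu) t) \<longlonglongrightarrow> 0 * wt (- nu) t" by simp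
    show "\<And>k. AE t in lborel. norm (min 4 ((?d k)\<^sup>2 * (norm (t::'a))\<^sup>2) * wt (- nu) t) \<le> 4 * wt (- nu) t"
      by (intro AE_I2) (auto simp: abs_mult intro!: mult_right_mono)
  qed auto
  then have "(\<lambda>k. kap (?d k)) \<longlonglongrightarrow> 0" by simp
  from order_tendstoD(2)[OF this assms] obtain k where "kap (?d k) < eps"
    using eventually_happens'[OF sequentially_bot] by blast
  moreover have "?d k > 0" "?d k \<le> 1" by (auto simp: inverse_le_1_iff)
  ultimately show ?thesis by blast
qed

lemma kap_scaled:
  assumes "h > 0"
  shows "(\<integral>\<^sup>+(t::'a). ennreal (min 4 ((\<delta> * h)\<^sup>2 * (norm t)\<^sup>2) * wt (- nu) (h *\<^sub>R t)) \<partial>lborel) = ennreal (kap \<delta> / h ^ DIM('a))"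
proof -
  let ?f = "\<lambda>t::'a. ennreal (min 4 (\<delta>\<^sup>2 * (norm t)\<^sup>2) * wt (- nu) t)"
  have "ennreal (kap \<delta>) = (\<integral>\<^sup>+t. ?f t \<partial>lborel)"
    unfolding kap_def by (rule nn_integral_eq_integral[symmetric, OF kap_integrable]) auto
  also have "\<dots> = ennreal (h ^ DIM('a)) * (\<integral>\<^sup>+t. ?f (h *\<^sub>R t) \<partial>lborel)"
    using assms by (subst nn_integral_lborel_affine[where c=h and t=0]) auto
  finally have k: "ennreal (kap \<delta>) = ennreal (h ^ DIM('a)) * (\<integral>\<^sup>+t. ?f (h *\<^sub>R t) \<partial>lborel)" .
  have "?f (h *\<^sub>R t) = ennreal (min 4 ((\<delta> * h)\<^sup>2 * (norm t)\<^sup>2) * wt (- nu) (h *\<^sub>R t))" for t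
    by (simp add: power_mult_distrib mult.assoc)
  then have "(\<integral>\<^sup>+(t::'a). ennreal (min 4 ((\<delta> * h)\<^sup>2 * (norm t)\<^sup>2) * wt (- nu) (h *\<^sub>R t)) \<partial>lborel) = (\<integral>\<^sup>+t. ?f (h *\<^sub>R t) \<partial>lborel)"
    by (simp only:)
  also have "\<dots> = (ennreal (1 / h ^ DIM('a)) * ennreal (h ^ DIM('a))) * (\<integral>\<^sup>+t. ?f (h *\<^sub>R t) \<partial>lborel)"
    using assms by (subst ennreal_mult[symmetric]) auto
  also have "\<dots> = ennreal (1 / h ^ DIM('a)) * ennreal (kap \<delta>)"
    unfolding k by (simp only: mult.assoc)
  also have "\<dots> = ennreal (kap \<delta> / h ^ DIM('a))"
    using assms kap_nonneg by (subst ennreal_mult[symmetric]) auto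
  finally show ?thesis .
qed

text \<open>\<open>loc W h z\<close> is the Fourier density of the localisation of \<open>ftr W\<close> by a Gaussian window
  of width \<open>h\<close> centred at \<open>z\<close>.\<close>

definition loc :: "('a \<Rightarrow> complex) \<Rightarrow> real \<Rightarrow> 'a \<Rightarrow> 'a \<Rightarrow> complex" where
  "loc W h z t = ftr (\<lambda>\<xi>. complex_of_real (gauss \<xi>) * W (t - \<xi> /\<^sub>R h)) (- (z /\<^sub>R h))"

lemma loc_measurable [measurable]:
  assumes [measurable]: "W \<in> borel_measurable borel"
  shows "(\<lambda>(z, t). loc W h z t) \<in> borel_measurable (borel \<Otimes>\<^sub>M borel)"
proof -
  have "(\<lambda>p. LINT \<xi>|lborel. complex_of_real (gauss \<xi>) * W (snd p - \<xi> /\<^sub>R h) * cis (\<xi> \<bullet> (- (fst p /\<^sub>R h)))) \<in> borel_measurable (borel \<Otimes>\<^sub>M borel)"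
    by (rule sigma_finite_measure.borel_measurable_lebesgue_integral) (auto simp: lborel.sigma_finite_measure_axioms split_beta')
  then show ?thesis by (simp add: loc_def ftr_def split_beta')
qed

text \<open>The Gaussian window is itself a Gaussian mixture of characters, by
  \<open>gauss_fourier\<close>, and multiplying \<open>ftr W\<close> by a character shifts
  \<open>W\<close>; Fubini assembles these shifts into \<open>loc\<close>.\<close>

lemma loc_ftr:
  fixes W :: "'a \<Rightarrow> complex"
  assumes W: "integrable lborel W" and h: "h > 0"
  shows "integrable lborel (loc W h z)"
    and "complex_of_real (exp (- (norm ((y - z) /\<^sub>R h))\<^sup>2 / 2)) * ftr W y = ftr (loc W h z) y"
proof -
  have [measurable]: "W \<in> borel_measurable borel" using W by simp
  let ?k = "\<lambda>\<xi> t. complex_of_real (gauss \<xi>) * W (t - \<xi> /\<^sub>R h) * cis (\<xi> \<bullet> (- (z /\<^sub>R h)))"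
  have Ws: "integrable lborel (\<lambda>t. W (t - v))" for v
    using integrable_lborel_shift[OF W, of "- v"] by simp
  have ki: "integrable (lborel \<Otimes>\<^sub>M lborel) (\<lambda>(\<xi>, t). ?k \<xi> t)"
  proof (rule lborel_pair.Fubini_integrable)
    have "(LINT t|lborel. norm (?k \<xi> t)) = gauss \<xi> * (LINT t|lborel. cmod (W t))" for \<xi>
      using integral_lborel_shift[of "\<lambda>t. cmod (W t)" "- (\<xi> /\<^sub>R h)"] gauss_pos[of \<xi>] by (simp add: norm_mult)
    then show "integrable lborel (\<lambda>\<xi>. LINT t|lborel. norm (case (\<xi>, t) of (\<xi>, t) \<Rightarrow> ?k \<xi> t))"
      using integrable_gauss[where 'a='a] by simp
    show "AE \<xi> in lborel. integrable lborel (\<lambda>t. case (\<xi>, t) of (\<xi>, t) \<Rightarrow> ?k \<xi> t)"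
      using Ws by simp
  qed measurable
  have loc: "loc W h z t = (LINT \<xi>|lborel. ?k \<xi> t)" for t by (simp add: loc_def ftr_def)
  show "integrable lborel (loc W h z)"
    unfolding loc[abs_def] using lborel_pair.integrable_snd[OF ki] by simp
  have kci: "integrable (lborel \<Otimes>\<^sub>M lborel) (\<lambda>(\<xi>, t). ?k \<xi> t * cis (t \<bullet> y))"
    by (rule Bochner_Integration.integrable_bound[OF ki]) (auto simp: norm_mult)
  have "ftr (loc W h z) y = (LINT t|lborel. LINT \<xi>|lborel. ?k \<xi> t * cis (t \<bullet> y))"
    unfolding ftr_def[of "loc W h z"] loc by simp
  also have "\<dots> = (LINT \<xi>|lborel. LINT t|lborel. ?k \<xi> t * cis (t \<bullet> y))"
    by (rule lborel_pair.Fubini_integral) (use kci in simp)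
  also have "\<dots> = (LINT \<xi>|lborel. (complex_of_real (gauss \<xi>) * cis (\<xi> \<bullet> ((y - z) /\<^sub>R h))) * ftr W y)"
  proof (intro Bochner_Integration.integral_cong refl)
    fix \<xi>
    have "(LINT t|lborel. ?k \<xi> t * cis (t \<bullet> y)) = complex_of_real (gauss \<xi>) * cis (\<xi> \<bullet> (- (z /\<^sub>R h))) * ftr (\<lambda>t. W (t + - (\<xi> /\<^sub>R h))) y"
      unfolding ftr_def by (subst integral_mult_right_zero[symmetric]) (simp add: mult_ac)
    also have "ftr (\<lambda>t. W (t + - (\<xi> /\<^sub>R h))) y = cis (- (- (\<xi> /\<^sub>R h) \<bullet> y)) * ftr W y"
      by (rule ftr_shift) simp
    also have "complex_of_real (gauss \<xi>) * cis (\<xi> \<bullet> (- (z /\<^sub>R h))) * (cis (- (- (\<xi> /\<^sub>R h) \<bullet> y)) * ftr W y)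
       = (complex_of_real (gauss \<xi>) * (cis (\<xi> \<bullet> (- (z /\<^sub>R h))) * cis (- (- (\<xi> /\<^sub>R h) \<bullet> y)))) * ftr W y"
      by (simp only: mult.assoc)
    also have "cis (\<xi> \<bullet> (- (z /\<^sub>R h))) * cis (- (- (\<xi> /\<^sub>R h) \<bullet> y)) = cis (\<xi> \<bullet> ((y - z) /\<^sub>R h))"
      by (simp add: cis_mult inner_diff_right right_diff_distrib)
    finally show "(LINT t|lborel. ?k \<xi> t * cis (t \<bullet> y)) = (complex_of_real (gauss \<xi>) * cis (\<xi> \<bullet> ((y - z) /\<^sub>R h))) * ftr W y" .
  qed
  also have "\<dots> = (LINT \<xi>|lborel. complex_of_real (gauss \<xi>) * cis (\<xi> \<bullet> ((y - z) /\<^sub>R h))) * ftr W y"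
    by (rule integral_mult_left_zero)
  also have "\<dots> = complex_of_real (exp (- (norm ((y - z) /\<^sub>R h))\<^sup>2 / 2)) * ftr W y"
    unfolding gauss_fourier ..
  finally show "complex_of_real (exp (- (norm ((y - z) /\<^sub>R h))\<^sup>2 / 2)) * ftr W y = ftr (loc W h z) y" ..
qed

text \<open>The window is 1 at \<open>z\<close> and some \<open>g\<close> in [0, 1] at
  \<open>y\<close>, so \<open>ftr W z - g * ftr W y\<close> is a difference of two values of the
  localised function. Cauchy-Schwarz with the weight \<open>wt nu (h *\<^sub>R t)\<close> and its
  inverse separates the oscillation constant from the local Sobolev norm.\<close>

lemma local_oscillation:
  fixes W :: "'a \<Rightarrow> complex"
  assumes W: "integrable lborel W" and h: "h > 0" and yz: "norm (y - z) \<le> \<delta> * h"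
  shows "ennreal ((cmod (ftr W z))\<^sup>2) \<le> 2 * ennreal ((cmod (ftr W y))\<^sup>2)
    + 2 * (ennreal (kap \<delta> / h ^ DIM('a)) * (\<integral>\<^sup>+t. ennreal ((cmod (loc W h z t))\<^sup>2 * wt nu (h *\<^sub>R t)) \<partial>lborel))"
proof -
  have [measurable]: "W \<in> borel_measurable borel" using W by simp
  note L = loc_ftr(1)[OF W h, of z] loc_ftr(2)[OF W h, where z=z]
  have [measurable]: "loc W h z \<in> borel_measurable borel" using L(1) by simp
  define g where "g = exp (- (norm ((y - z) /\<^sub>R h))\<^sup>2 / 2)"
  have g: "0 \<le> g" "g \<le> 1" by (auto simp: g_def)
  define D where "D = ftr W z - complex_of_real g * ftr W y"
  have D: "D = (LINT t|lborel. loc W h z t * (cis (t \<bullet> z) - cis (t \<bullet> y)))"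
  proof -
    have "D = ftr (loc W h z) z - ftr (loc W h z) y"
      using L(2)[of z] L(2)[of y] by (simp add: D_def g_def)
    also have "\<dots> = (LINT t|lborel. loc W h z t * cis (t \<bullet> z) - loc W h z t * cis (t \<bullet> y))"
      unfolding ftr_def by (rule Bochner_Integration.integral_diff[symmetric]) (rule integrable_mult_cis[OF L(1)], simp)+
    finally show ?thesis by (simp add: right_diff_distrib)
  qed
  have Di: "integrable lborel (\<lambda>t. loc W h z t * (cis (t \<bullet> z) - cis (t \<bullet> y)))"
    unfolding right_diff_distrib by (rule Bochner_Integration.integrable_diff) (rule integrable_mult_cis[OF L(1)], simp)+
  let ?p = "\<lambda>t. sqrt (wt nu (h *\<^sub>R t))" and ?m = "\<lambda>t. sqrt (wt (- nu) (h *\<^sub>R t))"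
  have pm: "?p t * ?m t = 1" for t
    by (simp add: wt_add flip: real_sqrt_mult)
  have "ennreal ((cmod D)\<^sup>2) = (ennreal (cmod D))\<^sup>2" by (simp add: ennreal_power)
  also have "\<dots> \<le> (\<integral>\<^sup>+t. ennreal (cmod (cis (t \<bullet> z) - cis (t \<bullet> y)) * ?m t) * ennreal (cmod (loc W h z t) * ?p t) \<partial>lborel)\<^sup>2"
  proof (rule power_mono)
    have "ennreal (cmod D) \<le> (\<integral>\<^sup>+t. ennreal (norm (loc W h z t * (cis (t \<bullet> z) - cis (t \<bullet> y)))) \<partial>lborel)"
      unfolding D by (rule integral_norm_bound_ennreal[OF Di])
    also have "\<dots> = (\<integral>\<^sup>+t. ennreal (cmod (cis (t \<bullet> z) - cis (t \<bullet> y)) * ?m t) * ennreal (cmod (loc W h z t) * ?p t) \<partial>lborel)"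
    proof (intro nn_integral_cong)
      fix t
      have "norm (loc W h z t * (cis (t \<bullet> z) - cis (t \<bullet> y))) = (cmod (cis (t \<bullet> z) - cis (t \<bullet> y)) * cmod (loc W h z t)) * (?p t * ?m t)"
        unfolding pm norm_mult by simp
      also have "\<dots> = (cmod (cis (t \<bullet> z) - cis (t \<bullet> y)) * ?m t) * (cmod (loc W h z t) * ?p t)"
        by (simp only: mult_ac)
      finally show "ennreal (norm (loc W h z t * (cis (t \<bullet> z) - cis (t \<bullet> y)))) = ennreal (cmod (cis (t \<bullet> z) - cis (t \<bullet> y)) * ?m t) * ennreal (cmod (loc W h z t) * ?p t)"
        by (simp add: ennreal_mult)
    qed
    finally show "ennreal (cmod D) \<le> (\<integral>\<^sup>+t. ennreal (cmod (cis (t \<bullet> z) - cis (t \<bullet> y)) * ?m t) * ennreal (cmod (loc W h z t) * ?p t) \<partial>lborel)" .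
  qed simp
  also have "\<dots> \<le> (\<integral>\<^sup>+t. (ennreal (cmod (cis (t \<bullet> z) - cis (t \<bullet> y)) * ?m t))\<^sup>2 \<partial>lborel) * (\<integral>\<^sup>+t. (ennreal (cmod (loc W h z t) * ?p t))\<^sup>2 \<partial>lborel)"
    by (rule Cauchy_Schwarz_nn_integral) measurable
  also have "\<dots> \<le> (\<integral>\<^sup>+(t::'a). ennreal (min 4 ((\<delta> * h)\<^sup>2 * (norm t)\<^sup>2) * wt (- nu) (h *\<^sub>R t)) \<partial>lborel) * (\<integral>\<^sup>+t. ennreal ((cmod (loc W h z t))\<^sup>2 * wt nu (h *\<^sub>R t)) \<partial>lborel)"
  proof (intro mult_mono nn_integral_mono)
    fix t
    have "\<bar>t \<bullet> z - t \<bullet> y\<bar> = \<bar>t \<bullet> (z - y)\<bar>" by (simp add: inner_diff_right)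
    also have "\<dots> \<le> norm t * norm (z - y)" by (rule Cauchy_Schwarz_ineq2)
    also have "\<dots> \<le> norm t * (\<delta> * h)" using yz by (intro mult_left_mono) (auto simp: norm_minus_commute)
    finally have "\<bar>t \<bullet> z - t \<bullet> y\<bar>\<^sup>2 \<le> (norm t * (\<delta> * h))\<^sup>2" by (intro power_mono) auto
    then have "min 4 ((t \<bullet> z - t \<bullet> y)\<^sup>2) \<le> min 4 ((\<delta> * h)\<^sup>2 * (norm t)\<^sup>2)"
      by (intro min.mono) (auto simp: power_mult_distrib mult_ac)
    with cmod_cis_diff_sq[of "t \<bullet> z" "t \<bullet> y"] have "(cmod (cis (t \<bullet> z) - cis (t \<bullet> y)))\<^sup>2 \<le> min 4 ((\<delta> * h)\<^sup>2 * (norm t)\<^sup>2)" by linarith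
    then show "(ennreal (cmod (cis (t \<bullet> z) - cis (t \<bullet> y)) * ?m t))\<^sup>2 \<le> ennreal (min 4 ((\<delta> * h)\<^sup>2 * (norm t)\<^sup>2) * wt (- nu) (h *\<^sub>R t))"
      by (simp only: ennreal_power[OF mult_nonneg_nonneg] norm_ge_zero real_sqrt_ge_zero wt_nonneg power_mult_distrib real_sqrt_pow2)
        (intro ennreal_leI mult_right_mono, auto)
    show "(ennreal (cmod (loc W h z t) * ?p t))\<^sup>2 \<le> ennreal ((cmod (loc W h z t))\<^sup>2 * wt nu (h *\<^sub>R t))"
      by (simp add: ennreal_power power_mult_distrib)
  qed auto
  also have "(\<integral>\<^sup>+(t::'a). ennreal (min 4 ((\<delta> * h)\<^sup>2 * (norm t)\<^sup>2) * wt (- nu) (h *\<^sub>R t)) \<partial>lborel) = ennreal (kap \<delta> / h ^ DIM('a))"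
    by (rule kap_scaled[OF h])
  finally have D2: "ennreal ((cmod D)\<^sup>2) \<le> ennreal (kap \<delta> / h ^ DIM('a)) * (\<integral>\<^sup>+t. ennreal ((cmod (loc W h z t))\<^sup>2 * wt nu (h *\<^sub>R t)) \<partial>lborel)" .
  have "(cmod (ftr W z))\<^sup>2 \<le> 2 * (cmod (ftr W y))\<^sup>2 + 2 * (cmod D)\<^sup>2"
  proof -
    have "cmod (ftr W z) \<le> cmod (complex_of_real g * ftr W y) + cmod D"
      using norm_triangle_ineq[of "complex_of_real g * ftr W y" D] by (simp add: D_def)
    also have "cmod (complex_of_real g * ftr W y) \<le> cmod (ftr W y)"
      using g by (simp add: norm_mult mult_left_le_one_le)
    finally have "(cmod (ftr W z))\<^sup>2 \<le> (cmod (ftr W y) + cmod D)\<^sup>2" by (intro power_mono) auto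
    also have "\<dots> \<le> 2 * (cmod (ftr W y))\<^sup>2 + 2 * (cmod D)\<^sup>2"
      using sum_squares_bound[of "cmod (ftr W y)" "cmod D"] by (simp add: power2_sum)
    finally show ?thesis .
  qed
  then have "ennreal ((cmod (ftr W z))\<^sup>2) \<le> ennreal (2 * (cmod (ftr W y))\<^sup>2 + 2 * (cmod D)\<^sup>2)" by (rule ennreal_leI)
  also have "\<dots> = 2 * ennreal ((cmod (ftr W y))\<^sup>2) + 2 * ennreal ((cmod D)\<^sup>2)" by (simp add: ennreal_mult')
  also have "\<dots> \<le> 2 * ennreal ((cmod (ftr W y))\<^sup>2) + 2 * (ennreal (kap \<delta> / h ^ DIM('a)) * (\<integral>\<^sup>+t. ennreal ((cmod (loc W h z t))\<^sup>2 * wt nu (h *\<^sub>R t)) \<partial>lborel))"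
    by (intro add_left_mono mult_left_mono D2) auto
  finally show ?thesis .
qed

definition gw :: real where "gw = (LINT \<xi>|lborel. (gauss (\<xi>::'a))\<^sup>2 * wt nu \<xi>)"

lemma gw_integrable: "integrable lborel (\<lambda>\<xi>::'a. (gauss \<xi>)\<^sup>2 * wt nu \<xi>)"
proof (rule Bochner_Integration.integrable_bound)
  let ?M = "exp (1 / 2 + nu * (ln (2 * nu) - 1))"
  show "integrable lborel (\<lambda>\<xi>::'a. ?M * gauss \<xi>)" using integrable_gauss[where 'a='a] by simp
  have "(gauss \<xi>)\<^sup>2 * wt nu \<xi> \<le> ?M * gauss \<xi>" for \<xi> :: 'a
    using mult_right_mono[OF wt_gauss_bounded[OF nu_pos, of \<xi>] less_imp_le[OF gauss_pos[of \<xi>]]]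
    by (simp add: power2_eq_square mult_ac)
  then show "AE \<xi> in lborel. norm ((gauss (\<xi>::'a))\<^sup>2 * wt nu \<xi>) \<le> norm (?M * gauss \<xi>)"
    by (intro AE_I2) (auto simp: abs_mult less_imp_le[OF gauss_pos])
qed measurable

lemma gw_nonneg: "0 \<le> gw"
  unfolding gw_def by simp

text \<open>For fixed \<open>t\<close>, \<open>loc\<close> is a transform evaluated at minus
  \<open>z\<close> over \<open>h\<close>; hence the \<open>z\<close>-integral is taken first, where
  \<open>bessel\<close> applies with Jacobian \<open>h ^ DIM('a)\<close>. Peetre's inequality then
  moves the weight from \<open>h *\<^sub>R t\<close> to \<open>h *\<^sub>R s\<close>, leaving the
  Gaussian moment \<open>gw\<close>.\<close>

lemma loc_total:
  fixes W :: "'a \<Rightarrow> complex"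
  assumes W: "integrable lborel W" and bd: "\<And>x. cmod (W x) \<le> B" and h: "h > 0"
  shows "(\<integral>\<^sup>+z. (\<integral>\<^sup>+t. ennreal ((cmod (loc W h z t))\<^sup>2 * wt nu (h *\<^sub>R t)) \<partial>lborel) \<partial>lborel)
    \<le> ennreal (h ^ DIM('a) * ((2 * pi) ^ DIM('a) * 2 powr nu * gw)) * (\<integral>\<^sup>+s. ennreal ((cmod (W s))\<^sup>2 * wt nu (h *\<^sub>R s)) \<partial>lborel)"
proof -
  have [measurable]: "W \<in> borel_measurable borel" using W by simp
  define G where "G t \<xi> = complex_of_real (gauss \<xi>) * W (t - \<xi> /\<^sub>R h)" for t \<xi>
  have [measurable]: "G t \<in> borel_measurable borel" for t unfolding G_def[abs_def] by measurable
  have B: "B \<ge> 0" using order.trans[OF norm_ge_zero bd] by blast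
  have G1: "integrable lborel (G t)" for t
  proof (rule Bochner_Integration.integrable_bound)
    show "integrable lborel (\<lambda>\<xi>::'a. B * gauss \<xi>)" using integrable_gauss[where 'a='a] by simp
    have "norm (G t \<xi>) \<le> B * gauss \<xi>" for \<xi>
      using mult_right_mono[OF bd[of "t - \<xi> /\<^sub>R h"] less_imp_le[OF gauss_pos[of \<xi>]]] gauss_pos[of \<xi>]
      by (simp add: G_def norm_mult mult.commute)
    then show "AE \<xi> in lborel. norm (G t \<xi>) \<le> norm (B * gauss \<xi>)"
      by (intro AE_I2) (auto intro: order.trans[OF _ abs_ge_self])
  qed measurable
  have G2: "integrable lborel (\<lambda>\<xi>. (cmod (G t \<xi>))\<^sup>2)" for t
  proof (rule Bochner_Integration.integrable_bound)
    show "integrable lborel (\<lambda>\<xi>::'a. (B\<^sup>2 * gauss (0::'a)) * gauss \<xi>)" using integrable_gauss[where 'a='a] by simp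
    have "(cmod (G t \<xi>))\<^sup>2 \<le> (B\<^sup>2 * gauss (0::'a)) * gauss \<xi>" for \<xi>
    proof -
      have "(cmod (G t \<xi>))\<^sup>2 = (cmod (W (t - \<xi> /\<^sub>R h)))\<^sup>2 * (gauss \<xi> * gauss \<xi>)"
        using gauss_pos[of \<xi>] by (simp add: G_def norm_mult power_mult_distrib power2_eq_square)
      also have "\<dots> \<le> B\<^sup>2 * (gauss (0::'a) * gauss \<xi>)"
        by (intro mult_mono power_mono bd gauss_le) (auto simp: less_imp_le[OF gauss_pos])
      finally show ?thesis by (simp add: mult.assoc)
    qed
    then show "AE \<xi> in lborel. norm ((cmod (G t \<xi>))\<^sup>2) \<le> norm ((B\<^sup>2 * gauss (0::'a)) * gauss \<xi>)"
      by (intro AE_I2) (auto simp: abs_mult less_imp_le[OF gauss_pos])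
  qed measurable
  have inner: "(\<integral>\<^sup>+z. ennreal ((cmod (loc W h z t))\<^sup>2) \<partial>lborel) \<le> ennreal (h ^ DIM('a) * (2 * pi) ^ DIM('a)) * (\<integral>\<^sup>+\<xi>. ennreal ((cmod (G t \<xi>))\<^sup>2) \<partial>lborel)" for t
  proof -
    let ?F = "\<lambda>x. ennreal ((cmod (ftr (G t) x))\<^sup>2)"
    have [measurable]: "ftr (G t) \<in> borel_measurable borel" by (rule ftr_measurable) measurable
    have "(\<integral>\<^sup>+x. ?F x \<partial>lborel) = ennreal (\<bar>- (1 / h)\<bar> ^ DIM('a)) * (\<integral>\<^sup>+z. ?F (0 + (- (1 / h)) *\<^sub>R z) \<partial>lborel)"
      using h by (intro nn_integral_lborel_affine) auto
    then have e: "(\<integral>\<^sup>+x. ?F x \<partial>lborel) = ennreal (1 / h ^ DIM('a)) * (\<integral>\<^sup>+z. ennreal ((cmod (loc W h z t))\<^sup>2) \<partial>lborel)"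
      using h by (simp add: loc_def G_def[abs_def] power_one_over divide_inverse_commute power_inverse)
    have "(\<integral>\<^sup>+z. ennreal ((cmod (loc W h z t))\<^sup>2) \<partial>lborel) = (ennreal (h ^ DIM('a)) * ennreal (1 / h ^ DIM('a))) * (\<integral>\<^sup>+z. ennreal ((cmod (loc W h z t))\<^sup>2) \<partial>lborel)"
      using h by (subst ennreal_mult[symmetric]) auto
    also have "\<dots> = ennreal (h ^ DIM('a)) * (\<integral>\<^sup>+x. ?F x \<partial>lborel)" unfolding e by (simp only: mult.assoc)
    also have "\<dots> \<le> ennreal (h ^ DIM('a)) * ennreal ((2 * pi) ^ DIM('a) * (LINT \<xi>|lborel. (cmod (G t \<xi>))\<^sup>2))"
      by (intro mult_left_mono bessel G1 G2) simp
    also have "\<dots> = ennreal (h ^ DIM('a)) * (ennreal ((2 * pi) ^ DIM('a)) * (\<integral>\<^sup>+\<xi>. ennreal ((cmod (G t \<xi>))\<^sup>2) \<partial>lborel))"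
      using nn_integral_eq_integral[OF G2[of t]] by (subst ennreal_mult) auto
    also have "\<dots> = ennreal (h ^ DIM('a) * (2 * pi) ^ DIM('a)) * (\<integral>\<^sup>+\<xi>. ennreal ((cmod (G t \<xi>))\<^sup>2) \<partial>lborel)"
      using h by (subst ennreal_mult) (auto simp: mult.assoc)
    finally show ?thesis .
  qed
  let ?c = "ennreal (h ^ DIM('a) * (2 * pi) ^ DIM('a))"
  let ?J = "\<integral>\<^sup>+s. ennreal ((cmod (W s))\<^sup>2 * wt nu (h *\<^sub>R s)) \<partial>lborel"
  have [measurable]: "(\<lambda>(z, t). ennreal ((cmod (loc W h z t))\<^sup>2 * wt nu (h *\<^sub>R t))) \<in> borel_measurable (lborel \<Otimes>\<^sub>M lborel)"
    using loc_measurable[of W h] by (simp add: split_beta' )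
  have locm: "(\<lambda>z. loc W h z t) \<in> borel_measurable borel" for t
    using measurable_compose[OF _ loc_measurable[of W h], of "\<lambda>z. (z, t)" borel] by simp
  have "(\<integral>\<^sup>+z. (\<integral>\<^sup>+t. ennreal ((cmod (loc W h z t))\<^sup>2 * wt nu (h *\<^sub>R t)) \<partial>lborel) \<partial>lborel)
     = (\<integral>\<^sup>+t. (\<integral>\<^sup>+z. ennreal ((cmod (loc W h z t))\<^sup>2 * wt nu (h *\<^sub>R t)) \<partial>lborel) \<partial>lborel)"
    by (rule lborel_pair.Fubini'[symmetric]) measurable
  also have "\<dots> = (\<integral>\<^sup>+t. ennreal (wt nu (h *\<^sub>R t)) * (\<integral>\<^sup>+z. ennreal ((cmod (loc W h z t))\<^sup>2) \<partial>lborel) \<partial>lborel)"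
    using locm by (intro nn_integral_cong, subst nn_integral_cmult[symmetric]) (auto simp: ennreal_mult mult.commute)
  also have "\<dots> \<le> (\<integral>\<^sup>+t. ennreal (wt nu (h *\<^sub>R t)) * (?c * (\<integral>\<^sup>+\<xi>. ennreal ((cmod (G t \<xi>))\<^sup>2) \<partial>lborel)) \<partial>lborel)"
    by (intro nn_integral_mono mult_left_mono inner) simp
  also have "\<dots> = (\<integral>\<^sup>+t. (\<integral>\<^sup>+\<xi>. ?c * ennreal ((cmod (G t \<xi>))\<^sup>2 * wt nu (h *\<^sub>R t)) \<partial>lborel) \<partial>lborel)"
  proof (intro nn_integral_cong)
    fix t
    have "(\<integral>\<^sup>+\<xi>. ?c * ennreal ((cmod (G t \<xi>))\<^sup>2 * wt nu (h *\<^sub>R t)) \<partial>lborel) = (\<integral>\<^sup>+\<xi>. (ennreal (wt nu (h *\<^sub>R t)) * ?c) * ennreal ((cmod (G t \<xi>))\<^sup>2) \<partial>lborel)"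
      by (intro nn_integral_cong) (unfold ennreal_mult[OF zero_le_power2 wt_nonneg], simp only: mult_ac)
    also have "\<dots> = (ennreal (wt nu (h *\<^sub>R t)) * ?c) * (\<integral>\<^sup>+\<xi>. ennreal ((cmod (G t \<xi>))\<^sup>2) \<partial>lborel)"
      by (rule nn_integral_cmult) measurable
    finally show "ennreal (wt nu (h *\<^sub>R t)) * (?c * (\<integral>\<^sup>+\<xi>. ennreal ((cmod (G t \<xi>))\<^sup>2) \<partial>lborel)) = (\<integral>\<^sup>+\<xi>. ?c * ennreal ((cmod (G t \<xi>))\<^sup>2 * wt nu (h *\<^sub>R t)) \<partial>lborel)"
      by (simp only: mult.assoc)
  qed
  also have "\<dots> = (\<integral>\<^sup>+\<xi>. (\<integral>\<^sup>+t. ?c * ennreal ((cmod (G t \<xi>))\<^sup>2 * wt nu (h *\<^sub>R t)) \<partial>lborel) \<partial>lborel)"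
    by (rule lborel_pair.Fubini'[symmetric]) (simp add: G_def split_beta')
  also have "\<dots> \<le> (\<integral>\<^sup>+(\<xi>::'a). ennreal ((gauss \<xi>)\<^sup>2 * wt nu \<xi>) * (?c * ennreal (2 powr nu) * ?J) \<partial>lborel)"
  proof (rule nn_integral_mono)
    fix \<xi> :: 'a
    have "(\<integral>\<^sup>+t. ?c * ennreal ((cmod (G t \<xi>))\<^sup>2 * wt nu (h *\<^sub>R t)) \<partial>lborel)
       = (\<integral>\<^sup>+s. ?c * ennreal ((gauss \<xi>)\<^sup>2 * (cmod (W s))\<^sup>2 * wt nu (h *\<^sub>R s + \<xi>)) \<partial>lborel)"
      using h by (subst nn_integral_lborel_affine[where c=1 and t="\<xi> /\<^sub>R h"])
        (auto simp: G_def norm_mult power_mult_distrib scaleR_add_right add.commute)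
    also have "\<dots> \<le> (\<integral>\<^sup>+s. (?c * ennreal (2 powr nu) * ennreal ((gauss \<xi>)\<^sup>2 * wt nu \<xi>)) * ennreal ((cmod (W s))\<^sup>2 * wt nu (h *\<^sub>R s)) \<partial>lborel)"
    proof (rule nn_integral_mono)
      fix s
      have "(gauss \<xi>)\<^sup>2 * (cmod (W s))\<^sup>2 * wt nu (h *\<^sub>R s + \<xi>) \<le> (gauss \<xi>)\<^sup>2 * (cmod (W s))\<^sup>2 * (2 powr nu * wt nu (h *\<^sub>R s) * wt nu \<xi>)"
        using nu_pos by (intro mult_left_mono wt_peetre) auto
      also have "\<dots> = 2 powr nu * ((gauss \<xi>)\<^sup>2 * wt nu \<xi>) * ((cmod (W s))\<^sup>2 * wt nu (h *\<^sub>R s))" by simp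
      finally have "ennreal ((gauss \<xi>)\<^sup>2 * (cmod (W s))\<^sup>2 * wt nu (h *\<^sub>R s + \<xi>)) \<le> ennreal (2 powr nu * ((gauss \<xi>)\<^sup>2 * wt nu \<xi>) * ((cmod (W s))\<^sup>2 * wt nu (h *\<^sub>R s)))"
        by (rule ennreal_leI)
      also have "\<dots> = ennreal (2 powr nu) * ennreal ((gauss \<xi>)\<^sup>2 * wt nu \<xi>) * ennreal ((cmod (W s))\<^sup>2 * wt nu (h *\<^sub>R s))"
        by (simp only: ennreal_mult mult_nonneg_nonneg zero_le_power2 wt_nonneg powr_ge_zero)
      finally show "?c * ennreal ((gauss \<xi>)\<^sup>2 * (cmod (W s))\<^sup>2 * wt nu (h *\<^sub>R s + \<xi>)) \<le> (?c * ennreal (2 powr nu) * ennreal ((gauss \<xi>)\<^sup>2 * wt nu \<xi>)) * ennreal ((cmod (W s))\<^sup>2 * wt nu (h *\<^sub>R s))"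
        unfolding mult.assoc by (intro mult_left_mono) auto
    qed
    also have "\<dots> = (?c * ennreal (2 powr nu) * ennreal ((gauss \<xi>)\<^sup>2 * wt nu \<xi>)) * ?J"
      by (rule nn_integral_cmult) measurable
    finally show "(\<integral>\<^sup>+t. ?c * ennreal ((cmod (G t \<xi>))\<^sup>2 * wt nu (h *\<^sub>R t)) \<partial>lborel) \<le> ennreal ((gauss \<xi>)\<^sup>2 * wt nu \<xi>) * (?c * ennreal (2 powr nu) * ?J)"
      by (simp only: mult_ac)
  qed
  also have "\<dots> = (\<integral>\<^sup>+\<xi>. ennreal ((gauss (\<xi>::'a))\<^sup>2 * wt nu \<xi>) \<partial>lborel) * (?c * ennreal (2 powr nu) * ?J)"
    by (rule nn_integral_multc) measurable
  also have "(\<integral>\<^sup>+\<xi>. ennreal ((gauss (\<xi>::'a))\<^sup>2 * wt nu \<xi>) \<partial>lborel) = ennreal gw"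
    unfolding gw_def by (rule nn_integral_eq_integral[OF gw_integrable]) auto
  also have "ennreal gw * (?c * ennreal (2 powr nu) * ?J) = ennreal gw * (?c * ennreal (2 powr nu)) * ?J"
    by (simp only: mult.assoc)
  also have "ennreal gw * (?c * ennreal (2 powr nu)) = ennreal (h ^ DIM('a) * ((2 * pi) ^ DIM('a) * 2 powr nu * gw))"
    using h gw_nonneg by (subst ennreal_mult[symmetric], simp, simp, subst ennreal_mult[symmetric]) (auto simp: mult_ac)
  finally show ?thesis .
qed

text \<open>The factor 2 of \<open>local_oscillation\<close>, the constant of
  \<open>loc_total\<close> and the factor of \<open>wt_scaled_le\<close>. The powers of
  \<open>h\<close> in \<open>kap_scaled\<close> and \<open>loc_total\<close> cancel, so
  \<open>CS\<close> is free of the scale.\<close>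

definition CS :: real where "CS = 2 * ((2 * pi) ^ DIM('a) * 2 powr nu * gw) * 2 powr nu"

lemma CS_nonneg: "0 \<le> CS"
  unfolding CS_def using gw_nonneg by simp

text \<open>At scale \<open>h\<close> the weight is of order 1 below the frequency 1 / h and of
  order \<open>h powr (2 * nu)\<close> times the full weight above it; the sum covers both
  ranges.\<close>

lemma wt_scaled_le:
  assumes h: "h > 0"
  shows "wt nu (h *\<^sub>R (s::'a)) \<le> 2 powr nu * (1 + h powr (2 * nu) * wt nu s)"
proof -
  have h2: "(h\<^sup>2) powr nu = h powr (2 * nu)"
    using h by (simp add: powr_powr flip: powr_numeral)
  let ?m = "max 1 (h\<^sup>2 * (1 + (norm s)\<^sup>2))"
  have "1 + (norm (h *\<^sub>R s))\<^sup>2 \<le> 1 + h\<^sup>2 * (1 + (norm s)\<^sup>2)"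
    using h by (simp add: power_mult_distrib distrib_left)
  also have "\<dots> \<le> 2 * ?m" by simp
  finally have "wt nu (h *\<^sub>R s) \<le> (2 * ?m) powr nu"
    unfolding wt_def using nu_pos by (intro powr_mono2) auto
  also have "\<dots> = 2 powr nu * ?m powr nu" by (rule powr_mult)
  also have "?m powr nu \<le> 1 + h powr (2 * nu) * wt nu s"
  proof (cases "h\<^sup>2 * (1 + (norm s)\<^sup>2) \<le> 1")
    case True
    then show ?thesis by (simp add: max_def)
  next
    case False
    have "(h\<^sup>2 * (1 + (norm s)\<^sup>2)) powr nu = h powr (2 * nu) * wt nu s"
      by (simp only: powr_mult h2 wt_def)
    then show ?thesis using False by (simp add: max_def)
  qed
  finally show ?thesis by simp
qed

text \<open>Gaussian windows replace a decomposition into cells: the local Sobolev norms are summed by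
  Bessel's inequality in the window centre, and \<open>kap \<delta>\<close> makes the oscillation term absorbable.\<close>

lemma sampling_inequality:
  fixes W :: "'a \<Rightarrow> complex" and xs :: "nat \<Rightarrow> 'a"
  assumes W: "integrable lborel W" and cont: "continuous_on UNIV W" and bd: "\<And>x. cmod (W x) \<le> B"
    and H: "integrable lborel (\<lambda>s. (cmod (W s))\<^sup>2 * wt nu s)"
    and w2: "integrable lborel (\<lambda>x. (cmod (ftr W x))\<^sup>2)"
    and supp: "\<And>x. x \<notin> S \<Longrightarrow> ftr W x = 0"
    and h: "h > 0" and d: "\<delta> > 0" and m: "m > 0"
    and dense: "\<And>z. z \<in> S \<Longrightarrow> m \<le> real (card {k. k < n \<and> norm (xs k - z) \<le> \<delta> * h})"
    and small: "kap \<delta> * CS \<le> 1 / 2"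
  shows "(LINT x|lborel. (cmod (ftr W x))\<^sup>2) \<le>
     4 * (unit_ball_vol (real DIM('a)) * (\<delta> * h) ^ DIM('a)) / m * (\<Sum>k<n. (cmod (ftr W (xs k)))\<^sup>2)
     + 2 * kap \<delta> * CS * h powr (2 * nu) * (LINT s|lborel. (cmod (W s))\<^sup>2 * wt nu s)"
proof -
  have [measurable]: "W \<in> borel_measurable borel" using W by simp
  define I where "I = (LINT x|lborel. (cmod (ftr W x))\<^sup>2)"
  define HH where "HH = (LINT s|lborel. (cmod (W s))\<^sup>2 * wt nu s)"
  define X where "X = (\<Sum>k<n. (cmod (ftr W (xs k)))\<^sup>2)"
  define r where "r = \<delta> * h"
  define V where "V = unit_ball_vol (real DIM('a)) * r ^ DIM('a)"
  have r: "r > 0" using h d by (simp add: r_def)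
  have V0: "V \<ge> 0" using r by (simp add: V_def)
  let ?T = "\<lambda>z. \<integral>\<^sup>+t. ennreal ((cmod (loc W h z t))\<^sup>2 * wt nu (h *\<^sub>R t)) \<partial>lborel"
  let ?E = "\<lambda>z. 2 * (ennreal (kap \<delta> / h ^ DIM('a)) * ?T z)"
  let ?N = "\<lambda>z. \<Sum>k<n. ennreal (2 / m * (cmod (ftr W (xs k)))\<^sup>2) * indicator (cball (xs k) r) z"
  have Tm [measurable]: "?T \<in> borel_measurable borel"
  proof -
    have "(\<lambda>z. \<integral>\<^sup>+t. ennreal ((cmod (loc W h z t))\<^sup>2 * wt nu (h *\<^sub>R t)) \<partial>lborel) \<in> borel_measurable lborel"
      by (rule lborel.borel_measurable_nn_integral) (use loc_measurable[of W h] in \<open>simp add: split_beta'\<close>)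
    then show ?thesis by simp
  qed
  have Nm [measurable]: "?N \<in> borel_measurable borel"
    by (intro borel_measurable_sum borel_measurable_times_ennreal borel_measurable_const borel_measurable_indicator) simp
  \<comment> \<open>Averages \<open>local_oscillation\<close> over the design points within
    \<open>\<delta> * h\<close> of \<open>z\<close>, of which there are at least \<open>m\<close>.
    The case of an infinite local norm is trivial and split off so that the rest can be computed in
    the reals.\<close>
  have point: "ennreal ((cmod (ftr W z))\<^sup>2) \<le> ?N z + ?E z" for z
  proof (cases "z \<in> S")
    case False
    then show ?thesis by (simp add: supp)
  next
    case True
    let ?K = "{k. k < n \<and> norm (xs k - z) \<le> \<delta> * h}"
      have cK: "real (card ?K) \<ge> m" using dense[OF True] .
    then have cK0: "card ?K > 0" using m by (cases "card ?K") auto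
    show ?thesis
    proof (cases "?E z = \<infinity>")
      case True
      show ?thesis unfolding True by simp
    next
      case False
      then obtain E where E: "?E z = ennreal E" "E \<ge> 0" by (cases "?E z") auto
      have osc: "(cmod (ftr W z))\<^sup>2 \<le> 2 * (cmod (ftr W (xs k)))\<^sup>2 + E" if "k \<in> ?K" for k
      proof -
        have "ennreal ((cmod (ftr W z))\<^sup>2) \<le> 2 * ennreal ((cmod (ftr W (xs k)))\<^sup>2) + ?E z"
          using that by (intro local_oscillation[OF W h]) simp
        also have "\<dots> = ennreal (2 * (cmod (ftr W (xs k)))\<^sup>2 + E)"
          unfolding E(1) using E(2) by (simp add: ennreal_mult')
        finally show ?thesis using E(2) by (subst (asm) ennreal_le_iff) auto
      qed
      have quot: "b \<le> 2 * s / c + e" if "c * b \<le> 2 * s + c * e" "c > 0" for b c e s :: real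
        using that by (simp add: field_simps)
      from osc have "(\<Sum>k\<in>?K. (cmod (ftr W z))\<^sup>2) \<le> (\<Sum>k\<in>?K. 2 * (cmod (ftr W (xs k)))\<^sup>2 + E)"
        by (intro sum_mono)
      then have "real (card ?K) * (cmod (ftr W z))\<^sup>2 \<le> 2 * (\<Sum>k\<in>?K. (cmod (ftr W (xs k)))\<^sup>2) + real (card ?K) * E"
        by (simp add: sum.distrib sum_distrib_left)
      then have "(cmod (ftr W z))\<^sup>2 \<le> 2 * (\<Sum>k\<in>?K. (cmod (ftr W (xs k)))\<^sup>2) / real (card ?K) + E"
        by (rule quot) (use cK0 in simp)
      also have "2 * (\<Sum>k\<in>?K. (cmod (ftr W (xs k)))\<^sup>2) / real (card ?K) \<le> 2 * (\<Sum>k\<in>?K. (cmod (ftr W (xs k)))\<^sup>2) / m"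
        using cK m by (intro divide_left_mono mult_nonneg_nonneg sum_nonneg) auto
      finally have "ennreal ((cmod (ftr W z))\<^sup>2) \<le> ennreal (2 * (\<Sum>k\<in>?K. (cmod (ftr W (xs k)))\<^sup>2) / m + E)"
        by (intro ennreal_leI) simp
      also have "\<dots> = ennreal (2 * (\<Sum>k\<in>?K. (cmod (ftr W (xs k)))\<^sup>2) / m) + ?E z"
        unfolding E(1) using E(2) m by (intro ennreal_plus) (auto intro!: divide_nonneg_nonneg sum_nonneg)
      also have "ennreal (2 * (\<Sum>k\<in>?K. (cmod (ftr W (xs k)))\<^sup>2) / m) = ?N z"
      proof -
        have "?N z = (\<Sum>k<n. if k \<in> ?K then ennreal (2 / m * (cmod (ftr W (xs k)))\<^sup>2) else 0)"
          by (intro sum.cong) (auto simp: indicator_def r_def dist_norm)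
        also have "\<dots> = (\<Sum>k\<in>{..<n} \<inter> ?K. ennreal (2 / m * (cmod (ftr W (xs k)))\<^sup>2))"
          by (simp only: sum.inter_restrict[OF finite_lessThan])
        also have "{..<n} \<inter> ?K = ?K" by auto
        also have "(\<Sum>k\<in>?K. ennreal (2 / m * (cmod (ftr W (xs k)))\<^sup>2)) = ennreal (\<Sum>k\<in>?K. 2 / m * (cmod (ftr W (xs k)))\<^sup>2)"
          using m by (intro sum_ennreal) auto
        finally show ?thesis by (simp add: sum_distrib_left sum_divide_distrib)
      qed
      finally show ?thesis .
    qed
  qed
  have NI: "(\<integral>\<^sup>+z. ?N z \<partial>lborel) = ennreal (2 * V / m * X)"
  proof -
    have "(\<integral>\<^sup>+z. ?N z \<partial>lborel) = (\<Sum>k<n. \<integral>\<^sup>+z. ennreal (2 / m * (cmod (ftr W (xs k)))\<^sup>2) * indicator (cball (xs k) r) z \<partial>lborel)"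
      by (rule nn_integral_sum) (intro borel_measurable_times_ennreal borel_measurable_const borel_measurable_indicator, simp)
    also have "\<dots> = (\<Sum>k<n. ennreal (2 / m * (cmod (ftr W (xs k)))\<^sup>2) * ennreal V)"
      using r by (simp add: nn_integral_cmult_indicator emeasure_cball V_def)
    also have "\<dots> = (\<Sum>k<n. ennreal (2 / m * (cmod (ftr W (xs k)))\<^sup>2 * V))"
      using m V0 by (intro sum.cong refl ennreal_mult[symmetric]) auto
    also have "\<dots> = ennreal (\<Sum>k<n. 2 / m * (cmod (ftr W (xs k)))\<^sup>2 * V)"
      using m V0 by (intro sum_ennreal) auto
    finally show ?thesis by (simp add: X_def sum_distrib_left mult_ac)
  qed
  let ?J = "\<integral>\<^sup>+s. ennreal ((cmod (W s))\<^sup>2 * wt nu (h *\<^sub>R s)) \<partial>lborel"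
  have W2: "integrable lborel (\<lambda>s. (cmod (W s))\<^sup>2)"
  proof (rule Bochner_Integration.integrable_bound[OF H])
    show "AE s in lborel. norm ((cmod (W s))\<^sup>2) \<le> norm ((cmod (W s))\<^sup>2 * wt nu s)"
    proof (intro AE_I2)
      fix s
      have "(cmod (W s))\<^sup>2 * 1 \<le> (cmod (W s))\<^sup>2 * wt nu s"
        using wt_mono[of 0 nu s] nu_pos by (intro mult_left_mono) auto
      then show "norm ((cmod (W s))\<^sup>2) \<le> norm ((cmod (W s))\<^sup>2 * wt nu s)" by simp
    qed
  qed measurable
  \<comment> \<open>Brings the unweighted part of the local norms back to \<open>I\<close> itself,
    so that it can be absorbed.\<close>
  have WI: "(LINT s|lborel. (cmod (W s))\<^sup>2) \<le> I"
  proof -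
    have "(1::real) \<le> (2 * pi) ^ DIM('a)" using pi_gt3 by (intro one_le_power) simp
    from mult_right_mono[OF this, of "LINT s|lborel. (cmod (W s))\<^sup>2"]
    have "(LINT s|lborel. (cmod (W s))\<^sup>2) \<le> (2 * pi) ^ DIM('a) * (LINT s|lborel. (cmod (W s))\<^sup>2)" by simp
    also have "\<dots> \<le> I" unfolding I_def by (rule plancherel_le[OF W cont bd w2])
    finally show ?thesis .
  qed
  have HH0: "HH \<ge> 0" and I0: "I \<ge> 0" and X0: "X \<ge> 0" by (simp_all add: HH_def I_def X_def sum_nonneg)
  have Ji: "integrable lborel (\<lambda>s. 2 powr nu * ((cmod (W s))\<^sup>2 + h powr (2 * nu) * ((cmod (W s))\<^sup>2 * wt nu s)))"
    using W2 H by simp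
  have J: "?J \<le> ennreal (2 powr nu * (I + h powr (2 * nu) * HH))"
  proof -
    have "?J \<le> (\<integral>\<^sup>+s. ennreal (2 powr nu * ((cmod (W s))\<^sup>2 + h powr (2 * nu) * ((cmod (W s))\<^sup>2 * wt nu s))) \<partial>lborel)"
      using mult_left_mono[OF wt_scaled_le[OF h], of "(cmod (W _))\<^sup>2"]
      by (intro nn_integral_mono ennreal_leI) (simp add: algebra_simps)
    also have "\<dots> = ennreal (LINT s|lborel. 2 powr nu * ((cmod (W s))\<^sup>2 + h powr (2 * nu) * ((cmod (W s))\<^sup>2 * wt nu s)))"
      by (rule nn_integral_eq_integral[OF Ji]) simp
    also have "(LINT s|lborel. 2 powr nu * ((cmod (W s))\<^sup>2 + h powr (2 * nu) * ((cmod (W s))\<^sup>2 * wt nu s))) = 2 powr nu * ((LINT s|lborel. (cmod (W s))\<^sup>2) + h powr (2 * nu) * HH)"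
      using W2 H by (simp add: HH_def)
    also have "ennreal \<dots> \<le> ennreal (2 powr nu * (I + h powr (2 * nu) * HH))"
      using WI by (intro ennreal_leI mult_left_mono add_right_mono) auto
    finally show ?thesis .
  qed
  have EI: "(\<integral>\<^sup>+z. ?E z \<partial>lborel) \<le> ennreal (kap \<delta> * CS * (I + h powr (2 * nu) * HH))"
  proof -
    have "(\<integral>\<^sup>+z. ?E z \<partial>lborel) = 2 * (ennreal (kap \<delta> / h ^ DIM('a)) * (\<integral>\<^sup>+z. ?T z \<partial>lborel))"
      by (simp add: nn_integral_cmult)
    also have "\<dots> \<le> 2 * (ennreal (kap \<delta> / h ^ DIM('a)) * (ennreal (h ^ DIM('a) * ((2 * pi) ^ DIM('a) * 2 powr nu * gw)) * ?J))"
      by (intro mult_left_mono loc_total[OF W bd h]) auto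
    also have "\<dots> \<le> 2 * (ennreal (kap \<delta> / h ^ DIM('a)) * (ennreal (h ^ DIM('a) * ((2 * pi) ^ DIM('a) * 2 powr nu * gw)) * ennreal (2 powr nu * (I + h powr (2 * nu) * HH))))"
      by (intro mult_left_mono J) auto
    also have "\<dots> = ennreal (2 * (kap \<delta> / h ^ DIM('a) * (h ^ DIM('a) * ((2 * pi) ^ DIM('a) * 2 powr nu * gw) * (2 powr nu * (I + h powr (2 * nu) * HH)))))"
    proof -
      have "0 \<le> I + h powr (2 * nu) * HH" using HH0 I0 by simp
      moreover have "0 \<le> kap \<delta> / h ^ DIM('a)" using h kap_nonneg by simp
      moreover have "0 \<le> h ^ DIM('a) * ((2 * pi) ^ DIM('a) * 2 powr nu * gw)" using h gw_nonneg by simp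
      moreover have "2 = ennreal 2" by simp
      ultimately show ?thesis by (simp only: ennreal_mult mult_nonneg_nonneg powr_ge_zero zero_le_numeral)
    qed
    also have "2 * (kap \<delta> / h ^ DIM('a) * (h ^ DIM('a) * ((2 * pi) ^ DIM('a) * 2 powr nu * gw) * (2 powr nu * (I + h powr (2 * nu) * HH)))) = kap \<delta> * CS * (I + h powr (2 * nu) * HH)"
      using h by (simp add: CS_def)
    finally show ?thesis .
  qed
  have "ennreal I = (\<integral>\<^sup>+x. ennreal ((cmod (ftr W x))\<^sup>2) \<partial>lborel)"
    unfolding I_def by (rule nn_integral_eq_integral[symmetric, OF w2]) simp
  also have "\<dots> \<le> (\<integral>\<^sup>+z. ?N z + ?E z \<partial>lborel)"
    by (intro nn_integral_mono point)
  also have "\<dots> = (\<integral>\<^sup>+z. ?N z \<partial>lborel) + (\<integral>\<^sup>+z. ?E z \<partial>lborel)"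
    by (rule nn_integral_add) measurable
  also have "\<dots> \<le> ennreal (2 * V / m * X) + ennreal (kap \<delta> * CS * (I + h powr (2 * nu) * HH))"
    unfolding NI by (intro add_left_mono EI)
  also have "\<dots> = ennreal (2 * V / m * X + kap \<delta> * CS * (I + h powr (2 * nu) * HH))"
    using V0 m X0 I0 HH0 kap_nonneg CS_nonneg by (intro ennreal_plus[symmetric]) (auto intro!: mult_nonneg_nonneg add_nonneg_nonneg divide_nonneg_nonneg)
  finally have "I \<le> 2 * V / m * X + kap \<delta> * CS * (I + h powr (2 * nu) * HH)"
    using V0 m X0 I0 HH0 kap_nonneg CS_nonneg
    by (subst (asm) ennreal_le_iff) (auto intro!: mult_nonneg_nonneg add_nonneg_nonneg divide_nonneg_nonneg)
  \<comment> \<open>Absorption: by \<open>small\<close> at most half of \<open>I\<close> appears on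
    the right, which costs a factor 2 in the remaining terms.\<close>
  moreover have "kap \<delta> * CS * I \<le> 1 / 2 * I" using small I0 by (intro mult_right_mono)
  ultimately have "I \<le> 2 * (2 * V / m * X) + 2 * (kap \<delta> * CS * (h powr (2 * nu) * HH))"
    unfolding distrib_left by linarith
  then show ?thesis by (simp add: I_def HH_def X_def V_def r_def mult_ac)
qed

end

section \<open>Lower bound for the dual weights\<close>

text \<open>Convolving densities multiplies the functions they represent. It is used with
  \<open>X\<close> the density of \<open>beta\<close>, to cut the residual off to the ball where the
  design is dense.\<close>

definition conv :: "('a::euclidean_space \<Rightarrow> complex) \<Rightarrow> ('a \<Rightarrow> complex) \<Rightarrow> 'a \<Rightarrow> complex" where
  "conv X F t = (LINT \<xi>|lborel. X (t - \<xi>) * F \<xi>)"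

lemma conv_props:
  fixes X F :: "'a::euclidean_space \<Rightarrow> complex"
  assumes X: "integrable lborel X" and F: "integrable lborel F"
    and cont: "continuous_on UNIV X" and bd: "\<And>x. cmod (X x) \<le> B"
  shows "integrable lborel (conv X F)"
    and "ftr (conv X F) y = ftr X y * ftr F y"
    and "continuous_on UNIV (conv X F)"
    and "cmod (conv X F t) \<le> B * (LINT \<xi>|lborel. cmod (F \<xi>))"
proof -
  have [measurable]: "X \<in> borel_measurable borel" "F \<in> borel_measurable borel" using X F by auto
  have Xs: "integrable lborel (\<lambda>t. X (t - \<xi>))" for \<xi>
    using integrable_lborel_shift[OF X, of "- \<xi>"] by simp
  have ki: "integrable (lborel \<Otimes>\<^sub>M lborel) (\<lambda>(\<xi>, t). X (t - \<xi>) * F \<xi>)"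
  proof (rule lborel_pair.Fubini_integrable)
    have "(LINT t|lborel. norm (X (t - \<xi>) * F \<xi>)) = (LINT t|lborel. cmod (X t)) * cmod (F \<xi>)" for \<xi>
      using integral_lborel_shift[of "\<lambda>t. cmod (X t)" "- \<xi>"] by (simp add: norm_mult)
    then show "integrable lborel (\<lambda>\<xi>. LINT t|lborel. norm (case (\<xi>, t) of (\<xi>, t) \<Rightarrow> X (t - \<xi>) * F \<xi>))"
      using F by simp
    show "AE \<xi> in lborel. integrable lborel (\<lambda>t. case (\<xi>, t) of (\<xi>, t) \<Rightarrow> X (t - \<xi>) * F \<xi>)"
      using Xs by simp
  qed measurable
  show "integrable lborel (conv X F)"
    unfolding conv_def[abs_def] using lborel_pair.integrable_snd[OF ki] by simp
  have kci: "integrable (lborel \<Otimes>\<^sub>M lborel) (\<lambda>(\<xi>, t). X (t - \<xi>) * F \<xi> * cis (t \<bullet> y))"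
    by (rule Bochner_Integration.integrable_bound[OF ki]) (auto simp: norm_mult)
  have "ftr (conv X F) y = (LINT t|lborel. LINT \<xi>|lborel. X (t - \<xi>) * F \<xi> * cis (t \<bullet> y))"
    unfolding ftr_def conv_def by simp
  also have "\<dots> = (LINT \<xi>|lborel. LINT t|lborel. X (t - \<xi>) * F \<xi> * cis (t \<bullet> y))"
    by (rule lborel_pair.Fubini_integral) (use kci in simp)
  also have "\<dots> = (LINT \<xi>|lborel. ftr X y * (F \<xi> * cis (\<xi> \<bullet> y)))"
  proof (intro Bochner_Integration.integral_cong refl)
    fix \<xi>
    have "(LINT t|lborel. X (t - \<xi>) * F \<xi> * cis (t \<bullet> y)) = F \<xi> * ftr (\<lambda>t. X (t + - \<xi>)) y"
      unfolding ftr_def by (subst integral_mult_right_zero[symmetric]) (simp add: mult_ac)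
    also have "ftr (\<lambda>t. X (t + - \<xi>)) y = cis (- (- \<xi> \<bullet> y)) * ftr X y"
      by (rule ftr_shift) simp
    finally show "(LINT t|lborel. X (t - \<xi>) * F \<xi> * cis (t \<bullet> y)) = ftr X y * (F \<xi> * cis (\<xi> \<bullet> y))" by simp
  qed
  also have "\<dots> = ftr X y * ftr F y" by (simp add: ftr_def)
  finally show "ftr (conv X F) y = ftr X y * ftr F y" .
  have b: "cmod (X (t - \<xi>) * F \<xi>) \<le> B * cmod (F \<xi>)" for t \<xi>
    unfolding norm_mult by (intro mult_right_mono bd) simp
  have Fi: "integrable lborel (\<lambda>\<xi>. B * cmod (F \<xi>))" using F by simp
  have "isCont (conv X F) t" for t
    unfolding conv_def[abs_def] continuous_at_sequentially comp_def
  proof safe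
    fix u assume u: "u \<longlonglongrightarrow> t"
    show "(\<lambda>n. LINT \<xi>|lborel. X (u n - \<xi>) * F \<xi>) \<longlonglongrightarrow> (LINT \<xi>|lborel. X (t - \<xi>) * F \<xi>)"
    proof (rule integral_dominated_convergence[OF _ _ Fi])
      have "(\<lambda>n. X (u n - \<xi>)) \<longlonglongrightarrow> X (t - \<xi>)" for \<xi>
        using cont u by (intro isCont_tendsto_compose[of _ X] tendsto_intros) (auto simp: continuous_on_eq_continuous_at)
      then show "AE \<xi> in lborel. (\<lambda>n. X (u n - \<xi>) * F \<xi>) \<longlonglongrightarrow> X (t - \<xi>) * F \<xi>"
        by (intro AE_I2 tendsto_mult_right)
    qed (use b in auto)
  qed
  then show "continuous_on UNIV (conv X F)" by (simp add: continuous_on_eq_continuous_at)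
  have "integrable lborel (\<lambda>\<xi>. X (t - \<xi>) * F \<xi>)"
    by (rule Bochner_Integration.integrable_bound[OF Fi]) (simp, intro AE_I2 order.trans[OF b], simp)
  then have "cmod (conv X F t) \<le> (LINT \<xi>|lborel. B * cmod (F \<xi>))"
    unfolding conv_def by (rule Bochner_Integration.integral_norm_bound_integral[OF _ Fi b])
  then show "cmod (conv X F t) \<le> B * (LINT \<xi>|lborel. cmod (F \<xi>))" by simp
qed

text \<open>A weighted Young inequality: Cauchy-Schwarz after splitting |X| into two square roots,
  Peetre's inequality to distribute \<open>wt p t\<close> over \<open>t - \<xi>\<close> and
  \<open>\<xi>\<close>, then Fubini. One of the two integrals of \<open>X\<close> stays
  unweighted.\<close>

lemma conv_weighted:
  fixes X F :: "'a::euclidean_space \<Rightarrow> complex"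
  assumes X: "integrable lborel X" and F: "integrable lborel F" and p: "p \<ge> 0"
    and cont: "continuous_on UNIV X" and bd: "\<And>x. cmod (X x) \<le> B"
    and Xw: "integrable lborel (\<lambda>s. cmod (X s) * wt p s)" and Fw: "integrable lborel (\<lambda>s. (cmod (F s))\<^sup>2 * wt p s)"
  shows "integrable lborel (\<lambda>t. (cmod (conv X F t))\<^sup>2 * wt p t)"
    and "(LINT t|lborel. (cmod (conv X F t))\<^sup>2 * wt p t) \<le>
      (LINT s|lborel. cmod (X s)) * (2 powr p * (LINT s|lborel. cmod (X s) * wt p s)) * (LINT s|lborel. (cmod (F s))\<^sup>2 * wt p s)"
proof -
  have [measurable]: "X \<in> borel_measurable borel" "F \<in> borel_measurable borel" using X F by auto
  have [measurable]: "conv X F \<in> borel_measurable borel" using conv_props(1)[OF X F cont bd] by simp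
  let ?x = "LINT s|lborel. cmod (X s)" and ?A = "LINT s|lborel. cmod (X s) * wt p s" and ?Q = "LINT s|lborel. (cmod (F s))\<^sup>2 * wt p s"
  have b: "cmod (X (t - \<xi>) * F \<xi>) \<le> B * cmod (F \<xi>)" for t \<xi>
    unfolding norm_mult by (intro mult_right_mono bd) simp
  have pt: "ennreal ((cmod (conv X F t))\<^sup>2 * wt p t) \<le> ennreal ?x * (\<integral>\<^sup>+\<xi>. ennreal (2 powr p * (cmod (X (t - \<xi>)) * wt p (t - \<xi>)) * ((cmod (F \<xi>))\<^sup>2 * wt p \<xi>)) \<partial>lborel)" for t
  proof -
    have i: "integrable lborel (\<lambda>\<xi>. X (t - \<xi>) * F \<xi>)"
      by (rule Bochner_Integration.integrable_bound[where f="\<lambda>\<xi>. B * cmod (F \<xi>)"])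
        (use F in simp, simp, intro AE_I2 order.trans[OF b], simp)
    have "(ennreal (cmod (conv X F t)))\<^sup>2 \<le> (\<integral>\<^sup>+\<xi>. ennreal (sqrt (cmod (X (t - \<xi>)))) * ennreal (sqrt (cmod (X (t - \<xi>))) * cmod (F \<xi>)) \<partial>lborel)\<^sup>2"
    proof (rule power_mono)
      have "ennreal (cmod (conv X F t)) \<le> (\<integral>\<^sup>+\<xi>. ennreal (cmod (X (t - \<xi>) * F \<xi>)) \<partial>lborel)"
        unfolding conv_def by (rule integral_norm_bound_ennreal[OF i])
      also have "\<dots> = (\<integral>\<^sup>+\<xi>. ennreal (sqrt (cmod (X (t - \<xi>)))) * ennreal (sqrt (cmod (X (t - \<xi>))) * cmod (F \<xi>)) \<partial>lborel)"
      proof (intro nn_integral_cong)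
        fix \<xi>
        have "cmod (X (t - \<xi>) * F \<xi>) = sqrt (cmod (X (t - \<xi>))) * (sqrt (cmod (X (t - \<xi>))) * cmod (F \<xi>))"
          unfolding mult.assoc[symmetric] by (simp add: norm_mult)
        then show "ennreal (cmod (X (t - \<xi>) * F \<xi>)) = ennreal (sqrt (cmod (X (t - \<xi>)))) * ennreal (sqrt (cmod (X (t - \<xi>))) * cmod (F \<xi>))"
          by (simp only: ennreal_mult norm_ge_zero real_sqrt_ge_zero mult_nonneg_nonneg)
      qed
      finally show "ennreal (cmod (conv X F t)) \<le> (\<integral>\<^sup>+\<xi>. ennreal (sqrt (cmod (X (t - \<xi>)))) * ennreal (sqrt (cmod (X (t - \<xi>))) * cmod (F \<xi>)) \<partial>lborel)" .
    qed simp
    also have "\<dots> \<le> (\<integral>\<^sup>+\<xi>. (ennreal (sqrt (cmod (X (t - \<xi>)))))\<^sup>2 \<partial>lborel) * (\<integral>\<^sup>+\<xi>. (ennreal (sqrt (cmod (X (t - \<xi>))) * cmod (F \<xi>)))\<^sup>2 \<partial>lborel)"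
      by (rule Cauchy_Schwarz_nn_integral) measurable
    also have "(\<integral>\<^sup>+\<xi>. (ennreal (sqrt (cmod (X (t - \<xi>)))))\<^sup>2 \<partial>lborel) = (\<integral>\<^sup>+\<xi>. ennreal (cmod (X (t - \<xi>))) \<partial>lborel)"
      by (simp add: ennreal_power)
    also have "\<dots> = ennreal ?x"
      using nn_integral_eq_integral[OF integrable_norm[OF integrable_lborel_reflect[OF X, of t]]]
        integral_lborel_reflect[of "\<lambda>s. cmod (X s)" t] by simp
    finally have 1: "(ennreal (cmod (conv X F t)))\<^sup>2 \<le> ennreal ?x * (\<integral>\<^sup>+\<xi>. (ennreal (sqrt (cmod (X (t - \<xi>))) * cmod (F \<xi>)))\<^sup>2 \<partial>lborel)" .
    have "ennreal ((cmod (conv X F t))\<^sup>2 * wt p t) = (ennreal (cmod (conv X F t)))\<^sup>2 * ennreal (wt p t)"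
      by (simp add: ennreal_power ennreal_mult)
    also have "\<dots> \<le> ennreal ?x * (\<integral>\<^sup>+\<xi>. (ennreal (sqrt (cmod (X (t - \<xi>))) * cmod (F \<xi>)))\<^sup>2 \<partial>lborel) * ennreal (wt p t)"
      by (intro mult_right_mono 1) simp
    also have "\<dots> = ennreal ?x * (\<integral>\<^sup>+\<xi>. (ennreal (sqrt (cmod (X (t - \<xi>))) * cmod (F \<xi>)))\<^sup>2 * ennreal (wt p t) \<partial>lborel)"
      by (subst nn_integral_multc) (auto simp: mult.assoc)
    also have "\<dots> \<le> ennreal ?x * (\<integral>\<^sup>+\<xi>. ennreal (2 powr p * (cmod (X (t - \<xi>)) * wt p (t - \<xi>)) * ((cmod (F \<xi>))\<^sup>2 * wt p \<xi>)) \<partial>lborel)"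
    proof (intro mult_left_mono nn_integral_mono)
      fix \<xi>
      have "(ennreal (sqrt (cmod (X (t - \<xi>))) * cmod (F \<xi>)))\<^sup>2 * ennreal (wt p t) = ennreal (cmod (X (t - \<xi>)) * (cmod (F \<xi>))\<^sup>2 * wt p t)"
        by (simp add: ennreal_power power_mult_distrib flip: ennreal_mult)
      also have "\<dots> \<le> ennreal (cmod (X (t - \<xi>)) * (cmod (F \<xi>))\<^sup>2 * (2 powr p * wt p (t - \<xi>) * wt p \<xi>))"
        using wt_peetre[OF p, of "t - \<xi>" \<xi>] by (intro ennreal_leI mult_left_mono) auto
      finally show "(ennreal (sqrt (cmod (X (t - \<xi>))) * cmod (F \<xi>)))\<^sup>2 * ennreal (wt p t) \<le> ennreal (2 powr p * (cmod (X (t - \<xi>)) * wt p (t - \<xi>)) * ((cmod (F \<xi>))\<^sup>2 * wt p \<xi>))"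
        by (simp add: mult_ac)
    qed simp
    finally show ?thesis .
  qed
  have "(\<integral>\<^sup>+t. ennreal ((cmod (conv X F t))\<^sup>2 * wt p t) \<partial>lborel) \<le> (\<integral>\<^sup>+t. ennreal ?x * (\<integral>\<^sup>+\<xi>. ennreal (2 powr p * (cmod (X (t - \<xi>)) * wt p (t - \<xi>)) * ((cmod (F \<xi>))\<^sup>2 * wt p \<xi>)) \<partial>lborel) \<partial>lborel)"
    by (intro nn_integral_mono pt)
  also have "\<dots> = ennreal ?x * (\<integral>\<^sup>+t. (\<integral>\<^sup>+\<xi>. ennreal (2 powr p * (cmod (X (t - \<xi>)) * wt p (t - \<xi>)) * ((cmod (F \<xi>))\<^sup>2 * wt p \<xi>)) \<partial>lborel) \<partial>lborel)"
    by (rule nn_integral_cmult) measurable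
  also have "(\<integral>\<^sup>+t. (\<integral>\<^sup>+\<xi>. ennreal (2 powr p * (cmod (X (t - \<xi>)) * wt p (t - \<xi>)) * ((cmod (F \<xi>))\<^sup>2 * wt p \<xi>)) \<partial>lborel) \<partial>lborel)
     = (\<integral>\<^sup>+\<xi>. (\<integral>\<^sup>+t. ennreal (2 powr p * (cmod (X (t - \<xi>)) * wt p (t - \<xi>)) * ((cmod (F \<xi>))\<^sup>2 * wt p \<xi>)) \<partial>lborel) \<partial>lborel)"
    by (rule lborel_pair.Fubini'[symmetric]) measurable
  also have "\<dots> = (\<integral>\<^sup>+\<xi>. ennreal (2 powr p * ?A) * ennreal ((cmod (F \<xi>))\<^sup>2 * wt p \<xi>) \<partial>lborel)"
  proof (intro nn_integral_cong)
    fix \<xi>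
    have "(\<integral>\<^sup>+t. ennreal (2 powr p * (cmod (X (t - \<xi>)) * wt p (t - \<xi>)) * ((cmod (F \<xi>))\<^sup>2 * wt p \<xi>)) \<partial>lborel)
       = (\<integral>\<^sup>+t. ennreal (2 powr p * (cmod (X t) * wt p t) * ((cmod (F \<xi>))\<^sup>2 * wt p \<xi>)) \<partial>lborel)"
      by (subst nn_integral_lborel_affine[where c=1 and t=\<xi>]) auto
    also have "\<dots> = ennreal (LINT t|lborel. 2 powr p * (cmod (X t) * wt p t) * ((cmod (F \<xi>))\<^sup>2 * wt p \<xi>))"
      using Xw by (intro nn_integral_eq_integral) auto
    also have "\<dots> = ennreal (2 powr p * ?A * ((cmod (F \<xi>))\<^sup>2 * wt p \<xi>))" by simp
    also have "\<dots> = ennreal (2 powr p * ?A) * ennreal ((cmod (F \<xi>))\<^sup>2 * wt p \<xi>)"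
      by (intro ennreal_mult) auto
    finally show "(\<integral>\<^sup>+t. ennreal (2 powr p * (cmod (X (t - \<xi>)) * wt p (t - \<xi>)) * ((cmod (F \<xi>))\<^sup>2 * wt p \<xi>)) \<partial>lborel) = ennreal (2 powr p * ?A) * ennreal ((cmod (F \<xi>))\<^sup>2 * wt p \<xi>)" .
  qed
  also have "\<dots> = ennreal (2 powr p * ?A) * (\<integral>\<^sup>+\<xi>. ennreal ((cmod (F \<xi>))\<^sup>2 * wt p \<xi>) \<partial>lborel)"
    by (rule nn_integral_cmult) measurable
  also have "(\<integral>\<^sup>+\<xi>. ennreal ((cmod (F \<xi>))\<^sup>2 * wt p \<xi>) \<partial>lborel) = ennreal ?Q"
    by (rule nn_integral_eq_integral[OF Fw]) auto
  also have "ennreal ?x * (ennreal (2 powr p * ?A) * ennreal ?Q) = ennreal (?x * (2 powr p * ?A) * ?Q)"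
    by (simp add: ennreal_mult mult.assoc)
  finally have le: "(\<integral>\<^sup>+t. ennreal ((cmod (conv X F t))\<^sup>2 * wt p t) \<partial>lborel) \<le> ennreal (?x * (2 powr p * ?A) * ?Q)" .
  show i: "integrable lborel (\<lambda>t. (cmod (conv X F t))\<^sup>2 * wt p t)"
    by (rule integrableI_nonneg) (use le in \<open>auto intro: order.strict_trans1\<close>)
  show "(LINT t|lborel. (cmod (conv X F t))\<^sup>2 * wt p t) \<le> ?x * (2 powr p * ?A) * ?Q"
    using le unfolding nn_integral_eq_integral[OF i, simplified] by (subst (asm) ennreal_le_iff) (auto intro!: mult_nonneg_nonneg)
qed

context kernel_bump
begin

section \<open>Fourier densities of the bump and of the residual\<close>

lemma tfh_uminus: "tfh om th (- w) = cnj (tfh om th w)"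
proof -
  have "cnj (tfh om th w) = (LINT x|lborel. cnj (complex_of_real (tf om th x) * cis (x \<bullet> w)))"
    unfolding tfh_def ftr_def by (rule Bochner_Integration.integral_cnj[symmetric])
  also have "\<dots> = tfh om th (- w)" unfolding tfh_def ftr_def by (simp add: cis_cnj del: Bochner_Integration.integral_cnj)
  finally show ?thesis ..
qed

text \<open>The density whose transform is \<open>beta\<close>; the reflection of
  \<open>bhat\<close> compensates for the positive sign in \<open>ftr\<close>.\<close>

definition bden :: "'a \<Rightarrow> complex" where "bden w = bhat (- w) / (2 * pi) ^ DIM('a)"

lemma bden_ftr: "ftr bden x = complex_of_real (beta x)"
proof -
  have e: "tf 0 0 = beta" by (simp add: tf_def[abs_def])
  have "ftr bden x = (LINT w|lborel. (\<lambda>w. bhat w * cis (- (w \<bullet> x)) / (2 * pi) ^ DIM('a)) (- w))"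
    unfolding ftr_def bden_def by simp
  also have "\<dots> = (LINT w|lborel. bhat w * cis (- (w \<bullet> x)) / (2 * pi) ^ DIM('a))"
    by (rule integral_lborel_uminus) measurable
  also have "\<dots> = (LINT w|lborel. bhat w * cis (- (w \<bullet> x))) / (2 * pi) ^ DIM('a)" by simp
  also have "\<dots> = complex_of_real (beta x)"
    using tf_inversion[of 0 0 x] by (simp add: tfh_def e bhat_def)
  finally show ?thesis .
qed

lemma bden_integrable: "integrable lborel bden"
  unfolding bden_def[abs_def] using integrable_lborel_affine[OF bhat_integrable, of "-1" 0] by simp

lemma bden_cont: "continuous_on UNIV bden"
  unfolding bden_def[abs_def] by (intro continuous_intros continuous_on_compose2[OF bhat_cont]) auto

lemma bden_bound: "cmod (bden w) \<le> CB * wt (- (2 * nu)) w"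
proof -
  have 1: "(1::real) \<le> (2 * pi) ^ DIM('a)" using pi_gt3 by (intro one_le_power) simp
  have "cmod (bden w) = cmod (bhat (- w)) / (2 * pi) ^ DIM('a)"
    by (simp add: bden_def norm_divide norm_power norm_mult)
  also have "\<dots> \<le> cmod (bhat (- w)) / 1" by (intro divide_left_mono 1) auto
  finally have "cmod (bden w) \<le> cmod (bhat (- w))" by simp
  then show ?thesis using bhat_bound[of "- w"] by simp
qed

lemma bden_le: "cmod (bden w) \<le> CB"
proof -
  have "CB * wt (- (2 * nu)) w \<le> CB * 1"
    using CB_pos nu_pos by (intro mult_left_mono wt_le_one) auto
  then show ?thesis using bden_bound[of w] by simp
qed

lemma bden_weighted: "integrable lborel (\<lambda>w. cmod (bden w) * wt nu w)"
proof (rule Bochner_Integration.integrable_bound)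
  have [measurable]: "bden \<in> borel_measurable borel" using bden_integrable by simp
  show "(\<lambda>w. cmod (bden w) * wt nu w) \<in> borel_measurable lborel" by measurable
  show "integrable lborel (\<lambda>w::'a. CB * wt (- nu) w)" using wt_integrable by simp
  have "cmod (bden w) * wt nu w \<le> CB * wt (- nu) w" for w
    using mult_right_mono[OF bden_bound[of w], of "wt nu w"] by (simp add: mult.assoc wt_add)
  then show "AE w in lborel. norm (cmod (bden w) * wt nu w) \<le> norm (CB * wt (- nu) w)"
    using CB_pos by (intro AE_I2) (auto simp: abs_mult)
qed

text \<open>Bounds, relative to \<open>rsq\<close>, the weighted energy of the density of
  \<open>beta\<close> times the residual: the constant of \<open>conv_weighted\<close> times the
  \<open>c2\<close> of \<open>resid_density\<close>.\<close>

definition KH :: real where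
  "KH = (LINT s|lborel. cmod (bden s)) * (2 powr nu * (LINT s|lborel. cmod (bden s) * wt nu s)) * c2"

lemma KH_nonneg: "KH \<ge> 0"
  unfolding KH_def using c_pos by (intro mult_nonneg_nonneg) auto

text \<open>Here \<open>a\<close> solves the regularised normal equations with right-hand side \<open>pot (tf om th)\<close>, the
  representer of the functional \<open>f \<mapsto> \<integral> f tf\<close>. The residual \<open>resid\<close> of that representer has Fourier
  density \<open>fPsi * rsd\<close> and squared native norm \<open>rsq\<close>.\<close>

definition resid :: "nat \<Rightarrow> (nat \<Rightarrow> 'a) \<Rightarrow> (nat \<Rightarrow> real) \<Rightarrow> 'a \<Rightarrow> real \<Rightarrow> 'a \<Rightarrow> real" where
  "resid n xs a om th y = pot (tf om th) y - (\<Sum>k<n. a k * Psi (xs k - y))"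

definition rsd :: "nat \<Rightarrow> (nat \<Rightarrow> 'a) \<Rightarrow> (nat \<Rightarrow> real) \<Rightarrow> 'a \<Rightarrow> real \<Rightarrow> 'a \<Rightarrow> complex" where
  "rsd n xs a om th w = tfh om th w - trig n xs a w"

definition rsq :: "nat \<Rightarrow> (nat \<Rightarrow> 'a) \<Rightarrow> (nat \<Rightarrow> real) \<Rightarrow> 'a \<Rightarrow> real \<Rightarrow> real" where
  "rsq n xs a om th = (LINT w|lborel. fPsi w * (cmod (rsd n xs a om th w))\<^sup>2)"

lemma rsd_measurable [measurable]: "rsd n xs a om th \<in> borel_measurable borel"
  unfolding rsd_def[abs_def] by measurable

lemma rsd_bounded: "cmod (rsd n xs a om th w) \<le> (LINT x|lborel. \<bar>tf om th x\<bar>) + (\<Sum>k<n. \<bar>a k\<bar>)"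
  unfolding rsd_def using norm_triangle_ineq4[of "tfh om th w" "trig n xs a w"] tfh_bounded[of om th w] trig_bound[of n xs a w]
  by linarith

text \<open>\<open>spectral_pairing\<close> for the bump and the spectral form of \<open>Psi\<close>
  combine linearly; the reflection in \<open>F\<close> brings the negative character into the
  convention of \<open>ftr\<close>. In the weighted energy, one of the two factors
  \<open>fPsi\<close> cancels \<open>wt nu\<close> up to \<open>c2\<close>.\<close>

lemma resid_density:
  defines "F \<equiv> \<lambda>n xs a om th w. complex_of_real (fPsi (- w)) * rsd n xs a om th (- w)"
  shows "integrable lborel (F n xs a om th)"
    and "complex_of_real (resid n xs a om th y) = (LINT w|lborel. complex_of_real (fPsi w) * (rsd n xs a om th w * cis (- (w \<bullet> y))))"
    and "complex_of_real (resid n xs a om th y) = ftr (F n xs a om th) y"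
    and "integrable lborel (\<lambda>w. (cmod (F n xs a om th w))\<^sup>2 * wt nu w)"
    and "(LINT w|lborel. (cmod (F n xs a om th w))\<^sup>2 * wt nu w) \<le> c2 * rsq n xs a om th"
proof -
  let ?g = "rsd n xs a om th"
  have gi: "integrable lborel (\<lambda>w. complex_of_real (fPsi w) * ?g w)"
    by (rule fPsi_bounded_integrable[OF rsd_measurable rsd_bounded])
  show Fi: "integrable lborel (F n xs a om th)"
    using integrable_lborel_affine[OF gi, of "-1" 0] by (simp add: F_def)
  have Fm [measurable]: "F n xs a om th \<in> borel_measurable borel" using Fi by simp
  have ti: "integrable lborel (\<lambda>w. complex_of_real (fPsi w) * (tfh om th w * cis (- (w \<bullet> y))))"
    by (rule fPsi_bounded_integrable[where B="LINT x|lborel. \<bar>tf om th x\<bar>"]) (auto simp: norm_mult tfh_bounded)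
  have Pk: "complex_of_real (Psi (x - y)) = (LINT w|lborel. complex_of_real (fPsi w) * (cis (w \<bullet> x) * cis (- (w \<bullet> y))))" for x
    unfolding Psi_ftr_shift ftr_def by (simp add: mult_ac)
  have ki: "integrable lborel (\<lambda>w. complex_of_real (fPsi w) * (cis (w \<bullet> x) * cis (- (w \<bullet> y))))" for x
    by (rule fPsi_bounded_integrable[where B=1]) (auto simp: norm_mult)
  have si: "integrable lborel (\<lambda>w. \<Sum>k<n. complex_of_real (a k) * (complex_of_real (fPsi w) * (cis (w \<bullet> xs k) * cis (- (w \<bullet> y)))))"
    using ki by (intro Bochner_Integration.integrable_sum integrable_mult_right) auto
  have "complex_of_real (resid n xs a om th y) = (LINT w|lborel. complex_of_real (fPsi w) * (tfh om th w * cis (- (w \<bullet> y)))) - (\<Sum>k<n. complex_of_real (a k) * complex_of_real (Psi (xs k - y)))"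
    unfolding resid_def pot_def of_real_diff of_real_sum of_real_mult spectral_pairing[OF tf_integrable] tfh_def ..
  also have "(\<Sum>k<n. complex_of_real (a k) * complex_of_real (Psi (xs k - y))) = (LINT w|lborel. (\<Sum>k<n. complex_of_real (a k) * (complex_of_real (fPsi w) * (cis (w \<bullet> xs k) * cis (- (w \<bullet> y))))))"
    unfolding Pk using ki by simp
  also have "(LINT w|lborel. complex_of_real (fPsi w) * (tfh om th w * cis (- (w \<bullet> y)))) - \<dots> =
     (LINT w|lborel. complex_of_real (fPsi w) * (tfh om th w * cis (- (w \<bullet> y))) - (\<Sum>k<n. complex_of_real (a k) * (complex_of_real (fPsi w) * (cis (w \<bullet> xs k) * cis (- (w \<bullet> y))))))"
    by (rule Bochner_Integration.integral_diff[symmetric, OF ti si])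
  also have "\<dots> = (LINT w|lborel. complex_of_real (fPsi w) * (?g w * cis (- (w \<bullet> y))))"
  proof (intro Bochner_Integration.integral_cong refl)
    fix w
    have "(\<Sum>k<n. complex_of_real (a k) * (complex_of_real (fPsi w) * (cis (w \<bullet> xs k) * cis (- (w \<bullet> y))))) = complex_of_real (fPsi w) * (trig n xs a w * cis (- (w \<bullet> y)))"
      unfolding trig_def sum_distrib_right sum_distrib_left by (intro sum.cong) (auto simp: mult_ac)
    then show "complex_of_real (fPsi w) * (tfh om th w * cis (- (w \<bullet> y))) - (\<Sum>k<n. complex_of_real (a k) * (complex_of_real (fPsi w) * (cis (w \<bullet> xs k) * cis (- (w \<bullet> y))))) = complex_of_real (fPsi w) * (?g w * cis (- (w \<bullet> y)))"
      by (simp add: rsd_def left_diff_distrib right_diff_distrib)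
  qed
  finally show r: "complex_of_real (resid n xs a om th y) = (LINT w|lborel. complex_of_real (fPsi w) * (?g w * cis (- (w \<bullet> y))))" .
  have "ftr (F n xs a om th) y = (LINT w|lborel. (\<lambda>w. complex_of_real (fPsi w) * (?g w * cis (- (w \<bullet> y)))) (- w))"
    by (simp add: F_def ftr_def mult.assoc)
  also have "\<dots> = (LINT w|lborel. complex_of_real (fPsi w) * (?g w * cis (- (w \<bullet> y))))"
    by (rule integral_lborel_uminus) measurable
  finally show "complex_of_real (resid n xs a om th y) = ftr (F n xs a om th) y" using r by simp
  have qi: "integrable lborel (\<lambda>w. fPsi w * (cmod (?g w))\<^sup>2)"
    by (rule fPsi_bounded_integrable_sq[OF rsd_measurable rsd_bounded])
  have qm: "integrable lborel (\<lambda>w. c2 * (fPsi (- w) * (cmod (?g (- w)))\<^sup>2))"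
    using integrable_lborel_affine[OF qi, of "-1" 0] by simp
  have le: "(cmod (F n xs a om th w))\<^sup>2 * wt nu w \<le> c2 * (fPsi (- w) * (cmod (?g (- w)))\<^sup>2)" for w
  proof -
    have "fPsi (- w) * wt nu w \<le> c2 * wt (- nu) w * wt nu w"
      using fPsi_upper[of "- w"] by (intro mult_right_mono) auto
    then have f: "fPsi (- w) * wt nu w \<le> c2" by (simp add: mult.assoc wt_add)
    have "(cmod (F n xs a om th w))\<^sup>2 * wt nu w = (fPsi (- w) * wt nu w) * (fPsi (- w) * (cmod (?g (- w)))\<^sup>2)"
      by (simp add: F_def norm_mult power_mult_distrib power2_eq_square)
    also have "\<dots> \<le> c2 * (fPsi (- w) * (cmod (?g (- w)))\<^sup>2)" by (intro mult_right_mono f) simp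
    finally show ?thesis .
  qed
  show i: "integrable lborel (\<lambda>w. (cmod (F n xs a om th w))\<^sup>2 * wt nu w)"
    by (rule Bochner_Integration.integrable_bound[OF qm]) (simp, intro AE_I2, use le in \<open>auto intro: order.trans[OF _ abs_ge_self]\<close>)
  have "(LINT w|lborel. (cmod (F n xs a om th w))\<^sup>2 * wt nu w) \<le> (LINT w|lborel. c2 * (fPsi (- w) * (cmod (?g (- w)))\<^sup>2))"
    by (intro integral_mono i qm le)
  also have "\<dots> = c2 * rsq n xs a om th"
    using integral_lborel_uminus[of "\<lambda>w. fPsi w * (cmod (?g w))\<^sup>2"] by (simp add: rsq_def)
  finally show "(LINT w|lborel. (cmod (F n xs a om th w))\<^sup>2 * wt nu w) \<le> c2 * rsq n xs a om th" .
qed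

lemma resid_cont: "continuous_on UNIV (resid n xs a om th)"
proof -
  have "continuous_on UNIV (\<lambda>y. Re (complex_of_real (resid n xs a om th y)))"
    unfolding resid_density(3) by (intro continuous_intros continuous_ftr resid_density(1))
  then show ?thesis by simp
qed

text \<open>A rewriting of the dual system; it expresses the samples that enter the sampling
  inequality through the weights.\<close>

lemma resid_at_nodes:
  assumes "dual_solution mu n xs (tf om th) a" and "j < n"
  shows "resid n xs a om th (xs j) = mu * a j"
proof -
  have "(\<Sum>k<n. a k * Psi (xs k - xs j)) = (\<Sum>k<n. Psi (xs j - xs k) * a k)"
    using Psi_commute by (intro sum.cong refl) (simp add: mult.commute)
  moreover have "(\<Sum>k<n. Psi (xs j - xs k) * a k) + mu * a j = pot (tf om th) (xs j)"
    using assms unfolding dual_solution_def by blast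
  ultimately show ?thesis unfolding resid_def by linarith
qed

text \<open>In the squared modulus of \<open>rsd\<close> the conjugate factor is split into
  \<open>tfh\<close> and \<open>trig\<close>: the first part is the pairing with the bump, the
  second collects residual values at the design points, which are \<open>mu * a k\<close>.\<close>

lemma resid_energy:
  assumes a: "dual_solution mu n xs (tf om th) a"
  shows "rsq n xs a om th + mu * (\<Sum>k<n. (a k)\<^sup>2) = (LINT x|lborel. resid n xs a om th x * tf om th x)"
proof -
  let ?g = "rsd n xs a om th" and ?f = "resid n xs a om th"
  let ?F = "\<lambda>w. complex_of_real (fPsi (- w)) * rsd n xs a om th (- w)"
  have bt: "cmod (?g w * cnj (tfh om th w)) \<le> ((LINT x|lborel. \<bar>tf om th x\<bar>) + (\<Sum>k<n. \<bar>a k\<bar>)) * (LINT x|lborel. \<bar>tf om th x\<bar>)" for w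
    unfolding norm_mult complex_mod_cnj by (intro mult_mono rsd_bounded tfh_bounded) (auto intro!: add_nonneg_nonneg sum_nonneg)
  have i1: "integrable lborel (\<lambda>w. complex_of_real (fPsi w) * (?g w * cnj (tfh om th w)))"
    by (rule fPsi_bounded_integrable[OF _ bt]) measurable
  have i2k: "integrable lborel (\<lambda>w. complex_of_real (fPsi w) * (?g w * cis (- (w \<bullet> y))))" for y
    by (rule fPsi_bounded_integrable[where B="(LINT x|lborel. \<bar>tf om th x\<bar>) + (\<Sum>k<n. \<bar>a k\<bar>)"]) (auto simp: norm_mult rsd_bounded)
  have i2: "integrable lborel (\<lambda>w. \<Sum>k<n. complex_of_real (a k) * (complex_of_real (fPsi w) * (?g w * cis (- (w \<bullet> xs k)))))"
    using i2k by (intro Bochner_Integration.integrable_sum integrable_mult_right) auto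
  have tr: "complex_of_real (fPsi w) * (?g w * cnj (trig n xs a w)) = (\<Sum>k<n. complex_of_real (a k) * (complex_of_real (fPsi w) * (?g w * cis (- (w \<bullet> xs k)))))" for w
    unfolding trig_def cnj_sum sum_distrib_left by (intro sum.cong) (auto simp: cis_cnj mult_ac)
  have 1: "(LINT w|lborel. complex_of_real (fPsi w) * (?g w * cnj (tfh om th w))) = complex_of_real (LINT x|lborel. ?f x * tf om th x)"
  proof -
    have "complex_of_real (LINT x|lborel. ?f x * tf om th x) = (LINT x|lborel. complex_of_real (tf om th x) * ftr ?F x)"
      unfolding integral_complex_of_real[symmetric] of_real_mult resid_density(3) by (simp add: mult.commute)
    also have "\<dots> = (LINT w|lborel. ?F w * tfh om th w)"
      unfolding tfh_def using tf_integrable by (intro ftr_integral_swap resid_density(1)) auto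
    also have "\<dots> = (LINT w|lborel. (\<lambda>w. complex_of_real (fPsi w) * (?g w * cnj (tfh om th w))) (- w))"
      by (simp add: tfh_uminus mult.assoc)
    also have "\<dots> = (LINT w|lborel. complex_of_real (fPsi w) * (?g w * cnj (tfh om th w)))"
      by (rule integral_lborel_uminus) measurable
    finally show ?thesis ..
  qed
  have 2: "(LINT w|lborel. complex_of_real (fPsi w) * (?g w * cnj (trig n xs a w))) = complex_of_real (mu * (\<Sum>k<n. (a k)\<^sup>2))"
  proof -
    have "(LINT w|lborel. complex_of_real (fPsi w) * (?g w * cnj (trig n xs a w))) = (\<Sum>k<n. complex_of_real (a k) * complex_of_real (?f (xs k)))"
      unfolding tr resid_density(2) using i2k by simp
    also have "\<dots> = (\<Sum>k<n. complex_of_real (a k) * complex_of_real (mu * a k))"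
      by (intro sum.cong refl) (simp add: resid_at_nodes[OF a])
    finally show ?thesis by (simp add: sum_distrib_left power2_eq_square mult_ac)
  qed
  have "complex_of_real (rsq n xs a om th) = (LINT w|lborel. complex_of_real (fPsi w) * (?g w * cnj (tfh om th w)) - complex_of_real (fPsi w) * (?g w * cnj (trig n xs a w)))"
    unfolding rsq_def integral_complex_of_real[symmetric]
  proof (intro Bochner_Integration.integral_cong refl)
    fix w
    have "complex_of_real (fPsi w * (cmod (?g w))\<^sup>2) = complex_of_real (fPsi w) * (?g w * cnj (?g w))"
      by (simp only: of_real_mult complex_norm_square)
    then show "complex_of_real (fPsi w * (cmod (?g w))\<^sup>2) = complex_of_real (fPsi w) * (?g w * cnj (tfh om th w)) - complex_of_real (fPsi w) * (?g w * cnj (trig n xs a w))"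
      by (simp add: rsd_def right_diff_distrib)
  qed
  also have "\<dots> = (LINT w|lborel. complex_of_real (fPsi w) * (?g w * cnj (tfh om th w))) - (LINT w|lborel. complex_of_real (fPsi w) * (?g w * cnj (trig n xs a w)))"
    using i1 i2 unfolding tr by (rule Bochner_Integration.integral_diff)
  also have "\<dots> = complex_of_real ((LINT x|lborel. ?f x * tf om th x) - mu * (\<Sum>k<n. (a k)\<^sup>2))"
    unfolding 1 2 by simp
  finally have "rsq n xs a om th = (LINT x|lborel. ?f x * tf om th x) - mu * (\<Sum>k<n. (a k)\<^sup>2)"
    by (simp only: of_real_eq_iff)
  then show ?thesis by simp
qed

lemma rsq_nonneg: "0 \<le> rsq n xs a om th"
  unfolding rsq_def by simp

text \<open>The cosine has modulus at most 1 and may be cut off to the ball, so Cauchy-Schwarz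
  leaves only \<open>beta\<close> times the residual, with a bound uniform in the
  modulation.\<close>

lemma resid_pairing_bound:
  "(LINT x|lborel. resid n xs a om th x * tf om th x)\<^sup>2 \<le> measure lborel (ball z0 rho) * (LINT x|lborel. (beta x * resid n xs a om th x)\<^sup>2)"
  and resid_window_integrable: "integrable lborel (\<lambda>x. (beta x * resid n xs a om th x)\<^sup>2)"
proof -
  let ?f = "resid n xs a om th"
  have [measurable]: "?f \<in> borel_measurable borel" by (rule borel_measurable_continuous_onI[OF resid_cont])
  have [measurable]: "ball z0 rho \<in> sets borel" by simp
  show i: "integrable lborel (\<lambda>x. (beta x * ?f x)\<^sup>2)"
  proof (rule compact_support_integrable[of _ rho z0])
    show "continuous_on UNIV (\<lambda>x. (beta x * ?f x)\<^sup>2)" by (intro continuous_intros beta_cont resid_cont)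
  qed (simp add: beta_supp)
  let ?u = "\<lambda>x. complex_of_real (beta x * ?f x)" and ?v = "\<lambda>x. complex_of_real (cos (om \<bullet> x + th) * indicator (ball z0 rho) x)"
  have v: "(cmod (?v x))\<^sup>2 \<le> indicator (ball z0 rho) x" for x
    using abs_cos_le_one[of "om \<bullet> x + th"] by (auto simp: indicator_def power_le_one abs_square_le_1)
  have ii: "integrable lborel (indicator (ball z0 rho) :: 'a \<Rightarrow> real)"
    using emeasure_lborel_ball_finite[of z0 rho] by (intro integrable_real_indicator) auto
  have vi: "integrable lborel (\<lambda>x. (cmod (?v x))\<^sup>2)"
    by (rule Bochner_Integration.integrable_bound[OF ii]) (measurable, intro AE_I2, use v in \<open>auto intro: order.trans[OF _ abs_ge_self]\<close>)
  have ui: "integrable lborel (\<lambda>x. (cmod (?u x))\<^sup>2)" using i by (simp add: norm_mult power_mult_distrib)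
  have "?u x * ?v x = complex_of_real (?f x * tf om th x)" for x
    using beta_supp[of x] by (auto simp: tf_def indicator_def dist_norm norm_minus_commute)
  then have "(LINT x|lborel. ?f x * tf om th x)\<^sup>2 = (cmod (LINT x|lborel. ?u x * ?v x))\<^sup>2"
    by (simp only: integral_complex_of_real norm_of_real power2_abs)
  also have "\<dots> \<le> (LINT x|lborel. (cmod (?u x))\<^sup>2) * (LINT x|lborel. (cmod (?v x))\<^sup>2)"
    by (rule integral_cauchy_schwarz(2)[OF _ _ ui vi]) measurable
  also have "\<dots> \<le> (LINT x|lborel. (cmod (?u x))\<^sup>2) * measure lborel (ball z0 rho)"
  proof (intro mult_left_mono)
    have "(LINT x|lborel. (cmod (?v x))\<^sup>2) \<le> (LINT x|lborel. indicator (ball z0 rho) x)"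
      by (intro integral_mono vi ii v)
    then show "(LINT x|lborel. (cmod (?v x))\<^sup>2) \<le> measure lborel (ball z0 rho)" by simp
  qed simp
  finally show "(LINT x|lborel. ?f x * tf om th x)\<^sup>2 \<le> measure lborel (ball z0 rho) * (LINT x|lborel. (beta x * ?f x)\<^sup>2)"
    by (simp add: norm_mult power_mult_distrib mult.commute)
qed

text \<open>By inversion, \<open>(2 * pi) ^ DIM('a)\<close> times the gap is the integral of
  \<open>tfh\<close> against the conjugate of \<open>rsd\<close>. Inserting
  \<open>sqrt (fPsi w)\<close> and its inverse, Cauchy-Schwarz gives the native energy of the bump
  times \<open>rsq\<close>.\<close>

lemma resid_gap:
  "((LINT x|lborel. (tf om th x)\<^sup>2) - (\<Sum>k<n. a k * tf om th (xs k)))\<^sup>2 \<le> K1 * wt nu om / c1 * rsq n xs a om th"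
proof -
  let ?g = "rsd n xs a om th" and ?G = "(LINT x|lborel. (tf om th x)\<^sup>2) - (\<Sum>k<n. a k * tf om th (xs k))"
  let ?d = "(2 * pi) ^ DIM('a)"
  have d1: "1 \<le> ?d" using pi_gt3 by (intro one_le_power) simp
  have ti: "integrable lborel (\<lambda>w. tfh om th w * cnj (tfh om th w))"
  proof -
    have "integrable lborel (\<lambda>w. complex_of_real ((cmod (tfh om th w))\<^sup>2))"
    proof (intro integrable_of_real Bochner_Integration.integrable_bound[OF tfh_sobolev(1)[of om th]] AE_I2)
      fix w
      have "(cmod (tfh om th w))\<^sup>2 * 1 \<le> (cmod (tfh om th w))\<^sup>2 * wt nu w"
        using wt_mono[of 0 nu w] nu_pos by (intro mult_left_mono) auto
      then show "norm ((cmod (tfh om th w))\<^sup>2) \<le> norm ((cmod (tfh om th w))\<^sup>2 * wt nu w)" by simp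
    qed measurable
    then show ?thesis by (simp only: complex_norm_square)
  qed
  have ki: "integrable lborel (\<lambda>w. tfh om th w * cis (- (w \<bullet> y)))" for y
    by (rule integrable_mult_cis[OF tfh_integrable]) simp
  have si: "integrable lborel (\<lambda>w. \<Sum>k<n. complex_of_real (a k) * (tfh om th w * cis (- (w \<bullet> xs k))))"
    using ki by (intro Bochner_Integration.integrable_sum integrable_mult_right) auto
  have tr: "tfh om th w * cnj (trig n xs a w) = (\<Sum>k<n. complex_of_real (a k) * (tfh om th w * cis (- (w \<bullet> xs k))))" for w
    unfolding trig_def cnj_sum sum_distrib_left by (intro sum.cong) (auto simp: cis_cnj mult_ac)
  have 1: "(LINT w|lborel. tfh om th w * cnj (tfh om th w)) = ?d * complex_of_real (LINT x|lborel. (tf om th x)\<^sup>2)"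
  proof -
    have fi: "integrable lborel (\<lambda>w. tfh om th (- w))"
      using integrable_lborel_affine[OF tfh_integrable[of om th], of "-1" 0] by simp
    have "ftr (\<lambda>w. tfh om th (- w)) x = ?d * complex_of_real (tf om th x)" for x
    proof -
      have "ftr (\<lambda>w. tfh om th (- w)) x = (LINT w|lborel. (\<lambda>w. tfh om th w * cis (- (w \<bullet> x))) (- w))" by (simp add: ftr_def)
      also have "\<dots> = (LINT w|lborel. tfh om th w * cis (- (w \<bullet> x)))" by (rule integral_lborel_uminus) measurable
      finally show ?thesis by (simp add: tf_inversion)
    qed
    then have "?d * complex_of_real (LINT x|lborel. (tf om th x)\<^sup>2) = (LINT x|lborel. complex_of_real (tf om th x) * ftr (\<lambda>w. tfh om th (- w)) x)"
      unfolding integral_complex_of_real[symmetric] by (subst integral_mult_right_zero[symmetric]) (simp add: power2_eq_square mult_ac)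
    also have "\<dots> = (LINT w|lborel. tfh om th (- w) * tfh om th w)"
      unfolding tfh_def[of om th] using fi[unfolded tfh_def] tf_integrable by (intro ftr_integral_swap) auto
    finally show ?thesis by (simp add: tfh_uminus mult.commute)
  qed
  have 2: "(LINT w|lborel. tfh om th w * cnj (trig n xs a w)) = ?d * complex_of_real (\<Sum>k<n. a k * tf om th (xs k))"
  proof -
    have "(LINT w|lborel. tfh om th w * cnj (trig n xs a w)) = (\<Sum>k<n. complex_of_real (a k) * (LINT w|lborel. tfh om th w * cis (- (w \<bullet> xs k))))"
      unfolding tr using ki by simp
    then show ?thesis unfolding tf_inversion by (simp add: sum_distrib_left mult_ac)
  qed
  have "?d * complex_of_real ?G = (LINT w|lborel. tfh om th w * cnj (tfh om th w)) - (LINT w|lborel. tfh om th w * cnj (trig n xs a w))"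
    unfolding 1 2 by (simp add: right_diff_distrib)
  also have "\<dots> = (LINT w|lborel. tfh om th w * cnj (tfh om th w) - tfh om th w * cnj (trig n xs a w))"
    using ti si unfolding tr by (rule Bochner_Integration.integral_diff[symmetric])
  also have "\<dots> = (LINT w|lborel. (tfh om th w / sqrt (fPsi w)) * (sqrt (fPsi w) * cnj (?g w)))"
  proof (intro Bochner_Integration.integral_cong refl)
    fix w
    have "complex_of_real (sqrt (fPsi w)) \<noteq> 0" using fPsi_pos[of w] by simp
    then show "tfh om th w * cnj (tfh om th w) - tfh om th w * cnj (trig n xs a w) = (tfh om th w / sqrt (fPsi w)) * (sqrt (fPsi w) * cnj (?g w))"
      by (simp add: rsd_def right_diff_distrib)
  qed
  finally have G: "?d * complex_of_real ?G = (LINT w|lborel. (tfh om th w / sqrt (fPsi w)) * (sqrt (fPsi w) * cnj (?g w)))" .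
  have u: "(cmod (tfh om th w / sqrt (fPsi w)))\<^sup>2 \<le> (cmod (tfh om th w))\<^sup>2 * wt nu w / c1" for w
  proof -
    have "(cmod (tfh om th w / sqrt (fPsi w)))\<^sup>2 = (cmod (tfh om th w))\<^sup>2 / fPsi w"
      using fPsi_pos[of w] by (simp add: norm_divide power_divide)
    also have "\<dots> \<le> (cmod (tfh om th w))\<^sup>2 / (c1 * wt (- nu) w)"
      using fPsi_lower[of w] fPsi_pos[of w] c_pos wt_pos[of "- nu" w] by (intro divide_left_mono) auto
    finally show ?thesis by (simp add: wt_minus)
  qed
  have ub: "integrable lborel (\<lambda>w. (cmod (tfh om th w))\<^sup>2 * wt nu w / c1)" using tfh_sobolev(1)[of om th] by simp
  have ui: "integrable lborel (\<lambda>w. (cmod (tfh om th w / sqrt (fPsi w)))\<^sup>2)"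
    by (rule Bochner_Integration.integrable_bound[OF ub]) (measurable, intro AE_I2, use u c_pos in \<open>auto simp: abs_of_pos\<close>)
  have v: "(cmod (sqrt (fPsi w) * cnj (?g w)))\<^sup>2 = fPsi w * (cmod (?g w))\<^sup>2" for w
    by (simp add: norm_mult power_mult_distrib)
  have vi: "integrable lborel (\<lambda>w. (cmod (sqrt (fPsi w) * cnj (?g w)))\<^sup>2)"
    unfolding v by (rule fPsi_bounded_integrable_sq[OF rsd_measurable rsd_bounded])
  have "?G\<^sup>2 \<le> (?d * ?G)\<^sup>2"
    using mult_right_mono[OF one_le_power[OF d1, of 2] zero_le_power2[of ?G]] by (simp only: power_mult_distrib[of ?d ?G] mult_1)
  also have "\<dots> = (cmod (?d * complex_of_real ?G))\<^sup>2" by (simp add: norm_mult norm_power power_mult_distrib flip: of_real_diff)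
  also have "\<dots> \<le> (LINT w|lborel. (cmod (tfh om th w / sqrt (fPsi w)))\<^sup>2) * rsq n xs a om th"
    unfolding G rsq_def v[symmetric] by (rule integral_cauchy_schwarz(2)[OF _ _ ui vi]) measurable
  also have "\<dots> \<le> (K1 * wt nu om / c1) * rsq n xs a om th"
  proof (intro mult_right_mono rsq_nonneg)
    have "(LINT w|lborel. (cmod (tfh om th w / sqrt (fPsi w)))\<^sup>2) \<le> (LINT w|lborel. (cmod (tfh om th w))\<^sup>2 * wt nu w / c1)"
      by (intro integral_mono ui ub u)
    also have "\<dots> \<le> K1 * wt nu om / c1" using tfh_sobolev(2)[of om th] c_pos by (simp add: divide_right_mono)
    finally show "(LINT w|lborel. (cmod (tfh om th w / sqrt (fPsi w)))\<^sup>2) \<le> K1 * wt nu om / c1" .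
  qed
  finally show ?thesis .
qed

text \<open>Let P = rsq + mu |a|^2. Sampling applied to \<open>beta\<close> times the residual
  bounds its energy by E P: \<open>E1\<close> takes care of the samples, \<open>E2\<close> of the
  oscillation. By \<open>resid_energy\<close>, P is also the pairing of the residual with the bump,
  so P^2 \<le> V E P and hence P \<le> V E. Then \<open>E3\<close> makes the gap in
  \<open>resid_gap\<close> at most \<open>b2 / 4\<close>; the weights recover at least
  \<open>b2 / 4\<close> of the energy, and Cauchy-Schwarz bounds their norm from below.\<close>

lemma dual_norm_lower:
  assumes mu: "mu > 0" and a: "dual_solution mu n xs (tf om th) a"
    and th: "(LINT x|lborel. (tf om th x)\<^sup>2) \<ge> b2 / 2"
    and h: "h > 0" and d: "\<delta> > 0" and m: "m > 0"
    and dense: "\<And>z. norm (z - z0) < rho \<Longrightarrow> m \<le> real (card {k. k < n \<and> norm (xs k - z) \<le> \<delta> * h})"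
    and small: "kap \<delta> * CS \<le> 1 / 2"
    and E1: "4 * (unit_ball_vol (real DIM('a)) * (\<delta> * h) ^ DIM('a)) / m * bm\<^sup>2 * mu \<le> E"
    and E2: "2 * kap \<delta> * CS * h powr (2 * nu) * KH \<le> E"
    and E3: "K1 * wt nu om / c1 * (measure lborel (ball z0 rho) * E) \<le> (b2 / 4)\<^sup>2"
  shows "b2\<^sup>2 / 16 \<le> real n * bm\<^sup>2 * (\<Sum>k<n. (a k)\<^sup>2)"
proof -
  let ?f = "resid n xs a om th"
  let ?F = "\<lambda>w. complex_of_real (fPsi (- w)) * rsd n xs a om th (- w)"
  define A2 Q P V where "A2 = (\<Sum>k<n. (a k)\<^sup>2)" and "Q = rsq n xs a om th" and "P = Q + mu * A2"
    and "V = measure lborel (ball z0 rho)"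
  have A2: "A2 \<ge> 0" by (simp add: A2_def sum_nonneg)
  have Q: "Q \<ge> 0" by (simp add: Q_def rsq_nonneg)
  have P: "P \<ge> 0" using A2 Q mu by (simp add: P_def)
  have V: "V \<ge> 0" by (simp add: V_def)
  note W = conv_props[OF bden_integrable resid_density(1) bden_cont bden_le, of n xs a om th]
  note Ww = conv_weighted[OF bden_integrable resid_density(1) less_imp_le[OF nu_pos] bden_cont bden_le bden_weighted resid_density(4), of n xs a om th]
  have w: "ftr (conv bden ?F) y = complex_of_real (beta y * ?f y)" for y
    unfolding W(2) bden_ftr by (simp only: resid_density(3)[symmetric] of_real_mult)
  have wsq: "(cmod (ftr (conv bden ?F) y))\<^sup>2 = (beta y * ?f y)\<^sup>2" for y
    unfolding w by (simp only: norm_of_real power2_abs)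
  have H: "(LINT t|lborel. (cmod (conv bden ?F t))\<^sup>2 * wt nu t) \<le> KH * Q"
  proof -
    have "0 \<le> (LINT s|lborel. cmod (bden s)) * (2 powr nu * (LINT s|lborel. cmod (bden s) * wt nu s))"
      by (intro mult_nonneg_nonneg) auto
    from order.trans[OF Ww(2) mult_left_mono[OF resid_density(5) this]]
    show ?thesis by (simp add: KH_def Q_def mult.assoc)
  qed
  have "(LINT x|lborel. (cmod (ftr (conv bden ?F) x))\<^sup>2) \<le>
     4 * (unit_ball_vol (real DIM('a)) * (\<delta> * h) ^ DIM('a)) / m * (\<Sum>k<n. (cmod (ftr (conv bden ?F) (xs k)))\<^sup>2)
     + 2 * kap \<delta> * CS * h powr (2 * nu) * (LINT s|lborel. (cmod (conv bden ?F s))\<^sup>2 * wt nu s)"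
  proof (rule sampling_inequality[OF W(1) W(3) W(4) Ww(1) _ _ h d m _ small])
    show "integrable lborel (\<lambda>x. (cmod (ftr (conv bden ?F) x))\<^sup>2)" unfolding wsq by (rule resid_window_integrable)
    show "\<And>x. x \<notin> ball z0 rho \<Longrightarrow> ftr (conv bden ?F) x = 0"
      unfolding w by (auto simp: beta_supp dist_norm norm_minus_commute)
    show "\<And>z. z \<in> ball z0 rho \<Longrightarrow> m \<le> real (card {k. k < n \<and> norm (xs k - z) \<le> \<delta> * h})"
      by (rule dense) (simp add: dist_norm norm_minus_commute)
  qed
  also have "\<dots> \<le> E * mu * A2 + E * Q"
  proof (rule add_mono)
    \<comment> \<open>The samples carry \<open>mu\<close> squared: one factor joins the coefficient
      in \<open>E1\<close>, the other completes \<open>mu * A2\<close>, which is part of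
      \<open>P\<close>.\<close>
    have "(\<Sum>k<n. (cmod (ftr (conv bden ?F) (xs k)))\<^sup>2) \<le> (\<Sum>k<n. bm\<^sup>2 * (mu\<^sup>2 * (a k)\<^sup>2))"
    proof (rule sum_mono)
      fix k assume "k \<in> {..<n}"
      then have "(cmod (ftr (conv bden ?F) (xs k)))\<^sup>2 = (beta (xs k))\<^sup>2 * (mu\<^sup>2 * (a k)\<^sup>2)"
        unfolding wsq using resid_at_nodes[OF a, of k] by (simp add: power_mult_distrib)
      also have "\<dots> \<le> bm\<^sup>2 * (mu\<^sup>2 * (a k)\<^sup>2)"
        by (intro mult_right_mono power_mono bm beta_nonneg) auto
      finally show "(cmod (ftr (conv bden ?F) (xs k)))\<^sup>2 \<le> bm\<^sup>2 * (mu\<^sup>2 * (a k)\<^sup>2)" .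
    qed
    also have "\<dots> = bm\<^sup>2 * mu * (mu * A2)" by (simp add: A2_def sum_distrib_left power2_eq_square mult_ac)
    finally have s: "(\<Sum>k<n. (cmod (ftr (conv bden ?F) (xs k)))\<^sup>2) \<le> bm\<^sup>2 * mu * (mu * A2)" .
    have "4 * (unit_ball_vol (real DIM('a)) * (\<delta> * h) ^ DIM('a)) / m * (\<Sum>k<n. (cmod (ftr (conv bden ?F) (xs k)))\<^sup>2)
      \<le> 4 * (unit_ball_vol (real DIM('a)) * (\<delta> * h) ^ DIM('a)) / m * (bm\<^sup>2 * mu * (mu * A2))"
      using m d h by (intro mult_left_mono s) auto
    also have "\<dots> = (4 * (unit_ball_vol (real DIM('a)) * (\<delta> * h) ^ DIM('a)) / m * bm\<^sup>2 * mu) * (mu * A2)" by simp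
    also have "\<dots> \<le> E * (mu * A2)" using A2 mu by (intro mult_right_mono E1) auto
    finally show "4 * (unit_ball_vol (real DIM('a)) * (\<delta> * h) ^ DIM('a)) / m * (\<Sum>k<n. (cmod (ftr (conv bden ?F) (xs k)))\<^sup>2) \<le> E * mu * A2"
      by (simp add: mult.assoc)
    have "2 * kap \<delta> * CS * h powr (2 * nu) * (LINT s|lborel. (cmod (conv bden ?F s))\<^sup>2 * wt nu s) \<le> 2 * kap \<delta> * CS * h powr (2 * nu) * (KH * Q)"
      using kap_nonneg CS_nonneg by (intro mult_left_mono H) auto
    also have "\<dots> = (2 * kap \<delta> * CS * h powr (2 * nu) * KH) * Q" by simp
    also have "\<dots> \<le> E * Q" by (intro mult_right_mono E2 Q)
    finally show "2 * kap \<delta> * CS * h powr (2 * nu) * (LINT s|lborel. (cmod (conv bden ?F s))\<^sup>2 * wt nu s) \<le> E * Q" .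
  qed
  also have "\<dots> = E * P" by (simp add: P_def distrib_left)
  finally have I: "(LINT x|lborel. (beta x * ?f x)\<^sup>2) \<le> E * P" unfolding wsq .
  have "P\<^sup>2 \<le> V * (LINT x|lborel. (beta x * ?f x)\<^sup>2)"
    using resid_pairing_bound[of n xs a om th] resid_energy[OF a] by (simp add: P_def Q_def A2_def V_def)
  also have "\<dots> \<le> V * (E * P)" by (intro mult_left_mono I V)
  finally have "P * P \<le> (V * E) * P" by (simp add: power2_eq_square mult_ac)
  moreover have "E \<ge> 0"
    by (rule order.trans[OF _ E2]) (use kap_nonneg CS_nonneg KH_nonneg in simp)
  \<comment> \<open>Division by \<open>P\<close>; for \<open>P = 0\<close> the claim reduces to
    \<open>E \<ge> 0\<close>.\<close>
  ultimately have PE: "P \<le> V * E" using P V by (cases "P = 0") (auto simp: mult_le_cancel_right)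
  have "((LINT x|lborel. (tf om th x)\<^sup>2) - (\<Sum>k<n. a k * tf om th (xs k)))\<^sup>2 \<le> K1 * wt nu om / c1 * Q"
    unfolding Q_def by (rule resid_gap)
  also have "\<dots> \<le> K1 * wt nu om / c1 * (V * E)"
    using PE A2 mu K1_pos c_pos by (intro mult_left_mono) (auto simp: P_def intro: order.trans[rotated])
  also have "\<dots> \<le> (b2 / 4)\<^sup>2" unfolding V_def by (rule E3)
  finally have "(LINT x|lborel. (tf om th x)\<^sup>2) - (\<Sum>k<n. a k * tf om th (xs k)) \<le> b2 / 4"
    by (rule power2_le_imp_le) (use b2_pos in simp)
  with th have lo: "b2 / 4 \<le> (\<Sum>k<n. a k * tf om th (xs k))" by linarith
  have tf2: "(tf om th x)\<^sup>2 \<le> bm\<^sup>2" for x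
    using power_mono[of "\<bar>tf om th x\<bar>" bm 2] tf_abs_le[of om th x] bm(2)[of x] by simp
  have "(b2 / 4)\<^sup>2 \<le> (\<Sum>k<n. a k * tf om th (xs k))\<^sup>2" using lo b2_pos by (intro power_mono) auto
  also have "\<dots> \<le> A2 * (\<Sum>k<n. (tf om th (xs k))\<^sup>2)" unfolding A2_def by (rule Cauchy_Schwarz_ineq_sum)
  also have "\<dots> \<le> A2 * (real n * bm\<^sup>2)"
    using sum_bounded_above[of "{..<n}" "\<lambda>j. (tf om th (xs j))\<^sup>2" "bm\<^sup>2"] tf2
    by (intro mult_left_mono A2) auto
  finally show ?thesis by (simp add: A2_def power_divide mult_ac)
qed

end

section \<open>Variance lower bound\<close>

lemma prob_space_noise: "sig > 0 \<Longrightarrow> prob_space (noise_space sig n)"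
  unfolding noise_space_def by (intro prob_space_PiM prob_space_normal_density)

lemma noise_component_measurable: "k < n \<Longrightarrow> (\<lambda>e. e k) \<in> borel_measurable (noise_space sig n)"
  unfolding noise_space_def by (rule measurable_compose[OF measurable_component_singleton]) auto

lemma normal_power_moment:
  assumes sig: "sig > 0" and p: "p \<le> 2"
  shows "integrable (density lborel (normal_density 0 sig)) (\<lambda>x. x ^ p)"
    and "(LINT x|density lborel (normal_density 0 sig). x ^ p) = (if p = 0 then 1 else if p = 1 then 0 else sig\<^sup>2)"
proof -
  have "has_bochner_integral lborel (\<lambda>x. normal_density 0 sig x *\<^sub>R x ^ p) (if p = 0 then 1 else if p = 1 then 0 else sig\<^sup>2)"
  proof -
    consider "p = 0" | "p = 1" | "p = 2" using p by linarith
    then show ?thesis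
    proof cases
      case 1
      then show ?thesis using normal_moment_even[OF sig, of 0 0] by simp
    next
      case 2
      then show ?thesis using normal_moment_odd[OF sig, of 0 0] by simp
    next
      case 3
      then show ?thesis using normal_moment_even[OF sig, of 0 1] sig by (simp add: fact_2)
    qed
  qed
  then have "has_bochner_integral (density lborel (normal_density 0 sig)) (\<lambda>x. x ^ p) (if p = 0 then 1 else if p = 1 then 0 else sig\<^sup>2)"
    by (intro has_bochner_integral_density) auto
  then show "integrable (density lborel (normal_density 0 sig)) (\<lambda>x. x ^ p)"
    and "(LINT x|density lborel (normal_density 0 sig). x ^ p) = (if p = 0 then 1 else if p = 1 then 0 else sig\<^sup>2)"
    by (auto simp: has_bochner_integral_iff)
qed

lemma noise_second_moment:
  assumes sig: "sig > 0"
  shows "(\<integral>\<^sup>+e. ennreal ((\<Sum>j<n. e j * a j)\<^sup>2) \<partial>noise_space sig n) = ennreal (sig\<^sup>2 * (\<Sum>j<n. (a j)\<^sup>2))"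
proof -
  let ?N = "density lborel (normal_density 0 sig)"
  interpret N: prob_space ?N by (rule prob_space_normal_density[OF sig])
  interpret product_sigma_finite "\<lambda>_::nat. ?N" ..
  let ?M = "noise_space sig n"
  have cov: "integrable ?M (\<lambda>e. e j * e k)" "(LINT e|?M. e j * e k) = (if j = k then sig\<^sup>2 else 0)" if j: "j < n" and k: "k < n" for j k
  proof -
    \<comment> \<open>These exponents write \<open>e j * e k\<close> as a product over all
      coordinates, with exponent 2 when \<open>j = k\<close>, so that the product measure factorises
      the integral.\<close>
    let ?p = "\<lambda>i. (if i = j then 1 else 0) + (if i = k then 1 else 0) :: nat"
    have e: "e j * e k = (\<Prod>i<n. e i ^ ?p i)" for e :: "nat \<Rightarrow> real"
    proof -
      have "(\<Prod>i<n. e i ^ ?p i) = (\<Prod>i<n. (if i = j then e i else 1) * (if i = k then e i else 1))"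
        by (intro prod.cong) auto
      also have "\<dots> = e j * e k" using j k by (simp add: prod.distrib)
      finally show ?thesis ..
    qed
    have i: "integrable ?N (\<lambda>x. x ^ ?p i)" for i by (rule normal_power_moment(1)[OF sig]) simp
    show "integrable ?M (\<lambda>e. e j * e k)"
      unfolding e noise_space_def by (rule product_integrable_prod) (use i in auto)
    have "(LINT e|?M. e j * e k) = (\<Prod>i<n. LINT x|?N. x ^ ?p i)"
      unfolding e noise_space_def by (rule product_integral_prod) (use i in auto)
    also have "\<dots> = (\<Prod>i<n. if ?p i = 0 then 1 else if ?p i = 1 then 0 else sig\<^sup>2)"
      by (intro prod.cong refl normal_power_moment(2)[OF sig]) simp
    also have "\<dots> = (if j = k then sig\<^sup>2 else 0)"
    proof (cases "j = k")
      case True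
      have "(\<Prod>i<n. if ?p i = 0 then 1 else if ?p i = 1 then 0 else sig\<^sup>2) = (\<Prod>i<n. if i = j then sig\<^sup>2 else 1)"
        using True by (intro prod.cong) auto
      then show ?thesis using True j by simp
    next
      case False
      then show ?thesis using j by (auto intro!: prod_zero bexI[of _ j])
    qed
    finally show "(LINT e|?M. e j * e k) = (if j = k then sig\<^sup>2 else 0)" .
  qed
  have ex: "(\<Sum>j<n. e j * a j)\<^sup>2 = (\<Sum>j<n. \<Sum>k<n. a j * a k * (e j * e k))" for e :: "nat \<Rightarrow> real"
    unfolding power2_eq_square sum_product by (intro sum.cong) (auto simp: mult_ac)
  have i: "integrable ?M (\<lambda>e. (\<Sum>j<n. e j * a j)\<^sup>2)"
    unfolding ex by (intro Bochner_Integration.integrable_sum integrable_mult_right cov) auto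
  have "(LINT e|?M. (\<Sum>j<n. e j * a j)\<^sup>2) = (\<Sum>j<n. \<Sum>k<n. a j * a k * (if j = k then sig\<^sup>2 else 0))"
    unfolding ex by (subst Bochner_Integration.integral_sum) (auto intro!: Bochner_Integration.integrable_sum integrable_mult_right cov sum.cong simp: Bochner_Integration.integral_sum cov)
  also have "\<dots> = (\<Sum>j<n. (a j)\<^sup>2 * sig\<^sup>2)" by (intro sum.cong) (auto simp: power2_eq_square if_distrib cong: if_cong)
  also have "\<dots> = sig\<^sup>2 * (\<Sum>j<n. (a j)\<^sup>2)" by (simp add: sum_distrib_left mult.commute)
  finally show ?thesis using nn_integral_eq_integral[OF i] by simp
qed

text \<open>Expands the coefficients over the responses to unit data vectors. The dependence on the
  noise becomes a finite sum, from which joint measurability in noise and frequency can be read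
  off.\<close>

lemma krr_coef_linear:
  assumes "ridge_system (\<lambda>j k. Psi (xs j - xs k)) n mu" and "k < n"
  shows "krr_coef Psi mu n xs Y k = (\<Sum>j<n. Y j * krr_coef Psi mu n xs (\<lambda>i. if i = j then 1 else 0) k)"
proof (rule krr_coef_unique[OF assms(1) _ assms(2)])
  fix i assume i: "i < n"
  let ?m = "\<lambda>j. krr_coef Psi mu n xs (\<lambda>i. if i = j then 1 else 0)"
  have "(\<Sum>k<n. Psi (xs i - xs k) * (\<Sum>j<n. Y j * ?m j k)) + mu * (\<Sum>j<n. Y j * ?m j i)
     = (\<Sum>j<n. Y j * ((\<Sum>k<n. Psi (xs i - xs k) * ?m j k) + mu * ?m j i))"
  proof -
    have "(\<Sum>k<n. Psi (xs i - xs k) * (\<Sum>j<n. Y j * ?m j k)) = (\<Sum>j<n. \<Sum>k<n. Y j * (Psi (xs i - xs k) * ?m j k))"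
      unfolding sum_distrib_left by (subst sum.swap) (simp add: mult_ac)
    moreover have "mu * (\<Sum>j<n. Y j * ?m j i) = (\<Sum>j<n. Y j * (mu * ?m j i))"
      unfolding sum_distrib_left by (simp add: mult_ac)
    ultimately show ?thesis by (simp only: distrib_left sum.distrib sum_distrib_left)
  qed
  also have "\<dots> = (\<Sum>j<n. Y j * (if i = j then 1 else 0))"
    by (intro sum.cong refl arg_cong2[where f="(*)"] krr_coef_eq[OF assms(1) i])
  also have "\<dots> = (\<Sum>j<n. if i = j then Y j else 0)" by (intro sum.cong) auto
  also have "\<dots> = Y i" using i by simp
  finally show "(\<Sum>k<n. Psi (xs i - xs k) * (\<Sum>j<n. Y j * ?m j k)) + mu * (\<Sum>j<n. Y j * ?m j i) = Y i" .
qed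

context kernel_bump
begin

text \<open>With \<open>f = 0\<close> the error is the smoothed noise; Bessel's inequality bounds its energy below by
  its pairings with the modulated bumps of frequency up to \<open>1 / h\<close>, whose variances are the
  squared norms of the dual weights.\<close>

lemma variance_lower_bound:
  assumes mu: "mu > 0" and sig: "sig > 0" and h: "h > 0"
    and Om: "Om \<in> sets borel" "\<And>x. norm (x - z0) < rho \<Longrightarrow> x \<in> Om"
    and c0: "c0 \<ge> 0" "\<And>om th a. norm om < 1 / h \<Longrightarrow> (LINT x|lborel. (tf om th x)\<^sup>2) \<ge> b2 / 2 \<Longrightarrow>
        dual_solution mu n xs (tf om th) a \<Longrightarrow> c0 \<le> (\<Sum>k<n. (a k)\<^sup>2)"
  shows "ennreal (sig\<^sup>2 * c0 * measure lborel (ball (0::'a) (1 / h)) / ((2 * pi) ^ DIM('a) * bm\<^sup>2)) \<le>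
    (SUP f \<in> native_unit_ball Psi Om. \<integral>\<^sup>+ e. l2_dist_sq Om f (krr Psi mu n xs (\<lambda>k. f (xs k) + e k)) \<partial>noise_space sig n)"
proof -
  let ?M = "noise_space sig n"
  interpret M: prob_space ?M by (rule prob_space_noise[OF sig])
  interpret P: pair_sigma_finite ?M "lborel :: 'a measure" ..
  let ?c = "(2 * pi) ^ DIM('a) * bm\<^sup>2"
  have cpos: "?c > 0" using bm by simp
  define u where "u e = krr Psi mu n xs e" for e
  have um [measurable]: "u e \<in> borel_measurable borel" for e
    unfolding u_def by (rule borel_measurable_continuous_onI[OF krr_continuous])
  \<comment> \<open>The smoothed noise cut off by \<open>beta\<close> is continuous with compact
    support, so \<open>bessel\<close> applies, and its energy is at most \<open>bm\<close> squared
    times the squared distance on \<open>Om\<close>.\<close>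
  define w where "w e x = complex_of_real (beta x * u e x)" for e x
  have wc: "continuous_on UNIV (w e)" for e
    unfolding w_def[abs_def] u_def by (intro continuous_intros beta_cont krr_continuous)
  have wi: "integrable lborel (w e)" for e
    by (rule compact_support_integrable[OF wc, of rho z0]) (simp add: w_def beta_supp)
  have w2: "integrable lborel (\<lambda>x. (cmod (w e x))\<^sup>2)" for e
  proof (rule compact_support_integrable[of _ rho z0])
    show "continuous_on UNIV (\<lambda>x. (cmod (w e x))\<^sup>2)" by (intro continuous_intros wc)
  qed (simp add: w_def beta_supp)
  have dist: "(\<integral>\<^sup>+om. ennreal ((cmod (ftr (w e) om))\<^sup>2) \<partial>lborel) \<le> ennreal ?c * l2_dist_sq Om (\<lambda>x. 0) (u e)" for e
  proof -
    have "(\<integral>\<^sup>+om. ennreal ((cmod (ftr (w e) om))\<^sup>2) \<partial>lborel) \<le> ennreal ((2 * pi) ^ DIM('a) * (LINT x|lborel. (cmod (w e x))\<^sup>2))"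
      by (rule bessel[OF wi w2])
    also have "\<dots> = ennreal ((2 * pi) ^ DIM('a)) * (\<integral>\<^sup>+x. ennreal ((cmod (w e x))\<^sup>2) \<partial>lborel)"
      using nn_integral_eq_integral[OF w2[of e]] by (simp add: ennreal_mult)
    also have "\<dots> \<le> ennreal ((2 * pi) ^ DIM('a)) * (\<integral>\<^sup>+x. ennreal (bm\<^sup>2) * (ennreal ((0 - u e x)\<^sup>2) * indicator Om x) \<partial>lborel)"
    proof (intro mult_left_mono nn_integral_mono)
      fix x
      have "(cmod (w e x))\<^sup>2 = (beta x)\<^sup>2 * (u e x)\<^sup>2"
        unfolding w_def norm_of_real power2_abs power_mult_distrib ..
      moreover have "(beta x)\<^sup>2 * (u e x)\<^sup>2 \<le> bm\<^sup>2 * (u e x)\<^sup>2"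
        by (intro mult_right_mono power_mono bm beta_nonneg) auto
      moreover have "x \<notin> Om \<Longrightarrow> beta x = 0" using Om(2)[of x] by (intro beta_supp) force
      ultimately show "ennreal ((cmod (w e x))\<^sup>2) \<le> ennreal (bm\<^sup>2) * (ennreal ((0 - u e x)\<^sup>2) * indicator Om x)"
        by (cases "x \<in> Om") (auto simp: ennreal_mult[symmetric] intro!: ennreal_leI)
    qed simp
    also have "\<dots> = ennreal ((2 * pi) ^ DIM('a)) * (ennreal (bm\<^sup>2) * l2_dist_sq Om (\<lambda>x. 0) (u e))"
      unfolding l2_dist_sq_def using Om(1) by (subst nn_integral_cmult) auto
    also have "\<dots> = ennreal ?c * l2_dist_sq Om (\<lambda>x. 0) (u e)"
      by (simp add: ennreal_mult mult.assoc)
    finally show ?thesis .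
  qed
  let ?m = "\<lambda>j k. krr_coef Psi mu n xs (\<lambda>i. if i = j then 1 else 0) k"
  define G where "G k = ftr (\<lambda>x. complex_of_real (beta x * Psi (x - xs k)))" for k
  have Gm [measurable]: "G k \<in> borel_measurable borel" for k
    unfolding G_def by (rule ftr_measurable) measurable
  have bi: "integrable lborel (\<lambda>x. complex_of_real (beta x * Psi (x - xs k)))" for k
    using Psi_mult_integrable[OF beta_integrable, of "xs k"] by (intro integrable_of_real) (simp add: mult.commute)
  have wG: "ftr (w e) om = (\<Sum>k<n. complex_of_real (\<Sum>j<n. e j * ?m j k) * G k om)" for e om
  proof -
    have "ftr (w e) om = (LINT x|lborel. (\<Sum>k<n. complex_of_real (\<Sum>j<n. e j * ?m j k) * (complex_of_real (beta x * Psi (x - xs k)) * cis (x \<bullet> om))))"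
      unfolding ftr_def
    proof (intro Bochner_Integration.integral_cong refl)
      fix x
      have "u e x = (\<Sum>k<n. Psi (x - xs k) * (\<Sum>j<n. e j * ?m j k))"
        unfolding u_def krr_def
        by (intro sum.cong refl arg_cong2[where f="(*)"] krr_coef_linear[where Psi=Psi and xs=xs, OF ridge_system_Psi[OF mu]]) auto
      then show "w e x * cis (x \<bullet> om) = (\<Sum>k<n. complex_of_real (\<Sum>j<n. e j * ?m j k) * (complex_of_real (beta x * Psi (x - xs k)) * cis (x \<bullet> om)))"
        unfolding w_def by (simp only: of_real_mult of_real_sum sum_distrib_left sum_distrib_right mult_ac)
    qed
    also have "\<dots> = (\<Sum>k<n. complex_of_real (\<Sum>j<n. e j * ?m j k) * (LINT x|lborel. complex_of_real (beta x * Psi (x - xs k)) * cis (x \<bullet> om)))"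
      by (subst Bochner_Integration.integral_sum) (auto intro!: integrable_mult_right integrable_mult_cis bi simp del: of_real_sum of_real_mult)
    finally show ?thesis by (simp only: G_def ftr_def)
  qed
  have em: "(\<lambda>p. fst p j) \<in> borel_measurable (?M \<Otimes>\<^sub>M (lborel :: 'a measure))" if "j < n" for j
    by (rule measurable_compose[OF measurable_fst noise_component_measurable[OF that]])
  have "(\<lambda>p. (\<Sum>j<n. fst p j * ?m j k)) \<in> borel_measurable (?M \<Otimes>\<^sub>M (lborel :: 'a measure))" for k
    by (intro borel_measurable_sum borel_measurable_times borel_measurable_const em) simp
  from measurable_compose[OF this borel_measurable_of_real]
  have cm: "(\<lambda>p. complex_of_real (\<Sum>j<n. fst p j * ?m j k)) \<in> borel_measurable (?M \<Otimes>\<^sub>M (lborel :: 'a measure))" for k .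
  have gm: "(\<lambda>p. G k (snd p)) \<in> borel_measurable (?M \<Otimes>\<^sub>M (lborel :: 'a measure))" for k
    by (rule measurable_compose[OF measurable_snd]) simp
  have [measurable]: "(\<lambda>p. ftr (w (fst p)) (snd p)) \<in> borel_measurable (?M \<Otimes>\<^sub>M (lborel :: 'a measure))"
    unfolding wG by (intro borel_measurable_sum borel_measurable_times cm gm)
  have meas: "(\<lambda>(e, om). ennreal ((cmod (ftr (w e) om))\<^sup>2)) \<in> borel_measurable (?M \<Otimes>\<^sub>M lborel)"
    unfolding split_beta' by measurable
  \<comment> \<open>Phase and dual weights are chosen separately at each frequency. The choice
    disappears from the resulting bound, so it need not depend measurably on
    \<open>om\<close>.\<close>
  have point: "ennreal (sig\<^sup>2 * c0) * indicator (ball 0 (1 / h)) om \<le> (\<integral>\<^sup>+e. ennreal ((cmod (ftr (w e) om))\<^sup>2) \<partial>?M)" for om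
  proof (cases "norm om < 1 / h")
    case True
    obtain th where th: "(LINT x|lborel. (tf om th x)\<^sup>2) \<ge> b2 / 2" using phase_exists by blast
    obtain a where a: "dual_solution mu n xs (tf om th) a" using dual_solution_exists[OF mu] by blast
    \<comment> \<open>The real pairing with phase \<open>th\<close> is the real part of
      \<open>cis th\<close> times the transform at \<open>om\<close>.\<close>
    have q: "(\<Sum>j<n. e j * a j)\<^sup>2 \<le> (cmod (ftr (w e) om))\<^sup>2" for e
    proof -
      have "(\<Sum>j<n. e j * a j) = (LINT x|lborel. u e x * tf om th x)"
        unfolding u_def by (rule krr_pairing(2)[OF mu a tf_integrable, symmetric])
      also have "\<dots> = (LINT x|lborel. Re (cis th * (w e x * cis (x \<bullet> om))))"
        by (intro Bochner_Integration.integral_cong) (auto simp: w_def tf_def cos_add inner_commute algebra_simps)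
      also have "\<dots> = Re (LINT x|lborel. cis th * (w e x * cis (x \<bullet> om)))"
        by (rule integral_Re) (intro integrable_mult_right integrable_mult_cis wi, simp)
      also have "\<dots> = Re (cis th * ftr (w e) om)"
        by (simp only: ftr_def integral_mult_right_zero)
      finally have "\<bar>\<Sum>j<n. e j * a j\<bar> \<le> cmod (cis th * ftr (w e) om)"
        using abs_Re_le_cmod[of "cis th * ftr (w e) om"] by simp
      then have "\<bar>\<Sum>j<n. e j * a j\<bar>\<^sup>2 \<le> (cmod (ftr (w e) om))\<^sup>2"
        by (intro power_mono) (auto simp: norm_mult)
      then show ?thesis by simp
    qed
    have "ennreal (sig\<^sup>2 * c0) \<le> ennreal (sig\<^sup>2 * (\<Sum>k<n. (a k)\<^sup>2))"
      by (intro ennreal_leI mult_left_mono c0(2)[OF True th a]) simp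
    also have "\<dots> = (\<integral>\<^sup>+e. ennreal ((\<Sum>j<n. e j * a j)\<^sup>2) \<partial>?M)"
      by (rule noise_second_moment[OF sig, symmetric])
    also have "\<dots> \<le> (\<integral>\<^sup>+e. ennreal ((cmod (ftr (w e) om))\<^sup>2) \<partial>?M)"
      by (intro nn_integral_mono ennreal_leI q)
    finally show ?thesis using True by simp
  qed simp
  have "ennreal (sig\<^sup>2 * c0) * emeasure lborel (ball (0::'a) (1 / h)) = (\<integral>\<^sup>+(om::'a). ennreal (sig\<^sup>2 * c0) * indicator (ball 0 (1 / h)) om \<partial>lborel)"
    by (rule nn_integral_cmult_indicator[symmetric]) simp
  also have "\<dots> \<le> (\<integral>\<^sup>+om. (\<integral>\<^sup>+e. ennreal ((cmod (ftr (w e) om))\<^sup>2) \<partial>?M) \<partial>lborel)"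
    by (intro nn_integral_mono point)
  also have "\<dots> = (\<integral>\<^sup>+e. (\<integral>\<^sup>+om. ennreal ((cmod (ftr (w e) om))\<^sup>2) \<partial>lborel) \<partial>?M)"
    by (rule P.Fubini'[OF meas])
  finally have le: "ennreal (sig\<^sup>2 * c0) * emeasure lborel (ball (0::'a) (1 / h)) \<le> (\<integral>\<^sup>+e. (\<integral>\<^sup>+om. ennreal ((cmod (ftr (w e) om))\<^sup>2) \<partial>lborel) \<partial>?M)" .
  \<comment> \<open>Amplitude 0 gives the zero function.\<close>
  have mem: "(\<lambda>x. 0) \<in> native_unit_ball Psi Om"
    using tf_in_unit_ball[of 0 0 0 Om] c_pos by simp
  have fin: "emeasure lborel (ball (0::'a) (1 / h)) = ennreal (measure lborel (ball (0::'a) (1 / h)))"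
    using emeasure_lborel_ball_finite[of "0::'a" "1 / h"] by (intro emeasure_eq_ennreal_measure) auto
  have "ennreal (sig\<^sup>2 * c0 * measure lborel (ball (0::'a) (1 / h)) / ?c)
      = ennreal (1 / ?c) * (ennreal (sig\<^sup>2 * c0) * emeasure lborel (ball (0::'a) (1 / h)))"
    unfolding fin using c0(1) cpos by (simp flip: ennreal_mult)
  also have "\<dots> \<le> ennreal (1 / ?c) * (\<integral>\<^sup>+e. (\<integral>\<^sup>+om. ennreal ((cmod (ftr (w e) om))\<^sup>2) \<partial>lborel) \<partial>?M)"
    by (intro mult_left_mono le) simp
  also have "\<dots> = (\<integral>\<^sup>+e. ennreal (1 / ?c) * (\<integral>\<^sup>+om. ennreal ((cmod (ftr (w e) om))\<^sup>2) \<partial>lborel) \<partial>?M)"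
    by (rule nn_integral_cmult[symmetric]) (rule lborel.borel_measurable_nn_integral[OF meas])
  also have "\<dots> \<le> (\<integral>\<^sup>+e. l2_dist_sq Om (\<lambda>x. 0) (krr Psi mu n xs (\<lambda>k. 0 + e k)) \<partial>?M)"
  proof (intro nn_integral_mono)
    fix e
    have "ennreal (1 / ?c) * (\<integral>\<^sup>+om. ennreal ((cmod (ftr (w e) om))\<^sup>2) \<partial>lborel) \<le> ennreal (1 / ?c) * (ennreal ?c * l2_dist_sq Om (\<lambda>x. 0) (u e))"
      by (intro mult_left_mono dist) simp
    also have "\<dots> = (ennreal (1 / ?c) * ennreal ?c) * l2_dist_sq Om (\<lambda>x. 0) (u e)" by (simp only: mult.assoc)
    also have "ennreal (1 / ?c) * ennreal ?c = 1" using cpos by (subst ennreal_mult[symmetric]) auto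
    finally show "ennreal (1 / ?c) * (\<integral>\<^sup>+om. ennreal ((cmod (ftr (w e) om))\<^sup>2) \<partial>lborel) \<le> l2_dist_sq Om (\<lambda>x. 0) (krr Psi mu n xs (\<lambda>k. 0 + e k))"
      by (simp add: u_def)
  qed
  also have "\<dots> \<le> (SUP f \<in> native_unit_ball Psi Om. \<integral>\<^sup>+ e. l2_dist_sq Om f (krr Psi mu n xs (\<lambda>k. f (xs k) + e k)) \<partial>?M)"
    by (rule SUP_upper2[OF mem]) simp
  finally show ?thesis .
qed

end

section \<open>Random designs are dense at every polynomial scale\<close>

text \<open>Exponential Markov inequality with parameter 1 for the number of points in
  \<open>b\<close>. The exponent obtained is n p (1/2 - 1/e), where p is the measure of
  \<open>b\<close>, and the estimate e \<ge> 5/2 makes the bracket at least 1/10.\<close>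

lemma chernoff_lower_tail:
  fixes U :: "'b measure" and n :: nat
  assumes U: "prob_space U" and b: "b \<in> sets U"
  shows "{xs \<in> space (PiM {..<n} (\<lambda>_. U)). real n * measure U b / 2 > (\<Sum>k<n. indicator b (xs k))} \<in> sets (PiM {..<n} (\<lambda>_. U))"
    and "measure (PiM {..<n} (\<lambda>_. U)) {xs \<in> space (PiM {..<n} (\<lambda>_. U)). real n * measure U b / 2 > (\<Sum>k<n. indicator b (xs k))}
      \<le> exp (- (real n * measure U b / 10))"
proof -
  interpret U: prob_space U by (rule U)
  interpret product_sigma_finite "\<lambda>_::nat. U" ..
  let ?M = "PiM {..<n} (\<lambda>_. U)"
  interpret M: prob_space ?M by (intro prob_space_PiM U)
  define p where "p = measure U b"
  let ?S = "\<lambda>xs. \<Sum>k<n. indicator b (xs k) :: real"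
  let ?f = "\<lambda>x. exp (- indicator b x) :: real"
  have comp: "(\<lambda>xs. xs k) \<in> measurable ?M U" if "k < n" for k
    using that by (intro measurable_component_singleton) simp
  have Sm [measurable]: "?S \<in> borel_measurable ?M"
    using b by (intro borel_measurable_sum measurable_compose[OF comp borel_measurable_indicator]) auto
  show "{xs \<in> space ?M. real n * measure U b / 2 > ?S xs} \<in> sets ?M" by measurable
  have fm: "?f \<in> borel_measurable U" using b by measurable
  have fi: "integrable U ?f"
    by (rule U.integrable_const_bound[of _ 1]) (use fm in \<open>auto simp: indicator_def\<close>)
  have fe: "?f x = 1 - (1 - exp (- 1)) * indicator b x" for x
    by (simp add: indicator_def)
  have If: "(LINT x|U. ?f x) = 1 - (1 - exp (- 1)) * p"
  proof -
    have bi: "integrable U (indicator b :: 'b \<Rightarrow> real)" using b by (intro U.integrable_const_bound[of _ 1]) auto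
    have "(LINT x|U. ?f x) = (LINT x|U. 1) - (LINT x|U. (1 - exp (- 1)) * indicator b x)"
      unfolding fe using bi by (intro Bochner_Integration.integral_diff) auto
    then show ?thesis using b bi by (simp add: p_def U.prob_space)
  qed
  have prod: "exp (- ?S xs) = (\<Prod>k<n. ?f (xs k))" for xs
    by (simp add: exp_sum sum_negf[symmetric])
  have ei: "integrable ?M (\<lambda>xs. exp (- ?S xs))"
    unfolding prod by (rule product_integrable_prod) (use fi in auto)
  have "(LINT xs|?M. exp (- ?S xs)) = (\<Prod>k<n. LINT x|U. ?f x)"
    unfolding prod by (rule product_integral_prod) (use fi in auto)
  also have "\<dots> = (1 - (1 - exp (- 1)) * p) ^ n" by (simp add: If)
  also have "\<dots> \<le> (exp (- ((1 - exp (- 1)) * p))) ^ n"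
  proof (rule power_mono)
    show "1 - (1 - exp (- 1)) * p \<le> exp (- ((1 - exp (- 1)) * p))"
      using exp_ge_add_one_self[of "- ((1 - exp (- 1)) * p)"] by simp
    have "(1 - exp (- 1)) * p \<le> 1 * 1" unfolding p_def by (intro mult_mono) auto
    then show "0 \<le> 1 - (1 - exp (- 1)) * p" by simp
  qed
  also have "\<dots> = exp (- (real n * ((1 - exp (- 1)) * p)))" by (simp add: exp_of_nat_mult[symmetric])
  finally have E: "(LINT xs|?M. exp (- ?S xs)) \<le> exp (- (real n * ((1 - exp (- 1)) * p)))" .
  have "measure ?M {xs \<in> space ?M. real n * measure U b / 2 > ?S xs} \<le> measure ?M {xs \<in> space ?M. exp (- ?S xs) \<ge> exp (- (real n * p / 2))}"
    by (rule M.finite_measure_mono) (auto simp: p_def)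
  also have "\<dots> \<le> (LINT xs|?M. exp (- ?S xs)) / exp (- (real n * p / 2))"
    by (rule integral_Markov_inequality_measure[OF ei, of "{}"]) auto
  also have "\<dots> \<le> exp (- (real n * ((1 - exp (- 1)) * p))) / exp (- (real n * p / 2))"
    by (intro divide_right_mono E) simp
  also have "\<dots> = exp (- (real n * p * (1 / 2 - exp (- 1))))"
    by (simp add: exp_diff[symmetric] algebra_simps)
  also have "\<dots> \<le> exp (- (real n * p / 10))"
  proof -
    have "(5 / 2 :: real) \<le> exp 1" using exp_lower_Taylor_quadratic[of 1] by (simp add: power2_eq_square)
    then have "exp (- 1) \<le> (2 / 5 :: real)" by (simp add: exp_minus field_simps)
    then have "1 / 10 \<le> 1 / 2 - exp (- 1 :: real)" by simp
    then have "real n * p * (1 / 10) \<le> real n * p * (1 / 2 - exp (- 1))"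
      unfolding p_def by (intro mult_left_mono) auto
    then show ?thesis by simp
  qed
  finally show "measure ?M {xs \<in> space ?M. real n * measure U b / 2 > ?S xs} \<le> exp (- (real n * measure U b / 10))"
    by (simp add: p_def)
qed

text \<open>A separated set of maximal cardinality is a net. Cardinalities are bounded by volume:
  the balls of radius \<open>s / 2\<close> about its points are disjoint and, as
  \<open>s \<le> 2 * rho\<close>, lie in \<open>ball z0 (2 * rho)\<close>.\<close>

lemma separated_net:
  fixes z0 :: "'a::euclidean_space"
  assumes s: "0 < s" "s \<le> 2 * rho"
  shows "\<exists>Z. finite Z \<and> Z \<subseteq> ball z0 rho \<and> real (card Z) \<le> (4 * rho / s) ^ DIM('a) \<and> (\<forall>z\<in>ball z0 rho. \<exists>z'\<in>Z. norm (z - z') < s)"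
proof -
  let ?V = "unit_ball_vol (real DIM('a))"
  have Vpos: "?V > 0" by simp
  define sep where "sep Z \<longleftrightarrow> finite Z \<and> Z \<subseteq> ball z0 rho \<and> (\<forall>x\<in>Z. \<forall>y\<in>Z. x \<noteq> y \<longrightarrow> norm (x - y) \<ge> s)" for Z :: "'a set"
  have bound: "real (card Z) \<le> (4 * rho / s) ^ DIM('a)" if "sep Z" for Z
  proof -
    from that have fin: "finite Z" and sub: "Z \<subseteq> ball z0 rho" and d: "\<And>x y. x \<in> Z \<Longrightarrow> y \<in> Z \<Longrightarrow> x \<noteq> y \<Longrightarrow> norm (x - y) \<ge> s"
      by (auto simp: sep_def)
    have disj: "disjoint_family_on (\<lambda>z. ball z (s / 2)) Z"
      unfolding disjoint_family_on_def
    proof (intro ballI impI)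
      fix x y assume xy: "x \<in> Z" "y \<in> Z" "x \<noteq> y"
      have False if "dist x w < s / 2" "dist y w < s / 2" for w
        using dist_triangle_half_r[of w x s y] that d[OF xy] by (simp add: dist_commute dist_norm)
      then show "ball x (s / 2) \<inter> ball y (s / 2) = {}" by auto
    qed
    have subB: "(\<Union>z\<in>Z. ball z (s / 2)) \<subseteq> ball z0 (2 * rho)"
    proof safe
      fix z w assume "z \<in> Z" "w \<in> ball z (s / 2)"
      then have "dist z0 z < rho" "dist z w < s / 2" using sub by auto
      then show "w \<in> ball z0 (2 * rho)" using dist_triangle[of z0 w z] s by auto
    qed
    have vol: "measure lborel (ball (z::'a) t) = ?V * t ^ DIM('a)" if "t \<ge> 0" for z t
      using content_ball[OF that, of z] by simp
    have "(\<Sum>z\<in>Z. measure lborel (ball z (s / 2))) = measure lborel (\<Union>z\<in>Z. ball z (s / 2))"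
      using emeasure_lborel_ball_finite by (intro measure_finite_Union[symmetric] fin disj) (auto simp: less_top[symmetric])
    also have "\<dots> \<le> measure lborel (ball z0 (2 * rho))"
      using emeasure_lborel_ball_finite[of z0 "2 * rho"] by (intro measure_mono_fmeasurable subB) (auto simp: fmeasurable_def fin)
    finally have "real (card Z) * (?V * (s / 2) ^ DIM('a)) \<le> ?V * (2 * rho) ^ DIM('a)"
      using s by (simp add: vol)
    then have "real (card Z) * (s / 2) ^ DIM('a) \<le> (2 * rho) ^ DIM('a)"
      using Vpos by (simp add: mult.left_commute)
    then have "real (card Z) \<le> (2 * rho) ^ DIM('a) / (s / 2) ^ DIM('a)"
      using s by (simp add: pos_le_divide_eq)
    also have "\<dots> = (2 * rho / (s / 2)) ^ DIM('a)" by (rule power_divide[symmetric])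
    also have "2 * rho / (s / 2) = 4 * rho / s" by simp
    finally show ?thesis .
  qed
  define N where "N = nat \<lceil>(4 * rho / s) ^ DIM('a)\<rceil>"
  have "\<exists>c. (\<exists>Z. sep Z \<and> card Z = c) \<and> (\<forall>c'. (\<exists>Z. sep Z \<and> card Z = c') \<longrightarrow> c' \<le> c)"
  proof (rule Nat.ex_has_greatest_nat)
    show "\<exists>Z. sep Z \<and> card Z = 0" by (rule exI[of _ "{}"]) (simp add: sep_def)
    show "\<forall>c'. (\<exists>Z. sep Z \<and> card Z = c') \<longrightarrow> c' \<le> N"
    proof safe
      fix Z assume "sep Z"
      from bound[OF this] show "card Z \<le> N" unfolding N_def by linarith
    qed
  qed
  then obtain Z where Z: "sep Z" and max: "\<And>Z'. sep Z' \<Longrightarrow> card Z' \<le> card Z" by blast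
  have "\<exists>z'\<in>Z. norm (z - z') < s" if z: "z \<in> ball z0 rho" for z
  proof (rule ccontr)
    assume "\<not> ?thesis"
    then have far: "\<And>z'. z' \<in> Z \<Longrightarrow> norm (z - z') \<ge> s" by force
    then have "z \<notin> Z" using s by force
    have "sep (insert z Z)" using Z z far by (auto simp: sep_def norm_minus_commute)
    from max[OF this] show False using \<open>z \<notin> Z\<close> Z by (simp add: sep_def)
  qed
  then show ?thesis using Z bound[OF Z] by (auto simp: sep_def)
qed

text \<open>\<open>m\<close> is half the expected number of points in a ball of radius
  \<open>r / 2\<close>, so the Chernoff exponent becomes \<open>m / 5\<close>. A union bound over an
  \<open>r / 2\<close>-net reaches all centres at once, because the ball of radius \<open>r\<close>
  about \<open>z\<close> contains the ball of radius \<open>r / 2\<close> about a nearby net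
  point.\<close>

lemma dense_design:
  fixes Om :: "'a::euclidean_space set" and n :: nat
  assumes Om: "Om \<in> sets borel" "emeasure lborel Om > 0" "emeasure lborel Om < \<infinity>"
    and sub: "ball z0 (2 * rho) \<subseteq> Om" and r: "0 < r" "r \<le> 2 * rho"
  defines "m \<equiv> real n * (unit_ball_vol (real DIM('a)) * (r / 2) ^ DIM('a)) / measure lborel Om / 2"
  shows "\<exists>A\<in>sets (design_space Om n). measure (design_space Om n) A \<ge> 1 - (8 * rho / r) ^ DIM('a) * exp (- m / 5) \<and>
    (\<forall>xs\<in>A. \<forall>z. norm (z - z0) < rho \<longrightarrow> m \<le> real (card {k. k < n \<and> norm (xs k - z) \<le> r}))"
proof -
  let ?U = "uniform_measure lborel Om"
  let ?D = "design_space Om n"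
  have U: "prob_space ?U" using Om by (intro prob_space_uniform_measure) auto
  interpret D: prob_space ?D unfolding design_space_def by (intro prob_space_PiM U)
  have setsU: "sets ?U = sets borel" by simp
  obtain Z where Z: "finite Z" "Z \<subseteq> ball z0 rho" "real (card Z) \<le> (4 * rho / (r / 2)) ^ DIM('a)"
    "\<And>z. z \<in> ball z0 rho \<Longrightarrow> \<exists>z'\<in>Z. norm (z - z') < r / 2"
    using separated_net[of "r / 2" rho z0] r by auto
  let ?bad = "\<lambda>z. {xs \<in> space ?D. m > (\<Sum>k<n. indicator (ball z (r / 2)) (xs k))}"
  have p: "measure ?U (ball z (r / 2)) = unit_ball_vol (real DIM('a)) * (r / 2) ^ DIM('a) / measure lborel Om" if "z \<in> Z" for z
  proof -
    have "ball z (r / 2) \<subseteq> Om"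
    proof
      fix w assume "w \<in> ball z (r / 2)"
      then have "dist z0 z < rho" "dist z w < r / 2" using that Z(2) by auto
      then have "w \<in> ball z0 (2 * rho)" using dist_triangle[of z0 w z] r by auto
      then show "w \<in> Om" using sub by blast
    qed
    then have "Om \<inter> ball z (r / 2) = ball z (r / 2)" by blast
    then show ?thesis
      using Om content_ball[of "r / 2" z] r by (simp add: measure_uniform_measure)
  qed
  have bad: "?bad z \<in> sets ?D" "measure ?D (?bad z) \<le> exp (- m / 5)" if "z \<in> Z" for z
  proof -
    have m: "m = real n * measure ?U (ball z (r / 2)) / 2" by (simp add: p[OF that] m_def)
    have b: "ball z (r / 2) \<in> sets ?U" by simp
    show "?bad z \<in> sets ?D" unfolding m design_space_def by (rule chernoff_lower_tail(1)[OF U b])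
    have "measure ?D (?bad z) \<le> exp (- (real n * measure ?U (ball z (r / 2)) / 10))"
      unfolding m design_space_def by (rule chernoff_lower_tail(2)[OF U b])
    then show "measure ?D (?bad z) \<le> exp (- m / 5)" by (simp add: m)
  qed
  let ?B = "\<Union>z\<in>Z. ?bad z"
  have Bs: "?B \<in> sets ?D" using bad Z(1) by (intro sets.finite_UN) auto
  have "measure ?D ?B \<le> (\<Sum>z\<in>Z. measure ?D (?bad z))"
    using bad by (intro D.finite_measure_subadditive_finite Z(1)) auto
  also have "\<dots> \<le> real (card Z) * exp (- m / 5)"
    using bad by (intro sum_bounded_above) auto
  also have "\<dots> \<le> (8 * rho / r) ^ DIM('a) * exp (- m / 5)"
    using Z(3) by (intro mult_right_mono) auto
  finally have B: "measure ?D ?B \<le> (8 * rho / r) ^ DIM('a) * exp (- m / 5)" .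
  have "m \<le> real (card {k. k < n \<and> norm (xs k - z) \<le> r})" if xs: "xs \<in> space ?D - ?B" and z: "norm (z - z0) < rho" for xs z
  proof -
    obtain z' where z': "z' \<in> Z" "norm (z - z') < r / 2"
      using Z(4)[of z] z by (auto simp: dist_norm norm_minus_commute)
    have "m \<le> (\<Sum>k<n. indicator (ball z' (r / 2)) (xs k))" using xs z'(1) by force
    also have "\<dots> \<le> (\<Sum>k<n. if k \<in> {k. norm (xs k - z) \<le> r} then 1 else 0)"
    proof (rule sum_mono)
      fix k
      have "norm (xs k - z) \<le> r" if "xs k \<in> ball z' (r / 2)"
        using that z'(2) norm_triangle_ineq[of "xs k - z'" "z' - z"] by (simp add: dist_norm norm_minus_commute)
      then show "indicator (ball z' (r / 2)) (xs k) \<le> (if k \<in> {k. norm (xs k - z) \<le> r} then 1 else (0::real))"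
        by (auto simp: indicator_def)
    qed
    also have "\<dots> = (\<Sum>k\<in>{..<n} \<inter> {k. norm (xs k - z) \<le> r}. 1)"
      by (rule sum.inter_restrict[symmetric]) simp
    also have "\<dots> = real (card {k. k < n \<and> norm (xs k - z) \<le> r})"
      by (simp add: Int_def)
    finally show ?thesis .
  qed
  moreover have "measure ?D (space ?D - ?B) \<ge> 1 - (8 * rho / r) ^ DIM('a) * exp (- m / 5)"
    using B D.prob_compl[OF Bs] by simp
  moreover have "space ?D - ?B \<in> sets ?D" using Bs by auto
  ultimately show ?thesis by (intro bexI[of _ "space ?D - ?B"]) auto
qed

section \<open>Rates\<close>

context kernel_bump
begin

text \<open>The frequency is placed at weight \<open>L = K * n powr (1 - alpha)\<close>, the order
  of n / mu. In \<open>K\<close>, the entry 1 secures \<open>L \<ge> 1\<close> for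
  \<open>wt_surj\<close> and the other entry meets the threshold of \<open>bias_gap\<close>. The
  bound obtained has order n powr (alpha - 1) and is then relaxed to the exponent
  \<open>ex\<close>.\<close>

lemma bias_rate:
  assumes Om: "Om \<in> sets borel" "\<And>x. norm (x - z0) < rho \<Longrightarrow> x \<in> Om"
    and a: "a > 0" "\<And>n. n \<ge> 1 \<Longrightarrow> 0 < mu n" "\<And>n. n \<ge> 1 \<Longrightarrow> a * real n powr alpha \<le> mu n"
    and alpha: "alpha < 1" and ex: "1 - alpha \<le> ex"
  shows "\<exists>C>0. \<forall>n\<ge>1. \<forall>xs.
     (\<forall>e. ennreal (C * real n powr (- ex)) \<le> (SUP f \<in> native_unit_ball Psi Om. l2_dist_sq Om f (krr Psi (mu n) n xs (\<lambda>k. f (xs k) + e k)))) \<and>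
     (\<forall>sig>0. ennreal (C * real n powr (- ex)) \<le> (SUP f \<in> native_unit_ball Psi Om.
        \<integral>\<^sup>+ e. l2_dist_sq Om f (krr Psi (mu n) n xs (\<lambda>k. f (xs k) + e k)) \<partial>noise_space sig n))"
proof -
  define K where "K = max 1 (4 * bm\<^sup>2 * (c2 * K1) / (a * b2\<^sup>2))"
  define C where "C = c1 * b2 / (16 * K1) / K"
  have K: "K \<ge> 1" "4 * bm\<^sup>2 * (c2 * K1) / (a * b2\<^sup>2) \<le> K" by (auto simp: K_def)
  have K2: "4 * bm\<^sup>2 * (c2 * K1) \<le> a * b2\<^sup>2 * K"
    using K(2) a(1) b2_pos by (simp add: field_simps)
  have Cpos: "C > 0" using K c_pos b2_pos K1_pos by (simp add: C_def)
  show ?thesis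
  proof (intro exI[of _ C] conjI allI impI Cpos)
    fix n :: nat and xs :: "nat \<Rightarrow> 'a" and e :: "nat \<Rightarrow> real" and sig :: real
    assume n: "n \<ge> 1"
    define L where "L = K * real n powr (1 - alpha)"
    have n1: "1 \<le> real n powr (1 - alpha)" using n alpha by (intro ge_one_powr_ge_zero) auto
    have L1: "L \<ge> 1" using mult_mono[OF K(1) n1] K by (simp add: L_def)
    have "4 * real n * bm\<^sup>2 * (c2 * K1) = real n * (4 * bm\<^sup>2 * (c2 * K1))" by simp
    also have "\<dots> \<le> real n * (a * b2\<^sup>2 * K)" by (intro mult_left_mono K2) simp
    also have "\<dots> = (real n powr alpha * real n powr (1 - alpha)) * (a * b2\<^sup>2 * K)"
      using n by (simp flip: powr_add)
    also have "\<dots> = (a * real n powr alpha) * (b2\<^sup>2 * L)"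
      by (simp add: L_def)
    also have "\<dots> \<le> mu n * (b2\<^sup>2 * L)" using L1 a(3)[OF n] by (intro mult_right_mono) auto
    finally have L2: "4 * real n * bm\<^sup>2 * (c2 * K1) \<le> mu n * b2\<^sup>2 * L" by (simp add: mult.assoc)
    have "C * real n powr (- ex) \<le> C * real n powr (- (1 - alpha))"
      using Cpos ex n by (intro mult_left_mono powr_mono) auto
    also have "\<dots> = c1 * b2 / (16 * K1) / L"
      using powr_minus_divide[of "real n" "1 - alpha"] by (simp add: C_def L_def)
    finally have le: "ennreal (C * real n powr (- ex)) \<le> ennreal (c1 * b2 / (16 * K1) / L)" by (rule ennreal_leI)
    show "ennreal (C * real n powr (- ex)) \<le> (SUP f \<in> native_unit_ball Psi Om. l2_dist_sq Om f (krr Psi (mu n) n xs (\<lambda>k. f (xs k) + e k)))"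
      by (rule order.trans[OF le bias_lower_bound(1)[OF a(2)[OF n] Om L1 L2]])
    assume sig: "sig > 0"
    show "ennreal (C * real n powr (- ex)) \<le> (SUP f \<in> native_unit_ball Psi Om.
        \<integral>\<^sup>+ e. l2_dist_sq Om f (krr Psi (mu n) n xs (\<lambda>k. f (xs k) + e k)) \<partial>noise_space sig n)"
      by (rule order.trans[OF le bias_lower_bound(2)[OF a(2)[OF n] Om L1 L2 prob_space_noise[OF sig] noise_component_measurable]])
  qed
qed

text \<open>\<open>q\<close> is the growth exponent of h^(-d). The condition
  \<open>q \<le> 1 / 2\<close> keeps the expected number of points per ball, of order n powr (1 -
  q), at least of order sqrt n, and this is the exponent in the probability bound.\<close>

lemma variance_rate:
  assumes Om: "Om \<in> sets borel" "emeasure lborel Om > 0" "emeasure lborel Om < \<infinity>"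
    and sub: "ball z0 (2 * rho) \<subseteq> Om" and rho: "rho > 0" and sig: "sig > 0"
    and b: "b > 0" "\<And>n. n \<ge> 1 \<Longrightarrow> 0 < mu n" "\<And>n. n \<ge> 1 \<Longrightarrow> mu n \<le> b * real n powr alpha"
    and alpha: "alpha < 1" and q: "q = (1 - alpha) * real DIM('a) / (2 * nu)" "q \<le> 1 / 2"
  shows "\<exists>C7 C8 C9. 0 < C7 \<and> 0 < C8 \<and> 0 < C9 \<and> (\<forall>n\<ge>1. \<exists>A \<in> sets (design_space Om n).
      measure (design_space Om n) A \<ge> 1 - C7 * exp (- C8 * real n powr (1 / 2)) \<and>
      (\<forall>xs\<in>A. ennreal (C9 * real n powr (q - 1)) \<le> (SUP f \<in> native_unit_ball Psi Om.
         \<integral>\<^sup>+ e. l2_dist_sq Om f (krr Psi (mu n) n xs (\<lambda>k. f (xs k) + e k)) \<partial>noise_space sig n)))"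
proof -
  define V OV Vr where "V = unit_ball_vol (real DIM('a))" and "OV = measure lborel Om" and "Vr = measure lborel (ball z0 rho)"
  have V: "V > 0" by (simp add: V_def)
  have OV: "OV > 0" using Om(2,3) by (simp add: OV_def measure_def enn2real_positive_iff less_top)
  have Vr: "Vr \<ge> 0" by (simp add: Vr_def)
  have subr: "\<And>x. norm (x - z0) < rho \<Longrightarrow> x \<in> Om"
    using sub rho by (auto simp: subset_iff dist_norm norm_minus_commute)
  \<comment> \<open>Chosen so that \<open>E3\<close> of \<open>dual_norm_lower\<close> holds with
    \<open>E = e0 * h n powr (2 * nu)\<close> as soon as
    \<open>wt nu om * h n powr (2 * nu) \<le> 2 powr nu\<close>. The summand 1 makes the denominator
    positive from \<open>Vr \<ge> 0\<close>.\<close>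
  define e0 where "e0 = c1 * (b2 / 4)\<^sup>2 / (K1 * 2 powr nu * (Vr + 1))"
  have e0: "e0 > 0" using c_pos b2_pos K1_pos Vr by (simp add: e0_def)
  \<comment> \<open>The first entry gives the absorption condition
    \<open>kap \<delta> * CS \<le> 1 / 2\<close>, the second keeps the oscillation term in
    \<open>E2\<close> below \<open>e0 * h n powr (2 * nu)\<close>.\<close>
  define eps where "eps = min (1 / (2 * (CS + 1))) (e0 / (2 * (CS * KH + 1)))"
  have CSKH: "0 \<le> CS * KH" using CS_nonneg KH_nonneg by simp
  have eps: "eps > 0" using CS_nonneg CSKH e0 by (simp add: eps_def add_nonneg_pos)
  obtain \<delta> where d: "\<delta> > 0" "\<delta> \<le> 1" "kap \<delta> < eps" using kap_small[OF eps] by blast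
  have small: "kap \<delta> * CS \<le> 1 / 2"
  proof -
    have "kap \<delta> * CS \<le> 1 / (2 * (CS + 1)) * CS"
      using d(3) CS_nonneg by (intro mult_right_mono) (auto simp: eps_def)
    also have "\<dots> \<le> 1 / 2" using CS_nonneg by (simp add: divide_le_eq)
    finally show ?thesis .
  qed
  have small2: "2 * kap \<delta> * CS * KH \<le> e0"
  proof -
    have "2 * kap \<delta> * CS * KH = 2 * (kap \<delta> * (CS * KH))" by simp
    also have "\<dots> \<le> 2 * (e0 / (2 * (CS * KH + 1)) * (CS * KH))"
      using d(3) CSKH by (intro mult_left_mono mult_right_mono) (auto simp: eps_def)
    also have "\<dots> = e0 * ((CS * KH) / (CS * KH + 1))" using CSKH by (simp add: field_simps)
    also have "\<dots> \<le> e0 * 1" using CSKH e0 by (intro mult_left_mono) (auto simp: divide_le_eq)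
    finally show ?thesis by simp
  qed
  define cm where "cm = V / (2 ^ DIM('a) * 2 * OV)"
  have cm: "cm > 0" using V OV by (simp add: cm_def)
  \<comment> \<open>Makes \<open>E1\<close> hold: its left side is at most
    \<open>4 * V * bm^2 * b / cm\<close> times n powr (alpha - 1), while
    \<open>h n powr (2 * nu)\<close> will be \<open>L\<close> times the same power.\<close>
  define L where "L = 4 * V * bm\<^sup>2 * b / (cm * e0)"
  have L: "L > 0" using V bm b cm e0 by (simp add: L_def)
  define L' g where "L' = L powr (1 / (2 * nu))" and "g = (1 - alpha) / (2 * nu)"
  have L': "L' > 0" using L by (simp add: L'_def)
  have g: "g > 0" using alpha nu_pos by (simp add: g_def)
  have gd: "g * real DIM('a) = q" by (simp add: g_def q)
  define h where "h n = L' * real n powr (- g)" for n :: nat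
  have hpos: "h n > 0" if "n \<ge> 1" for n using L' that by (simp add: h_def)
  have hpow: "h n powr (2 * nu) = L * real n powr (alpha - 1)" if "n \<ge> 1" for n
  proof -
    have "h n powr (2 * nu) = L' powr (2 * nu) * (real n powr (- g)) powr (2 * nu)"
      unfolding h_def by (rule powr_mult)
    also have "L' powr (2 * nu) = L" using L nu_pos by (simp add: L'_def powr_powr)
    also have "(real n powr (- g)) powr (2 * nu) = real n powr (alpha - 1)"
      using nu_pos by (simp add: powr_powr g_def)
    finally show ?thesis .
  qed
  have hd: "h n ^ DIM('a) = L' ^ DIM('a) * real n powr (- q)" if "n \<ge> 1" for n
  proof -
    have "h n ^ DIM('a) = L' ^ DIM('a) * (real n powr (- g)) ^ DIM('a)" by (simp add: h_def power_mult_distrib)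
    also have "(real n powr (- g)) ^ DIM('a) = (real n powr (- g)) powr real DIM('a)"
      using that by (subst powr_realpow) auto
    also have "\<dots> = real n powr (- q)" by (simp add: powr_powr flip: gd)
    finally show ?thesis .
  qed
  \<comment> \<open>From \<open>n0\<close> on, \<open>h n\<close> is below 1, as needed for the
    weight bound at frequencies up to 1 / h, and below \<open>rho\<close>, as needed for the net.
    The finitely many smaller \<open>n\<close> are absorbed into \<open>C7\<close>.\<close>
  have "(\<lambda>n. real n powr (- g)) \<longlonglongrightarrow> 0"
    by (rule tendsto_neg_powr) (use g in simp, rule filterlim_real_sequentially)
  from tendsto_mult_left[OF this, of L'] have "h \<longlonglongrightarrow> 0" by (simp add: h_def[abs_def])
  from order_tendstoD(2)[OF this, of "min 1 rho"] rho obtain n0 where n0: "\<And>n. n \<ge> n0 \<Longrightarrow> h n < min 1 rho"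
    by (auto simp: eventually_sequentially)
  define c3 c4 where "c3 = cm * (\<delta> * L') ^ DIM('a)" and "c4 = (8 * rho / (\<delta> * L')) ^ DIM('a)"
  have c3: "c3 > 0" using cm d L' by (simp add: c3_def)
  have c4: "c4 > 0" using rho d L' by (simp add: c4_def)
  \<comment> \<open>\<open>C8\<close> is half of the available rate \<open>c3 / 5\<close>; the other
    half pays for the polynomial prefactor counting the net, through t exp (- t) \<le> 1. The second
    entry of \<open>C7\<close> makes the claim trivial below \<open>n0\<close>.\<close>
  define C8 C7 C9 where "C8 = c3 / 10" and "C7 = max (c4 * (10 / c3)) (exp (C8 * real n0 powr (1 / 2)))"
    and "C9 = sig\<^sup>2 * (b2\<^sup>2 / (16 * bm\<^sup>2)) * (V / L' ^ DIM('a)) / ((2 * pi) ^ DIM('a) * bm\<^sup>2)"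
  have C8: "C8 > 0" using c3 by (simp add: C8_def)
  have C7: "C7 > 0" using c3 c4 by (simp add: C7_def less_max_iff_disj)
  have C9: "C9 > 0" using sig b2_pos bm V L' by (simp add: C9_def)
  have "\<exists>A \<in> sets (design_space Om n).
      measure (design_space Om n) A \<ge> 1 - C7 * exp (- C8 * real n powr (1 / 2)) \<and>
      (\<forall>xs\<in>A. ennreal (C9 * real n powr (q - 1)) \<le> (SUP f \<in> native_unit_ball Psi Om.
         \<integral>\<^sup>+ e. l2_dist_sq Om f (krr Psi (mu n) n xs (\<lambda>k. f (xs k) + e k)) \<partial>noise_space sig n))" if n: "n \<ge> 1" for n :: nat
  proof (cases "n < n0")
    case True
    \<comment> \<open>Below \<open>n0\<close> the required probability is at most 0, so the empty
      set qualifies.\<close>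
    have "1 = exp (C8 * real n powr (1 / 2)) * exp (- C8 * real n powr (1 / 2))" by (simp flip: exp_add)
    also have "\<dots> \<le> C7 * exp (- C8 * real n powr (1 / 2))"
    proof (rule mult_right_mono)
      have "exp (C8 * real n powr (1 / 2)) \<le> exp (C8 * real n0 powr (1 / 2))"
        using True C8 by (simp add: powr_mono2)
      then show "exp (C8 * real n powr (1 / 2)) \<le> C7" unfolding C7_def by (rule max.coboundedI2)
    qed simp
    finally show ?thesis by (intro bexI[of _ "{}"]) auto
  next
    case False
    then have h1: "h n < 1" and hr: "h n < rho" using n0[of n] by auto
    note hp = hpos[OF n]
    define r m where "r = \<delta> * h n" and "m = real n * (V * (r / 2) ^ DIM('a)) / OV / 2"
    have r: "0 < r" "r \<le> 2 * rho"
    proof -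
      show "0 < r" using d hp by (simp add: r_def)
      have "r \<le> 1 * h n" unfolding r_def using d hp by (intro mult_right_mono) auto
      then show "r \<le> 2 * rho" using hr rho by simp
    qed
    have m_cm: "m = cm * real n * r ^ DIM('a)" by (simp add: m_def cm_def power_divide mult_ac)
    have mpos: "m > 0" using cm n r by (simp add: m_cm)
    have rd: "r ^ DIM('a) = (\<delta> * L') ^ DIM('a) * real n powr (- q)"
      unfolding r_def power_mult_distrib hd[OF n] by simp
    have m_n: "m = c3 * real n powr (1 - q)"
    proof -
      have "real n powr (1 - q) = real n * real n powr (- q)" using n powr_add[of "real n" 1 "- q"] by simp
      then show ?thesis by (simp add: m_cm rd c3_def)
    qed
    obtain A where A: "A \<in> sets (design_space Om n)"
      "measure (design_space Om n) A \<ge> 1 - (8 * rho / r) ^ DIM('a) * exp (- m / 5)"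
      "\<And>xs z. xs \<in> A \<Longrightarrow> norm (z - z0) < rho \<Longrightarrow> m \<le> real (card {k. k < n \<and> norm (xs k - z) \<le> r})"
      using dense_design[OF Om sub r, of n] unfolding m_def V_def OV_def by blast
    have prob: "(8 * rho / r) ^ DIM('a) * exp (- m / 5) \<le> C7 * exp (- C8 * real n powr (1 / 2))"
    proof -
      define x where "x = real n powr (1 / 2)"
      have x0: "x \<ge> 0" by (simp add: x_def)
      have "(8 * rho / r) ^ DIM('a) = c4 * real n powr q"
        unfolding power_divide rd c4_def using powr_minus_divide[of "real n" q] n by (simp add: power_divide)
      also have "\<dots> \<le> c4 * x" unfolding x_def using n q(2) c4 by (intro mult_left_mono powr_mono) auto
      finally have 1: "(8 * rho / r) ^ DIM('a) \<le> c4 * x" .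
      have "c3 * x \<le> m" unfolding m_n x_def using n q(2) c3 by (intro mult_left_mono powr_mono) auto
      then have 2: "exp (- m / 5) \<le> exp (- (2 * (C8 * x)))" by (simp add: C8_def)
      have "(8 * rho / r) ^ DIM('a) * exp (- m / 5) \<le> (c4 * x) * exp (- (2 * (C8 * x)))"
        using c4 x0 by (intro mult_mono 1 2) auto
      also have "\<dots> = c4 * (10 / c3) * ((C8 * x) * exp (- (C8 * x))) * exp (- (C8 * x))"
        using c3 by (simp add: C8_def mult.assoc flip: exp_add)
      also have "\<dots> \<le> c4 * (10 / c3) * 1 * exp (- (C8 * x))"
      proof (intro mult_right_mono mult_left_mono)
        have "C8 * x \<le> exp (C8 * x)" using exp_ge_add_one_self[of "C8 * x"] by linarith
        from mult_right_mono[OF this, of "exp (- (C8 * x))"] show "(C8 * x) * exp (- (C8 * x)) \<le> 1" by (simp flip: exp_add)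
      qed (use c3 c4 in auto)
      also have "\<dots> \<le> C7 * exp (- (C8 * x))" by (intro mult_right_mono) (auto simp: C7_def)
      finally show ?thesis by (simp add: x_def)
    qed
    have rate: "ennreal (C9 * real n powr (q - 1)) \<le> (SUP f \<in> native_unit_ball Psi Om.
         \<integral>\<^sup>+ e. l2_dist_sq Om f (krr Psi (mu n) n xs (\<lambda>k. f (xs k) + e k)) \<partial>noise_space sig n)" if xs: "xs \<in> A" for xs
    proof -
      define E where "E = e0 * h n powr (2 * nu)"
      let ?c0 = "b2\<^sup>2 / 16 / (real n * bm\<^sup>2)"
      have "ennreal (sig\<^sup>2 * ?c0 * measure lborel (ball (0::'a) (1 / h n)) / ((2 * pi) ^ DIM('a) * bm\<^sup>2)) \<le>
        (SUP f \<in> native_unit_ball Psi Om. \<integral>\<^sup>+ e. l2_dist_sq Om f (krr Psi (mu n) n xs (\<lambda>k. f (xs k) + e k)) \<partial>noise_space sig n)"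
      proof (rule variance_lower_bound[OF b(2)[OF n] sig hp Om(1) subr])
        show "0 \<le> ?c0" by simp
        fix om th a
        assume om: "norm om < 1 / h n" and th: "(LINT x|lborel. (tf om th x)\<^sup>2) \<ge> b2 / 2"
          and a: "dual_solution (mu n) n xs (tf om th) a"
        have "b2\<^sup>2 / 16 \<le> real n * bm\<^sup>2 * (\<Sum>k<n. (a k)\<^sup>2)"
        proof (rule dual_norm_lower[OF b(2)[OF n] a th hp d(1) mpos _ small])
          show "\<And>z. norm (z - z0) < rho \<Longrightarrow> m \<le> real (card {k. k < n \<and> norm (xs k - z) \<le> \<delta> * h n})"
            using A(3)[OF xs] by (simp add: r_def)
          have "4 * (V * r ^ DIM('a)) / m * bm\<^sup>2 * mu n = 4 * V * bm\<^sup>2 / (cm * real n) * mu n"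
            using r n cm by (simp add: m_cm)
          also have "\<dots> \<le> 4 * V * bm\<^sup>2 / (cm * real n) * (b * real n powr alpha)"
            using V cm by (intro mult_left_mono b(3)[OF n]) auto
          also have "\<dots> = (4 * V * bm\<^sup>2 * b / cm) * (real n powr alpha / real n)" by simp
          also have "real n powr alpha / real n = real n powr (alpha - 1)"
            using n by (simp add: powr_diff)
          also have "4 * V * bm\<^sup>2 * b / cm * real n powr (alpha - 1) = E"
            unfolding E_def hpow[OF n] using e0 by (simp add: L_def)
          finally show "4 * (unit_ball_vol (real DIM('a)) * (\<delta> * h n) ^ DIM('a)) / m * bm\<^sup>2 * mu n \<le> E"
            by (simp add: V_def r_def)
          have "2 * kap \<delta> * CS * KH * h n powr (2 * nu) \<le> e0 * h n powr (2 * nu)"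
            by (intro mult_right_mono small2) simp
          then show "2 * kap \<delta> * CS * h n powr (2 * nu) * KH \<le> E" by (simp add: E_def mult_ac)
          have wto: "wt nu om * h n powr (2 * nu) \<le> 2 powr nu"
          proof -
            have h2: "h n powr (2 * nu) = ((h n)\<^sup>2) powr nu"
              using hp by (simp add: powr_powr flip: powr_numeral)
            have "norm om * h n \<le> 1" using om hp by (simp add: field_simps)
            then have "(norm om * h n)\<^sup>2 \<le> 1" using hp by (simp add: power_le_one)
            moreover have "(h n)\<^sup>2 \<le> 1" using h1 hp by (simp add: power_le_one)
            ultimately have le2: "(1 + (norm om)\<^sup>2) * (h n)\<^sup>2 \<le> 2" by (simp add: distrib_right power_mult_distrib)
            have "wt nu om * h n powr (2 * nu) = ((1 + (norm om)\<^sup>2) * (h n)\<^sup>2) powr nu"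
              unfolding wt_def h2 by (rule powr_mult[symmetric])
            also have "\<dots> \<le> 2 powr nu" using nu_pos by (intro powr_mono2 le2) auto
            finally show ?thesis .
          qed
          have "K1 * wt nu om / c1 * (Vr * E) = (K1 / c1 * Vr * e0) * (wt nu om * h n powr (2 * nu))" by (simp add: E_def)
          also have "\<dots> \<le> (K1 / c1 * Vr * e0) * 2 powr nu"
            using K1_pos c_pos Vr e0 by (intro mult_left_mono wto) auto
          also have "\<dots> = (b2 / 4)\<^sup>2 * (Vr / (Vr + 1))"
            using K1_pos c_pos by (simp add: e0_def)
          also have "\<dots> \<le> (b2 / 4)\<^sup>2 * 1" using Vr by (intro mult_left_mono) (auto simp: divide_le_eq)
          finally show "K1 * wt nu om / c1 * (measure lborel (ball z0 rho) * E) \<le> (b2 / 4)\<^sup>2" by (simp add: Vr_def)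
        qed
        then show "?c0 \<le> (\<Sum>k<n. (a k)\<^sup>2)" using n bm by (subst pos_divide_le_eq) (auto simp: mult_ac)
      qed
      \<comment> \<open>The volume of the frequency ball of radius \<open>1 / h n\<close> supplies n
        powr q, the lower bound \<open>?c0\<close> on the weights supplies 1 / n.\<close>
      also have "sig\<^sup>2 * ?c0 * measure lborel (ball (0::'a) (1 / h n)) / ((2 * pi) ^ DIM('a) * bm\<^sup>2) = C9 * real n powr (q - 1)"
      proof -
        have "measure lborel (ball (0::'a) (1 / h n)) = V * (1 / h n) ^ DIM('a)"
          using content_ball[of "1 / h n" "0::'a"] hp by (simp add: V_def)
        also have "(1 / h n) ^ DIM('a) = real n powr q / L' ^ DIM('a)"
          unfolding power_divide hd[OF n] using powr_minus_divide[of "real n" q] by simp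
        finally have vol: "measure lborel (ball (0::'a) (1 / h n)) = V * (real n powr q / L' ^ DIM('a))" .
        have "real n powr (q - 1) = real n powr q / real n" using n by (simp add: powr_diff)
        then show ?thesis unfolding vol C9_def by (simp add: mult_ac)
      qed
      finally show ?thesis .
    qed
    show ?thesis
      using A(1,2) prob rate by (intro bexI[of _ A] conjI ballI) auto
  qed
  then show ?thesis using C7 C8 C9 by blast
qed

end

section \<open>Placement of the bump inside \<open>Om\<close> and arithmetic of the
  exponents\<close>

theorem theorem4p1:
  fixes Om :: "'a::euclidean_space set"
    and Psi :: "'a \<Rightarrow> real" and fPsi :: "'a \<Rightarrow> real"
    and nu sig alpha c1 c2 :: real
    and mu :: "nat \<Rightarrow> real"
  assumes Om_convex: "convex Om" and Om_compact: "compact Om"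
    and Om_pos: "emeasure lborel Om > 0"
    and Psi_0: "Psi 0 = 1"
    and Psi_int: "integrable lborel Psi"
    and Psi_spd: "strictly_pd Psi"
    and Psi_spec: "\<And>h. complex_of_real (Psi h) =
          (LINT w|lborel. exp (\<i> * complex_of_real (w \<bullet> h)) * complex_of_real (fPsi w))"
    and c_pos: "0 < c1" "c1 \<le> c2"
    and nu_gt: "nu > real DIM('a) / 2"
    and spec_bounds: "\<And>w. c1 * (1 + (norm w)\<^sup>2) powr (- nu) \<le> fPsi w \<and>
                            fPsi w \<le> c2 * (1 + (norm w)\<^sup>2) powr (- nu)"
    and sigma_pos: "sig > 0"
    and mu_pos: "\<And>n. mu n > 0"
    and mu_asymp: "\<exists>a b. 0 < a \<and> 0 < b \<and>
          (\<forall>n\<ge>1. a * real n powr alpha \<le> mu n \<and> mu n \<le> b * real n powr alpha)"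
    and alpha_lt: "alpha < 1"
  shows
   "(real DIM('a) / (2 * nu + real DIM('a)) < alpha \<longrightarrow>
      (let eta = ((alpha - 1) * (2 * nu + real DIM('a)) / (2 * nu) + 1) / 4 in
        0 < eta \<and> eta < 1 / 4 \<and>
        (\<exists>C1 C2 C3 eta1. 0 < C1 \<and> 0 < C2 \<and> 0 < C3 \<and> 0 < eta1 \<and>
          (\<forall>n::nat\<ge>1. \<exists>A \<in> sets (design_space Om n \<Otimes>\<^sub>M noise_space sig n).
             measure (design_space Om n \<Otimes>\<^sub>M noise_space sig n) A
               \<ge> 1 - C1 * exp (- C2 * real n powr eta1) \<and>
             (\<forall>(xs, e) \<in> A.
               (SUP f \<in> native_unit_ball Psi Om.
                  l2_dist_sq Om f (krr Psi (mu n) n xs (\<lambda>k. f (xs k) + e k)))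
               \<ge> ennreal (C3 * real n powr (- (1 - 2 * eta) * (2 * nu / (2 * nu + real DIM('a)))))))) \<and>
        (\<exists>C4 C5 C6 eta2. 0 < C4 \<and> 0 < C5 \<and> 0 < C6 \<and> 0 < eta2 \<and>
          (\<forall>n::nat\<ge>1. \<exists>A \<in> sets (design_space Om n).
             measure (design_space Om n) A \<ge> 1 - C4 * exp (- C5 * real n powr eta2) \<and>
             (\<forall>xs \<in> A.
               (SUP f \<in> native_unit_ball Psi Om.
                  \<integral>\<^sup>+ e. l2_dist_sq Om f (krr Psi (mu n) n xs (\<lambda>k. f (xs k) + e k)) \<partial>noise_space sig n)
               \<ge> ennreal (C6 * real n powr (- (1 - 2 * eta) * (2 * nu / (2 * nu + real DIM('a)))))))))) \<and>
    (alpha < real DIM('a) / (2 * nu + real DIM('a)) \<longrightarrow>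
      (let eta4 = min (- 1 / 2) ((1 - alpha) * real DIM('a) / (2 * nu) - 1) in
        eta4 > - (2 * nu / (2 * nu + real DIM('a))) \<and>
        (\<exists>C7 C8 C9 eta3. 0 < C7 \<and> 0 < C8 \<and> 0 < C9 \<and> 0 < eta3 \<and>
          (\<forall>n::nat\<ge>1. \<exists>A \<in> sets (design_space Om n).
             measure (design_space Om n) A \<ge> 1 - C7 * exp (- C8 * real n powr eta3) \<and>
             (\<forall>xs \<in> A.
               (SUP f \<in> native_unit_ball Psi Om.
                  \<integral>\<^sup>+ e. l2_dist_sq Om f (krr Psi (mu n) n xs (\<lambda>k. f (xs k) + e k)) \<partial>noise_space sig n)
               \<ge> ennreal (C9 * real n powr eta4))))))"
proof -
  let ?d = "real DIM('a)"
  have d0: "?d > 0" using DIM_positive[where 'a='a] by simp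
  have nu0: "nu > 0" using nu_gt d0 by simp
  obtain a b where a: "0 < a" and b: "0 < b"
    and mub: "\<And>n. n \<ge> 1 \<Longrightarrow> a * real n powr alpha \<le> mu n" "\<And>n. n \<ge> 1 \<Longrightarrow> mu n \<le> b * real n powr alpha"
    using mu_asymp by blast
  have Omb: "Om \<in> sets borel" using Om_compact by (rule borel_compact)
  have Omf: "emeasure lborel Om < \<infinity>" using Om_compact by (rule emeasure_compact_finite)
  \<comment> \<open>A convex set with empty interior is negligible, so positive measure provides a
    ball inside \<open>Om\<close> that can carry the bump.\<close>
  have "interior Om \<noteq> {}"
  proof
    assume "interior Om = {}"
    then have "negligible Om" using negligible_convex_interior[OF Om_convex] by simp
    then have "emeasure lborel Om = 0" using Omb by (simp add: negligible_iff_null_sets null_sets_def)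
    then show False using Om_pos by simp
  qed
  then obtain z0 where "z0 \<in> interior Om" by blast
  then obtain s where s: "s > 0" "ball z0 s \<subseteq> Om" using mem_interior by blast
  \<comment> \<open>Half the radius: the bump lives in \<open>ball z0 rho\<close>, while
    \<open>dense_design\<close> needs \<open>ball z0 (2 * rho)\<close> inside
    \<open>Om\<close>.\<close>
  define rho where "rho = s / 2"
  have rho: "rho > 0" and sub: "ball z0 (2 * rho) \<subseteq> Om" using s by (auto simp: rho_def)
  have subr: "\<And>x. norm (x - z0) < rho \<Longrightarrow> x \<in> Om"
    using sub rho by (auto simp: subset_iff dist_norm norm_minus_commute)
  obtain beta :: "'a \<Rightarrow> real" and CB where beta: "continuous_on UNIV beta" "\<And>x. 0 \<le> beta x"
    "\<And>x. rho \<le> norm (x - z0) \<Longrightarrow> beta x = 0" "(LINT x|lborel. beta x) > 0" "CB > 0"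
    "\<And>w. cmod (ftr (\<lambda>x. complex_of_real (beta x)) w) \<le> CB * (1 + (norm w)\<^sup>2) powr (- (2 * nu))"
    using bump_exists[OF rho, where p="2 * nu"] by metis
  interpret kernel_bump Psi fPsi nu c1 c2 beta z0 rho CB
    by unfold_locales (use Psi_0 Psi_int Psi_spec c_pos nu_gt spec_bounds beta in \<open>auto simp: wt_def\<close>)
  have prob_D: "prob_space (design_space Om n)" for n
    unfolding design_space_def using Om_pos Omf by (intro prob_space_PiM prob_space_uniform_measure) auto
  have prob_N: "prob_space (noise_space sig n)" for n by (rule prob_space_noise[OF sigma_pos])
  have prob_DN: "prob_space (design_space Om n \<Otimes>\<^sub>M noise_space sig n)" for n
  proof -
    interpret D: prob_space "design_space Om n" by (rule prob_D)
    interpret N: prob_space "noise_space sig n" by (rule prob_N)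
    interpret pair_prob_space "design_space Om n" "noise_space sig n" ..
    show ?thesis by unfold_locales
  qed
  show ?thesis
    unfolding Let_def
  proof (intro conjI impI)
    assume al: "?d / (2 * nu + ?d) < alpha"
    define eta where "eta = ((alpha - 1) * (2 * nu + ?d) / (2 * nu) + 1) / 4"
    define ex where "ex = (1 - 2 * eta) * (2 * nu / (2 * nu + ?d))"
    have al': "(1 - alpha) * (2 * nu + ?d) < 2 * nu"
      using al nu0 d0 by (simp add: field_simps)
    have "(1 - alpha) * (2 * nu + ?d) / (2 * nu) < 1" using al' nu0 by simp
    then have e0: "0 < eta" by (simp add: eta_def left_diff_distrib diff_divide_distrib)
    then show "0 < ((alpha - 1) * (2 * nu + ?d) / (2 * nu) + 1) / 4" by (simp add: eta_def)
    have "(alpha - 1) * (2 * nu + ?d) / (2 * nu) < 0"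
      using alpha_lt nu0 d0 by (intro divide_neg_pos mult_neg_pos) auto
    then show "((alpha - 1) * (2 * nu + ?d) / (2 * nu) + 1) / 4 < 1 / 4" by simp
    \<comment> \<open>\<open>ex\<close> is the mean of \<open>1 - alpha\<close> and
      \<open>2 * nu / (2 * nu + ?d)\<close>, and the assumption on \<open>alpha\<close> says that
      the former is the smaller of the two.\<close>
    have ex: "1 - alpha \<le> ex"
    proof -
      have "(1 - 2 * (((alpha - 1) * D / (2 * nu) + 1) / 4)) * (2 * nu / D) = nu / D + (1 - alpha) / 2" if "D > 0" for D
        using that nu0 by (simp add: field_simps)
      from this[of "2 * nu + ?d"] have "ex = nu / (2 * nu + ?d) + (1 - alpha) / 2"
        unfolding ex_def eta_def using nu0 d0 by simp
      moreover have "(1 - alpha) / 2 \<le> nu / (2 * nu + ?d)"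
        using al' nu0 d0 by (simp add: field_simps)
      moreover have "1 - alpha \<le> x + (1 - alpha) / 2" if "(1 - alpha) / 2 \<le> x" for x
        using that by (simp add: field_simps)
      ultimately show ?thesis by metis
    qed
    obtain C where C: "C > 0" and bias: "\<And>n xs. n \<ge> 1 \<Longrightarrow>
       (\<forall>e. ennreal (C * real n powr (- ex)) \<le> (SUP f \<in> native_unit_ball Psi Om. l2_dist_sq Om f (krr Psi (mu n) n xs (\<lambda>k. f (xs k) + e k)))) \<and>
       (\<forall>sig>0. ennreal (C * real n powr (- ex)) \<le> (SUP f \<in> native_unit_ball Psi Om.
        \<integral>\<^sup>+ e. l2_dist_sq Om f (krr Psi (mu n) n xs (\<lambda>k. f (xs k) + e k)) \<partial>noise_space sig n))"
      using bias_rate[where mu=mu and alpha=alpha and ex=ex, OF Omb subr a mu_pos mub(1) alpha_lt ex] by blast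
    have exeq: "- ex = - (1 - 2 * (((alpha - 1) * (2 * nu + ?d) / (2 * nu) + 1) / 4)) * (2 * nu / (2 * nu + ?d))"
      unfolding ex_def eta_def by (rule minus_mult_left)
    \<comment> \<open>The bias bound holds for every design and every noise vector, so
      \<open>A\<close> is the whole space and the constants of the probability bound can all be
      1.\<close>
    show "\<exists>C1 C2 C3 eta1. 0 < C1 \<and> 0 < C2 \<and> 0 < C3 \<and> 0 < eta1 \<and>
          (\<forall>n::nat\<ge>1. \<exists>A \<in> sets (design_space Om n \<Otimes>\<^sub>M noise_space sig n).
             measure (design_space Om n \<Otimes>\<^sub>M noise_space sig n) A
               \<ge> 1 - C1 * exp (- C2 * real n powr eta1) \<and>
             (\<forall>(xs, e) \<in> A.
               (SUP f \<in> native_unit_ball Psi Om.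
                  l2_dist_sq Om f (krr Psi (mu n) n xs (\<lambda>k. f (xs k) + e k)))
               \<ge> ennreal (C3 * real n powr (- (1 - 2 * (((alpha - 1) * (2 * nu + ?d) / (2 * nu) + 1) / 4)) * (2 * nu / (2 * nu + ?d))))))"
      unfolding exeq[symmetric]
      by (rule exI[of _ 1], rule exI[of _ 1], rule exI[of _ C], rule exI[of _ 1])
        (use C bias in \<open>auto intro!: bexI[OF _ sets.top] simp: prob_space.prob_space[OF prob_DN]\<close>)
    show "\<exists>C4 C5 C6 eta2. 0 < C4 \<and> 0 < C5 \<and> 0 < C6 \<and> 0 < eta2 \<and>
          (\<forall>n::nat\<ge>1. \<exists>A \<in> sets (design_space Om n).
             measure (design_space Om n) A \<ge> 1 - C4 * exp (- C5 * real n powr eta2) \<and>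
             (\<forall>xs \<in> A.
               (SUP f \<in> native_unit_ball Psi Om.
                  \<integral>\<^sup>+ e. l2_dist_sq Om f (krr Psi (mu n) n xs (\<lambda>k. f (xs k) + e k)) \<partial>noise_space sig n)
               \<ge> ennreal (C6 * real n powr (- (1 - 2 * (((alpha - 1) * (2 * nu + ?d) / (2 * nu) + 1) / 4)) * (2 * nu / (2 * nu + ?d))))))"
      unfolding exeq[symmetric]
      by (rule exI[of _ 1], rule exI[of _ 1], rule exI[of _ C], rule exI[of _ 1])
        (use C bias sigma_pos in \<open>auto intro!: bexI[OF _ sets.top] simp: prob_space.prob_space[OF prob_D]\<close>)
  next
    assume al: "alpha < ?d / (2 * nu + ?d)"
    \<comment> \<open>Raising the exponent enlarges \<open>h\<close>; at \<open>1 - nu / ?d\<close>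
      the value of \<open>q\<close> is exactly 1 / 2. This is legitimate because
      \<open>variance_rate\<close> asks only for positivity and an upper bound of
      \<open>mu n\<close>, and the upper bound survives an increase of the exponent.\<close>
    define al' where "al' = max alpha (1 - nu / ?d)"
    define q where "q = (1 - al') * ?d / (2 * nu)"
    have q_eq: "q = min ((1 - alpha) * ?d / (2 * nu)) (1 / 2)"
    proof -
      have "q = min (1 - alpha) (nu / ?d) * (?d / (2 * nu))" by (simp add: q_def al'_def max_def min_def)
      also have "\<dots> = min ((1 - alpha) * (?d / (2 * nu))) (nu / ?d * (?d / (2 * nu)))"
        using nu0 d0 by (intro min_mult_distrib_right[THEN trans]) auto
      also have "nu / ?d * (?d / (2 * nu)) = 1 / 2" using nu0 d0 by simp
      finally show ?thesis by simp
    qed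
    have q1: "q - 1 = min (- 1 / 2) ((1 - alpha) * ?d / (2 * nu) - 1)"
      unfolding q_eq by (simp add: min_def)
    have "2 * nu < (1 - alpha) * (2 * nu + ?d)" using al nu0 d0 by (simp add: field_simps)
    then have "1 / (2 * nu + ?d) < (1 - alpha) / (2 * nu)" using nu0 d0 by (simp add: field_simps)
    from mult_strict_right_mono[OF this d0] have "?d / (2 * nu + ?d) < (1 - alpha) * ?d / (2 * nu)" by simp
    moreover have "?d / (2 * nu + ?d) = 1 - 2 * nu / (2 * nu + ?d)" using nu0 d0 by (simp add: field_simps)
    \<comment> \<open>This settles the entry - 1 / 2 of the minimum and rests on
      \<open>nu > d / 2\<close>; the other entry was settled by the assumption on
      \<open>alpha\<close>.\<close>
    moreover have "2 * nu / (2 * nu + ?d) > 1 / 2" using nu_gt d0 by (simp add: field_simps)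
    ultimately show "min (- 1 / 2) ((1 - alpha) * ?d / (2 * nu) - 1) > - (2 * nu / (2 * nu + ?d))"
      by simp
    have al'1: "al' < 1" using alpha_lt nu0 d0 by (simp add: al'_def)
    have mub': "mu n \<le> b * real n powr al'" if "n \<ge> 1" for n
    proof -
      have "b * real n powr alpha \<le> b * real n powr al'"
        using b that by (intro mult_left_mono powr_mono) (auto simp: al'_def)
      then show ?thesis using mub(2)[OF that] by simp
    qed
    have "\<exists>C7 C8 C9. 0 < C7 \<and> 0 < C8 \<and> 0 < C9 \<and> (\<forall>n\<ge>1. \<exists>A \<in> sets (design_space Om n).
      measure (design_space Om n) A \<ge> 1 - C7 * exp (- C8 * real n powr (1 / 2)) \<and>
      (\<forall>xs\<in>A. ennreal (C9 * real n powr (q - 1)) \<le> (SUP f \<in> native_unit_ball Psi Om.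
         \<integral>\<^sup>+ e. l2_dist_sq Om f (krr Psi (mu n) n xs (\<lambda>k. f (xs k) + e k)) \<partial>noise_space sig n)))"
      by (rule variance_rate[OF Omb Om_pos Omf sub rho sigma_pos b mu_pos mub' al'1 q_def]) (auto simp: q_eq)
    then obtain C7 C8 C9 where C: "0 < C7" "0 < C8" "0 < C9" and var: "\<forall>n\<ge>1. \<exists>A \<in> sets (design_space Om n).
      measure (design_space Om n) A \<ge> 1 - C7 * exp (- C8 * real n powr (1 / 2)) \<and>
      (\<forall>xs\<in>A. ennreal (C9 * real n powr (q - 1)) \<le> (SUP f \<in> native_unit_ball Psi Om.
         \<integral>\<^sup>+ e. l2_dist_sq Om f (krr Psi (mu n) n xs (\<lambda>k. f (xs k) + e k)) \<partial>noise_space sig n))" by blast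
    show "\<exists>C7 C8 C9 eta3. 0 < C7 \<and> 0 < C8 \<and> 0 < C9 \<and> 0 < eta3 \<and>
          (\<forall>n::nat\<ge>1. \<exists>A \<in> sets (design_space Om n).
             measure (design_space Om n) A \<ge> 1 - C7 * exp (- C8 * real n powr eta3) \<and>
             (\<forall>xs \<in> A.
               (SUP f \<in> native_unit_ball Psi Om.
                  \<integral>\<^sup>+ e. l2_dist_sq Om f (krr Psi (mu n) n xs (\<lambda>k. f (xs k) + e k)) \<partial>noise_space sig n)
               \<ge> ennreal (C9 * real n powr (min (- 1 / 2) ((1 - alpha) * ?d / (2 * nu) - 1)))))"
      unfolding q1[symmetric]
      by (rule exI[of _ C7], rule exI[of _ C8], rule exI[of _ C9], rule exI[of _ "1 / 2"]) (use C var in simp)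
  qed
qed

end
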